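(* Let $1\le m<d$, $n=d-m$, let $A\in\mathbb R^{d\times m}$ have full column rank, and let $B\in\mathscr B_A$. Use the active-adapted notation of the context, with $r=\dim\mathcal W_A\le2m$, $s=r-m$, $q=d-r$. Starting from $\Sigma_{a,0}=I_s$ and (when $q>0$) $\beta_0=1$, consider the updates $$\Sigma_{a,k+1}=\Sigma_{a,k}^{1/2}e^{W_{a,k}/L_0}\Sigma_{a,k}^{1/2},\qquad \beta_{k+1}=\beta_ke^{w_{c,k}/L_0},$$ where $W_{a,k},w_{c,k}$ are $W_a,w_c$ evaluated at $(\Sigma_{a,k},\beta_k)$. Then: (i) These updates are exactly the full iteration $\Sigma_{k+1}=\Sigma_k^{1/2}\exp(L_0^{-1}W_B(\Sigma_k))\Sigma_k^{1/2}$ started at $\Sigma_0=I_n$, with $\Sigma_k=\Sigma_{a,k}\oplus\beta_kI_q$. (ii) The controllers $P_k=\Phi_A(B,\Sigma_k)$ satisfy $P_kA=B$, $P_k\succ0$, $\det P_k=1$ for all $k$, and the stopping test $\|W_{a,k}\|_F^2+q\,w_{c,k}^2\le\varepsilon^2$ implies $d_{\mathrm{AI}}(P_k,s_A(B))\le\varepsilon$. (iii) Preprocessing costs $O(dm^2+r^3)$ spectral-arithmetic operations and $O(dm+r^2)$ storage. Each iteration costs $O(r^3)$. For $D_0>0$, the total spectral-arithmetic cost to meet the stopping test with tolerance $\varepsilon>0$ is $$O\!\left(dm^2+r^3\left\{1+\frac1{\chi_0}\left[\log\frac{\sqrt{L_0}D_0}{\varepsilon}\right]_+\right\}\right),\qquad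 r\le2m .$$ The implicit controller application $x\mapsto P_kx$ costs $O(dr+r^2)$. (iv) The same formulas cover $q=0$ (with all complement terms omitted). If $s=0$, the solver has no variable and the canonical controller is $$s_A(B)=EME^\top+\rho(I-EE^\top).$$
   Context: $[t]_+=\max\{t,0\}$; $\psi(s)=s\coth s$ for $s>0$, $\psi(0)=1$. $\mathbb S_{++}^d$ denotes real symmetric positive definite matrices, $d_{\mathrm{AI}}(P,P')=\|\log(P^{-1/2}P'P^{-1/2})\|_F$, $\mathscr P_d=\{P\in\mathbb S_{++}^d:\det P=1\}$, $\mathscr B_A=\{B\in\mathbb R^{d\times m}:A^\top B\in\mathbb S_{++}^m\}$. The canonical controller $s_A(B)$ is the unique minimizer of $d_{\mathrm{AI}}(I,P)$ over $\{P\in\mathscr P_d:PA=B\}$. Active-adapted frame: $\mathcal W_A=\operatorname{span}(\operatorname{col}A,\operatorname{col}B)$. Write $A=UC$ with $U^\top U=I_m$, $C$ invertible. Choose $V_a\in\mathbb R^{d\times s}$ so that the columns of $E=[U,V_a]$ form an orthonormal basis of $\mathcal W_A$, and, if $q>0$, $Z\in\mathbb R^{d\times q}$ so that $Q=[U,V_a,Z]\in O(d)$; set $V=[V_a,Z]$. Full objects: $M=C^{-\top}A^\top BC^{-1}$, $N=V^\top BC^{-1}$, $T=NM^{-1}$, $L=\begin{pmatrix}I_m&0\\ T&I_n\end{pmatrix}$, $\rho=(\det M)^{-1/n}$, $\mathcal Q_\Sigma=\operatorname{diag}(M,\rho\Sigma)$, $R_0=L^{-1}L^{-\top}$, $\Phi_A(B,\Sigma)=QL\mathcal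 Q_\Sigma L^\top Q^\top$ for $\Sigma\in\mathscr P_n$, $\mathcal R(\Sigma)=\log(\mathcal Q_\Sigma^{-1/2}R_0\mathcal Q_\Sigma^{-1/2})$, and $W_B(\Sigma)=\mathcal R_{22}(\Sigma)-\frac{\operatorname{tr}\mathcal R_{22}(\Sigma)}nI_n$, where $\mathcal R_{22}$ is the lower-right $n\times n$ block. With $\Sigma_0=I_n$: $D_0=d_{\mathrm{AI}}(R_0,\mathcal Q_{\Sigma_0})$, $L_0=\psi(D_0/\sqrt2)$, and for $D_0>0$, $\chi_0=-\log(1-L_0^{-1})$. Active objects: $N_a=V_a^\top BC^{-1}$ (so $BC^{-1}=UM+V_aN_a$), $T_a=N_aM^{-1}$, $L_a=\begin{pmatrix}I_m&0\\ T_a&I_s\end{pmatrix}$, $R_{0,a}=L_a^{-1}L_a^{-\top}$. For a state $(\Sigma_a,\beta)$ with $\Sigma_a\in\mathbb S_{++}^s$, $\beta>0$, $\det\Sigma_a\,\beta^q=1$, let $\mathcal Q_a=\operatorname{diag}(M,\rho\Sigma_a)$, $\mathcal R_a=\log(\mathcal Q_a^{-1/2}R_{0,a}\mathcal Q_a^{-1/2})$ with lower-right $s\times s$ block $\mathcal R^a_{22}$, $r_c=-\log(\rho\beta)$, $\tau=\dfrac{\operatorname{tr}\mathcal R^a_{22}+q\,r_c}{s+q}$, $W_a=\mathcal R^a_{22}-\tau I_s$, $w_c=r_c-\tau$. The implicit controller is applied as $P_kx=cx+E(H_k-cI_r)E^\top x$ with $c=\rho\beta_k$ and $H_k=L_a\mathcal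 Q_aL_a^\top$ at $\Sigma_a=\Sigma_{a,k}$. Cost model (spectral arithmetic): dense factorizations and matrix functions of an $r\times r$ symmetric matrix cost $O(r^3)$, scalar elementary functions have unit cost, and counts are algebraic operation counts (not bit complexity). *)

theory Defs
  imports
    Complex_Main
    "Jordan_Normal_Form.Gauss_Jordan_Elimination"
    "Jordan_Normal_Form.Char_Poly"
    "Jordan_Normal_Form.DL_Rank"
begin

section \<open>Matrices\<close>

definition hcat :: "real mat \<Rightarrow> real mat \<Rightarrow> real mat" where
  "hcat X Y = four_block_mat X Y (0\<^sub>m 0 (dim_col X)) (0\<^sub>m 0 (dim_col Y))"

definition block_diag :: "real mat \<Rightarrow> real mat \<Rightarrow> real mat" where
  "block_diag X Y =
     four_block_mat X (0\<^sub>m (dim_row X) (dim_col Y)) (0\<^sub>m (dim_row Y) (dim_col X)) Y"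

definition unit_lower :: "real mat \<Rightarrow> real mat" where
  "unit_lower T =
     four_block_mat (1\<^sub>m (dim_col T)) (0\<^sub>m (dim_col T) (dim_row T)) T (1\<^sub>m (dim_row T))"

text \<open>The block that remains after deleting the first \<open>m\<close> rows and columns.\<close>

definition lower_right :: "nat \<Rightarrow> real mat \<Rightarrow> real mat" where
  "lower_right m X = mat (dim_row X - m) (dim_col X - m) (\<lambda>(i, j). X $$ (m + i, m + j))"

definition mat_trace :: "real mat \<Rightarrow> real" where
  "mat_trace X = (\<Sum>i<dim_row X. X $$ (i, i))"

definition frob_norm :: "real mat \<Rightarrow> real" where
  "frob_norm X = sqrt (\<Sum>i<dim_row X. \<Sum>j<dim_col X. (X $$ (i, j))\<^sup>2)"

text \<open>Only applied to invertible matrices.\<close>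

definition minv :: "real mat \<Rightarrow> real mat" where
  "minv X = the (mat_inverse X)"

definition spd :: "nat \<Rightarrow> real mat set" where
  "spd n = {P \<in> carrier_mat n n. transpose_mat P = P \<and>
     (\<forall>v \<in> carrier_vec n. v \<noteq> 0\<^sub>v n \<longrightarrow> v \<bullet> (P *\<^sub>v v) > 0)}"

definition unit_spd :: "nat \<Rightarrow> real mat set" where
  "unit_spd n = {P \<in> spd n. det P = 1}"

definition spectral_decomposition :: "real mat \<Rightarrow> real mat \<Rightarrow> (nat \<Rightarrow> real) \<Rightarrow> bool" where
  "spectral_decomposition S X ev \<longleftrightarrow> (let n = dim_row S in
     X \<in> carrier_mat n n \<and> transpose_mat X * X = 1\<^sub>m n \<and>
     S = X * mat_diag n ev * transpose_mat X)"

text \<open>The matrix function of a symmetric matrix; its value does not depend on the choice of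
  the spectral decomposition.\<close>

definition spectral_fun :: "(real \<Rightarrow> real) \<Rightarrow> real mat \<Rightarrow> real mat" where
  "spectral_fun f S = (THE Y. \<exists>X ev. spectral_decomposition S X ev \<and>
     Y = X * mat_diag (dim_row S) (\<lambda>i. f (ev i)) * transpose_mat X)"

definition mat_exp :: "real mat \<Rightarrow> real mat" where "mat_exp = spectral_fun exp"
definition mat_log :: "real mat \<Rightarrow> real mat" where "mat_log = spectral_fun ln"
definition mat_sqrt :: "real mat \<Rightarrow> real mat" where "mat_sqrt = spectral_fun sqrt"
definition mat_isqrt :: "real mat \<Rightarrow> real mat" where
  "mat_isqrt = spectral_fun (\<lambda>x. 1 / sqrt x)"

text \<open>The logarithm of \<open>R\<close> relative to \<open>P\<close>, and the affine-invariant distance.\<close>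

definition rel_log :: "real mat \<Rightarrow> real mat \<Rightarrow> real mat" where
  "rel_log P R = mat_log (mat_isqrt P * R * mat_isqrt P)"

definition d_AI :: "real mat \<Rightarrow> real mat \<Rightarrow> real" where
  "d_AI P R = frob_norm (rel_log P R)"

definition psi :: "real \<Rightarrow> real" where
  "psi t = (if t = 0 then 1 else t * (cosh t / sinh t))"


section \<open>Admissible data, canonical controller, active-adapted frame\<close>

definition admissible :: "real mat \<Rightarrow> real mat \<Rightarrow> bool" where
  "admissible A B \<longleftrightarrow> (let d = dim_row A; m = dim_col A in
     1 \<le> m \<and> m < d \<and> vec_space.rank d A = m \<and>
     B \<in> carrier_mat d m \<and> transpose_mat A * B \<in> spd m)"

definition canonical_controller :: "real mat \<Rightarrow> real mat \<Rightarrow> real mat" where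
  "canonical_controller A B =
     (THE P. is_arg_min (d_AI (1\<^sub>m (dim_row A)))
        (\<lambda>P. P \<in> unit_spd (dim_row A) \<and> P * A = B) P)"

definition active_space :: "real mat \<Rightarrow> real mat \<Rightarrow> real vec set" where
  "active_space A B =
     LinearCombinations.module.span class_ring (module_vec TYPE(real) (dim_row A))
       (set (cols A) \<union> set (cols B))"

definition dim_n :: "real mat \<Rightarrow> nat" where
  "dim_n A = dim_row A - dim_col A"

definition dim_r :: "real mat \<Rightarrow> real mat \<Rightarrow> nat" where
  "dim_r A B = vectorspace.dim class_ring
     (module_vec TYPE(real) (dim_row A) \<lparr>carrier := active_space A B\<rparr>)"

definition dim_s :: "real mat \<Rightarrow> real mat \<Rightarrow> nat" where
  "dim_s A B = dim_r A B - dim_col A"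

definition dim_q :: "real mat \<Rightarrow> real mat \<Rightarrow> nat" where
  "dim_q A B = dim_row A - dim_r A B"

record frame =
  frU :: "real mat"
  frC :: "real mat"
  frVa :: "real mat"
  frZ :: "real mat"

definition E_of :: "frame \<Rightarrow> real mat" where "E_of F = hcat (frU F) (frVa F)"
definition Q_of :: "frame \<Rightarrow> real mat" where "Q_of F = hcat (E_of F) (frZ F)"
definition V_of :: "frame \<Rightarrow> real mat" where "V_of F = hcat (frVa F) (frZ F)"

text \<open>For \<open>q = 0\<close> the matrix \<open>frZ F\<close> has no columns and \<open>Q_of F\<close> is \<open>E_of F\<close>.\<close>

definition active_frame :: "real mat \<Rightarrow> real mat \<Rightarrow> frame \<Rightarrow> bool" where
  "active_frame A B F \<longleftrightarrow> (let d = dim_row A; m = dim_col A in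
     frU F \<in> carrier_mat d m \<and> frC F \<in> carrier_mat m m \<and>
     frVa F \<in> carrier_mat d (dim_s A B) \<and> frZ F \<in> carrier_mat d (dim_q A B) \<and>
     transpose_mat (frU F) * frU F = 1\<^sub>m m \<and> invertible_mat (frC F) \<and> A = frU F * frC F \<and>
     transpose_mat (E_of F) * E_of F = 1\<^sub>m (dim_col (E_of F)) \<and>
     LinearCombinations.module.span class_ring (module_vec TYPE(real) d) (set (cols (E_of F)))
       = active_space A B \<and>
     Q_of F \<in> carrier_mat d d \<and> transpose_mat (Q_of F) * Q_of F = 1\<^sub>m d)"


section \<open>Full iteration\<close>

definition M_of :: "real mat \<Rightarrow> real mat \<Rightarrow> frame \<Rightarrow> real mat" where
  "M_of A B F = transpose_mat (minv (frC F)) * transpose_mat A * B * minv (frC F)"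

definition rho_of :: "real mat \<Rightarrow> real mat \<Rightarrow> frame \<Rightarrow> real" where
  "rho_of A B F = det (M_of A B F) powr (- 1 / real (dim_n A))"

definition T_of :: "real mat \<Rightarrow> real mat \<Rightarrow> frame \<Rightarrow> real mat" where
  "T_of A B F = (transpose_mat (V_of F) * B * minv (frC F)) * minv (M_of A B F)"

definition L_of :: "real mat \<Rightarrow> real mat \<Rightarrow> frame \<Rightarrow> real mat" where
  "L_of A B F = unit_lower (T_of A B F)"

definition QS_of :: "real mat \<Rightarrow> real mat \<Rightarrow> frame \<Rightarrow> real mat \<Rightarrow> real mat" where
  "QS_of A B F \<Sigma> = block_diag (M_of A B F) (rho_of A B F \<cdot>\<^sub>m \<Sigma>)"

definition R0_of :: "real mat \<Rightarrow> real mat \<Rightarrow> frame \<Rightarrow> real mat" where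
  "R0_of A B F = minv (L_of A B F) * transpose_mat (minv (L_of A B F))"

definition Phi :: "real mat \<Rightarrow> real mat \<Rightarrow> frame \<Rightarrow> real mat \<Rightarrow> real mat" where
  "Phi A B F \<Sigma> = Q_of F * L_of A B F * QS_of A B F \<Sigma> *
     transpose_mat (L_of A B F) * transpose_mat (Q_of F)"

definition W_full :: "real mat \<Rightarrow> real mat \<Rightarrow> frame \<Rightarrow> real mat \<Rightarrow> real mat" where
  "W_full A B F \<Sigma> =
     (let R22 = lower_right (dim_col A) (rel_log (QS_of A B F \<Sigma>) (R0_of A B F)) in
      R22 - (mat_trace R22 / real (dim_n A)) \<cdot>\<^sub>m 1\<^sub>m (dim_n A))"

definition D0_of :: "real mat \<Rightarrow> real mat \<Rightarrow> frame \<Rightarrow> real" where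
  "D0_of A B F = d_AI (R0_of A B F) (QS_of A B F (1\<^sub>m (dim_n A)))"

definition L0_of :: "real mat \<Rightarrow> real mat \<Rightarrow> frame \<Rightarrow> real" where
  "L0_of A B F = psi (D0_of A B F / sqrt 2)"

definition chi0_of :: "real mat \<Rightarrow> real mat \<Rightarrow> frame \<Rightarrow> real" where
  "chi0_of A B F = - ln (1 - 1 / L0_of A B F)"

primrec full_iter :: "real mat \<Rightarrow> real mat \<Rightarrow> frame \<Rightarrow> nat \<Rightarrow> real mat" where
  "full_iter A B F 0 = 1\<^sub>m (dim_n A)"
| "full_iter A B F (Suc k) =
     mat_sqrt (full_iter A B F k) *
     mat_exp ((1 / L0_of A B F) \<cdot>\<^sub>m W_full A B F (full_iter A B F k)) *
     mat_sqrt (full_iter A B F k)"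


section \<open>Active iteration\<close>

definition Ta_of :: "real mat \<Rightarrow> real mat \<Rightarrow> frame \<Rightarrow> real mat" where
  "Ta_of A B F = (transpose_mat (frVa F) * B * minv (frC F)) * minv (M_of A B F)"

definition La_of :: "real mat \<Rightarrow> real mat \<Rightarrow> frame \<Rightarrow> real mat" where
  "La_of A B F = unit_lower (Ta_of A B F)"

definition R0a_of :: "real mat \<Rightarrow> real mat \<Rightarrow> frame \<Rightarrow> real mat" where
  "R0a_of A B F = minv (La_of A B F) * transpose_mat (minv (La_of A B F))"

definition Qa_of :: "real mat \<Rightarrow> real mat \<Rightarrow> frame \<Rightarrow> real mat \<Rightarrow> real mat" where
  "Qa_of A B F \<Sigma>a = block_diag (M_of A B F) (rho_of A B F \<cdot>\<^sub>m \<Sigma>a)"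

definition active_state :: "nat \<Rightarrow> nat \<Rightarrow> real mat \<Rightarrow> real \<Rightarrow> bool" where
  "active_state s q \<Sigma>a \<beta> \<longleftrightarrow> \<Sigma>a \<in> spd s \<and> \<beta> > 0 \<and> det \<Sigma>a * \<beta> ^ q = 1"

definition Ra22_of :: "real mat \<Rightarrow> real mat \<Rightarrow> frame \<Rightarrow> real mat \<Rightarrow> real mat" where
  "Ra22_of A B F \<Sigma>a = lower_right (dim_col A) (rel_log (Qa_of A B F \<Sigma>a) (R0a_of A B F))"

definition rc_of :: "real mat \<Rightarrow> real mat \<Rightarrow> frame \<Rightarrow> real \<Rightarrow> real" where
  "rc_of A B F \<beta> = - ln (rho_of A B F * \<beta>)"

definition tau_of :: "real mat \<Rightarrow> real mat \<Rightarrow> frame \<Rightarrow> real mat \<Rightarrow> real \<Rightarrow> real" where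
  "tau_of A B F \<Sigma>a \<beta> =
     (mat_trace (Ra22_of A B F \<Sigma>a) + real (dim_q A B) * rc_of A B F \<beta>) /
     (real (dim_s A B) + real (dim_q A B))"

definition Wa_of :: "real mat \<Rightarrow> real mat \<Rightarrow> frame \<Rightarrow> real mat \<Rightarrow> real \<Rightarrow> real mat" where
  "Wa_of A B F \<Sigma>a \<beta> = Ra22_of A B F \<Sigma>a - tau_of A B F \<Sigma>a \<beta> \<cdot>\<^sub>m 1\<^sub>m (dim_s A B)"

definition wc_of :: "real mat \<Rightarrow> real mat \<Rightarrow> frame \<Rightarrow> real mat \<Rightarrow> real \<Rightarrow> real" where
  "wc_of A B F \<Sigma>a \<beta> = rc_of A B F \<beta> - tau_of A B F \<Sigma>a \<beta>"

text \<open>For \<open>q = 0\<close> there is no complement variable: \<open>rc_of\<close> then enters \<open>tau_of\<close> and \<open>residual_sq\<close>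
  with the factor \<open>0\<close>, and the second component below is a dummy that does not influence the
  first.\<close>

primrec active_iter :: "real mat \<Rightarrow> real mat \<Rightarrow> frame \<Rightarrow> nat \<Rightarrow> real mat \<times> real" where
  "active_iter A B F 0 = (1\<^sub>m (dim_s A B), 1)"
| "active_iter A B F (Suc k) =
     (case active_iter A B F k of (\<Sigma>a, \<beta>) \<Rightarrow>
       (mat_sqrt \<Sigma>a * mat_exp ((1 / L0_of A B F) \<cdot>\<^sub>m Wa_of A B F \<Sigma>a \<beta>) * mat_sqrt \<Sigma>a,
        \<beta> * exp (wc_of A B F \<Sigma>a \<beta> / L0_of A B F)))"

definition residual_sq :: "real mat \<Rightarrow> real mat \<Rightarrow> frame \<Rightarrow> real mat \<Rightarrow> real \<Rightarrow> real" where
  "residual_sq A B F \<Sigma>a \<beta> =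
     (frob_norm (Wa_of A B F \<Sigma>a \<beta>))\<^sup>2 + real (dim_q A B) * (wc_of A B F \<Sigma>a \<beta>)\<^sup>2"

definition H_of :: "real mat \<Rightarrow> real mat \<Rightarrow> frame \<Rightarrow> real mat \<Rightarrow> real mat" where
  "H_of A B F \<Sigma>a = La_of A B F * Qa_of A B F \<Sigma>a * transpose_mat (La_of A B F)"


section \<open>Spectral arithmetic\<close>

text \<open>
  A register machine whose registers hold real matrices; scalars are matrices of size
  \<open>1 \<times> 1\<close>. A program is a fixed text that does not depend on the dimensions of its inputs.
  The cost of an instruction is one plus the number of scalar operations or entry moves that it
  needs. Matrix functions and eigendecompositions are provided for symmetric matrices of order
  \<open>k\<close> only and cost \<open>k\<^sup>3\<close>; the case \<open>k = 1\<close> gives the scalar elementary functions at unit cost.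
  An instruction whose operands are not of the right shape or not in the domain is stuck.
\<close>

type_synonym reg = nat
type_synonym store = "reg \<Rightarrow> real mat"

datatype efun = EExp | ELn | ESqrt | EInv

fun efun_val :: "efun \<Rightarrow> real \<Rightarrow> real" where
  "efun_val EExp = exp"
| "efun_val ELn = ln"
| "efun_val ESqrt = sqrt"
| "efun_val EInv = inverse"

fun efun_dom :: "efun \<Rightarrow> real set" where
  "efun_dom EExp = UNIV"
| "efun_dom ELn = {0<..}"
| "efun_dom ESqrt = {0..}"
| "efun_dom EInv = - {0}"

definition scal :: "real \<Rightarrow> real mat" where
  "scal x = mat 1 1 (\<lambda>_. x)"

definition sym_mat :: "real mat \<Rightarrow> bool" where
  "sym_mat X \<longleftrightarrow> square_mat X \<and> transpose_mat X = X"

definition entries :: "real mat \<Rightarrow> nat" where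
  "entries X = dim_row X * dim_col X"

definition eig_sys :: "real mat \<Rightarrow> real mat \<times> (nat \<Rightarrow> real)" where
  "eig_sys S = (SOME (X, ev). spectral_decomposition S X ev)"

text \<open>The columns of \<open>X\<close> at which the column vector \<open>y\<close> has a positive entry.\<close>

definition select_cols :: "real mat \<Rightarrow> real mat \<Rightarrow> real mat" where
  "select_cols X y =
     mat_of_cols (dim_row X) [col X j. j \<leftarrow> [0..<dim_col X], y $$ (j, 0) > 0]"

datatype op =
    IConst int
  | NRows reg
  | NCols reg
  | Eye reg
  | Zeros reg reg
  | Copy reg
  | Transp reg
  | Plus reg reg
  | Minus reg reg
  | Times reg reg
  | Scale reg reg
  | Trace reg
  | Apply efun reg
  | EigVecs reg
  | EigVals reg
  | SelCols reg reg
  | HCat reg reg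
  | Blocks reg reg reg reg
  | LowerRight reg reg

fun op_ok :: "store \<Rightarrow> op \<Rightarrow> bool" where
  "op_ok \<sigma> (Plus i j) \<longleftrightarrow> dim_row (\<sigma> i) = dim_row (\<sigma> j) \<and> dim_col (\<sigma> i) = dim_col (\<sigma> j)"
| "op_ok \<sigma> (Minus i j) \<longleftrightarrow> dim_row (\<sigma> i) = dim_row (\<sigma> j) \<and> dim_col (\<sigma> i) = dim_col (\<sigma> j)"
| "op_ok \<sigma> (Times i j) \<longleftrightarrow> dim_col (\<sigma> i) = dim_row (\<sigma> j)"
| "op_ok \<sigma> (Scale i j) \<longleftrightarrow> \<sigma> i \<in> carrier_mat 1 1"
| "op_ok \<sigma> (Trace i) \<longleftrightarrow> square_mat (\<sigma> i)"
| "op_ok \<sigma> (Apply f i) \<longleftrightarrow> sym_mat (\<sigma> i) \<and> (\<forall>x. eigenvalue (\<sigma> i) x \<longrightarrow> x \<in> efun_dom f)"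
| "op_ok \<sigma> (EigVecs i) \<longleftrightarrow> sym_mat (\<sigma> i)"
| "op_ok \<sigma> (EigVals i) \<longleftrightarrow> sym_mat (\<sigma> i)"
| "op_ok \<sigma> (SelCols i j) \<longleftrightarrow> \<sigma> j \<in> carrier_mat (dim_col (\<sigma> i)) 1"
| "op_ok \<sigma> (HCat i j) \<longleftrightarrow> dim_row (\<sigma> i) = dim_row (\<sigma> j)"
| "op_ok \<sigma> (Blocks i j k l) \<longleftrightarrow>
     dim_row (\<sigma> i) = dim_row (\<sigma> j) \<and> dim_row (\<sigma> k) = dim_row (\<sigma> l) \<and>
     dim_col (\<sigma> i) = dim_col (\<sigma> k) \<and> dim_col (\<sigma> j) = dim_col (\<sigma> l)"
| "op_ok \<sigma> (LowerRight i j) \<longleftrightarrow>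
     dim_row (\<sigma> j) \<le> dim_row (\<sigma> i) \<and> dim_row (\<sigma> j) \<le> dim_col (\<sigma> i)"
| "op_ok \<sigma> _ \<longleftrightarrow> True"

fun op_val :: "store \<Rightarrow> op \<Rightarrow> real mat" where
  "op_val \<sigma> (IConst c) = scal (of_int c)"
| "op_val \<sigma> (NRows i) = scal (real (dim_row (\<sigma> i)))"
| "op_val \<sigma> (NCols i) = scal (real (dim_col (\<sigma> i)))"
| "op_val \<sigma> (Eye i) = 1\<^sub>m (dim_row (\<sigma> i))"
| "op_val \<sigma> (Zeros i j) = 0\<^sub>m (dim_row (\<sigma> i)) (dim_col (\<sigma> j))"
| "op_val \<sigma> (Copy i) = \<sigma> i"
| "op_val \<sigma> (Transp i) = transpose_mat (\<sigma> i)"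
| "op_val \<sigma> (Plus i j) = \<sigma> i + \<sigma> j"
| "op_val \<sigma> (Minus i j) = \<sigma> i - \<sigma> j"
| "op_val \<sigma> (Times i j) = \<sigma> i * \<sigma> j"
| "op_val \<sigma> (Scale i j) = (\<sigma> i $$ (0, 0)) \<cdot>\<^sub>m \<sigma> j"
| "op_val \<sigma> (Trace i) = scal (mat_trace (\<sigma> i))"
| "op_val \<sigma> (Apply f i) = spectral_fun (efun_val f) (\<sigma> i)"
| "op_val \<sigma> (EigVecs i) = fst (eig_sys (\<sigma> i))"
| "op_val \<sigma> (EigVals i) = mat (dim_row (\<sigma> i)) 1 (\<lambda>(j, _). snd (eig_sys (\<sigma> i)) j)"
| "op_val \<sigma> (SelCols i j) = select_cols (\<sigma> i) (\<sigma> j)"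
| "op_val \<sigma> (HCat i j) = hcat (\<sigma> i) (\<sigma> j)"
| "op_val \<sigma> (Blocks i j k l) = four_block_mat (\<sigma> i) (\<sigma> j) (\<sigma> k) (\<sigma> l)"
| "op_val \<sigma> (LowerRight i j) = lower_right (dim_row (\<sigma> j)) (\<sigma> i)"

fun op_cost :: "store \<Rightarrow> op \<Rightarrow> nat" where
  "op_cost \<sigma> (Times i j) = 1 + 2 * dim_row (\<sigma> i) * dim_col (\<sigma> i) * dim_col (\<sigma> j)"
| "op_cost \<sigma> (Trace i) = 1 + dim_row (\<sigma> i)"
| "op_cost \<sigma> (Apply f i) = 1 + dim_row (\<sigma> i) ^ 3"
| "op_cost \<sigma> (EigVecs i) = 1 + dim_row (\<sigma> i) ^ 3"
| "op_cost \<sigma> (EigVals i) = 1 + dim_row (\<sigma> i) ^ 3"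
| "op_cost \<sigma> (SelCols i j) = 1 + dim_col (\<sigma> i) + entries (\<sigma> i)"
| "op_cost \<sigma> f = 1 + entries (op_val \<sigma> f)"

datatype com =
    Assign reg op
  | Seq com com
  | IfGreater reg reg com com
  | WhileGreater reg reg com

definition guard_ok :: "store \<Rightarrow> reg \<Rightarrow> reg \<Rightarrow> bool" where
  "guard_ok \<sigma> i j \<longleftrightarrow> \<sigma> i \<in> carrier_mat 1 1 \<and> \<sigma> j \<in> carrier_mat 1 1"

definition greater :: "store \<Rightarrow> reg \<Rightarrow> reg \<Rightarrow> bool" where
  "greater \<sigma> i j \<longleftrightarrow> \<sigma> i $$ (0, 0) > \<sigma> j $$ (0, 0)"

text \<open>The number of reals held in a store; all but finitely many registers are empty.\<close>

definition words :: "store \<Rightarrow> nat" where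
  "words \<sigma> = (\<Sum>i | entries (\<sigma> i) \<noteq> 0. entries (\<sigma> i))"

text \<open>\<open>exec c \<sigma> t w \<sigma>'\<close>: started in \<open>\<sigma>\<close>, the program \<open>c\<close> terminates in \<open>\<sigma>'\<close> with cost \<open>t\<close> and peak
  storage \<open>w\<close>.\<close>

inductive exec :: "com \<Rightarrow> store \<Rightarrow> nat \<Rightarrow> nat \<Rightarrow> store \<Rightarrow> bool" where
  Assign: "op_ok \<sigma> f \<Longrightarrow> \<sigma>' = \<sigma>(i := op_val \<sigma> f) \<Longrightarrow>
     exec (Assign i f) \<sigma> (op_cost \<sigma> f) (max (words \<sigma>) (words \<sigma>')) \<sigma>'"
| Seq: "exec c1 \<sigma> t1 w1 \<sigma>' \<Longrightarrow> exec c2 \<sigma>' t2 w2 \<sigma>'' \<Longrightarrow>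
     exec (Seq c1 c2) \<sigma> (t1 + t2) (max w1 w2) \<sigma>''"
| IfTrue: "guard_ok \<sigma> i j \<Longrightarrow> greater \<sigma> i j \<Longrightarrow> exec c1 \<sigma> t w \<sigma>' \<Longrightarrow>
     exec (IfGreater i j c1 c2) \<sigma> (1 + t) w \<sigma>'"
| IfFalse: "guard_ok \<sigma> i j \<Longrightarrow> \<not> greater \<sigma> i j \<Longrightarrow> exec c2 \<sigma> t w \<sigma>' \<Longrightarrow>
     exec (IfGreater i j c1 c2) \<sigma> (1 + t) w \<sigma>'"
| WhileFalse: "guard_ok \<sigma> i j \<Longrightarrow> \<not> greater \<sigma> i j \<Longrightarrow>
     exec (WhileGreater i j c) \<sigma> 1 (words \<sigma>) \<sigma>"
| WhileTrue: "guard_ok \<sigma> i j \<Longrightarrow> greater \<sigma> i j \<Longrightarrow> exec c \<sigma> t1 w1 \<sigma>' \<Longrightarrow>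
     exec (WhileGreater i j c) \<sigma>' t2 w2 \<sigma>'' \<Longrightarrow>
     exec (WhileGreater i j c) \<sigma> (1 + t1 + t2) (max w1 w2) \<sigma>''"


section \<open>Interface of the solver\<close>

definition reg_A :: reg where "reg_A = 0"
definition reg_B :: reg where "reg_B = 1"
definition reg_eps :: reg where "reg_eps = 2"
definition reg_E :: reg where "reg_E = 3"
definition reg_M :: reg where "reg_M = 4"
definition reg_La :: reg where "reg_La = 5"
definition reg_R0a :: reg where "reg_R0a = 6"
definition reg_rho :: reg where "reg_rho = 7"
definition reg_L0 :: reg where "reg_L0 = 8"
definition reg_tol :: reg where "reg_tol = 9"
definition reg_Sig :: reg where "reg_Sig = 10"
definition reg_beta :: reg where "reg_beta = 11"
definition reg_res :: reg where "reg_res = 12"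
definition reg_H :: reg where "reg_H = 13"
definition reg_c :: reg where "reg_c = 14"
definition reg_x :: reg where "reg_x = 15"
definition reg_y :: reg where "reg_y = 16"

definition input_store :: "real mat \<Rightarrow> real mat \<Rightarrow> real \<Rightarrow> store" where
  "input_store A B \<epsilon> = (\<lambda>_. 0\<^sub>m 0 0)(reg_A := A, reg_B := B, reg_eps := scal \<epsilon>)"

text \<open>The store holds the preprocessed data of the frame \<open>F\<close>, the \<open>k\<close>-th state, the left-hand
  side of the stopping test there, and the pair \<open>(H\<^sub>k, c)\<close> of the implicit controller.\<close>

definition holds_state ::
  "real mat \<Rightarrow> real mat \<Rightarrow> frame \<Rightarrow> real \<Rightarrow> nat \<Rightarrow> store \<Rightarrow> bool" where
  "holds_state A B F \<epsilon> k \<sigma> \<longleftrightarrow> (case active_iter A B F k of (\<Sigma>a, \<beta>) \<Rightarrow>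
     \<sigma> reg_E = E_of F \<and> \<sigma> reg_M = M_of A B F \<and> \<sigma> reg_La = La_of A B F \<and>
     \<sigma> reg_R0a = R0a_of A B F \<and> \<sigma> reg_rho = scal (rho_of A B F) \<and>
     \<sigma> reg_L0 = scal (L0_of A B F) \<and> \<sigma> reg_tol = scal (\<epsilon>\<^sup>2) \<and>
     \<sigma> reg_Sig = \<Sigma>a \<and> \<sigma> reg_beta = scal \<beta> \<and>
     \<sigma> reg_res = scal (residual_sq A B F \<Sigma>a \<beta>) \<and>
     \<sigma> reg_H = H_of A B F \<Sigma>a \<and> \<sigma> reg_c = scal (rho_of A B F * \<beta>))"

end

theory Submission
  imports Defs "HOL-Analysis.Henstock_Kurzweil_Integration"
begin

hide_const (open) Finite_Cartesian_Product.vec Finite_Cartesian_Product.mat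
hide_type (open) Finite_Cartesian_Product.vec
no_notation Finite_Cartesian_Product.vec_nth (infixl \<open>$\<close> 90)

section \<open>Products, blocks and norms of real matrices\<close>

lemma mult_assoc_dim:
  fixes A :: "'a :: semiring_0 mat"
  shows "dim_col A = dim_row B \<Longrightarrow> dim_col B = dim_row C \<Longrightarrow> A * B * C = A * (B * C)"
  by (rule assoc_mult_mat[of A "dim_row A" "dim_row B" B "dim_row C" C "dim_col C"]) auto

lemma transpose_mult_dim:
  fixes A :: "'a :: comm_semiring_0 mat"
  shows "dim_col A = dim_row B \<Longrightarrow> transpose_mat (A * B) = transpose_mat B * transpose_mat A"
  by (rule transpose_mult[of A "dim_row A" "dim_row B" B "dim_col B"]) auto

lemma mult_cancel_left:
  fixes A :: "'a :: semiring_1 mat"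
  assumes "A * B = 1\<^sub>m k" "dim_col A = dim_row B" "dim_col B = dim_row C"
  shows "A * (B * C) = C"
proof -
  have "dim_col B = k" using arg_cong[OF assms(1), of dim_col] by simp
  then show ?thesis
    using mult_assoc_dim[OF assms(2,3)] assms by simp
qed

lemma left_inverse_is_right_inverse:
  fixes A :: "'a :: field mat"
  assumes "A \<in> carrier_mat n n" "B \<in> carrier_mat n n" "A * B = 1\<^sub>m n"
  shows "B * A = 1\<^sub>m n"
  using mat_mult_left_right_inverse[OF assms] .

lemma mat_diag_simps [simp]:
  "dim_row (mat_diag n f) = n" "dim_col (mat_diag n f) = n"
  "transpose_mat (mat_diag n f) = mat_diag n f"
  "i < n \<Longrightarrow> j < n \<Longrightarrow> mat_diag n f $$ (i, j) = (if i = j then f j else 0)"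
  by (auto simp: mat_diag_def)

lemma mat_diag_cong: "(\<And>i. i < n \<Longrightarrow> f i = g i) \<Longrightarrow> mat_diag n f = mat_diag n g"
  by (auto simp: mat_diag_def)

lemma smult_mat_diag: "c \<cdot>\<^sub>m mat_diag n f = mat_diag n (\<lambda>i. c * f i)" for c :: real
  by (auto simp: mat_diag_def)

lemma index_mult_sum:
  "i < dim_row A \<Longrightarrow> j < dim_col B \<Longrightarrow> dim_col A = dim_row B \<Longrightarrow>
   (A * B) $$ (i, j) = (\<Sum>k<dim_row B. A $$ (i, k) * B $$ (k, j))"
  by (simp add: scalar_prod_def atLeast0LessThan)

lemma index_mult_vec_sum:
  "i < dim_row A \<Longrightarrow> dim_col A = dim_vec v \<Longrightarrow>
   (A *\<^sub>v v) $ i = (\<Sum>k<dim_vec v. A $$ (i, k) * v $ k)"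
  by (simp add: scalar_prod_def atLeast0LessThan)

lemma block_diag_dims [simp]:
  "dim_row (block_diag X Y) = dim_row X + dim_row Y"
  "dim_col (block_diag X Y) = dim_col X + dim_col Y"
  by (auto simp: block_diag_def)

lemma block_diag_carrier [simp, intro]:
  "X \<in> carrier_mat a b \<Longrightarrow> Y \<in> carrier_mat c e \<Longrightarrow> block_diag X Y \<in> carrier_mat (a + c) (b + e)"
  by (auto intro!: carrier_matI)

lemma block_diag_index:
  "i < dim_row X + dim_row Y \<Longrightarrow> j < dim_col X + dim_col Y \<Longrightarrow>
   block_diag X Y $$ (i, j) =
     (if i < dim_row X then (if j < dim_col X then X $$ (i, j) else 0)
      else (if j < dim_col X then 0 else Y $$ (i - dim_row X, j - dim_col X)))"
  by (auto simp: block_diag_def)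

lemma block_diag_mult:
  assumes "dim_col X = dim_row X'" "dim_col Y = dim_row Y'"
  shows "block_diag X Y * block_diag X' Y' = block_diag (X * X') (Y * Y')"
proof -
  have "block_diag X Y * block_diag X' Y' = four_block_mat
     (X * X' + 0\<^sub>m (dim_row X) (dim_col Y) * 0\<^sub>m (dim_row Y') (dim_col X'))
     (X * 0\<^sub>m (dim_row X') (dim_col Y') + 0\<^sub>m (dim_row X) (dim_col Y) * Y')
     (0\<^sub>m (dim_row Y) (dim_col X) * X' + Y * 0\<^sub>m (dim_row Y') (dim_col X'))
     (0\<^sub>m (dim_row Y) (dim_col X) * 0\<^sub>m (dim_row X') (dim_col Y') + Y * Y')"
    unfolding block_diag_def by (rule mult_four_block_mat) (use assms in auto)
  also have "\<dots> = block_diag (X * X') (Y * Y')"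
    using assms unfolding block_diag_def by (intro cong_four_block_mat) auto
  finally show ?thesis .
qed

lemma block_diag_transpose: "transpose_mat (block_diag X Y) = block_diag (transpose_mat X) (transpose_mat Y)"
  by (rule eq_matI) (auto simp: block_diag_index)

lemma block_diag_one [simp]: "block_diag (1\<^sub>m a) (1\<^sub>m b) = 1\<^sub>m (a + b)"
  by (rule eq_matI) (auto simp: block_diag_index)

lemma block_diag_smult: "c \<cdot>\<^sub>m block_diag X Y = block_diag (c \<cdot>\<^sub>m X) (c \<cdot>\<^sub>m Y)"
  by (rule eq_matI) (auto simp: block_diag_index)

lemma block_diag_mat_diag:
  "block_diag (mat_diag a f) (mat_diag b g) = mat_diag (a + b) (\<lambda>i. if i < a then f i else g (i - a))"
  by (rule eq_matI) (auto simp: block_diag_index)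

lemma block_diag_minus:
  "X \<in> carrier_mat a b \<Longrightarrow> X' \<in> carrier_mat a b \<Longrightarrow> Y \<in> carrier_mat c e \<Longrightarrow> Y' \<in> carrier_mat c e \<Longrightarrow>
   block_diag X Y - block_diag X' Y' = block_diag (X - X') (Y - Y')"
  by (rule eq_matI) (auto simp: block_diag_index)

lemma block_diag_assoc:
  "block_diag (block_diag X Y) Z = block_diag X (block_diag Y Z)" (is "?L = ?R")
proof (rule eq_matI)
  fix i j assume "i < dim_row ?R" "j < dim_col ?R"
  then have ij: "i < dim_row X + (dim_row Y + dim_row Z)" "j < dim_col X + (dim_col Y + dim_col Z)"
    by simp_all
  have "i < dim_row X \<or> dim_row X \<le> i \<and> i < dim_row X + dim_row Y \<or> dim_row X + dim_row Y \<le> i"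
    "j < dim_col X \<or> dim_col X \<le> j \<and> j < dim_col X + dim_col Y \<or> dim_col X + dim_col Y \<le> j"
    by linarith+
  then show "?L $$ (i, j) = ?R $$ (i, j)"
    using ij by (elim disjE conjE; simp add: block_diag_index diff_diff_left less_diff_conv2)
qed simp_all

lemma block_diag_empty [simp]: "block_diag X (mat 0 0 f) = X" "block_diag X (1\<^sub>m 0) = X"
  by (rule eq_matI; auto simp: block_diag_index)+

lemma lower_right_block_diag [simp]: "X \<in> carrier_mat a a \<Longrightarrow> lower_right a (block_diag X Y) = Y"
  by (rule eq_matI) (auto simp: lower_right_def block_diag_index)

lemma det_block_diag:
  assumes "X \<in> carrier_mat a a" "Y \<in> carrier_mat b b"
  shows "det (block_diag X Y) = det X * det Y"
  using det_four_block_mat_upper_right_zero[of X a "0\<^sub>m a b" b "0\<^sub>m b a" Y] assms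
  by (simp add: block_diag_def)

text \<open>The Frobenius inner product.\<close>

definition frob :: "real mat \<Rightarrow> real mat \<Rightarrow> real" where
  "frob X Y = (\<Sum>i<dim_row X. \<Sum>j<dim_col X. X $$ (i, j) * Y $$ (i, j))"

lemma frob_norm_sq: "(frob_norm X)\<^sup>2 = frob X X"
  unfolding frob_norm_def frob_def
  by (subst real_sqrt_pow2) (auto intro!: sum_nonneg simp: power2_eq_square)

lemma frob_norm_nonneg [simp]: "0 \<le> frob_norm X"
  unfolding frob_norm_def by (intro real_sqrt_ge_zero sum_nonneg) auto

lemma mat_trace_mult:
  assumes "X \<in> carrier_mat n k" "Y \<in> carrier_mat k n"
  shows "mat_trace (X * Y) = (\<Sum>i<n. \<Sum>j<k. X $$ (i, j) * Y $$ (j, i))"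
  using assms by (auto simp: mat_trace_def scalar_prod_def atLeast0LessThan intro!: sum.cong)

lemma mat_trace_commute:
  assumes "X \<in> carrier_mat n k" "Y \<in> carrier_mat k n"
  shows "mat_trace (X * Y) = mat_trace (Y * X)"
  unfolding mat_trace_mult[OF assms] mat_trace_mult[OF assms(2,1)]
  by (subst sum.swap) (auto simp: mult.commute intro!: sum.cong)

lemma frob_trace:
  assumes "X \<in> carrier_mat n k" "Y \<in> carrier_mat n k"
  shows "frob X Y = mat_trace (transpose_mat X * Y)"
proof -
  have "mat_trace (transpose_mat X * Y) = (\<Sum>j<k. \<Sum>i<n. X $$ (i, j) * Y $$ (i, j))"
    using assms by (subst mat_trace_mult[of _ k n]) auto
  also have "\<dots> = frob X Y"
    unfolding frob_def using assms by (subst sum.swap) auto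
  finally show ?thesis by simp
qed

lemma frob_orthogonal_conj:
  assumes c: "X \<in> carrier_mat n n" "Y \<in> carrier_mat n n" "U \<in> carrier_mat n n"
    and U: "transpose_mat U * U = 1\<^sub>m n"
  shows "frob (U * X * transpose_mat U) (U * Y * transpose_mat U) = frob X Y"
proof -
  have "transpose_mat (U * X * transpose_mat U) * (U * Y * transpose_mat U)
      = U * (transpose_mat X * (Y * transpose_mat U))"
    using c by (simp add: transpose_mult_dim mult_assoc_dim mult_cancel_left[OF U])
  then have "frob (U * X * transpose_mat U) (U * Y * transpose_mat U)
      = mat_trace (U * (transpose_mat X * (Y * transpose_mat U)))"
    using c by (subst frob_trace[of _ n n]) auto
  also have "\<dots> = mat_trace ((transpose_mat X * (Y * transpose_mat U)) * U)"
    using c by (subst mat_trace_commute[of _ n n]) auto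
  also have "(transpose_mat X * (Y * transpose_mat U)) * U = transpose_mat X * Y"
    using c by (simp add: mult_assoc_dim U)
  finally show ?thesis using c by (simp add: frob_trace[of _ n n])
qed

lemma frob_diag: "frob (mat_diag n f) (mat_diag n g) = (\<Sum>i<n. f i * g i)"
proof -
  have "frob (mat_diag n f) (mat_diag n g) = (\<Sum>i<n. \<Sum>j<n. if i = j then f j * g j else 0)"
    unfolding frob_def by (intro sum.cong refl) auto
  then show ?thesis by simp
qed

lemma sum_split: "(\<Sum>i<a + b. f i) = (\<Sum>i<a. f i) + (\<Sum>i<b. f (a + i))"
  for f :: "nat \<Rightarrow> real"
  by (induction b) auto

lemma frob_block_diag:
  assumes "X \<in> carrier_mat a a" "X' \<in> carrier_mat a a" "Y \<in> carrier_mat b b" "Y' \<in> carrier_mat b b"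
  shows "frob (block_diag X Y) (block_diag X' Y') = frob X X' + frob Y Y'"
  using assms by (simp add: frob_def sum_split block_diag_index)

lemma mat_trace_block_diag:
  assumes "X \<in> carrier_mat a a" "Y \<in> carrier_mat b b"
  shows "mat_trace (block_diag X Y) = mat_trace X + mat_trace Y"
  using assms by (simp add: mat_trace_def sum_split block_diag_index)

lemma frob_minus_left: "X \<in> carrier_mat a b \<Longrightarrow> Y \<in> carrier_mat a b \<Longrightarrow> frob (X - Y) Z = frob X Z - frob Y Z"
  by (simp add: frob_def sum_subtractf algebra_simps)

lemma frob_smult_left: "frob (c \<cdot>\<^sub>m X) Y = c * frob X Y"
  by (simp add: frob_def sum_distrib_left mult.assoc)

lemma frob_commute: "X \<in> carrier_mat a b \<Longrightarrow> Y \<in> carrier_mat a b \<Longrightarrow> frob X Y = frob Y X"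
  by (simp add: frob_def mult.commute)

lemma frob_one_left: "X \<in> carrier_mat n n \<Longrightarrow> frob (1\<^sub>m n) X = mat_trace X"
  by (simp add: frob_trace[of _ n n])

lemma frob_nonneg: "0 \<le> frob X X"
  unfolding frob_def by (intro sum_nonneg) auto

lemma frob_eq_0:
  assumes "frob X X = 0" "X \<in> carrier_mat a b"
  shows "X = 0\<^sub>m a b"
proof -
  have *: "\<forall>i\<in>{..<a}. (\<Sum>j<b. X $$ (i, j) * X $$ (i, j)) = 0"
    using assms by (subst sum_nonneg_eq_0_iff[symmetric]) (auto simp: frob_def intro!: sum_nonneg)
  have "X $$ (i, j) = 0" if "i < a" "j < b" for i j
  proof -
    have "\<forall>j\<in>{..<b}. X $$ (i, j) * X $$ (i, j) = 0"
      using * that by (subst sum_nonneg_eq_0_iff[symmetric]) auto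
    then show ?thesis using that by auto
  qed
  then show ?thesis using assms by (intro eq_matI) auto
qed

lemma frob_Cauchy_Schwarz: "frob X Y \<le> frob_norm X * frob_norm Y"
  if "X \<in> carrier_mat a b" "Y \<in> carrier_mat a b"
proof -
  define x where "x = (\<lambda>p. X $$ p)"
  define y where "y = (\<lambda>p. Y $$ p)"
  have e: "frob X Y = (\<Sum>p\<in>{..<a} \<times> {..<b}. x p * y p)"
      "frob X X = (\<Sum>p\<in>{..<a} \<times> {..<b}. (x p)\<^sup>2)" "frob Y Y = (\<Sum>p\<in>{..<a} \<times> {..<b}. (y p)\<^sup>2)"
    using that by (auto simp: frob_def sum.cartesian_product x_def y_def power2_eq_square intro!: sum.cong)
  have "(frob X Y)\<^sup>2 \<le> frob X X * frob Y Y"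
    unfolding e by (rule Cauchy_Schwarz_ineq_sum)
  then have "(frob X Y)\<^sup>2 \<le> (frob_norm X * frob_norm Y)\<^sup>2"
    by (simp add: power_mult_distrib frob_norm_sq)
  then show ?thesis
    by (rule power2_le_imp_le) simp
qed

section \<open>The spectral theorem for real symmetric matrices\<close>

lemma symmetric_has_eigenvector:
  fixes S :: "real mat"
  assumes S: "S \<in> carrier_mat n n" and sym: "transpose_mat S = S" and n: "0 < n"
  obtains v l where "v \<in> carrier_vec n" "v \<noteq> 0\<^sub>v n" "S *\<^sub>v v = l \<cdot>\<^sub>v v"
proof -
  define Sc where "Sc = map_mat complex_of_real S"
  have Sc: "Sc \<in> carrier_mat n n" using S by (simp add: Sc_def)
  have "degree (char_poly Sc) = n" using degree_monic_char_poly[OF Sc] by simp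
  then have "\<not> constant (poly (char_poly Sc))" using n by (simp add: constant_degree)
  then obtain \<mu> where "poly (char_poly Sc) \<mu> = 0" using fundamental_theorem_of_algebra by blast
  then have "eigenvalue Sc \<mu>" using eigenvalue_root_char_poly[OF Sc] by simp
  then obtain z where z: "z \<in> carrier_vec n" "z \<noteq> 0\<^sub>v n" "Sc *\<^sub>v z = \<mu> \<cdot>\<^sub>v z"
    using Sc by (auto simp: eigenvalue_def eigenvector_def)
  define x where "x = map_vec Re z"
  define y where "y = map_vec Im z"
  have xy [simp]: "x \<in> carrier_vec n" "y \<in> carrier_vec n" using z by (auto simp: x_def y_def)
  have row: "(\<Sum>k<n. complex_of_real (S $$ (i, k)) * z $ k) = \<mu> * z $ i" if "i < n" for i
    using arg_cong[OF z(3), of "\<lambda>v. v $ i"] that S Sc z(1)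
    by (simp add: index_mult_vec_sum Sc_def del: index_mult_mat_vec)
  have Sx: "S *\<^sub>v x = Re \<mu> \<cdot>\<^sub>v x - Im \<mu> \<cdot>\<^sub>v y"
  proof (rule eq_vecI)
    fix i assume "i < dim_vec (Re \<mu> \<cdot>\<^sub>v x - Im \<mu> \<cdot>\<^sub>v y)"
    then have i: "i < n" using z by (simp add: y_def)
    show "(S *\<^sub>v x) $ i = (Re \<mu> \<cdot>\<^sub>v x - Im \<mu> \<cdot>\<^sub>v y) $ i"
      using arg_cong[OF row[OF i], of Re] i S z(1)
      by (simp add: index_mult_vec_sum x_def y_def del: index_mult_mat_vec)
  qed (use S z in \<open>auto simp: y_def\<close>)
  have Sy: "S *\<^sub>v y = Im \<mu> \<cdot>\<^sub>v x + Re \<mu> \<cdot>\<^sub>v y"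
  proof (rule eq_vecI)
    fix i assume "i < dim_vec (Im \<mu> \<cdot>\<^sub>v x + Re \<mu> \<cdot>\<^sub>v y)"
    then have i: "i < n" using z by (simp add: y_def)
    show "(S *\<^sub>v y) $ i = (Im \<mu> \<cdot>\<^sub>v x + Re \<mu> \<cdot>\<^sub>v y) $ i"
      using arg_cong[OF row[OF i], of Im] i S z(1)
      by (simp add: index_mult_vec_sum x_def y_def del: index_mult_mat_vec)
  qed (use S z in \<open>auto simp: y_def\<close>)
  have ne: "x \<noteq> 0\<^sub>v n \<or> y \<noteq> 0\<^sub>v n"
  proof (rule ccontr)
    assume "\<not> ?thesis"
    then have "x = 0\<^sub>v n" "y = 0\<^sub>v n" by auto
    then have "z $ i = 0" if "i < n" for i
    proof -
      have "x $ i = 0" "y $ i = 0" using that \<open>x = 0\<^sub>v n\<close> \<open>y = 0\<^sub>v n\<close> by simp_all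
      then show ?thesis using that z(1) by (simp add: x_def y_def complex_eq_iff)
    qed
    then show False using z by (auto simp: vec_eq_iff)
  qed
  have "y \<bullet> (S *\<^sub>v x) = (S *\<^sub>v y) \<bullet> x"
    using transpose_vec_mult_scalar[OF S xy] sym by simp
  then have "Im \<mu> * (x \<bullet> x + y \<bullet> y) = 0"
    unfolding Sx Sy
    using comm_scalar_prod[OF xy] smult_scalar_prod_distrib[OF xy] smult_scalar_prod_distrib[OF xy(2,1)]
      smult_scalar_prod_distrib[OF xy(1,1)] scalar_prod_smult_distrib[OF xy(2,1)] scalar_prod_smult_distrib[OF xy(2,2)]
    by (simp add: scalar_prod_minus_distrib[of _ n] add_scalar_prod_distrib[of _ n] algebra_simps)
  moreover have "0 < x \<bullet> x + y \<bullet> y"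
    using ne conjugate_square_greater_0_vec[OF xy(1)] conjugate_square_greater_0_vec[OF xy(2)]
      conjugate_square_ge_0_vec[of x] conjugate_square_ge_0_vec[of y] by auto
  ultimately have im: "Im \<mu> = 0" by simp
  have "S *\<^sub>v x = Re \<mu> \<cdot>\<^sub>v x" "S *\<^sub>v y = Re \<mu> \<cdot>\<^sub>v y"
  proof -
    have d: "dim_vec x = n" "dim_vec y = n" using z by (auto simp: x_def y_def)
    show "S *\<^sub>v x = Re \<mu> \<cdot>\<^sub>v x" "S *\<^sub>v y = Re \<mu> \<cdot>\<^sub>v y"
      unfolding Sx Sy im by (rule eq_vecI; simp add: d)+
  qed
  then show ?thesis using that[of x] that[of y] ne xy by blast
qed

text \<open>A unit vector is the first column of an orthogonal matrix, namely of the Householder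
  reflection that swaps it with the first basis vector.\<close>

lemma unit_vector_extends_to_orthogonal:
  fixes v :: "real vec"
  assumes v: "v \<in> carrier_vec n" "v \<bullet> v = 1" and n: "0 < n"
  obtains H where "H \<in> carrier_mat n n" "transpose_mat H * H = 1\<^sub>m n" "col H 0 = v"
proof (cases "v = unit_vec n 0")
  case True
  then show ?thesis using n by (intro that[of "1\<^sub>m n"]) auto
next
  case False
  define w where "w = unit_vec n 0 - v"
  have w [simp]: "w \<in> carrier_vec n" using v by (simp add: w_def)
  have ww: "w \<bullet> w = 2 * (1 - v $ 0)"
    using v n
    by (simp add: w_def minus_scalar_prod_distrib[of _ n] scalar_prod_minus_distrib[of _ n])
  have "w \<noteq> 0\<^sub>v n"
  proof
    assume "w = 0\<^sub>v n"
    then have "(unit_vec n 0 - v) $ i = 0" if "i < n" for i using that by (simp add: w_def)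
    then show False using False v by (auto intro!: eq_vecI)
  qed
  then have "0 < w \<bullet> w" using w by (metis conjugate_square_greater_0_vec vec_conjugate_real)
  then have pos: "1 - v $ 0 > 0" using ww by simp
  define c where "c = 1 / (1 - v $ 0)"
  define H where "H = mat n n (\<lambda>(i, j). (if i = j then 1 else 0) - c * w $ i * w $ j)"
  have sumw: "(\<Sum>k<n. w $ k * w $ k) = 2 * (1 - v $ 0)"
    using ww w by (simp add: scalar_prod_def atLeast0LessThan)
  show ?thesis
  proof
    show H: "H \<in> carrier_mat n n" by (simp add: H_def)
    show "transpose_mat H * H = 1\<^sub>m n"
    proof (rule eq_matI)
      fix i j assume ij: "i < dim_row (1\<^sub>m n :: real mat)" "j < dim_col (1\<^sub>m n :: real mat)"
      then have "(transpose_mat H * H) $$ (i, j) =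
          (\<Sum>k<n. ((if k = i then 1 else 0) - c * w $ k * w $ i) * ((if k = j then 1 else 0) - c * w $ k * w $ j))"
        using H by (subst index_mult_sum) (auto simp: H_def)
      also have "\<dots> = (\<Sum>k<n. (if k = i then (if i = j then 1 else 0) - c * w $ i * w $ j else 0)
          - (if k = j then c * w $ j * w $ i else 0) + c * c * w $ i * w $ j * (w $ k * w $ k))"
        by (rule sum.cong) (auto simp: algebra_simps)
      also have "\<dots> = (if i = j then 1 else 0) - c * w $ i * w $ j - c * w $ j * w $ i
          + c * c * w $ i * w $ j * (\<Sum>k<n. w $ k * w $ k)"
        using ij by (simp add: sum.distrib sum_subtractf sum_distrib_left[symmetric])
      also have "\<dots> = (if i = j then 1 else 0)"
      proof -
        have "c * (1 - v $ 0) = 1" using pos by (simp add: c_def)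
        then have "c * (2 * (1 - v $ 0)) = 2" by (metis mult.left_commute mult_numeral_1_right numeral_One)
        then have "c * c * w $ i * w $ j * (2 * (1 - v $ 0)) = 2 * (c * w $ i * w $ j)" by (simp add: mult_ac)
        then show ?thesis unfolding sumw by (simp add: mult_ac)
      qed
      finally show "(transpose_mat H * H) $$ (i, j) = 1\<^sub>m n $$ (i, j)" using ij by simp
    qed (use H in auto)
    show "col H 0 = v"
    proof (rule eq_vecI)
      fix i assume "i < dim_vec v"
      then have i: "i < n" using v by simp
      have "w $ 0 = 1 - v $ 0" using v n by (simp add: w_def)
      then have "c * w $ i * w $ 0 = w $ i" using pos by (simp add: c_def)
      then show "col H 0 $ i = v $ i"
        using i n v by (auto simp: H_def w_def)
    qed (use v in \<open>simp add: H_def\<close>)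
  qed
qed

lemma spectral_decompositionD:
  assumes "spectral_decomposition S X ev" "S \<in> carrier_mat n n"
  shows "X \<in> carrier_mat n n" "transpose_mat X * X = 1\<^sub>m n" "X * transpose_mat X = 1\<^sub>m n"
    "S = X * mat_diag n ev * transpose_mat X"
proof -
  show *: "X \<in> carrier_mat n n" "transpose_mat X * X = 1\<^sub>m n" "S = X * mat_diag n ev * transpose_mat X"
    using assms by (auto simp: spectral_decomposition_def Let_def)
  then show "X * transpose_mat X = 1\<^sub>m n"
    by (intro left_inverse_is_right_inverse[of "transpose_mat X" n X]) auto
qed

lemma spectral_decompositionI:
  assumes "X \<in> carrier_mat n n" "transpose_mat X * X = 1\<^sub>m n" "S = X * mat_diag n ev * transpose_mat X"
  shows "spectral_decomposition S X ev"
  using assms by (auto simp: spectral_decomposition_def Let_def)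

lemma spectral_decomposition_block_diag:
  assumes "spectral_decomposition S X ev" "S \<in> carrier_mat a a"
    and "spectral_decomposition T Y ew" "T \<in> carrier_mat b b"
  shows "spectral_decomposition (block_diag S T) (block_diag X Y) (\<lambda>i. if i < a then ev i else ew (i - a))"
proof -
  note X = spectral_decompositionD[OF assms(1,2)] and Y = spectral_decompositionD[OF assms(3,4)]
  show ?thesis
  proof (rule spectral_decompositionI[of _ "a + b"])
    show "transpose_mat (block_diag X Y) * block_diag X Y = 1\<^sub>m (a + b)"
      using X Y by (simp add: block_diag_transpose block_diag_mult)
    show "block_diag S T = block_diag X Y * mat_diag (a + b) (\<lambda>i. if i < a then ev i else ew (i - a))
        * transpose_mat (block_diag X Y)"
      using X(1) Y(1) unfolding X(4) Y(4)
      by (simp add: block_diag_mult block_diag_transpose flip: block_diag_mat_diag)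
  qed (use X Y in auto)
qed

lemma spectral_decomposition_orthogonal_conj:
  assumes "spectral_decomposition S X ev" "S \<in> carrier_mat n n"
    and H: "H \<in> carrier_mat n n" "transpose_mat H * H = 1\<^sub>m n"
  shows "spectral_decomposition (H * S * transpose_mat H) (H * X) ev"
proof -
  note X = spectral_decompositionD[OF assms(1,2)]
  show ?thesis
  proof (rule spectral_decompositionI[of _ n])
    show "transpose_mat (H * X) * (H * X) = 1\<^sub>m n"
      using X(1,2) H by (simp add: transpose_mult_dim mult_assoc_dim mult_cancel_left[OF H(2)])
    show "H * S * transpose_mat H = H * X * mat_diag n ev * transpose_mat (H * X)"
      using X(1) H unfolding X(4) by (simp add: transpose_mult_dim mult_assoc_dim)
  qed (use X H in auto)
qed

theorem symmetric_spectral_theorem: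
  fixes S :: "real mat"
  assumes "S \<in> carrier_mat n n" "transpose_mat S = S"
  shows "\<exists>X ev. spectral_decomposition S X ev"
  using assms
proof (induction n arbitrary: S)
  case 0
  then show ?case
    by (intro exI[of _ "1\<^sub>m 0"] exI[of _ "\<lambda>_. 0"]) (auto simp: spectral_decomposition_def Let_def)
next
  case (Suc n)
  obtain v0 l where v0: "v0 \<in> carrier_vec (Suc n)" "v0 \<noteq> 0\<^sub>v (Suc n)" "S *\<^sub>v v0 = l \<cdot>\<^sub>v v0"
    using symmetric_has_eigenvector[OF Suc.prems] by auto
  define v where "v = (1 / sqrt (v0 \<bullet> v0)) \<cdot>\<^sub>v v0"
  have pos: "0 < v0 \<bullet> v0" using v0 by (metis conjugate_square_greater_0_vec vec_conjugate_real)
  have v: "v \<in> carrier_vec (Suc n)" "S *\<^sub>v v = l \<cdot>\<^sub>v v" "v \<bullet> v = 1"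
    using v0 pos Suc.prems
    by (auto simp: v_def mult_mat_vec[of _ "Suc n" "Suc n"] smult_smult_assoc mult.commute)
  obtain H where H: "H \<in> carrier_mat (Suc n) (Suc n)" "transpose_mat H * H = 1\<^sub>m (Suc n)" "col H 0 = v"
    using unit_vector_extends_to_orthogonal[OF v(1,3)] by auto
  note HH = left_inverse_is_right_inverse[OF _ H(1) H(2), simplified, OF H(1)]
  define S' where "S' = transpose_mat H * S * H"
  have S': "S' \<in> carrier_mat (Suc n) (Suc n)" using H Suc.prems by (simp add: S'_def)
  have symS': "transpose_mat S' = S'"
    using H Suc.prems by (simp add: S'_def transpose_mult_dim mult_assoc_dim)
  have "col S' 0 = transpose_mat H *\<^sub>v (S *\<^sub>v v)"
  proof -
    have SH: "S * H \<in> carrier_mat (Suc n) (Suc n)" using H Suc.prems by simp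
    have "S' = transpose_mat H * (S * H)" using H Suc.prems by (simp add: S'_def mult_assoc_dim)
    then have "col S' 0 = transpose_mat H *\<^sub>v col (S * H) 0"
      using col_mult2[OF transpose_carrier_mat[THEN iffD2, OF H(1)] SH zero_less_Suc] by (simp only:)
    also have "col (S * H) 0 = S *\<^sub>v v"
      using col_mult2[OF Suc.prems(1) H(1) zero_less_Suc] by (simp only: H(3))
    finally show ?thesis .
  qed
  also have "\<dots> = l \<cdot>\<^sub>v (transpose_mat H *\<^sub>v col H 0)"
    using H v by (simp add: mult_mat_vec[of _ "Suc n" "Suc n"])
  also have "transpose_mat H *\<^sub>v col H 0 = col (transpose_mat H * H) 0"
    using H(1) by (simp only: col_mult2[of "transpose_mat H" "Suc n" "Suc n" H "Suc n"] transpose_carrier_mat)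
  finally have col0: "col S' 0 = l \<cdot>\<^sub>v unit_vec (Suc n) 0" using H by simp
  have c: "S' $$ (i, 0) = (if i = 0 then l else 0)" if "i < Suc n" for i
    using arg_cong[OF col0, of "\<lambda>v. v $ i"] that S' by auto
  have r: "S' $$ (0, i) = (if i = 0 then l else 0)" if "i < Suc n" for i
    using c[OF that] arg_cong[OF symS', of "\<lambda>M. M $$ (i, 0)"] that S' by auto
  define S2 where "S2 = lower_right 1 S'"
  have S2: "S2 \<in> carrier_mat n n" using S' by (auto simp: S2_def lower_right_def)
  have eqS': "S' = block_diag (mat_diag 1 (\<lambda>_. l)) S2"
    using S' c r by (intro eq_matI) (auto simp: block_diag_index S2_def lower_right_def)
  have "transpose_mat S2 = S2"
  proof (rule eq_matI)
    fix i j assume "i < dim_row S2" "j < dim_col S2"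
    then show "transpose_mat S2 $$ (i, j) = S2 $$ (i, j)"
      using S' arg_cong[OF symS', of "\<lambda>M. M $$ (Suc i, Suc j)"] by (auto simp: S2_def lower_right_def)
  qed (use S2 in auto)
  then obtain X ev where X: "spectral_decomposition S2 X ev" using Suc.IH[OF S2] by blast
  have "spectral_decomposition (mat_diag 1 (\<lambda>_. l)) (1\<^sub>m 1) (\<lambda>_. l)"
    by (rule spectral_decompositionI[of _ 1]) auto
  from spectral_decomposition_block_diag[OF this _ X S2, of 1]
  have sd: "spectral_decomposition S' (block_diag (1\<^sub>m 1) X) (\<lambda>i. if i < 1 then l else ev (i - 1))"
    unfolding eqS' by simp
  have "S = H * S' * transpose_mat H"
    using H Suc.prems by (simp add: S'_def mult_assoc_dim mult_cancel_left[OF HH] HH)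
  then show ?case
    using spectral_decomposition_orthogonal_conj[OF sd S' H(1,2)] by auto
qed

section \<open>Functions of a symmetric matrix\<close>

lemma spectral_fun_well_defined:
  fixes X Y :: "real mat" and ev ew :: "nat \<Rightarrow> real" and f :: "real \<Rightarrow> real"
  assumes X: "X \<in> carrier_mat n n" "transpose_mat X * X = 1\<^sub>m n"
    and Y: "Y \<in> carrier_mat n n" "transpose_mat Y * Y = 1\<^sub>m n"
    and eq: "X * mat_diag n ev * transpose_mat X = Y * mat_diag n ew * transpose_mat Y"
  shows "X * mat_diag n (\<lambda>i. f (ev i)) * transpose_mat X = Y * mat_diag n (\<lambda>i. f (ew i)) * transpose_mat Y"
proof -
  have XX: "X * transpose_mat X = 1\<^sub>m n" and YY: "Y * transpose_mat Y = 1\<^sub>m n"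
    using left_inverse_is_right_inverse[of "transpose_mat X" n X]
      left_inverse_is_right_inverse[of "transpose_mat Y" n Y] X Y by simp_all
  define G where "G = transpose_mat Y * X"
  have G: "G \<in> carrier_mat n n" using X Y by (simp add: G_def)
  have "G * mat_diag n ev = transpose_mat Y * (X * mat_diag n ev * transpose_mat X) * X"
    using X Y by (simp add: G_def mult_assoc_dim)
  also have "\<dots> = mat_diag n ew * G"
    unfolding eq using X Y by (simp add: G_def mult_assoc_dim mult_cancel_left[OF Y(2)])
  finally have comm: "G * mat_diag n ev = mat_diag n ew * G" .
  \<comment> \<open>\<open>G\<close> links only indices with equal eigenvalues, so it intertwines any function of them.\<close>
  have "G * mat_diag n (\<lambda>i. f (ev i)) = mat_diag n (\<lambda>i. f (ew i)) * G"
  proof (rule eq_matI)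
    fix i j assume "i < dim_row (mat_diag n (\<lambda>i. f (ew i)) * G)" "j < dim_col (mat_diag n (\<lambda>i. f (ew i)) * G)"
    then have ij: "i < n" "j < n" using G by auto
    have "G $$ (i, j) * ev j = ew i * G $$ (i, j)"
      using arg_cong[OF comm, of "\<lambda>M. M $$ (i, j)"] ij
      by (simp add: mat_diag_mult_left[OF G] mat_diag_mult_right[OF G])
    then have "G $$ (i, j) = 0 \<or> ev j = ew i" by auto
    then show "(G * mat_diag n (\<lambda>i. f (ev i))) $$ (i, j) = (mat_diag n (\<lambda>i. f (ew i)) * G) $$ (i, j)"
      using ij by (auto simp: mat_diag_mult_left[OF G] mat_diag_mult_right[OF G])
  qed (use G in auto)
  then have "Y * (G * mat_diag n (\<lambda>i. f (ev i))) * transpose_mat X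
      = Y * (mat_diag n (\<lambda>i. f (ew i)) * G) * transpose_mat X" by simp
  then show ?thesis
    using X Y by (simp add: G_def mult_assoc_dim mult_cancel_left[OF YY] XX)
qed

lemma spectral_fun_eq:
  assumes "spectral_decomposition S X ev" "S \<in> carrier_mat n n"
  shows "spectral_fun f S = X * mat_diag n (\<lambda>i. f (ev i)) * transpose_mat X"
  unfolding spectral_fun_def
proof (rule the_equality)
  show "\<exists>X' ev'. spectral_decomposition S X' ev' \<and>
     X * mat_diag n (\<lambda>i. f (ev i)) * transpose_mat X
       = X' * mat_diag (dim_row S) (\<lambda>i. f (ev' i)) * transpose_mat X'"
    using assms by auto
next
  fix Y assume "\<exists>X' ev'. spectral_decomposition S X' ev' \<and>
     Y = X' * mat_diag (dim_row S) (\<lambda>i. f (ev' i)) * transpose_mat X'"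
  then obtain X' ev' where *: "spectral_decomposition S X' ev'"
      "Y = X' * mat_diag n (\<lambda>i. f (ev' i)) * transpose_mat X'"
    using assms by auto
  note X = spectral_decompositionD[OF assms] and X' = spectral_decompositionD[OF *(1) assms(2)]
  show "Y = X * mat_diag n (\<lambda>i. f (ev i)) * transpose_mat X"
    unfolding *(2) by (rule spectral_fun_well_defined) (use X X' in auto)
qed

lemma spectral_fun_decomposition:
  assumes "spectral_decomposition S X ev" "S \<in> carrier_mat n n"
  shows "spectral_decomposition (spectral_fun f S) X (\<lambda>i. f (ev i))"
  using spectral_decompositionD(1,2)[OF assms]
  by (intro spectral_decompositionI[of _ n]) (auto simp: spectral_fun_eq[OF assms])

lemma spectral_decomposition_sym:
  assumes "spectral_decomposition S X ev" "S \<in> carrier_mat n n"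
  shows "transpose_mat S = S"
  using spectral_decompositionD(1)[OF assms] unfolding spectral_decompositionD(4)[OF assms]
  by (simp add: transpose_mult_dim mult_assoc_dim)

lemma sym_decomp:
  fixes S :: "real mat"
  assumes "S \<in> carrier_mat n n" "transpose_mat S = S"
  shows "\<exists>X ev. spectral_decomposition S X ev \<and> X \<in> carrier_mat n n \<and>
    transpose_mat X * X = 1\<^sub>m n \<and> X * transpose_mat X = 1\<^sub>m n \<and>
    S = X * mat_diag n ev * transpose_mat X"
  using symmetric_spectral_theorem[OF assms] spectral_decompositionD[OF _ assms(1)] by metis

lemma spectral_fun_sym:
  assumes "S \<in> carrier_mat n n" "transpose_mat S = S"
  shows spectral_fun_carrier: "spectral_fun f S \<in> carrier_mat n n"
    and spectral_fun_transpose: "transpose_mat (spectral_fun f S) = spectral_fun f S"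
proof -
  from sym_decomp[OF assms] obtain X ev where X: "spectral_decomposition S X ev" "X \<in> carrier_mat n n" by blast
  show "spectral_fun f S \<in> carrier_mat n n" using X(2) by (auto simp: spectral_fun_eq[OF X(1) assms(1)])
  then show "transpose_mat (spectral_fun f S) = spectral_fun f S"
    using spectral_decomposition_sym[OF spectral_fun_decomposition[OF X(1) assms(1)]] by blast
qed

lemma spectral_fun_compose:
  assumes "S \<in> carrier_mat n n" "transpose_mat S = S"
  shows "spectral_fun g (spectral_fun f S) = spectral_fun (\<lambda>x. g (f x)) S"
proof -
  from sym_decomp[OF assms] obtain X ev where X: "spectral_decomposition S X ev" "X \<in> carrier_mat n n" by blast
  show ?thesis
    using spectral_fun_eq[OF spectral_fun_decomposition[OF X(1) assms(1)] spectral_fun_carrier[OF assms]]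
    by (simp add: spectral_fun_eq[OF X(1) assms(1)])
qed

lemma spectral_fun_mult:
  assumes "S \<in> carrier_mat n n" "transpose_mat S = S"
  shows "spectral_fun f S * spectral_fun g S = spectral_fun (\<lambda>x. f x * g x) S"
proof -
  from sym_decomp[OF assms] obtain X ev where X: "spectral_decomposition S X ev" "X \<in> carrier_mat n n"
    "transpose_mat X * X = 1\<^sub>m n" by blast
  have "mat_diag n (\<lambda>i. f (ev i)) * (mat_diag n (\<lambda>i. g (ev i)) * transpose_mat X) =
     mat_diag n (\<lambda>i. f (ev i) * g (ev i)) * transpose_mat X"
    using X by (subst mult_assoc_dim[symmetric]) auto
  then show ?thesis
    using X(2) by (simp add: spectral_fun_eq[OF X(1) assms(1)] mult_assoc_dim mult_cancel_left[OF X(3)])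
qed

lemma spectral_fun_block_diag:
  assumes "S \<in> carrier_mat a a" "transpose_mat S = S" "T \<in> carrier_mat b b" "transpose_mat T = T"
  shows "spectral_fun f (block_diag S T) = block_diag (spectral_fun f S) (spectral_fun f T)"
proof -
  from sym_decomp[OF assms(1,2)] obtain X ev where X: "spectral_decomposition S X ev" "X \<in> carrier_mat a a" by blast
  from sym_decomp[OF assms(3,4)] obtain Y ew where Y: "spectral_decomposition T Y ew" "Y \<in> carrier_mat b b" by blast
  have "(\<lambda>i. f (if i < a then ev i else ew (i - a))) = (\<lambda>i. if i < a then f (ev i) else f (ew (i - a)))"
    by auto
  then have "spectral_fun f (block_diag S T) = block_diag X Y *
      block_diag (mat_diag a (\<lambda>i. f (ev i))) (mat_diag b (\<lambda>i. f (ew i))) * transpose_mat (block_diag X Y)"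
    using spectral_fun_eq[OF spectral_decomposition_block_diag[OF X(1) assms(1) Y(1) assms(3)], of "a + b" f]
      assms by (simp add: block_diag_mat_diag)
  then show ?thesis
    using X(2) Y(2)
    by (simp add: spectral_fun_eq[OF X(1) assms(1)] spectral_fun_eq[OF Y(1) assms(3)]
        block_diag_mult block_diag_transpose)
qed

lemma spectral_fun_mat_diag: "spectral_fun f (mat_diag n ev) = mat_diag n (\<lambda>i. f (ev i))"
proof -
  have "spectral_decomposition (mat_diag n ev) (1\<^sub>m n) ev"
    by (rule spectral_decompositionI[of _ n]) auto
  from spectral_fun_eq[OF this, of n] show ?thesis by simp
qed

lemma scalar_mat_diag: "c \<cdot>\<^sub>m 1\<^sub>m n = mat_diag n (\<lambda>_. c :: real)"
  by (rule eq_matI) auto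

lemma spectral_fun_scalar: "spectral_fun f (c \<cdot>\<^sub>m 1\<^sub>m n) = f c \<cdot>\<^sub>m 1\<^sub>m n"
  by (simp add: scalar_mat_diag spectral_fun_mat_diag)

lemma spectral_fun_one: "spectral_fun f (1\<^sub>m n) = f 1 \<cdot>\<^sub>m 1\<^sub>m n"
proof -
  have "1 \<cdot>\<^sub>m 1\<^sub>m n = (1\<^sub>m n :: real mat)" by (rule eq_matI) auto
  then show ?thesis using spectral_fun_scalar[of f 1 n] by simp
qed

section \<open>Positive definite matrices\<close>

lemma spdD:
  assumes "P \<in> spd n"
  shows "P \<in> carrier_mat n n" "transpose_mat P = P"
  using assms by (auto simp: spd_def)

lemma dim_spd: "P \<in> spd n \<Longrightarrow> dim_row P = n" "P \<in> spd n \<Longrightarrow> dim_col P = n"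
  by (auto dest: spdD)

lemma spd_congruence:
  assumes S: "S \<in> spd k" and A: "A \<in> carrier_mat k n"
    and inj: "\<And>v. v \<in> carrier_vec n \<Longrightarrow> A *\<^sub>v v = 0\<^sub>v k \<Longrightarrow> v = 0\<^sub>v n"
  shows "transpose_mat A * S * A \<in> spd n"
proof -
  note S' = spdD[OF S]
  have "v \<bullet> ((transpose_mat A * S * A) *\<^sub>v v) > 0" if v: "v \<in> carrier_vec n" "v \<noteq> 0\<^sub>v n" for v
  proof -
    have "v \<bullet> ((transpose_mat A * S * A) *\<^sub>v v) = v \<bullet> (transpose_mat A *\<^sub>v (S *\<^sub>v (A *\<^sub>v v)))"
      using S' A v by (simp add: assoc_mult_mat_vec[of _ n k] assoc_mult_mat_vec[of _ n k _ n])
    also have "\<dots> = (A *\<^sub>v v) \<bullet> (S *\<^sub>v (A *\<^sub>v v))"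
      using transpose_vec_mult_scalar[of "transpose_mat A" n k "S *\<^sub>v (A *\<^sub>v v)" v] S' A v by simp
    also have "\<dots> > 0"
    proof -
      have "A *\<^sub>v v \<in> carrier_vec k" "A *\<^sub>v v \<noteq> 0\<^sub>v k" using A v inj[OF v(1)] by auto
      then show ?thesis using S by (auto simp: spd_def)
    qed
    finally show ?thesis .
  qed
  then show ?thesis
    using S' A by (auto simp: spd_def transpose_mult_dim mult_assoc_dim)
qed

lemma spd_congruence_invertible:
  assumes S: "S \<in> spd n" and G: "G \<in> carrier_mat n n" "G' \<in> carrier_mat n n" "G * G' = 1\<^sub>m n"
  shows "G * S * transpose_mat G \<in> spd n"
proof -
  have "transpose_mat (transpose_mat G) * S * transpose_mat G \<in> spd n"
  proof (rule spd_congruence[OF S])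
    fix v assume v: "v \<in> carrier_vec n" "transpose_mat G *\<^sub>v v = 0\<^sub>v n"
    have "transpose_mat G' * transpose_mat G = 1\<^sub>m n"
      using G by (simp flip: transpose_mult_dim)
    then have "v = transpose_mat G' *\<^sub>v (transpose_mat G *\<^sub>v v)"
      using G v(1) by (simp flip: assoc_mult_mat_vec[of _ n n _ n])
    then show "v = 0\<^sub>v n" unfolding v(2) using G by auto
  qed (use G in auto)
  then show ?thesis by simp
qed

lemma spd_mat_diag:
  assumes "\<And>i. i < n \<Longrightarrow> 0 < f i" shows "mat_diag n f \<in> spd n"
proof -
  have "v \<bullet> (mat_diag n f *\<^sub>v v) > 0" if v: "v \<in> carrier_vec n" "v \<noteq> 0\<^sub>v n" for v
  proof -
    have "(mat_diag n f *\<^sub>v v) $ i = f i * v $ i" if "i < n" for i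
    proof -
      have "(mat_diag n f *\<^sub>v v) $ i = (\<Sum>k<n. (if k = i then f i * v $ i else 0))"
      proof (subst index_mult_vec_sum)
        show "(\<Sum>k<dim_vec v. mat_diag n f $$ (i, k) * v $ k) = (\<Sum>k<n. if k = i then f i * v $ i else 0)"
          using that v(1) by (intro sum.cong) auto
      qed (use that v(1) in auto)
      then show ?thesis using that by simp
    qed
    then have *: "v \<bullet> (mat_diag n f *\<^sub>v v) = (\<Sum>i<n. f i * (v $ i)\<^sup>2)"
      using v(1) by (auto simp: scalar_prod_def power2_eq_square atLeast0LessThan intro!: sum.cong)
    obtain i where "i < n" "v $ i \<noteq> 0"
    proof (rule ccontr)
      assume "\<not> thesis"
      then have "\<forall>i<n. v $ i = 0" using that by blast
      then show False using v by (auto intro!: eq_vecI)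
    qed
    then show ?thesis unfolding *
      using assms by (intro sum_pos2[of _ i]) (auto simp: less_imp_le)
  qed
  then show ?thesis by (auto simp: spd_def)
qed

lemma spd_one [simp]: "1\<^sub>m n \<in> spd n"
  using spd_mat_diag[of n "\<lambda>_. 1"] by simp

lemma spectral_decomposition_eigenvector:
  assumes "spectral_decomposition S X ev" "S \<in> carrier_mat n n" "i < n"
  shows "S *\<^sub>v col X i = ev i \<cdot>\<^sub>v col X i" "col X i \<bullet> col X i = 1"
proof -
  note X = spectral_decompositionD[OF assms(1,2)]
  have c1: "(transpose_mat X * X) $$ (i, i) = 1" using X(2) assms(3) by simp
  then show "col X i \<bullet> col X i = 1" using X(1) assms(3) by simp
  have "S * X = X * mat_diag n ev"
    using X(1,2) unfolding X(4) by (simp add: mult_assoc_dim)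
  then have "col (S * X) i = col (X * mat_diag n ev) i" by simp
  moreover have "col (S * X) i = S *\<^sub>v col X i" by (rule col_mult2[OF assms(2) X(1) assms(3)])
  moreover have "col (X * mat_diag n ev) i = ev i \<cdot>\<^sub>v col X i"
    using X(1) assms by (intro eq_vecI) (auto simp: mat_diag_mult_right[OF X(1)])
  ultimately show "S *\<^sub>v col X i = ev i \<cdot>\<^sub>v col X i" by simp
qed

lemma spd_eigenvalues_pos:
  assumes "spectral_decomposition S X ev" "S \<in> spd n" "i < n"
  shows "0 < ev i"
proof -
  note S = spdD[OF assms(2)]
  note X = spectral_decompositionD[OF assms(1) S(1)]
  note e = spectral_decomposition_eigenvector[OF assms(1) S(1) assms(3)]
  have c: "col X i \<in> carrier_vec n" using X(1) assms(3) by simp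
  then have "col X i \<noteq> 0\<^sub>v n" using e(2) by auto
  then have "0 < col X i \<bullet> (S *\<^sub>v col X i)" using assms(2) c by (auto simp: spd_def)
  then show ?thesis using e c by simp
qed

lemma spd_decomp:
  assumes "S \<in> spd n"
  shows "\<exists>X ev. spectral_decomposition S X ev \<and> X \<in> carrier_mat n n \<and>
    transpose_mat X * X = 1\<^sub>m n \<and> X * transpose_mat X = 1\<^sub>m n \<and>
    S = X * mat_diag n ev * transpose_mat X \<and> (\<forall>i<n. 0 < ev i)"
  using sym_decomp[OF spdD[OF assms]] spd_eigenvalues_pos[OF _ assms] by metis

lemma spdI_decomposition:
  assumes "spectral_decomposition S X ev" "S \<in> carrier_mat n n" "\<And>i. i < n \<Longrightarrow> 0 < ev i"
  shows "S \<in> spd n"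
  using spectral_decompositionD[OF assms(1,2)] spd_mat_diag[of n ev] assms(3)
  by (metis spd_congruence_invertible transpose_carrier_mat)

lemma spectral_fun_spd:
  assumes "S \<in> carrier_mat n n" "transpose_mat S = S" "\<And>x. f x > 0"
  shows "spectral_fun f S \<in> spd n"
proof -
  from sym_decomp[OF assms(1,2)] obtain X ev where X: "spectral_decomposition S X ev" by blast
  show ?thesis
    by (rule spdI_decomposition[OF spectral_fun_decomposition[OF X assms(1)]])
      (use assms spectral_fun_carrier in auto)
qed

lemma spectral_fun_spd_pos:
  assumes "S \<in> spd n" "\<And>x. x > 0 \<Longrightarrow> f x > 0"
  shows "spectral_fun f S \<in> spd n"
proof -
  from spd_decomp[OF assms(1)] obtain X ev where X: "spectral_decomposition S X ev" "\<And>i. i < n \<Longrightarrow> 0 < ev i" by blast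
  show ?thesis
    by (rule spdI_decomposition[OF spectral_fun_decomposition[OF X(1) spdD(1)[OF assms(1)]]])
      (use assms X spdD[OF assms(1)] spectral_fun_carrier in auto)
qed

lemma spectral_fun_cong_spd:
  assumes "S \<in> spd n" "\<And>x. x > 0 \<Longrightarrow> f x = g x"
  shows "spectral_fun f S = spectral_fun g S"
proof -
  from spd_decomp[OF assms(1)] obtain X ev where X: "spectral_decomposition S X ev" "\<And>i. i < n \<Longrightarrow> 0 < ev i" by blast
  then show ?thesis
    using assms(2) spdD[OF assms(1)]
    by (simp add: spectral_fun_eq[OF X(1)] cong: mat_diag_cong)
qed

lemma spectral_fun_id:
  assumes "S \<in> carrier_mat n n" "transpose_mat S = S"
  shows "spectral_fun (\<lambda>x. x) S = S"
proof -
  from sym_decomp[OF assms] obtain X ev where X: "spectral_decomposition S X ev"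
    "S = X * mat_diag n ev * transpose_mat X" by blast
  then show ?thesis using spectral_fun_eq[OF X(1) assms(1)] by simp
qed

lemma spectral_fun_const:
  assumes "S \<in> carrier_mat n n" "transpose_mat S = S"
  shows "spectral_fun (\<lambda>x. c) S = c \<cdot>\<^sub>m 1\<^sub>m n"
proof -
  from sym_decomp[OF assms] obtain X ev where X: "spectral_decomposition S X ev"
    "X \<in> carrier_mat n n" "X * transpose_mat X = 1\<^sub>m n" by blast
  then show ?thesis
    using spectral_fun_eq[OF X(1) assms(1), of "\<lambda>_. c"] mult_smult_distrib[OF X(2), of "1\<^sub>m n" n c]
      mult_smult_assoc_mat[OF X(2), of "transpose_mat X" n c]
    by (simp flip: scalar_mat_diag)
qed

lemma mat_sqrt_isqrt:
  assumes "P \<in> spd n"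
  shows "mat_sqrt P \<in> spd n" "mat_isqrt P \<in> spd n"
    "mat_sqrt P * mat_sqrt P = P" "mat_isqrt P * mat_sqrt P = 1\<^sub>m n" "mat_sqrt P * mat_isqrt P = 1\<^sub>m n"
proof -
  note P = spdD[OF assms]
  show "mat_sqrt P \<in> spd n" "mat_isqrt P \<in> spd n"
    unfolding mat_sqrt_def mat_isqrt_def by (rule spectral_fun_spd_pos[OF assms]; simp)+
  show "mat_sqrt P * mat_sqrt P = P"
    unfolding mat_sqrt_def spectral_fun_mult[OF P]
    using spectral_fun_cong_spd[OF assms, of "\<lambda>x. sqrt x * sqrt x" "\<lambda>x. x"] by (simp add: spectral_fun_id[OF P])
  have "spectral_fun (\<lambda>x. 1 / sqrt x * sqrt x) P = spectral_fun (\<lambda>x. 1) P"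
    "spectral_fun (\<lambda>x. sqrt x * (1 / sqrt x)) P = spectral_fun (\<lambda>x. 1) P"
    by (rule spectral_fun_cong_spd[OF assms]; simp)+
  moreover have "spectral_fun (\<lambda>x. 1) P = 1\<^sub>m n"
    unfolding spectral_fun_const[OF P] by (rule eq_matI) auto
  ultimately show "mat_isqrt P * mat_sqrt P = 1\<^sub>m n" "mat_sqrt P * mat_isqrt P = 1\<^sub>m n"
    unfolding mat_sqrt_def mat_isqrt_def spectral_fun_mult[OF P] by simp_all
qed

lemma mat_exp_log:
  assumes "P \<in> spd n" shows "mat_exp (mat_log P) = P"
  unfolding mat_exp_def mat_log_def spectral_fun_compose[OF spdD[OF assms]]
  using spectral_fun_cong_spd[OF assms, of "\<lambda>x. exp (ln x)" "\<lambda>x. x"] by (simp add: spectral_fun_id[OF spdD[OF assms]])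

lemma det_orthogonal_conj:
  fixes X :: "real mat"
  assumes "X \<in> carrier_mat n n" "D \<in> carrier_mat n n" "transpose_mat X * X = 1\<^sub>m n"
  shows "det (X * D * transpose_mat X) = det D"
proof -
  have "det (transpose_mat X * X) = 1" using assms by simp
  then have "det X * det (transpose_mat X) = 1"
    using assms by (subst (asm) det_mult[of _ n]) (auto simp: det_transpose)
  then show ?thesis
    using assms by (simp add: det_mult[of _ n])
qed

lemma det_mat_diag: "det (mat_diag n f) = (\<Prod>i<n. f i)" for f :: "nat \<Rightarrow> real"
  by (subst det_upper_triangular[of _ n]) (auto simp: prod_list_diag_prod atLeast0LessThan intro!: prod.cong)

lemma det_spectral:
  assumes "spectral_decomposition S X ev" "S \<in> carrier_mat n n"
  shows "det S = (\<Prod>i<n. ev i)"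
  using spectral_decompositionD[OF assms] det_orthogonal_conj[of X n "mat_diag n ev"] by (simp add: det_mat_diag)

lemma det_spd_pos: assumes "S \<in> spd n" shows "0 < det S"
proof -
  from spd_decomp[OF assms] obtain X ev where X: "spectral_decomposition S X ev" "\<And>i. i < n \<Longrightarrow> 0 < ev i" by blast
  then show ?thesis unfolding det_spectral[OF X(1) spdD(1)[OF assms]] by (intro prod_pos) auto
qed

lemma mat_trace_spectral:
  assumes "spectral_decomposition S X ev" "S \<in> carrier_mat n n"
  shows "mat_trace S = (\<Sum>i<n. ev i)"
proof -
  note X = spectral_decompositionD[OF assms]
  have "mat_trace S = mat_trace (transpose_mat X * (X * mat_diag n ev))"
    using mat_trace_commute[of "X * mat_diag n ev" n n "transpose_mat X"] X(1) by (simp flip: X(4))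
  also have "\<dots> = mat_trace (mat_diag n ev)" using X(1) by (simp add: mult_cancel_left[OF X(2)])
  finally show ?thesis by (simp add: mat_trace_def)
qed

lemma det_mat_exp:
  assumes "S \<in> carrier_mat n n" "transpose_mat S = S"
  shows "det (mat_exp S) = exp (mat_trace S)"
proof -
  from sym_decomp[OF assms] obtain X ev where X: "spectral_decomposition S X ev" by blast
  show ?thesis unfolding mat_exp_def
    det_spectral[OF spectral_fun_decomposition[OF X assms(1)] spectral_fun_carrier[OF assms]]
    mat_trace_spectral[OF X assms(1)] by (simp add: exp_sum)
qed

lemma mat_trace_log:
  assumes "P \<in> spd n" shows "mat_trace (mat_log P) = ln (det P)"
  using det_mat_exp[of "mat_log P" n] mat_exp_log[OF assms] spectral_fun_sym[OF spdD[OF assms]]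
  by (simp add: mat_log_def)

lemma frob_spectral:
  assumes "spectral_decomposition S X ev" "S \<in> carrier_mat n n"
  shows "frob S S = (\<Sum>i<n. (ev i)\<^sup>2)"
  using spectral_decompositionD[OF assms] frob_orthogonal_conj[of "mat_diag n ev" n "mat_diag n ev" X]
  by (simp add: frob_diag power2_eq_square)

lemma smult_dim:
  fixes A :: "real mat"
  shows "dim_col A = dim_row B \<Longrightarrow> A * (k \<cdot>\<^sub>m B) = k \<cdot>\<^sub>m (A * B)"
    "dim_col A = dim_row B \<Longrightarrow> (k \<cdot>\<^sub>m A) * B = k \<cdot>\<^sub>m (A * B)"
  by (rule mult_smult_distrib[of A "dim_row A" "dim_col A" B "dim_col B"]; auto)
    (rule mult_smult_assoc_mat[of A "dim_row A" "dim_col A" B "dim_col B"]; auto)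

lemma distrib_dim:
  fixes A :: "real mat"
  shows "dim_col A = dim_row B \<Longrightarrow> dim_row B = dim_row C \<Longrightarrow> dim_col B = dim_col C \<Longrightarrow> A * (B + C) = A * B + A * C"
    "dim_col A = dim_row C \<Longrightarrow> dim_row A = dim_row B \<Longrightarrow> dim_col A = dim_col B \<Longrightarrow> (A + B) * C = A * C + B * C"
    "dim_col A = dim_row B \<Longrightarrow> dim_row B = dim_row C \<Longrightarrow> dim_col B = dim_col C \<Longrightarrow> A * (B - C) = A * B - A * C"
    "dim_col A = dim_row C \<Longrightarrow> dim_row A = dim_row B \<Longrightarrow> dim_col A = dim_col B \<Longrightarrow> (A - B) * C = A * C - B * C"
  by (rule mult_add_distrib_mat[of A "dim_row A" "dim_col A" B "dim_col B"]; auto)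
    (rule add_mult_distrib_mat[of A "dim_row A" "dim_col A" B C "dim_col C"]
      mult_minus_distrib_mat[of A "dim_row A" "dim_col A" B "dim_col B"]
      minus_mult_distrib_mat[of A "dim_row A" "dim_col A" B C "dim_col C"]; auto)+

section \<open>Differentiating a log-determinant\<close>

lemma continuous_on_det:
  fixes f :: "'z :: topological_space \<Rightarrow> nat \<Rightarrow> nat \<Rightarrow> real"
  assumes "\<And>i j. i < n \<Longrightarrow> j < n \<Longrightarrow> continuous_on S (\<lambda>z. f z i j)"
  shows "continuous_on S (\<lambda>z. det (mat n n (\<lambda>(i, j). f z i j)))"
proof -
  have "det (mat n n (\<lambda>(i, j). f z i j))
      = (\<Sum>p | p permutes {0..<n}. signof p * (\<Prod>i = 0..<n. f z i (p i)))" for z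
    by (subst det_def'[of _ n]) (auto intro!: sum.cong prod.cong simp: permutes_in_image)
  then show ?thesis
    using assms by (auto intro!: continuous_intros simp: permutes_in_image)
qed

lemma cofactor_mat:
  assumes "i < n" "j < n"
  shows "cofactor (mat n n (\<lambda>(a, b). f a b)) i j = (-1) ^ (i + j) *
    det (mat (n - 1) (n - 1) (\<lambda>(a, b). f (if a < i then a else Suc a) (if b < j then b else Suc b)))"
proof -
  have "mat_delete (mat n n (\<lambda>(a, b). f a b)) i j =
    mat (n - 1) (n - 1) (\<lambda>(a, b). f (if a < i then a else Suc a) (if b < j then b else Suc b))"
    using assms by (intro eq_matI) (auto simp: mat_delete_def)
  then show ?thesis by (simp add: cofactor_def)
qed

text \<open>Jacobi's formula.\<close>

lemma det_has_field_derivative: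
  fixes N :: "real \<Rightarrow> nat \<Rightarrow> nat \<Rightarrow> real"
  assumes D: "\<And>i j. i < n \<Longrightarrow> j < n \<Longrightarrow> ((\<lambda>s. N s i j) has_field_derivative D i j) (at s)"
  shows "((\<lambda>s. det (mat n n (\<lambda>(i, j). N s i j))) has_field_derivative
     (\<Sum>k<n. \<Sum>j<n. D k j * cofactor (mat n n (\<lambda>(i, j). N s i j)) k j)) (at s)"
proof -
  define Nk where "Nk k = mat n n (\<lambda>(i, j). if i = k then D k j else N s i j)" for k
  have "(\<Sum>j<n. D k j * cofactor (mat n n (\<lambda>(i, j). N s i j)) k j) =
     (\<Sum>p | p permutes {0..<n}. signof p * (D k (p k) * (\<Prod>i\<in>{0..<n} - {k}. N s i (p i))))" if k: "k < n" for k
  proof -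
    have "cofactor (Nk k) k j = cofactor (mat n n (\<lambda>(i, j). N s i j)) k j" if "j < n" for j
      unfolding cofactor_def mat_delete_def Nk_def using k that
      by (intro arg_cong2[of _ _ _ _ "(*)"] arg_cong[of _ _ det] refl eq_matI) auto
    then have "(\<Sum>j<n. D k j * cofactor (mat n n (\<lambda>(i, j). N s i j)) k j) = det (Nk k)"
      using k laplace_expansion_row[of "Nk k" n k] by (simp add: Nk_def)
    also have "\<dots> = (\<Sum>p | p permutes {0..<n}. signof p * (\<Prod>i = 0..<n. if i = k then D k (p i) else N s i (p i)))"
      unfolding Nk_def by (subst det_def'[of _ n]) (auto intro!: sum.cong prod.cong simp: permutes_in_image)
    also have "\<dots> = (\<Sum>p | p permutes {0..<n}. signof p * (D k (p k) * (\<Prod>i\<in>{0..<n} - {k}. N s i (p i))))"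
      using k by (intro sum.cong refl) (simp add: prod.remove[of "{0..<n}" k])
    finally show ?thesis .
  qed
  then have sum: "(\<Sum>k<n. \<Sum>j<n. D k j * cofactor (mat n n (\<lambda>(i, j). N s i j)) k j) =
     (\<Sum>p | p permutes {0..<n}. signof p * (\<Sum>k = 0..<n. D k (p k) * (\<Prod>i\<in>{0..<n} - {k}. N s i (p i))))"
    by (simp add: sum_distrib_left atLeast0LessThan, subst sum.swap) simp
  have det: "det (mat n n (\<lambda>(i, j). N s i j))
      = (\<Sum>p | p permutes {0..<n}. signof p * (\<Prod>i = 0..<n. N s i (p i)))" for s
    by (subst det_def'[of _ n]) (auto intro!: sum.cong prod.cong simp: permutes_in_image)
  show ?thesis
    unfolding sum unfolding det
    by (intro DERIV_sum DERIV_cmult has_field_derivative_prod D) (auto simp: permutes_in_image)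
qed

text \<open>The entries of the inverse as rational functions of the entries of the matrix.\<close>

definition inv_entry :: "nat \<Rightarrow> (nat \<Rightarrow> nat \<Rightarrow> real) \<Rightarrow> nat \<Rightarrow> nat \<Rightarrow> real" where
  "inv_entry n f i j = cofactor (mat n n (\<lambda>(i, j). f i j)) j i / det (mat n n (\<lambda>(i, j). f i j))"

lemma inv_entry:
  assumes "det (mat n n (\<lambda>(i, j). f i j)) \<noteq> 0"
  shows "mat n n (\<lambda>(i, j). inv_entry n f i j) * mat n n (\<lambda>(i, j). f i j) = 1\<^sub>m n" (is "?G * ?N = _")
    and "mat n n (\<lambda>(i, j). f i j) * mat n n (\<lambda>(i, j). inv_entry n f i j) = 1\<^sub>m n"
proof -
  have G: "?G = (1 / det ?N) \<cdot>\<^sub>m adj_mat ?N"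
    by (rule eq_matI) (auto simp: adj_mat_def inv_entry_def)
  show 1: "?G * ?N = 1\<^sub>m n"
  proof -
    have a: "adj_mat ?N \<in> carrier_mat n n" "adj_mat ?N * ?N = det ?N \<cdot>\<^sub>m 1\<^sub>m n"
      using adj_mat[of ?N n] by auto
    have "?G * ?N = (1 / det ?N) \<cdot>\<^sub>m (det ?N \<cdot>\<^sub>m 1\<^sub>m n)"
      unfolding G a(2)[symmetric] by (rule mult_smult_assoc_mat[OF a(1)]) auto
    moreover have "(1 / e) \<cdot>\<^sub>m (e \<cdot>\<^sub>m 1\<^sub>m n) = (1\<^sub>m n :: real mat)" if "e \<noteq> 0" for e :: real
      using that by (intro eq_matI) auto
    ultimately show ?thesis using assms by metis
  qed
  show "?N * ?G = 1\<^sub>m n"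
    by (rule left_inverse_is_right_inverse[OF _ _ 1]) auto
qed

lemma inv_entry_sum:
  assumes "det (mat n n (\<lambda>(i, j). f i j)) \<noteq> 0" "i < n" "j < n"
  shows "(\<Sum>k<n. inv_entry n f i k * f k j) = (if i = j then 1 else 0)"
    and "(\<Sum>k<n. f i k * inv_entry n f k j) = (if i = j then 1 else 0)"
  using arg_cong[OF inv_entry(1)[OF assms(1)], of "\<lambda>M. M $$ (i, j)"]
    arg_cong[OF inv_entry(2)[OF assms(1)], of "\<lambda>M. M $$ (i, j)"] assms(2,3)
  by (simp_all add: scalar_prod_def atLeast0LessThan)

lemma continuous_on_inv_entry:
  fixes f :: "'z :: topological_space \<Rightarrow> nat \<Rightarrow> nat \<Rightarrow> real"
  assumes "\<And>i j. i < n \<Longrightarrow> j < n \<Longrightarrow> continuous_on S (\<lambda>z. f z i j)"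
    and "\<And>z. z \<in> S \<Longrightarrow> det (mat n n (\<lambda>(i, j). f z i j)) \<noteq> 0" and "i < n" "j < n"
  shows "continuous_on S (\<lambda>z. inv_entry n (f z) i j)"
proof -
  have "continuous_on S (\<lambda>z. det (mat (n - 1) (n - 1)
      (\<lambda>(a, b). f z (if a < j then a else Suc a) (if b < i then b else Suc b))))"
    by (rule continuous_on_det, rule assms(1)) (use assms(3,4) in auto)
  moreover have "continuous_on S (\<lambda>z. det (mat n n (\<lambda>(i, j). f z i j)))"
    by (rule continuous_on_det[OF assms(1)])
  ultimately show ?thesis
    unfolding inv_entry_def cofactor_mat[OF assms(4,3)] using assms(2)
    by (intro continuous_on_divide continuous_on_mult continuous_on_const) auto
qed

lemma inv_entry_has_field_derivative:
  fixes N :: "real \<Rightarrow> nat \<Rightarrow> nat \<Rightarrow> real"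
  assumes D: "\<And>i j. i < n \<Longrightarrow> j < n \<Longrightarrow> ((\<lambda>s. N s i j) has_field_derivative D i j) (at s)"
    and ne: "\<And>s. det (mat n n (\<lambda>(i, j). N s i j)) \<noteq> 0" and "i < n" "l < n"
  shows "((\<lambda>s. inv_entry n (N s) i l) has_field_derivative
    - (\<Sum>j<n. \<Sum>k<n. inv_entry n (N s) i k * D k j * inv_entry n (N s) j l)) (at s)"
proof -
  have "\<exists>d. ((\<lambda>s. inv_entry n (N s) i l) has_field_derivative d) (at s)" if "i < n" "l < n" for i l
  proof -
    have "\<exists>d. ((\<lambda>s. cofactor (mat n n (\<lambda>(i, j). N s i j)) l i) has_field_derivative d) (at s)"
      unfolding cofactor_mat[OF that(2,1)]
      by (rule exI, rule DERIV_cmult, rule det_has_field_derivative, rule D) (use that in auto)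
    then obtain d where d: "((\<lambda>s. cofactor (mat n n (\<lambda>(i, j). N s i j)) l i) has_field_derivative d) (at s)" ..
    show ?thesis
      unfolding inv_entry_def
      by (rule exI, rule DERIV_divide[OF d det_has_field_derivative[of n N D s, OF D] ne])
  qed
  then obtain G' where G': "((\<lambda>s. inv_entry n (N s) i l) has_field_derivative G' i l) (at s)"
    if "i < n" "l < n" for i l by metis
  let ?G = "\<lambda>i j. inv_entry n (N s) i j"
  have eq: "(\<Sum>k<n. G' i k * N s k j) = - (\<Sum>k<n. ?G i k * D k j)" if "j < n" for j
  proof -
    have "((\<lambda>s. \<Sum>k<n. inv_entry n (N s) i k * N s k j) has_field_derivative
        (\<Sum>k<n. G' i k * N s k j + D k j * inv_entry n (N s) i k)) (at s)"
      by (intro DERIV_sum DERIV_mult G' D) (use that assms in auto)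
    moreover have "((\<lambda>s. \<Sum>k<n. inv_entry n (N s) i k * N s k j) has_field_derivative 0) (at s)"
      using inv_entry_sum(1)[OF ne \<open>i < n\<close> that] by simp
    ultimately have "(\<Sum>k<n. G' i k * N s k j + D k j * inv_entry n (N s) i k) = 0"
      by (rule DERIV_unique)
    then show ?thesis by (simp add: sum.distrib mult.commute)
  qed
  have "G' i l = (\<Sum>k<n. G' i k * (\<Sum>j<n. N s k j * ?G j l))"
  proof -
    have "(\<Sum>k<n. G' i k * (\<Sum>j<n. N s k j * ?G j l)) = (\<Sum>k<n. if k = l then G' i k else 0)"
      by (intro sum.cong refl) (simp add: inv_entry_sum(2)[OF ne _ \<open>l < n\<close>])
    then show ?thesis using \<open>l < n\<close> by simp
  qed
  also have "\<dots> = (\<Sum>j<n. (\<Sum>k<n. G' i k * N s k j) * ?G j l)"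
    by (simp add: sum_distrib_left sum_distrib_right mult.assoc, subst sum.swap) simp
  also have "\<dots> = - (\<Sum>j<n. \<Sum>k<n. ?G i k * D k j * ?G j l)"
    by (simp add: eq sum_distrib_right sum_negf)
  finally show ?thesis using G'[OF assms(3,4)] by simp
qed

section \<open>The log-determinant of a pencil along a geodesic\<close>

text \<open>The entries of \<open>diag(exp (s x)) + e R\<close>.\<close>

definition pencil :: "(nat \<Rightarrow> real) \<Rightarrow> real mat \<Rightarrow> real \<Rightarrow> real \<Rightarrow> nat \<Rightarrow> nat \<Rightarrow> real" where
  "pencil x R e s i j = (if i = j then exp (s * x i) else 0) + e * R $$ (i, j)"

definition pencil_logdet :: "nat \<Rightarrow> (nat \<Rightarrow> real) \<Rightarrow> real mat \<Rightarrow> real \<Rightarrow> real \<Rightarrow> real" where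
  "pencil_logdet n x R e s = ln (det (mat n n (\<lambda>(i, j). pencil x R e s i j)))"

definition pencil_logdet1 :: "nat \<Rightarrow> (nat \<Rightarrow> real) \<Rightarrow> real mat \<Rightarrow> real \<Rightarrow> real \<Rightarrow> real" where
  "pencil_logdet1 n x R e s = (\<Sum>i<n. x i * exp (s * x i) * inv_entry n (pencil x R e s) i i)"

definition pencil_logdet2 :: "nat \<Rightarrow> (nat \<Rightarrow> real) \<Rightarrow> real mat \<Rightarrow> real \<Rightarrow> real \<Rightarrow> real" where
  "pencil_logdet2 n x R e s = (\<Sum>i<n. x i * (x i * exp (s * x i)) * inv_entry n (pencil x R e s) i i -
     (\<Sum>j<n. x i * exp (s * x i) * inv_entry n (pencil x R e s) i j
       * (x j * exp (s * x j) * inv_entry n (pencil x R e s) j i)))"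

lemma pencil_has_field_derivative:
  "((\<lambda>s. pencil x R e s i j) has_field_derivative (if i = j then x i * exp (s * x i) else 0)) (at s)"
  unfolding pencil_def by (auto intro!: derivative_eq_intros)

lemma pencil_logdet_deriv:
  assumes pos: "\<And>s. 0 < det (mat n n (\<lambda>(i, j). pencil x R e s i j))"
  shows "(pencil_logdet n x R e has_field_derivative pencil_logdet1 n x R e s) (at s)"
proof -
  let ?d = "det (mat n n (\<lambda>(i, j). pencil x R e s i j))"
  have "(pencil_logdet n x R e has_field_derivative
    (1 / ?d) * (\<Sum>k<n. \<Sum>j<n. (if k = j then x k * exp (s * x k) else 0) * cofactor (mat n n (\<lambda>(i, j). pencil x R e s i j)) k j)) (at s)"
    unfolding pencil_logdet_def
    by (rule DERIV_chain2[OF DERIV_ln_divide[OF pos] det_has_field_derivative[OF pencil_has_field_derivative]])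
  also have "(1 / ?d) * (\<Sum>k<n. \<Sum>j<n. (if k = j then x k * exp (s * x k) else 0) * cofactor (mat n n (\<lambda>(i, j). pencil x R e s i j)) k j)
      = pencil_logdet1 n x R e s"
  proof -
    have "(\<Sum>j<n. (if k = j then x k * exp (s * x k) else 0) * cofactor (mat n n (\<lambda>(i, j). pencil x R e s i j)) k j)
      = x k * exp (s * x k) * cofactor (mat n n (\<lambda>(i, j). pencil x R e s i j)) k k" if "k < n" for k
    proof -
      have "(\<Sum>j<n. (if k = j then x k * exp (s * x k) else 0) * cofactor (mat n n (\<lambda>(i, j). pencil x R e s i j)) k j)
        = (\<Sum>j<n. if k = j then x k * exp (s * x k) * cofactor (mat n n (\<lambda>(i, j). pencil x R e s i j)) k j else 0)"
        by (intro sum.cong) auto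
      then show ?thesis using that by simp
    qed
    then show ?thesis by (simp add: pencil_logdet1_def inv_entry_def sum_distrib_left)
  qed
  finally show ?thesis .
qed

lemma pencil_logdet1_deriv:
  assumes pos: "\<And>s. 0 < det (mat n n (\<lambda>(i, j). pencil x R e s i j))"
  shows "(pencil_logdet1 n x R e has_field_derivative pencil_logdet2 n x R e s) (at s)"
proof -
  let ?G = "inv_entry n (pencil x R e s)"
  have ne: "det (mat n n (\<lambda>(i, j). pencil x R e s i j)) \<noteq> 0" for s using pos[of s] by simp
  have G: "((\<lambda>s. inv_entry n (pencil x R e s) i i) has_field_derivative
      - (\<Sum>j<n. ?G i j * (x j * exp (s * x j)) * ?G j i)) (at s)" if "i < n" for i
  proof -
    have "(\<Sum>k<n. ?G i k * (if k = j then x k * exp (s * x k) else 0) * ?G j i)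
      = ?G i j * (x j * exp (s * x j)) * ?G j i" if "j < n" for j
    proof -
      have "(\<Sum>k<n. ?G i k * (if k = j then x k * exp (s * x k) else 0) * ?G j i)
        = (\<Sum>k<n. if k = j then ?G i j * (x j * exp (s * x j)) * ?G j i else 0)"
        by (intro sum.cong) auto
      then show ?thesis using that by simp
    qed
    then show ?thesis
      using inv_entry_has_field_derivative[OF pencil_has_field_derivative ne that that, where s = s] by simp
  qed
  have "((\<lambda>s. x i * exp (s * x i) * inv_entry n (pencil x R e s) i i) has_field_derivative
      x i * (x i * exp (s * x i)) * ?G i i - (\<Sum>j<n. x i * exp (s * x i) * ?G i j * (x j * exp (s * x j) * ?G j i))) (at s)"
    if "i < n" for i
    by (auto intro!: derivative_eq_intros G[OF that] simp: sum_distrib_left algebra_simps)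
  then show ?thesis
    unfolding pencil_logdet1_def[abs_def] pencil_logdet2_def by (intro DERIV_sum) auto
qed

lemma continuous_on_pencil_logdet:
  assumes pos: "\<And>s t. 0 < det (mat n n (\<lambda>(i, j). pencil x R (exp t) s i j))"
  shows "continuous_on S (\<lambda>(s, t). pencil_logdet n x R (exp t) s)"
    "continuous_on S (\<lambda>(s, t). pencil_logdet1 n x R (exp t) s)"
    "continuous_on S (\<lambda>(s, t). pencil_logdet2 n x R (exp t) s)"
proof -
  have p: "continuous_on S (\<lambda>z. pencil x R (exp (snd z)) (fst z) i j)" for i j
    unfolding pencil_def by (cases "i = j") (auto intro!: continuous_intros)
  have ne: "det (mat n n (\<lambda>(i, j). pencil x R (exp t) s i j)) \<noteq> 0" for s t using pos[of t s] by simp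
  have G: "continuous_on S (\<lambda>z. inv_entry n (pencil x R (exp (snd z)) (fst z)) i j)" if "i < n" "j < n" for i j
    by (rule continuous_on_inv_entry) (use p ne that in auto)
  show "continuous_on S (\<lambda>(s, t). pencil_logdet n x R (exp t) s)"
  proof -
    have "(\<lambda>(s, t). pencil_logdet n x R (exp t) s)
      = (\<lambda>z. ln (det (mat n n (\<lambda>(i, j). pencil x R (exp (snd z)) (fst z) i j))))"
      by (simp add: fun_eq_iff pencil_logdet_def)
    moreover have "continuous_on S (\<lambda>z. ln (det (mat n n (\<lambda>(i, j). pencil x R (exp (snd z)) (fst z) i j))))"
      by (intro continuous_on_ln continuous_on_det p) (use ne in auto)
    ultimately show ?thesis by simp
  qed
  show "continuous_on S (\<lambda>(s, t). pencil_logdet1 n x R (exp t) s)"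
    unfolding pencil_logdet1_def case_prod_beta by (intro continuous_intros G) auto
  show "continuous_on S (\<lambda>(s, t). pencil_logdet2 n x R (exp t) s)"
    unfolding pencil_logdet2_def case_prod_beta by (intro continuous_intros G) auto
qed

text \<open>The inverse pencil is diagonal in the eigenbasis of \<open>R\<close> relative to the base point. In
  that basis the second derivative becomes a sum over pairs of eigenvalues.\<close>

lemma pencil_spectral:
  fixes x :: "nat \<Rightarrow> real" and R U :: "real mat"
  assumes R: "R \<in> carrier_mat n n"
    and K: "mat_diag n (\<lambda>i. exp (- (s * x i) / 2)) * R * mat_diag n (\<lambda>i. exp (- (s * x i) / 2))
      = U * mat_diag n k * transpose_mat U"
    and U: "U \<in> carrier_mat n n" "transpose_mat U * U = 1\<^sub>m n"
    and k: "\<And>i. i < n \<Longrightarrow> 0 < k i" and e: "0 < e"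
  defines "Y \<equiv> transpose_mat U * mat_diag n x * U" and "a \<equiv> (\<lambda>i. 1 / (1 + e * k i))"
  shows pencil_det: "det (mat n n (\<lambda>(i, j). pencil x R e s i j)) = exp (s * (\<Sum>i<n. x i)) * (\<Prod>i<n. 1 + e * k i)"
    and pencil_logdet1_spectral: "pencil_logdet1 n x R e s = (\<Sum>i<n. Y $$ (i, i) * a i)"
    and pencil_logdet2_spectral: "pencil_logdet2 n x R e s = (\<Sum>i<n. \<Sum>j<n. (Y $$ (i, j))\<^sup>2 * (a i * (1 - a j)))"
proof -
  note UU = left_inverse_is_right_inverse[OF _ U(1) U(2), simplified, OF U(1)]
  define D where "D = mat_diag n (\<lambda>i. exp (s * x i / 2))"
  define Di where "Di = mat_diag n (\<lambda>i. exp (- (s * x i) / 2))"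
  define L where "L = mat_diag n (\<lambda>i. 1 + e * k i)"
  define A where "A = mat_diag n a"
  define X where "X = mat_diag n x"
  define G where "G = U * A * transpose_mat U"
  define N where "N = mat n n (\<lambda>(i, j). pencil x R e s i j)"
  have c: "D \<in> carrier_mat n n" "Di \<in> carrier_mat n n" "L \<in> carrier_mat n n" "A \<in> carrier_mat n n"
    "X \<in> carrier_mat n n" "G \<in> carrier_mat n n" "N \<in> carrier_mat n n" "Y \<in> carrier_mat n n"
    using U by (auto simp: D_def Di_def L_def A_def X_def G_def N_def Y_def)
  have DDi: "D * Di = 1\<^sub>m n" "Di * D = 1\<^sub>m n"
    by (simp_all add: D_def Di_def flip: exp_add)
  have pos: "0 < 1 + e * k i" if "i < n" for i using k[OF that] e by (simp add: add_pos_pos)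
  have LA: "A * L = 1\<^sub>m n"
  proof -
    have "A * L = mat_diag n (\<lambda>i. a i * (1 + e * k i))" by (simp add: A_def L_def)
    also have "\<dots> = mat_diag n (\<lambda>i. 1)"
      using pos by (intro mat_diag_cong) (auto simp: a_def less_imp_neq[THEN not_sym])
    finally show ?thesis by simp
  qed
  have N: "N = D * (U * L * transpose_mat U) * D"
  proof -
    have "L = 1\<^sub>m n + e \<cdot>\<^sub>m mat_diag n k"
      by (rule eq_matI) (auto simp: L_def)
    then have "U * L * transpose_mat U = 1\<^sub>m n + e \<cdot>\<^sub>m (U * mat_diag n k * transpose_mat U)"
      using U UU by (simp add: distrib_dim smult_dim)
    also have "U * mat_diag n k * transpose_mat U = Di * R * Di"
      using K by (simp add: Di_def)
    finally have "D * (U * L * transpose_mat U) * D = D * (1\<^sub>m n + e \<cdot>\<^sub>m (Di * R * Di)) * D" by simp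
    also have "\<dots> = D * D + e \<cdot>\<^sub>m (D * (Di * R * Di) * D)"
      using c R by (simp add: distrib_dim smult_dim)
    also have "D * (Di * R * Di) * D = R"
      using c R by (simp add: mult_assoc_dim DDi mult_cancel_left[OF DDi(1)])
    also have "D * D + e \<cdot>\<^sub>m R = N"
      using R by (intro eq_matI) (auto simp: D_def N_def pencil_def simp flip: exp_add)
    finally show ?thesis by simp
  qed
  show det: "det (mat n n (\<lambda>(i, j). pencil x R e s i j)) = exp (s * (\<Sum>i<n. x i)) * (\<Prod>i<n. 1 + e * k i)"
  proof -
    have "det N = det D * det (U * L * transpose_mat U) * det D"
      unfolding N using c U by (simp add: det_mult[of _ n])
    also have "det (U * L * transpose_mat U) = (\<Prod>i<n. 1 + e * k i)"
      using det_orthogonal_conj[OF U(1) c(3) U(2)] by (simp add: L_def det_mat_diag)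
    also have "det D = exp (s * (\<Sum>i<n. x i) / 2)"
      by (simp add: D_def det_mat_diag exp_sum[symmetric] sum_distrib_left sum_divide_distrib)
    finally show ?thesis by (simp add: N_def flip: exp_add)
  qed
  have detN: "det N \<noteq> 0" unfolding N_def det using pos by (auto simp: prod_pos less_imp_neq[THEN not_sym])
  have GN: "(Di * G * Di) * N = 1\<^sub>m n"
    unfolding N G_def using c U
    by (simp add: mult_assoc_dim mult_cancel_left[OF DDi(2)] mult_cancel_left[OF U(2)] mult_cancel_left[OF LA]
        mult_cancel_left[OF UU] DDi(2) UU)
  have inv: "mat n n (\<lambda>(i, j). inv_entry n (pencil x R e s) i j) = Di * G * Di" (is "?I = _")
  proof -
    have "N * ?I = 1\<^sub>m n" using inv_entry(2)[of n "pencil x R e s"] detN by (simp add: N_def)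
    then have "(Di * G * Di) * (N * ?I) = Di * G * Di" using c by simp
    moreover have "(Di * G * Di) * (N * ?I) = ?I"
      using c by (intro mult_cancel_left[OF GN]) auto
    ultimately show ?thesis by simp
  qed
  have ent: "inv_entry n (pencil x R e s) i j = exp (- (s * x i) / 2) * G $$ (i, j) * exp (- (s * x j) / 2)"
    if "i < n" "j < n" for i j
  proof -
    have "inv_entry n (pencil x R e s) i j = (Di * G * Di) $$ (i, j)"
      using arg_cong[OF inv, of "\<lambda>M. M $$ (i, j)"] that by simp
    then show ?thesis using that c
      by (simp add: Di_def mat_diag_mult_left[of _ n n] mat_diag_mult_right[of _ n n])
  qed
  have XG: "(X * G) $$ (i, j) = x i * G $$ (i, j)" if "i < n" "j < n" for i j
    using that c by (simp add: X_def mat_diag_mult_left[of _ n n])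
  have half: "exp (s * x i) * (exp (- (s * x i) / 2) * exp (- (s * x i) / 2)) = 1" for i
    by (simp flip: exp_add)
  have h1: "x i * exp (s * x i) * inv_entry n (pencil x R e s) i i = (X * G) $$ (i, i)" if "i < n" for i
  proof -
    have "x i * exp (s * x i) * inv_entry n (pencil x R e s) i i
      = x i * G $$ (i, i) * (exp (s * x i) * (exp (- (s * x i) / 2) * exp (- (s * x i) / 2)))"
      unfolding ent[OF that that] by (simp only: mult_ac)
    then show ?thesis unfolding half XG[OF that that] by simp
  qed
  have h2: "x i * exp (s * x i) * inv_entry n (pencil x R e s) i j
       * (x j * exp (s * x j) * inv_entry n (pencil x R e s) j i) = (X * G) $$ (i, j) * (X * G) $$ (j, i)"
    if "i < n" "j < n" for i j
  proof -
    have "x i * exp (s * x i) * inv_entry n (pencil x R e s) i j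
       * (x j * exp (s * x j) * inv_entry n (pencil x R e s) j i)
      = x i * G $$ (i, j) * (x j * G $$ (j, i)) * (exp (s * x i) * (exp (- (s * x i) / 2) * exp (- (s * x i) / 2)))
         * (exp (s * x j) * (exp (- (s * x j) / 2) * exp (- (s * x j) / 2)))"
      unfolding ent[OF that] ent[OF that(2,1)] by (simp only: mult_ac)
    then show ?thesis unfolding half XG[OF that] XG[OF that(2,1)] by simp
  qed
  \<comment> \<open>Conjugation by \<open>U\<close> turns \<open>X * G\<close> into \<open>Y * A\<close>.\<close>
  have XG_U: "X * G = U * (Y * A) * transpose_mat U"
    using c U by (simp add: G_def Y_def X_def mult_assoc_dim mult_cancel_left[OF UU])
  have tr: "mat_trace (U * Z * transpose_mat U) = mat_trace Z" if "Z \<in> carrier_mat n n" for Z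
    using that U mat_trace_commute[of "U * Z" n n "transpose_mat U"] by (simp add: mult_cancel_left[OF U(2)])
  have YA: "(Y * A) $$ (i, j) = Y $$ (i, j) * a j" if "i < n" "j < n" for i j
    using that c by (simp add: A_def mat_diag_mult_right[of _ n n])
  have "pencil_logdet1 n x R e s = mat_trace (X * G)"
    unfolding pencil_logdet1_def mat_trace_def by (rule sum.cong) (use c h1 in auto)
  also have "\<dots> = mat_trace (Y * A)" unfolding XG_U using c by (intro tr) auto
  also have "\<dots> = (\<Sum>i<n. Y $$ (i, i) * a i)"
    using c by (simp add: mat_trace_def YA del: index_mult_mat(1))
  finally show "pencil_logdet1 n x R e s = (\<Sum>i<n. Y $$ (i, i) * a i)" .
  have symY: "transpose_mat Y = Y" using U by (simp add: Y_def transpose_mult_dim mult_assoc_dim)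
  have sY: "Y $$ (j, i) = Y $$ (i, j)" if "i < n" "j < n" for i j
    using arg_cong[OF symY, of "\<lambda>M. M $$ (i, j)"] that c by simp
  have "X * (X * G) = U * (Y * (Y * A)) * transpose_mat U"
    unfolding XG_U using c U by (simp add: Y_def X_def mult_assoc_dim mult_cancel_left[OF UU])
  then have "mat_trace (X * (X * G)) = mat_trace (Y * (Y * A))" using c by (simp add: tr)
  moreover have "(X * G) * (X * G) = U * ((Y * A) * (Y * A)) * transpose_mat U"
    unfolding XG_U using c U by (simp add: mult_assoc_dim mult_cancel_left[OF U(2)])
  then have "mat_trace ((X * G) * (X * G)) = mat_trace ((Y * A) * (Y * A))"
    using tr[of "(Y * A) * (Y * A)"] c(4,8) by (metis mult_carrier_mat)
  moreover have "pencil_logdet2 n x R e s = mat_trace (X * (X * G)) - mat_trace ((X * G) * (X * G))"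
  proof -
    have "mat_trace (X * (X * G)) = (\<Sum>i<n. x i * (X * G) $$ (i, i))"
      using c by (simp add: mat_trace_def X_def mat_diag_mult_left[of _ n n])
    moreover have "mat_trace ((X * G) * (X * G)) = (\<Sum>i<n. \<Sum>j<n. (X * G) $$ (i, j) * (X * G) $$ (j, i))"
      using c by (intro mat_trace_mult) auto
    ultimately have t: "mat_trace (X * (X * G)) = (\<Sum>i<n. x i * (X * G) $$ (i, i))"
      "mat_trace ((X * G) * (X * G)) = (\<Sum>i<n. \<Sum>j<n. (X * G) $$ (i, j) * (X * G) $$ (j, i))"
      by blast+
    show ?thesis
      unfolding pencil_logdet2_def t
    proof (simp only: sum_subtractf, intro arg_cong2[of _ _ _ _ "(-)"] sum.cong refl)
      fix i assume "i \<in> {..<n}"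
      then show "x i * (x i * exp (s * x i)) * inv_entry n (pencil x R e s) i i = x i * (X * G) $$ (i, i)"
        using h1[of i] by (simp only: lessThan_iff mult.assoc)
    next
      fix i j assume "i \<in> {..<n}" "j \<in> {..<n}"
      then show "x i * exp (s * x i) * inv_entry n (pencil x R e s) i j
          * (x j * exp (s * x j) * inv_entry n (pencil x R e s) j i) = (X * G) $$ (i, j) * (X * G) $$ (j, i)"
        using h2[of i j] by (simp only: lessThan_iff)
    qed
  qed
  ultimately have "pencil_logdet2 n x R e s = mat_trace (Y * (Y * A)) - mat_trace ((Y * A) * (Y * A))" by simp
  also have "mat_trace (Y * (Y * A)) = (\<Sum>i<n. \<Sum>j<n. (Y $$ (i, j))\<^sup>2 * a i)"
  proof -
    have "mat_trace (Y * (Y * A)) = (\<Sum>i<n. \<Sum>j<n. Y $$ (i, j) * (Y * A) $$ (j, i))"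
      using c by (intro mat_trace_mult) auto
    then show ?thesis by (simp add: YA sY power2_eq_square mult.assoc del: index_mult_mat(1))
  qed
  also have "mat_trace ((Y * A) * (Y * A)) = (\<Sum>i<n. \<Sum>j<n. (Y $$ (i, j))\<^sup>2 * (a i * a j))"
  proof -
    have "mat_trace ((Y * A) * (Y * A)) = (\<Sum>i<n. \<Sum>j<n. (Y * A) $$ (i, j) * (Y * A) $$ (j, i))"
      using c by (intro mat_trace_mult) auto
    then show ?thesis by (simp add: YA sY power2_eq_square mult_ac del: index_mult_mat(1))
  qed
  finally show "pencil_logdet2 n x R e s = (\<Sum>i<n. \<Sum>j<n. (Y $$ (i, j))\<^sup>2 * (a i * (1 - a j)))"
    by (simp add: sum_subtractf[symmetric] algebra_simps)
qed

section \<open>The function \<open>t coth t\<close> as an integral\<close>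

lemma sinh_ge_self: "x \<le> sinh x" if "0 \<le> x" for x :: real
proof -
  have "sinh 0 - 0 \<le> sinh x - x"
    by (rule DERIV_nonneg_imp_nondecreasing[OF that, of "\<lambda>x. sinh x - x"])
      (auto intro!: exI derivative_eq_intros simp: cosh_real_ge_1)
  then show ?thesis by simp
qed

lemma sinh_less_self_cosh: "sinh x < x * cosh x" if "0 < x" for x :: real
proof -
  have d: "\<exists>d. ((\<lambda>x. x * cosh x - sinh x) has_real_derivative d) (at y) \<and> 0 < d" if "0 < y" for y :: real
    using that by (intro exI[of _ "y * sinh y"]) (auto intro!: derivative_eq_intros)
  have "0 * cosh 0 - sinh 0 < x * cosh x - sinh x"
    by (rule DERIV_pos_imp_increasing_open[OF that, of "\<lambda>x. x * cosh x - sinh x"])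
      (auto intro!: d continuous_intros)
  then show ?thesis by simp
qed

lemma psi_gt_1: "1 < psi t" if "0 < t"
  using sinh_less_self_cosh[OF that] that by (simp add: psi_def field_simps)

lemma psi_mono: "psi s \<le> psi t" if "0 \<le> s" "s \<le> t"
proof (cases "s = 0")
  case True
  then show ?thesis using psi_gt_1[of t] that by (cases "t = 0") (auto simp: psi_def)
next
  case False
  then have s: "0 < s" using that by simp
  have "s * (cosh s / sinh s) \<le> t * (cosh t / sinh t)"
  proof (rule DERIV_nonneg_imp_nondecreasing[OF that(2), of "\<lambda>t. t * (cosh t / sinh t)"])
    fix x assume "s \<le> x" "x \<le> t"
    then have x: "0 < x" using s by simp
    have "x \<le> sinh x * cosh x"
      using mult_mono[OF sinh_ge_self cosh_real_ge_1, of x x] x by simp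
    then have pos: "0 \<le> (sinh x * cosh x - x) / (sinh x)\<^sup>2" by simp
    have "((\<lambda>t. t * (cosh t / sinh t)) has_real_derivative
        (cosh x / sinh x + x * ((sinh x * sinh x - cosh x * cosh x) / (sinh x * sinh x)))) (at x)"
      using x by (auto intro!: derivative_eq_intros simp: field_simps)
    also have "cosh x / sinh x + x * ((sinh x * sinh x - cosh x * cosh x) / (sinh x * sinh x))
        = (sinh x * cosh x - x) / (sinh x)\<^sup>2"
      using x cosh_square_eq[of x] by (simp add: field_simps power2_eq_square)
    finally show "\<exists>y. ((\<lambda>t. t * (cosh t / sinh t)) has_real_derivative y) (at x) \<and> 0 \<le> y"
      using pos by blast
  qed
  then show ?thesis using False that by (simp add: psi_def)
qed

lemma psi_ge_1: "1 \<le> psi t" if "0 \<le> t"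
  using psi_mono[of 0 t] that by (simp add: psi_def)

lemma one_plus_exp_pos [simp]: "0 < 1 + exp t * k" if "0 < k" for k :: real
  using that by (simp add: add_pos_pos)

lemma one_plus_exp_ne [simp]: "1 + exp t * k \<noteq> 0" if "0 < k" for k :: real
  using one_plus_exp_pos[OF that, of t] by linarith

lemma resolvent_weight_integral:
  fixes k c :: real
  assumes k: "0 < k" and c: "0 \<le> c"
  shows "((\<lambda>t. 1 / (1 + exp t * k)) has_integral
    (2 * c - ln (1 + exp c * k) + ln (1 + exp (- c) * k))) {-c..c}"
proof -
  have d: "((\<lambda>t. t - ln (1 + exp t * k)) has_real_derivative 1 / (1 + exp t * k)) (at t within {-c..c})" for t :: real
  proof -
    have w: "0 < 1 + exp t * k" by (rule one_plus_exp_pos[OF k])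
    have "((\<lambda>t. t - ln (1 + exp t * k)) has_real_derivative 1 - exp t * k / (1 + exp t * k)) (at t within {-c..c})"
      using w by (auto intro!: derivative_eq_intros)
    moreover have "1 - exp t * k / (1 + exp t * k) = 1 / (1 + exp t * k)" using w by (simp add: field_simps)
    ultimately show ?thesis by (simp only:)
  qed
  have "((\<lambda>t. 1 / (1 + exp t * k)) has_integral (c - ln (1 + exp c * k)) - (- c - ln (1 + exp (- c) * k))) {-c..c}"
    using c d by (intro fundamental_theorem_of_calculus) (auto simp: has_real_derivative_iff_has_vector_derivative[symmetric])
  moreover have "(c - ln (1 + exp c * k)) - (- c - ln (1 + exp (- c) * k)) = 2 * c - ln (1 + exp c * k) + ln (1 + exp (- c) * k)"
    by simp
  ultimately show ?thesis by (simp only:)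
qed

lemma diagonal_weight_integral:
  fixes k c :: real
  assumes k: "0 < k" and c: "0 \<le> c"
  shows "((\<lambda>t. 1 / (1 + exp t * k) * (1 - 1 / (1 + exp t * k))) has_integral
    (1 / (1 + exp (- c) * k) - 1 / (1 + exp c * k))) {-c..c}"
proof -
  have d: "((\<lambda>t. - 1 / (1 + exp t * k)) has_real_derivative 1 / (1 + exp t * k) * (1 - 1 / (1 + exp t * k))) (at t within {-c..c})" for t :: real
  proof -
    have w: "1 + exp t * k \<noteq> 0" by (rule one_plus_exp_ne[OF k])
    have "((\<lambda>t. - 1 / (1 + exp t * k)) has_real_derivative exp t * k / ((1 + exp t * k) * (1 + exp t * k))) (at t within {-c..c})"
      using w by (auto intro!: derivative_eq_intros)
    moreover have "exp t * k / ((1 + exp t * k) * (1 + exp t * k)) = 1 / (1 + exp t * k) * (1 - 1 / (1 + exp t * k))"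
      using w by (simp add: divide_simps)
    ultimately show ?thesis by (simp only:)
  qed
  have "((\<lambda>t. 1 / (1 + exp t * k) * (1 - 1 / (1 + exp t * k))) has_integral
      (- 1 / (1 + exp c * k)) - (- 1 / (1 + exp (- c) * k))) {-c..c}"
    using c d by (intro fundamental_theorem_of_calculus) (auto simp: has_real_derivative_iff_has_vector_derivative[symmetric])
  then show ?thesis by simp
qed

definition pair_weight :: "real \<Rightarrow> real \<Rightarrow> real \<Rightarrow> real" where
  "pair_weight k l t = 1 / (1 + exp t * k) * (1 - 1 / (1 + exp t * l)) + 1 / (1 + exp t * l) * (1 - 1 / (1 + exp t * k))"

lemma pair_weight_commute: "pair_weight k l = pair_weight l k"
  by (auto simp: pair_weight_def)

lemma pair_weight_integrable:
  fixes k l c :: real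
  assumes "0 < k" "0 < l" shows "pair_weight k l integrable_on {-c..c}"
  unfolding pair_weight_def[abs_def]
  by (intro integrable_continuous_real continuous_intros ballI one_plus_exp_ne assms)

text \<open>Over the whole line the integral below equals \<open>2 \<psi>((ln k - ln l) / 2)\<close>: this is where
  the hyperbolic cotangent of the curvature bound comes from.\<close>

lemma pair_weight_upper_ordered:
  fixes k l c :: real
  assumes "0 < l" "l < k" and c: "0 \<le> c"
  shows "integral {-c..c} (pair_weight k l) \<le> 2 * psi ((ln k - ln l) / 2)"
proof -
  have k: "0 < k" using assms by simp
  define \<phi> where "\<phi> t = (k + l) / (k - l) * (ln (1 + exp t * k) - ln (1 + exp t * l))" for t
  have "pair_weight k l t = (k + l) / (k - l) * (exp t * k / (1 + exp t * k) - exp t * l / (1 + exp t * l))" for t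
  proof -
    have "1 + exp t * k \<noteq> 0" "1 + exp t * l \<noteq> 0" using k assms by auto
    then have "pair_weight k l t = exp t * (k + l) / ((1 + exp t * k) * (1 + exp t * l))"
      by (simp add: pair_weight_def divide_simps) (simp add: algebra_simps)
    moreover have "exp t * k / (1 + exp t * k) - exp t * l / (1 + exp t * l)
        = exp t * (k - l) / ((1 + exp t * k) * (1 + exp t * l))"
      using \<open>1 + exp t * k \<noteq> 0\<close> \<open>1 + exp t * l \<noteq> 0\<close> by (simp add: divide_simps) (simp add: algebra_simps)
    ultimately show ?thesis using assms by simp
  qed
  then have d: "(\<phi> has_real_derivative pair_weight k l t) (at t within {-c..c})" for t
    unfolding \<phi>_def using k assms by (auto intro!: derivative_eq_intros)
  have "(pair_weight k l has_integral \<phi> c - \<phi> (- c)) {-c..c}"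
    using c d by (intro fundamental_theorem_of_calculus) (auto simp: has_real_derivative_iff_has_vector_derivative[symmetric])
  then have "integral {-c..c} (pair_weight k l) = \<phi> c - \<phi> (- c)" by (rule integral_unique)
  also have "\<dots> \<le> (k + l) / (k - l) * (ln k - ln l)"
  proof -
    have "(1 + exp c * k) * l \<le> (1 + exp c * l) * k" using assms by (simp add: algebra_simps)
    then have "ln ((1 + exp c * k) * l) \<le> ln ((1 + exp c * l) * k)"
      using k assms(1) by (subst ln_le_cancel_iff) auto
    then have "ln (1 + exp c * k) - ln (1 + exp c * l) \<le> ln k - ln l"
      using k assms(1) by (simp add: ln_mult)
    moreover have "ln (1 + exp (- c) * l) \<le> ln (1 + exp (- c) * k)"
      using k assms by (subst ln_le_cancel_iff) auto
    moreover have "0 \<le> (k + l) / (k - l)" using k assms by simp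
    ultimately show ?thesis
      unfolding \<phi>_def right_diff_distrib[symmetric] by (intro mult_left_mono) auto
  qed
  also have "\<dots> = 2 * psi ((ln k - ln l) / 2)"
  proof -
    define u where "u = (ln k - ln l) / 2"
    have u: "0 < u" using assms k by (simp add: u_def)
    have kl: "k = l * exp (2 * u)"
    proof -
      have "2 * u = ln k - ln l" by (simp add: u_def)
      then show ?thesis using k assms by (simp add: exp_diff)
    qed
    have "(k + l) / (k - l) = cosh u / sinh u"
    proof -
      have e: "exp (2 * u) = exp u * exp u" by (simp flip: exp_add)
      have "k + l = 2 * l * exp u * cosh u" "k - l = 2 * l * exp u * sinh u"
        unfolding kl e cosh_def sinh_def by (simp_all add: algebra_simps flip: exp_add)
      then show ?thesis using assms(1) by simp
    qed
    then show ?thesis using u by (simp add: psi_def u_def)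
  qed
  finally show ?thesis .
qed

lemma pair_weight_upper:
  fixes k l c :: real
  assumes "0 < k" "0 < l" and c: "0 \<le> c"
  shows "integral {-c..c} (pair_weight k l) \<le> 2 * psi (\<bar>ln k - ln l\<bar> / 2)"
proof (cases "k = l")
  case True
  have "((\<lambda>t. 2 * (1 / (1 + exp t * k) * (1 - 1 / (1 + exp t * k)))) has_integral
      2 * (1 / (1 + exp (- c) * k) - 1 / (1 + exp c * k))) {-c..c}"
    by (rule has_integral_mult_right[OF diagonal_weight_integral[OF assms(1) c]])
  moreover have "(\<lambda>t. 2 * (1 / (1 + exp t * k) * (1 - 1 / (1 + exp t * k)))) = pair_weight k l"
    using True by (auto simp: pair_weight_def)
  ultimately have "integral {-c..c} (pair_weight k l) = 2 * (1 / (1 + exp (- c) * k) - 1 / (1 + exp c * k))"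
    by (simp add: integral_unique)
  also have "\<dots> \<le> 2 * 1"
  proof -
    have "1 / (1 + exp (- c) * k) \<le> 1" using assms by (simp add: divide_le_eq_1)
    moreover have "0 \<le> 1 / (1 + exp c * k)"
      by (intro divide_nonneg_nonneg less_imp_le[OF one_plus_exp_pos[OF assms(1)]]) simp
    ultimately show ?thesis
      unfolding left_diff_distrib right_diff_distrib by argo
  qed
  finally show ?thesis using True by (simp add: psi_def)
next
  case False
  then consider "l < k" | "k < l" by linarith
  then show ?thesis
  proof cases
    case 1
    then have "0 < ln k - ln l" using assms by simp
    then show ?thesis using pair_weight_upper_ordered[OF assms(2) 1 c] by simp
  next
    case 2
    then have "\<bar>ln k - ln l\<bar> = ln l - ln k" using assms by simp
    then show ?thesis using pair_weight_upper_ordered[OF assms(1) 2 c] by (simp add: pair_weight_commute)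
  qed
qed

lemma weight_bounds:
  fixes k t :: real
  assumes "0 < k" shows "0 < 1 / (1 + exp t * k)" "1 / (1 + exp t * k) < 1"
  using assms by (auto simp: divide_less_eq_1 add_pos_pos)

lemma pair_weight_nonneg: "0 \<le> pair_weight k l t" if "0 < k" "0 < l"
  unfolding pair_weight_def
  using weight_bounds[OF that(1), of t] weight_bounds[OF that(2), of t] by (intro add_nonneg_nonneg mult_nonneg_nonneg) auto

lemma pair_weight_lower:
  fixes k l b c :: real
  assumes kl: "0 < k" "0 < l" "k \<le> b" "1 / k \<le> b" "l \<le> b" "1 / l \<le> b" and c: "0 \<le> c"
  shows "2 * (1 - 2 * b * exp (- c)) \<le> integral {-c..c} (pair_weight k l)"
proof -
  let ?f = "\<lambda>k t. 1 / (1 + exp t * k) * (1 - 1 / (1 + exp t * k))"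
  let ?J = "\<lambda>k. 1 / (1 + exp (- c) * k) - 1 / (1 + exp c * k)"
  have J: "1 - 2 * b * exp (- c) \<le> ?J k" if "0 < k" "k \<le> b" "1 / k \<le> b" for k
  proof -
    have "1 - exp (- c) * k \<le> 1 / (1 + exp (- c) * k)"
    proof -
      have "(1 - exp (- c) * k) * (1 + exp (- c) * k) = 1 - (exp (- c) * k)\<^sup>2"
        by (simp add: algebra_simps power2_eq_square)
      then have "(1 - exp (- c) * k) * (1 + exp (- c) * k) \<le> 1" by simp
      then show ?thesis using one_plus_exp_pos[OF that(1), of "- c"] by (simp add: le_divide_eq)
    qed
    moreover have "1 / (1 + exp c * k) \<le> exp (- c) * (1 / k)"
    proof -
      have "1 / (1 + exp c * k) \<le> 1 / (exp c * k)" using that by (intro divide_left_mono) (auto intro!: mult_pos_pos)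
      then show ?thesis by (simp add: exp_minus field_simps)
    qed
    moreover have "exp (- c) * k \<le> exp (- c) * b" "exp (- c) * (1 / k) \<le> exp (- c) * b"
      using that by (auto intro!: mult_left_mono simp del: times_divide_eq_right)
    moreover have "2 * b * exp (- c) = exp (- c) * b + exp (- c) * b" by simp
    ultimately show ?thesis by argo
  qed
  have "?f k t + ?f l t \<le> pair_weight k l t" for t
  proof -
    have "pair_weight k l t - (?f k t + ?f l t) = (1 / (1 + exp t * k) - 1 / (1 + exp t * l))\<^sup>2"
      by (simp add: pair_weight_def algebra_simps power2_eq_square)
    then show ?thesis by (smt (verit) zero_le_power2)
  qed
  then have "?J k + ?J l \<le> integral {-c..c} (pair_weight k l)"
    using has_integral_add[OF diagonal_weight_integral[OF kl(1) c] diagonal_weight_integral[OF kl(2) c]]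
    by (intro has_integral_le[OF _ integrable_integral[OF pair_weight_integrable[OF kl(1,2)]]]) auto
  then show ?thesis using J[of k] J[of l] kl by simp
qed

section \<open>The squared logarithm as an integral of softplus functions\<close>

definition softplus_int :: "real \<Rightarrow> real \<Rightarrow> real" where
  "softplus_int c u = integral {-c..c} (\<lambda>t. ln (1 + exp (t + u)))"

lemma ln_one_plus_exp_bounds: "0 \<le> ln (1 + exp y)" "ln (1 + exp y) \<le> exp y" for y :: real
  using ln_add_one_self_le_self[of "exp y"] by (auto simp: ln_ge_zero)

lemma softplus_int_expansion:
  fixes c u :: real
  assumes c: "0 \<le> c"
  shows "\<bar>softplus_int c u - softplus_int c 0 - c * u - u\<^sup>2 / 2\<bar> \<le> exp (\<bar>u\<bar> - c) * \<bar>u\<bar>"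
proof -
  have pos: "0 < 1 + exp y" "1 + exp y \<noteq> 0" for y :: real using exp_gt_zero[of y] by linarith+
  have deriv: "(softplus_int c has_field_derivative ln (1 + exp (c + u)) - ln (1 + exp (- c + u))) (at u)" for u :: real
  proof -
    have "((\<lambda>u. integral (cbox (-c) c) (\<lambda>t. ln (1 + exp (t + u)))) has_field_derivative
        integral (cbox (-c) c) (\<lambda>t. exp (t + u) / (1 + exp (t + u)))) (at u within UNIV)"
    proof (rule leibniz_rule_field_derivative)
      show "((\<lambda>u. ln (1 + exp (t + u))) has_field_derivative exp (t + u) / (1 + exp (t + u))) (at u within UNIV)" for u t :: real
        using pos[of "t + u"] by (auto intro!: derivative_eq_intros)
      show "(\<lambda>t. ln (1 + exp (t + u))) integrable_on cbox (-c) c" for u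
        using pos by (intro integrable_continuous continuous_intros) auto
      show "continuous_on (UNIV \<times> cbox (-c) c) (\<lambda>(u, t). exp (t + u) / (1 + exp (t + u)))"
        unfolding case_prod_beta using pos by (intro continuous_intros) auto
    qed auto
    moreover have "((\<lambda>t. exp (t + u) / (1 + exp (t + u))) has_integral
        ln (1 + exp (c + u)) - ln (1 + exp (- c + u))) {-c..c}"
      using c pos by (intro fundamental_theorem_of_calculus)
        (auto simp: has_real_derivative_iff_has_vector_derivative[symmetric] intro!: derivative_eq_intros)
    then have "integral (cbox (-c) c) (\<lambda>t. exp (t + u) / (1 + exp (t + u))) = ln (1 + exp (c + u)) - ln (1 + exp (- c + u))"
      by (simp add: integral_unique)
    ultimately show ?thesis unfolding softplus_int_def by simp
  qed
  define \<phi> where "\<phi> u = softplus_int c u - c * u - u\<^sup>2 / 2" for u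
  define \<phi>' where "\<phi>' u = ln (1 + exp (- c - u)) - ln (1 + exp (u - c))" for u
  have lnc: "ln (1 + exp (c + v)) = c + v + ln (1 + exp (- c - v))" for v
  proof -
    have "1 + exp (c + v) = exp (c + v) * (1 + exp (- c - v))" by (simp add: algebra_simps flip: exp_add)
    then show ?thesis using pos by (simp add: ln_mult)
  qed
  have "(\<phi> has_field_derivative \<phi>' v) (at v)" for v
  proof -
    have "(\<phi> has_field_derivative ln (1 + exp (c + v)) - ln (1 + exp (- c + v)) - c - v) (at v)"
      unfolding \<phi>_def by (auto intro!: derivative_eq_intros deriv)
    then show ?thesis unfolding lnc[of v] \<phi>'_def by (simp add: algebra_simps)
  qed
  moreover have "norm (\<phi>' v) \<le> exp (\<bar>u\<bar> - c)" if "v \<in> {-\<bar>u\<bar>..\<bar>u\<bar>}" for v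
  proof -
    have "exp (- c - v) \<le> exp (\<bar>u\<bar> - c)" "exp (v - c) \<le> exp (\<bar>u\<bar> - c)" using that by auto
    then show ?thesis
      using ln_one_plus_exp_bounds[of "- c - v"] ln_one_plus_exp_bounds[of "v - c"]
      unfolding \<phi>'_def real_norm_def by linarith
  qed
  ultimately have "norm (\<phi> u - \<phi> 0) \<le> exp (\<bar>u\<bar> - c) * norm (u - 0)"
    by (intro field_differentiable_bound[of "{-\<bar>u\<bar>..\<bar>u\<bar>}" \<phi> \<phi>']) (auto intro: has_field_derivative_at_within)
  then show ?thesis by (simp add: \<phi>_def algebra_simps)
qed

lemma tendsto_exp_minus: "((\<lambda>c. a * exp (- c)) \<longlongrightarrow> 0) at_top" for a :: real
  by real_asymp

lemma softplus_int_limit: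
  "((\<lambda>c. softplus_int c u - softplus_int c 0 - c * u) \<longlongrightarrow> u\<^sup>2 / 2) at_top"
proof -
  have "((\<lambda>c. u\<^sup>2 / 2 - (softplus_int c u - softplus_int c 0 - c * u)) \<longlongrightarrow> 0) at_top"
  proof (rule tendsto_rabs_zero_cancel, rule tendsto_sandwich[OF _ _ tendsto_const tendsto_exp_minus])
    show "\<forall>\<^sub>F c in at_top. \<bar>u\<^sup>2 / 2 - (softplus_int c u - softplus_int c 0 - c * u)\<bar> \<le> (exp \<bar>u\<bar> * \<bar>u\<bar>) * exp (- c)"
      using eventually_ge_at_top[of "0 :: real"]
    proof eventually_elim
      case (elim c)
      then show ?case using softplus_int_expansion[OF elim, of u] by (simp add: exp_diff exp_minus field_simps abs_minus_commute)
    qed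
  qed auto
  from tendsto_diff[OF tendsto_const this, of "u\<^sup>2 / 2"] show ?thesis by (simp add: algebra_simps)
qed

lemma mult_carrier_iff [simp]: "A * B \<in> carrier_mat a b \<longleftrightarrow> dim_row A = a \<and> dim_col B = b"
  by auto

section \<open>The affine-invariant distance\<close>

lemma rel_log_sym:
  assumes "P \<in> spd n" "R \<in> spd n"
  shows "mat_isqrt P * R * mat_isqrt P \<in> spd n"
    and rel_log_carrier: "rel_log P R \<in> carrier_mat n n"
    and rel_log_transpose: "transpose_mat (rel_log P R) = rel_log P R"
proof -
  note Q = mat_sqrt_isqrt[OF assms(1)]
  have "mat_isqrt P * R * transpose_mat (mat_isqrt P) \<in> spd n"
    by (rule spd_congruence_invertible[OF assms(2) _ _ Q(4)]) (use Q spdD in auto)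
  then show K: "mat_isqrt P * R * mat_isqrt P \<in> spd n" using spdD(2)[OF Q(2)] by simp
  show "rel_log P R \<in> carrier_mat n n" "transpose_mat (rel_log P R) = rel_log P R"
    unfolding rel_log_def mat_log_def using spectral_fun_sym[OF spdD[OF K]] by auto
qed

lemma d_AI_sq: "(d_AI P R)\<^sup>2 = frob (rel_log P R) (rel_log P R)"
  by (simp add: d_AI_def frob_norm_sq)

lemma d_AI_nonneg: "0 \<le> d_AI P R"
  by (simp add: d_AI_def)

text \<open>Any simultaneous diagonalisation computes the distance.\<close>

lemma d_AI_diagonalisation:
  assumes P: "P \<in> spd n" and R: "R \<in> spd n" and G: "G \<in> carrier_mat n n"
    and GP: "G * P * transpose_mat G = 1\<^sub>m n" and GR: "G * R * transpose_mat G = mat_diag n (\<lambda>i. exp (u i))"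
  shows "(d_AI P R)\<^sup>2 = (\<Sum>i<n. (u i)\<^sup>2)"
proof -
  note Q = mat_sqrt_isqrt[OF P] and p = spdD[OF P] and r = spdD[OF R]
  note S = spdD[OF Q(1)] and Si = spdD[OF Q(2)]
  define U where "U = G * mat_sqrt P"
  have U: "U \<in> carrier_mat n n" using G S by (simp add: U_def)
  have "U * transpose_mat U = G * (mat_sqrt P * mat_sqrt P) * transpose_mat G"
    using G S by (simp add: U_def transpose_mult_dim mult_assoc_dim)
  then have UU: "U * transpose_mat U = 1\<^sub>m n" using GP Q(3) by simp
  have UU': "transpose_mat U * U = 1\<^sub>m n" by (rule left_inverse_is_right_inverse[OF U _ UU]) (use U in simp)
  define K where "K = mat_isqrt P * R * mat_isqrt P"
  have K: "K \<in> carrier_mat n n" using Si r by (auto simp: K_def)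
  have "U * K * transpose_mat U = G * R * transpose_mat G"
    using G S Si r by (simp add: U_def K_def transpose_mult_dim mult_assoc_dim mult_cancel_left[OF Q(5)] mult_cancel_left[OF Q(4)])
  then have UK: "U * K * transpose_mat U = mat_diag n (\<lambda>i. exp (u i))" using GR by simp
  have "transpose_mat U * (U * K * transpose_mat U) * U = K"
    using U K by (simp add: mult_assoc_dim mult_cancel_left[OF UU'] UU')
  then have "K = transpose_mat U * mat_diag n (\<lambda>i. exp (u i)) * transpose_mat (transpose_mat U)"
    unfolding UK by simp
  then have sd: "spectral_decomposition K (transpose_mat U) (\<lambda>i. exp (u i))"
    using U UU by (intro spectral_decompositionI[of _ n]) auto
  have "(d_AI P R)\<^sup>2 = frob (spectral_fun ln K) (spectral_fun ln K)"
    by (simp add: d_AI_sq rel_log_def mat_log_def K_def)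
  also have "\<dots> = (\<Sum>i<n. (ln (exp (u i)))\<^sup>2)"
    by (rule frob_spectral[OF spectral_fun_decomposition[OF sd K]])
      (use spectral_fun_carrier[OF K spectral_decomposition_sym[OF sd K]] in auto)
  finally show ?thesis by simp
qed

lemma simultaneous_diagonalisation:
  assumes P: "P \<in> spd n" and R: "R \<in> spd n"
  shows "\<exists>G Gi u. G \<in> carrier_mat n n \<and> Gi \<in> carrier_mat n n \<and> Gi * G = 1\<^sub>m n \<and>
    G * P * transpose_mat G = 1\<^sub>m n \<and> G * R * transpose_mat G = mat_diag n (\<lambda>i. exp (u i))"
proof -
  note Q = mat_sqrt_isqrt[OF P] and p = spdD[OF P] and r = spdD[OF R]
  note S = spdD[OF Q(1)] and Si = spdD[OF Q(2)]
  define K where "K = mat_isqrt P * R * mat_isqrt P"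
  have K: "K \<in> spd n" unfolding K_def by (rule rel_log_sym[OF P R])
  from spd_decomp[OF K] obtain U k where U: "U \<in> carrier_mat n n" "transpose_mat U * U = 1\<^sub>m n"
    "U * transpose_mat U = 1\<^sub>m n" "K = U * mat_diag n k * transpose_mat U" "\<forall>i<n. 0 < k i" by blast
  define G where "G = transpose_mat U * mat_isqrt P"
  have "mat_sqrt P * U * G = 1\<^sub>m n"
    using U(1,3) S Si by (simp add: G_def mult_assoc_dim mult_cancel_left[OF U(3)] Q)
  moreover have "G * P * transpose_mat G = 1\<^sub>m n"
  proof -
    have "G * P * transpose_mat G = transpose_mat U * (mat_isqrt P * (mat_sqrt P * mat_sqrt P) * mat_isqrt P) * U"
      using U(1) S Si p unfolding Q(3) by (simp add: G_def transpose_mult_dim mult_assoc_dim)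
    also have "mat_isqrt P * (mat_sqrt P * mat_sqrt P) * mat_isqrt P = 1\<^sub>m n"
      using S Si by (simp add: mult_assoc_dim mult_cancel_left[OF Q(4)] Q(5))
    finally show ?thesis using U by simp
  qed
  moreover have "G * R * transpose_mat G = mat_diag n (\<lambda>i. exp (ln (k i)))"
  proof -
    have "G * R * transpose_mat G = transpose_mat U * K * U"
      using U(1) Si r by (simp add: G_def K_def transpose_mult_dim mult_assoc_dim)
    also have "\<dots> = mat_diag n k"
      unfolding U(4) using U(1) by (simp add: mult_assoc_dim mult_cancel_left[OF U(2)] U(2))
    also have "\<dots> = mat_diag n (\<lambda>i. exp (ln (k i)))" using U(5) by (intro mat_diag_cong) auto
    finally show ?thesis .
  qed
  moreover have "G \<in> carrier_mat n n" "mat_sqrt P * U \<in> carrier_mat n n" using U S Si by (auto simp: G_def)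
  ultimately show ?thesis
    by (intro exI[of _ G] exI[of _ "mat_sqrt P * U"] exI[of _ "\<lambda>i. ln (k i)"] conjI)
qed

lemma d_AI_congruence:
  assumes P: "P \<in> spd n" and R: "R \<in> spd n"
    and H: "H \<in> carrier_mat n n" "Hi \<in> carrier_mat n n" "H * Hi = 1\<^sub>m n"
  shows "d_AI (H * P * transpose_mat H) (H * R * transpose_mat H) = d_AI P R"
proof -
  from simultaneous_diagonalisation[OF P R] obtain G u where G: "G \<in> carrier_mat n n"
    "G * P * transpose_mat G = 1\<^sub>m n" "G * R * transpose_mat G = mat_diag n (\<lambda>i. exp (u i))" by blast
  note HH = left_inverse_is_right_inverse[OF H]
  have T: "transpose_mat H * transpose_mat Hi = 1\<^sub>m n" using H HH by (simp flip: transpose_mult_dim)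
  have conj: "G * Hi * (H * Z * transpose_mat H) * transpose_mat (G * Hi) = G * Z * transpose_mat G"
    if "Z \<in> carrier_mat n n" for Z
    using that G(1) H(1,2) by (simp add: transpose_mult_dim mult_assoc_dim mult_cancel_left[OF HH] mult_cancel_left[OF T])
  have "(d_AI (H * P * transpose_mat H) (H * R * transpose_mat H))\<^sup>2 = (\<Sum>i<n. (u i)\<^sup>2)"
  proof (rule d_AI_diagonalisation[of _ n _ "G * Hi"])
    show "G * Hi * (H * P * transpose_mat H) * transpose_mat (G * Hi) = 1\<^sub>m n"
      unfolding conj[OF spdD(1)[OF P]] by (rule G)
    show "G * Hi * (H * R * transpose_mat H) * transpose_mat (G * Hi) = mat_diag n (\<lambda>i. exp (u i))"
      unfolding conj[OF spdD(1)[OF R]] by (rule G)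
  qed (use G H P R in \<open>auto intro!: spd_congruence_invertible[OF _ H]\<close>)
  also have "\<dots> = (d_AI P R)\<^sup>2" by (rule d_AI_diagonalisation[OF P R G, symmetric])
  finally show ?thesis using d_AI_nonneg by (simp add: power2_eq_iff_nonneg)
qed

lemma d_AI_commute:
  assumes P: "P \<in> spd n" and R: "R \<in> spd n"
  shows "d_AI R P = d_AI P R"
proof -
  from simultaneous_diagonalisation[OF P R] obtain G u where G: "G \<in> carrier_mat n n"
    "G * P * transpose_mat G = 1\<^sub>m n" "G * R * transpose_mat G = mat_diag n (\<lambda>i. exp (u i))" by blast
  define D where "D = mat_diag n (\<lambda>i. exp (- u i / 2))"
  have conj: "(D * G) * Z * transpose_mat (D * G) = D * (G * Z * transpose_mat G) * D" if "Z \<in> carrier_mat n n" for Z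
    using that G(1) by (simp add: D_def transpose_mult_dim mult_assoc_dim)
  have "(d_AI R P)\<^sup>2 = (\<Sum>i<n. (- u i)\<^sup>2)"
  proof (rule d_AI_diagonalisation[OF R P, of "D * G"])
    show "(D * G) * R * transpose_mat (D * G) = 1\<^sub>m n"
      unfolding conj[OF spdD(1)[OF R]] G(3) by (simp add: D_def flip: exp_add)
    show "(D * G) * P * transpose_mat (D * G) = mat_diag n (\<lambda>i. exp (- u i))"
      unfolding conj[OF spdD(1)[OF P]] G(2) by (simp add: D_def flip: exp_add)
  qed (use G in \<open>auto simp: D_def\<close>)
  also have "\<dots> = (d_AI P R)\<^sup>2" using d_AI_diagonalisation[OF P R G] by simp
  finally show ?thesis using d_AI_nonneg by (simp add: power2_eq_iff_nonneg)
qed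

lemma d_AI_eq_0:
  assumes P: "P \<in> spd n" and R: "R \<in> spd n" and 0: "d_AI P R = 0"
  shows "P = R"
proof -
  from simultaneous_diagonalisation[OF P R] obtain G Gi u where G: "G \<in> carrier_mat n n"
    "G * P * transpose_mat G = 1\<^sub>m n" "G * R * transpose_mat G = mat_diag n (\<lambda>i. exp (u i))"
    and Gi: "Gi \<in> carrier_mat n n" "Gi * G = 1\<^sub>m n" by blast
  have "(\<Sum>i<n. (u i)\<^sup>2) = 0" using d_AI_diagonalisation[OF P R G] 0 by simp
  then have "\<forall>i\<in>{..<n}. (u i)\<^sup>2 = 0" by (subst sum_nonneg_eq_0_iff[symmetric]) auto
  then have "mat_diag n (\<lambda>i. exp (u i)) = mat_diag n (\<lambda>i. 1)" by (intro mat_diag_cong) auto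
  then have eq: "G * R * transpose_mat G = G * P * transpose_mat G" using G by simp
  have T: "transpose_mat G * transpose_mat Gi = 1\<^sub>m n" using G Gi by (simp flip: transpose_mult_dim)
  have "Gi * (G * Z * transpose_mat G) * transpose_mat Gi = Z" if "Z \<in> carrier_mat n n" for Z
    using that G(1) Gi by (simp add: mult_assoc_dim mult_cancel_left[OF Gi(2)] T)
  from this[of P] this[of R] show ?thesis using eq spdD(1)[OF P] spdD(1)[OF R] by simp
qed

lemma d_AI_refl:
  assumes P: "P \<in> spd n" shows "d_AI P P = 0"
proof -
  note Q = mat_sqrt_isqrt[OF P]
  have "mat_isqrt P * P * mat_isqrt P = mat_isqrt P * (mat_sqrt P * mat_sqrt P) * mat_isqrt P" using Q(3) by simp
  also have "\<dots> = 1\<^sub>m n"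
    using spdD[OF Q(1)] spdD[OF Q(2)] by (simp add: mult_assoc_dim mult_cancel_left[OF Q(4)] Q(5))
  finally have "rel_log P P = 0 \<cdot>\<^sub>m 1\<^sub>m n"
    by (simp add: rel_log_def mat_log_def spectral_fun_one)
  then show ?thesis by (simp add: d_AI_def frob_norm_def)
qed

lemma rel_log_block_diag:
  assumes "P \<in> spd a" "R \<in> spd a" "P' \<in> spd b" "R' \<in> spd b"
  shows "rel_log (block_diag P P') (block_diag R R') = block_diag (rel_log P R) (rel_log P' R')"
proof -
  note p = spdD[OF assms(1)] and p' = spdD[OF assms(3)]
  note K = spdD[OF rel_log_sym(1)[OF assms(1,2)]] spdD[OF rel_log_sym(1)[OF assms(3,4)]]
  have "mat_isqrt P \<in> carrier_mat a a" "mat_isqrt P' \<in> carrier_mat b b"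
    using mat_sqrt_isqrt assms spdD by blast+
  then have "mat_isqrt (block_diag P P') * block_diag R R' * mat_isqrt (block_diag P P')
      = block_diag (mat_isqrt P * R * mat_isqrt P) (mat_isqrt P' * R' * mat_isqrt P')"
    using spdD[OF assms(2)] spdD[OF assms(4)] unfolding mat_isqrt_def
    by (simp add: spectral_fun_block_diag[OF p p'] block_diag_mult)
  then show ?thesis
    unfolding rel_log_def mat_log_def using spectral_fun_block_diag[OF K] by simp
qed

lemma d_AI_block_diag:
  assumes "P \<in> spd a" "R \<in> spd a" "P' \<in> spd b" "R' \<in> spd b"
  shows "(d_AI (block_diag P P') (block_diag R R'))\<^sup>2 = (d_AI P R)\<^sup>2 + (d_AI P' R')\<^sup>2"
  unfolding d_AI_sq rel_log_block_diag[OF assms]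
  by (rule frob_block_diag) (use assms rel_log_carrier in auto)

section \<open>Convexity of the squared distance along a diagonal geodesic\<close>

locale diagonal_geodesic =
  fixes n :: nat and x :: "nat \<Rightarrow> real" and R :: "real mat"
  assumes R: "R \<in> spd n"
begin

definition half_inv :: "real \<Rightarrow> real mat" where
  "half_inv s = mat_diag n (\<lambda>i. exp (- (s * x i) / 2))"

definition rel :: "real \<Rightarrow> real mat" where
  "rel s = half_inv s * R * half_inv s"

definition hsq :: "real \<Rightarrow> real" where
  "hsq s = (d_AI (mat_diag n (\<lambda>i. exp (s * x i))) R)\<^sup>2 / 2"

lemma rel_spd: "rel s \<in> spd n"
proof -
  have "half_inv s * R * transpose_mat (half_inv s) \<in> spd n"
    by (rule spd_congruence_invertible[OF R, of _ "mat_diag n (\<lambda>i. exp (s * x i / 2))"])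
      (auto simp: half_inv_def simp flip: exp_add)
  then show ?thesis by (simp add: rel_def half_inv_def)
qed

lemma hsq_spectral:
  assumes "spectral_decomposition (rel s) U k"
  shows "hsq s = (\<Sum>i<n. (ln (k i))\<^sup>2) / 2"
proof -
  have "sqrt (exp y) = exp (y / 2)" for y :: real
    by (rule real_sqrt_unique) (auto simp flip: exp_add simp: power2_eq_square)
  then have "exp (- y / 2) = 1 / sqrt (exp y)" for y :: real
    by (simp add: exp_minus inverse_eq_divide)
  then have "mat_isqrt (mat_diag n (\<lambda>i. exp (s * x i))) = half_inv s"
    by (simp add: mat_isqrt_def spectral_fun_mat_diag half_inv_def)
  then have "(d_AI (mat_diag n (\<lambda>i. exp (s * x i))) R)\<^sup>2 = frob (spectral_fun ln (rel s)) (spectral_fun ln (rel s))"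
    by (simp add: d_AI_sq rel_log_def mat_log_def rel_def)
  then show ?thesis
    using frob_spectral[OF spectral_fun_decomposition[OF assms spdD(1)[OF rel_spd]] spectral_fun_carrier[OF spdD[OF rel_spd]]]
    by (simp add: hsq_def)
qed

lemma rel_decomp:
  "\<exists>U k. spectral_decomposition (rel s) U k \<and> U \<in> carrier_mat n n \<and> transpose_mat U * U = 1\<^sub>m n \<and>
    U * transpose_mat U = 1\<^sub>m n \<and> rel s = U * mat_diag n k * transpose_mat U \<and> (\<forall>i<n. 0 < k i)"
  by (rule spd_decomp[OF rel_spd])

lemma pencil_det_pos: "0 < det (mat n n (\<lambda>(i, j). pencil x R (exp t) s i j))"
proof -
  from rel_decomp[of s] obtain U k where U: "U \<in> carrier_mat n n" "transpose_mat U * U = 1\<^sub>m n"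
    "rel s = U * mat_diag n k * transpose_mat U" "\<forall>i<n. 0 < k i" by blast
  show ?thesis
    using U by (subst pencil_det[OF spdD(1)[OF R] U(3)[unfolded rel_def half_inv_def] U(1,2)])
      (auto intro!: mult_pos_pos prod_pos simp: add_pos_pos)
qed

definition logdet_int :: "real \<Rightarrow> real \<Rightarrow> real" where
  "logdet_int c s = integral {-c..c} (\<lambda>t. pencil_logdet n x R (exp t) s)"

definition logdet_int1 :: "real \<Rightarrow> real \<Rightarrow> real" where
  "logdet_int1 c s = integral {-c..c} (\<lambda>t. pencil_logdet1 n x R (exp t) s)"

definition logdet_int2 :: "real \<Rightarrow> real \<Rightarrow> real" where
  "logdet_int2 c s = integral {-c..c} (\<lambda>t. pencil_logdet2 n x R (exp t) s)"

lemma continuous_on_slice: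
  assumes "continuous_on UNIV (\<lambda>(s, t). f s t)"
  shows "continuous_on S (\<lambda>t. f (s :: real) (t :: real) :: real)"
proof -
  have "continuous_on S (\<lambda>t. (s, t))" by (intro continuous_intros)
  from continuous_on_compose2[OF assms this] show ?thesis by simp
qed

lemma logdet_int_deriv: "(logdet_int c has_field_derivative logdet_int1 c s) (at s)"
proof -
  note cont = continuous_on_pencil_logdet[OF pencil_det_pos]
  have "((\<lambda>s. integral (cbox (-c) c) (\<lambda>t. pencil_logdet n x R (exp t) s)) has_field_derivative
      integral (cbox (-c) c) (\<lambda>t. pencil_logdet1 n x R (exp t) s)) (at s within UNIV)"
    by (rule leibniz_rule_field_derivative)
      (auto intro!: pencil_logdet_deriv pencil_det_pos integrable_continuous_real continuous_on_slice cont)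
  then show ?thesis by (simp add: logdet_int_def[abs_def] logdet_int1_def)
qed

lemma logdet_int1_deriv: "(logdet_int1 c has_field_derivative logdet_int2 c s) (at s)"
proof -
  note cont = continuous_on_pencil_logdet[OF pencil_det_pos]
  have "((\<lambda>s. integral (cbox (-c) c) (\<lambda>t. pencil_logdet1 n x R (exp t) s)) has_field_derivative
      integral (cbox (-c) c) (\<lambda>t. pencil_logdet2 n x R (exp t) s)) (at s within UNIV)"
    by (rule leibniz_rule_field_derivative)
      (auto intro!: pencil_logdet1_deriv pencil_det_pos integrable_continuous_real continuous_on_slice cont)
  then show ?thesis by (simp add: logdet_int1_def[abs_def] logdet_int2_def)
qed

lemma logdet_int2_pairs:
  assumes U: "U \<in> carrier_mat n n" "transpose_mat U * U = 1\<^sub>m n"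
    and K: "rel s = U * mat_diag n k * transpose_mat U" and k: "\<forall>i<n. 0 < k i"
  defines "Y \<equiv> transpose_mat U * mat_diag n x * U"
  shows "logdet_int2 c s = (\<Sum>i<n. \<Sum>j<n. (Y $$ (i, j))\<^sup>2 / 2 * integral {-c..c} (pair_weight (k i) (k j)))"
    and "(\<Sum>i<n. \<Sum>j<n. (Y $$ (i, j))\<^sup>2) = (\<Sum>i<n. (x i)\<^sup>2)"
proof -
  have Y: "Y \<in> carrier_mat n n" using U by (simp add: Y_def)
  have symY: "transpose_mat Y = Y" using U by (simp add: Y_def transpose_mult_dim mult_assoc_dim)
  have sY: "Y $$ (j, i) = Y $$ (i, j)" if "i < n" "j < n" for i j
    using arg_cong[OF symY, of "\<lambda>M. M $$ (i, j)"] that Y by simp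
  let ?w = "\<lambda>t i j. 1 / (1 + exp t * k i) * (1 - 1 / (1 + exp t * k j))"
  have pl: "pencil_logdet2 n x R (exp t) s = (\<Sum>i<n. \<Sum>j<n. (Y $$ (i, j))\<^sup>2 / 2 * pair_weight (k i) (k j) t)" for t
  proof -
    have e: "pencil_logdet2 n x R (exp t) s = (\<Sum>i<n. \<Sum>j<n. (Y $$ (i, j))\<^sup>2 * ?w t i j)"
      unfolding Y_def
      by (rule pencil_logdet2_spectral[OF spdD(1)[OF R] K[unfolded rel_def half_inv_def] U]) (use k in auto)
    also have "\<dots> = (\<Sum>i<n. \<Sum>j<n. (Y $$ (j, i))\<^sup>2 * ?w t j i)" by (rule sum.swap)
    also have "\<dots> = (\<Sum>i<n. \<Sum>j<n. (Y $$ (i, j))\<^sup>2 * ?w t j i)" by (intro sum.cong refl) (simp add: sY)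
    finally have "2 * pencil_logdet2 n x R (exp t) s
        = (\<Sum>i<n. \<Sum>j<n. (Y $$ (i, j))\<^sup>2 * ?w t i j) + (\<Sum>i<n. \<Sum>j<n. (Y $$ (i, j))\<^sup>2 * ?w t j i)"
      using e by linarith
    also have "\<dots> = (\<Sum>i<n. \<Sum>j<n. (Y $$ (i, j))\<^sup>2 * pair_weight (k i) (k j) t)"
      unfolding sum.distrib[symmetric] pair_weight_def distrib_left ..
    finally show ?thesis by (simp add: sum_divide_distrib[symmetric])
  qed
  show "logdet_int2 c s = (\<Sum>i<n. \<Sum>j<n. (Y $$ (i, j))\<^sup>2 / 2 * integral {-c..c} (pair_weight (k i) (k j)))"
  proof -
    have i: "(\<lambda>t. (Y $$ (i, j))\<^sup>2 / 2 * pair_weight (k i) (k j) t) integrable_on {-c..c}" if "i < n" "j < n" for i j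
      using k that by (intro integrable_on_mult_right pair_weight_integrable) auto
    have i': "(\<lambda>t. (Y $$ (i, j))\<^sup>2 * pair_weight (k i) (k j) t) integrable_on {-c..c}" if "i < n" "j < n" for i j
      using k that by (intro integrable_on_mult_right pair_weight_integrable) auto
    have "integral {-c..c} (\<lambda>t. \<Sum>i<n. \<Sum>j<n. (Y $$ (i, j))\<^sup>2 / 2 * pair_weight (k i) (k j) t)
      = (\<Sum>i<n. \<Sum>j<n. integral {-c..c} (\<lambda>t. (Y $$ (i, j))\<^sup>2 / 2 * pair_weight (k i) (k j) t))"
      by (subst integral_sum; (intro sum.cong refl integral_sum integrable_sum)?) (auto intro: i')
    then show ?thesis unfolding logdet_int2_def pl by (simp only: integral_mult_right)
  qed
  have "frob Y Y = frob (mat_diag n x) (mat_diag n x)"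
    using frob_orthogonal_conj[of "mat_diag n x" n "mat_diag n x" "transpose_mat U"] U
      left_inverse_is_right_inverse[of "transpose_mat U" n U] by (simp add: Y_def)
  then show "(\<Sum>i<n. \<Sum>j<n. (Y $$ (i, j))\<^sup>2) = (\<Sum>i<n. (x i)\<^sup>2)"
    using Y by (simp add: frob_diag frob_def[of Y] power2_eq_square)
qed

lemma logdet_int2_nonneg: "0 \<le> logdet_int2 c s"
proof -
  from rel_decomp[of s] obtain U k where U: "U \<in> carrier_mat n n" "transpose_mat U * U = 1\<^sub>m n"
    "rel s = U * mat_diag n k * transpose_mat U" "\<forall>i<n. 0 < k i" by blast
  show ?thesis
    unfolding logdet_int2_pairs(1)[OF U]
    by (intro sum_nonneg mult_nonneg_nonneg integral_nonneg pair_weight_integrable pair_weight_nonneg) (use U in auto)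
qed

lemma logdet_int2_upper:
  assumes c: "0 \<le> c"
  shows "logdet_int2 c s \<le> psi (sqrt (hsq s)) * (\<Sum>i<n. (x i)\<^sup>2)"
proof -
  from rel_decomp[of s] obtain U k where sd: "spectral_decomposition (rel s) U k"
    and U: "U \<in> carrier_mat n n" "transpose_mat U * U = 1\<^sub>m n"
    "rel s = U * mat_diag n k * transpose_mat U" "\<forall>i<n. 0 < k i" by blast
  note Y = logdet_int2_pairs[OF U]
  have w: "integral {-c..c} (pair_weight (k i) (k j)) \<le> 2 * psi (sqrt (hsq s))" if ij: "i < n" "j < n" for i j
  proof -
    have "(\<bar>ln (k i) - ln (k j)\<bar> / 2)\<^sup>2 \<le> hsq s"
    proof (cases "i = j")
      case False
      have "(ln (k i))\<^sup>2 + (ln (k j))\<^sup>2 \<le> (\<Sum>i<n. (ln (k i))\<^sup>2)"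
        using sum_mono2[of "{..<n}" "{i, j}" "\<lambda>i. (ln (k i))\<^sup>2"] ij False by simp
      moreover have "(ln (k i) - ln (k j))\<^sup>2 \<le> 2 * ((ln (k i))\<^sup>2 + (ln (k j))\<^sup>2)"
        using zero_le_power2[of "ln (k i) + ln (k j)"] by (simp add: power2_sum power2_diff)
      ultimately show ?thesis unfolding hsq_spectral[OF sd] by (simp add: power_divide)
    qed (simp add: hsq_def)
    then have "\<bar>ln (k i) - ln (k j)\<bar> / 2 \<le> sqrt (hsq s)" by (rule real_le_rsqrt)
    then have "psi (\<bar>ln (k i) - ln (k j)\<bar> / 2) \<le> psi (sqrt (hsq s))" by (intro psi_mono) auto
    then show ?thesis using pair_weight_upper[of "k i" "k j" c] U(4) ij c by fastforce
  qed
  have "logdet_int2 c s \<le> (\<Sum>i<n. \<Sum>j<n. ((transpose_mat U * mat_diag n x * U) $$ (i, j))\<^sup>2 / 2 * (2 * psi (sqrt (hsq s))))"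
    unfolding Y(1) by (intro sum_mono mult_left_mono w) auto
  also have "\<dots> = (\<Sum>i<n. \<Sum>j<n. ((transpose_mat U * mat_diag n x * U) $$ (i, j))\<^sup>2) * psi (sqrt (hsq s))"
    unfolding sum_distrib_right by (intro sum.cong refl) simp
  finally show ?thesis unfolding Y(2) by (simp add: mult.commute)
qed

lemma rel_eigenvalues_bounded:
  "\<exists>b>0. \<forall>s\<in>{0..S}. \<forall>U k. spectral_decomposition (rel s) U k \<longrightarrow> (\<forall>i<n. k i \<le> b \<and> 1 / k i \<le> b)"
proof -
  define Ri where "Ri = spectral_fun inverse R"
  have Ri: "Ri \<in> carrier_mat n n" unfolding Ri_def by (rule spectral_fun_carrier[OF spdD[OF R]])
  have RiR: "Ri * R = 1\<^sub>m n"
  proof -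
    have "Ri * R = spectral_fun (\<lambda>y. inverse y * y) R"
      using spectral_fun_mult[OF spdD[OF R], of inverse "\<lambda>y. y"] spectral_fun_id[OF spdD[OF R]] by (simp add: Ri_def)
    also have "\<dots> = spectral_fun (\<lambda>y. 1) R" by (rule spectral_fun_cong_spd[OF R]) simp
    finally show ?thesis using spectral_fun_const[OF spdD[OF R], of 1] by (auto intro!: eq_matI)
  qed
  define b where "b = 1 + (\<Sum>i<n. exp \<bar>S * x i\<bar> * (\<bar>R $$ (i, i)\<bar> + \<bar>Ri $$ (i, i)\<bar>))"
  have b: "0 < b" unfolding b_def by (intro add_pos_nonneg sum_nonneg) auto
  have e: "exp y \<le> exp \<bar>S * x i\<bar>" if "\<bar>y\<bar> \<le> \<bar>S * x i\<bar>" for i and y :: real using that by simp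
  have tr: "(\<Sum>i<n. exp (g i) * Z $$ (i, i)) \<le> b"
    if Z: "Z = R \<or> Z = Ri" and g: "\<And>i. \<bar>g i\<bar> \<le> \<bar>S * x i\<bar>" for g :: "nat \<Rightarrow> real" and Z
  proof -
    have "(\<Sum>i<n. exp (g i) * Z $$ (i, i)) \<le> (\<Sum>i<n. exp \<bar>S * x i\<bar> * (\<bar>R $$ (i, i)\<bar> + \<bar>Ri $$ (i, i)\<bar>))"
    proof (rule sum_mono)
      fix i assume "i \<in> {..<n}"
      have "exp (g i) * Z $$ (i, i) \<le> exp (g i) * (\<bar>R $$ (i, i)\<bar> + \<bar>Ri $$ (i, i)\<bar>)"
        using Z by (intro mult_left_mono) auto
      also have "\<dots> \<le> exp \<bar>S * x i\<bar> * (\<bar>R $$ (i, i)\<bar> + \<bar>Ri $$ (i, i)\<bar>)"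
        using e[OF g] by (intro mult_right_mono) auto
      finally show "exp (g i) * Z $$ (i, i) \<le> exp \<bar>S * x i\<bar> * (\<bar>R $$ (i, i)\<bar> + \<bar>Ri $$ (i, i)\<bar>)" .
    qed
    then show ?thesis by (simp add: b_def)
  qed
  have "k i \<le> b \<and> 1 / k i \<le> b"
    if s: "s \<in> {0..S}" and sd: "spectral_decomposition (rel s) U k" and i: "i < n" for s U k i
  proof -
    have k: "0 < k j" if "j < n" for j using spd_eigenvalues_pos[OF sd rel_spd that] .
    have g: "\<bar>s * x i\<bar> \<le> \<bar>S * x i\<bar>" for i using s by (simp add: abs_mult mult_right_mono)
    define D where "D = mat_diag n (\<lambda>i. exp (s * x i / 2))"
    have DH: "D * half_inv s = 1\<^sub>m n" by (simp add: D_def half_inv_def flip: exp_add)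
    have c: "D \<in> carrier_mat n n" "half_inv s \<in> carrier_mat n n" "R \<in> carrier_mat n n"
      using spdD[OF R] by (auto simp: D_def half_inv_def)
    have "(\<Sum>j<n. k j) = mat_trace (rel s)" using mat_trace_spectral[OF sd spdD(1)[OF rel_spd]] by simp
    also have "\<dots> = (\<Sum>i<n. exp (- (s * x i)) * R $$ (i, i))"
      using c(3) by (simp add: rel_def half_inv_def mat_trace_def mat_diag_mult_left[of _ n n] mat_diag_mult_right[of _ n n]
          mult.commute mult.left_commute flip: exp_add)
    also have "\<dots> \<le> b" using g by (intro tr) auto
    finally have "(\<Sum>j<n. k j) \<le> b" .
    moreover have "k i \<le> (\<Sum>j<n. k j)" using k i by (intro member_le_sum) (auto simp: less_imp_le)
    moreover have "1 / k i \<le> (\<Sum>j<n. inverse (k j))"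
      using k i by (subst divide_inverse, simp, intro member_le_sum[of i _ "\<lambda>j. inverse (k j)"]) (auto simp: less_imp_le)
    moreover have "(\<Sum>j<n. inverse (k j)) \<le> b"
    proof -
      define J where "J = spectral_fun inverse (rel s)"
      have J: "J \<in> carrier_mat n n" unfolding J_def by (rule spectral_fun_carrier[OF spdD[OF rel_spd]])
      have "rel s * J = spectral_fun (\<lambda>y. y * inverse y) (rel s)"
        using spectral_fun_mult[OF spdD[OF rel_spd], of "\<lambda>y. y" s inverse] spectral_fun_id[OF spdD[OF rel_spd]] by (simp add: J_def)
      also have "\<dots> = spectral_fun (\<lambda>y. 1) (rel s)" by (rule spectral_fun_cong_spd[OF rel_spd]) simp
      finally have rJ: "rel s * J = 1\<^sub>m n" using spectral_fun_const[OF spdD[OF rel_spd], of 1] by (auto intro!: eq_matI)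
      have one: "D * Ri * D * rel s = 1\<^sub>m n"
        using c Ri DH left_inverse_is_right_inverse[OF c(1,2) DH]
        by (simp add: rel_def mult_assoc_dim mult_cancel_left[OF DH] mult_cancel_left[OF RiR])
      have "D * Ri * D * (rel s * J) = J"
        using J c Ri spdD[OF rel_spd[of s]] by (intro mult_cancel_left[OF one]) auto
      then have "J = D * Ri * D" using rJ c Ri by simp
      moreover have "(\<Sum>j<n. inverse (k j)) = mat_trace J"
        unfolding J_def by (rule mat_trace_spectral[OF spectral_fun_decomposition[OF sd spdD(1)[OF rel_spd]], symmetric])
          (use J J_def in auto)
      moreover have "mat_trace (D * Ri * D) = (\<Sum>i<n. exp (s * x i) * Ri $$ (i, i))"
        using Ri by (simp add: D_def mat_trace_def mat_diag_mult_left[of _ n n] mat_diag_mult_right[of _ n n]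
          mult.commute mult.left_commute flip: exp_add)
      moreover have "(\<Sum>i<n. exp (s * x i) * Ri $$ (i, i)) \<le> b" using g by (intro tr) auto
      ultimately show ?thesis by simp
    qed
    ultimately show ?thesis by linarith
  qed
  then show ?thesis using b by blast
qed

lemma logdet_int2_lower:
  "\<exists>b>0. \<forall>c\<ge>0. \<forall>s\<in>{0..S}. (1 - 2 * b * exp (- c)) * (\<Sum>i<n. (x i)\<^sup>2) \<le> logdet_int2 c s"
proof -
  from rel_eigenvalues_bounded obtain b where b: "b > 0"
    "\<And>s U k i. s \<in> {0..S} \<Longrightarrow> spectral_decomposition (rel s) U k \<Longrightarrow> i < n \<Longrightarrow> k i \<le> b \<and> 1 / k i \<le> b" by blast
  have "(1 - 2 * b * exp (- c)) * (\<Sum>i<n. (x i)\<^sup>2) \<le> logdet_int2 c s" if c: "0 \<le> c" and s: "s \<in> {0..S}" for c s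
  proof -
    from rel_decomp[of s] obtain U k where sd: "spectral_decomposition (rel s) U k"
      and U: "U \<in> carrier_mat n n" "transpose_mat U * U = 1\<^sub>m n"
      "rel s = U * mat_diag n k * transpose_mat U" "\<forall>i<n. 0 < k i" by blast
    note Y = logdet_int2_pairs[OF U]
    have "(1 - 2 * b * exp (- c)) * (\<Sum>i<n. (x i)\<^sup>2)
      = (\<Sum>i<n. \<Sum>j<n. ((transpose_mat U * mat_diag n x * U) $$ (i, j))\<^sup>2 / 2 * (2 * (1 - 2 * b * exp (- c))))"
      unfolding Y(2)[symmetric] sum_distrib_left by (intro sum.cong refl) simp
    also have "\<dots> \<le> logdet_int2 c s"
      unfolding Y(1) by (intro sum_mono mult_left_mono pair_weight_lower) (use U(4) b(2)[OF s sd] c in auto)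
    finally show ?thesis .
  qed
  then show ?thesis using b(1) by blast
qed

text \<open>Subtracting a function of \<open>s\<close> that is affine turns \<open>logdet_int c\<close> into an approximation of
  half the squared distance.\<close>

definition approx :: "real \<Rightarrow> real \<Rightarrow> real" where
  "approx c s = logdet_int c s - 2 * c * (s * (\<Sum>i<n. x i)) - real n * softplus_int c 0
     - c * (ln (det R) - s * (\<Sum>i<n. x i))"

definition approx1 :: "real \<Rightarrow> real \<Rightarrow> real" where
  "approx1 c s = logdet_int1 c s - c * (\<Sum>i<n. x i)"

lemma approx_deriv: "(approx c has_field_derivative approx1 c s) (at s)"
  unfolding approx_def[abs_def] approx1_def
  by (rule derivative_eq_intros logdet_int_deriv refl)+ simp

lemma approx1_deriv: "(approx1 c has_field_derivative logdet_int2 c s) (at s)"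
  unfolding approx1_def[abs_def] by (rule derivative_eq_intros logdet_int1_deriv refl)+ simp

lemma approx_limit: "((\<lambda>c. approx c s) \<longlongrightarrow> hsq s) at_top"
proof -
  from rel_decomp[of s] obtain U k where sd: "spectral_decomposition (rel s) U k"
    and U: "U \<in> carrier_mat n n" "transpose_mat U * U = 1\<^sub>m n"
    "rel s = U * mat_diag n k * transpose_mat U" "\<forall>i<n. 0 < k i" by blast
  have pos: "0 < 1 + exp y" "1 + exp y \<noteq> 0" for y :: real using exp_gt_zero[of y] by linarith+
  have pl: "pencil_logdet n x R (exp t) s = s * (\<Sum>i<n. x i) + (\<Sum>i<n. ln (1 + exp (t + ln (k i))))" for t
  proof -
    have "pencil_logdet n x R (exp t) s = ln (exp (s * (\<Sum>i<n. x i)) * (\<Prod>i<n. 1 + exp t * k i))"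
      unfolding pencil_logdet_def
      by (subst pencil_det[OF spdD(1)[OF R] U(3)[unfolded rel_def half_inv_def] U(1,2)]) (use U(4) in auto)
    also have "(\<Prod>i<n. 1 + exp t * k i) = (\<Prod>i<n. 1 + exp (t + ln (k i)))"
      using U(4) by (intro prod.cong) (auto simp: exp_add)
    also have "ln (exp (s * (\<Sum>i<n. x i)) * (\<Prod>i<n. 1 + exp (t + ln (k i))))
        = s * (\<Sum>i<n. x i) + (\<Sum>i<n. ln (1 + exp (t + ln (k i))))"
      using pos by (subst ln_mult) (auto simp: ln_prod intro!: prod_pos)
    finally show ?thesis .
  qed
  have li: "logdet_int c s = 2 * c * (s * (\<Sum>i<n. x i)) + (\<Sum>i<n. softplus_int c (ln (k i)))" if "0 \<le> c" for c
  proof -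
    have "(\<lambda>t. ln (1 + exp (t + u))) integrable_on {-c..c}" for u
      using pos by (intro integrable_continuous_real continuous_intros) auto
    then show ?thesis
      unfolding logdet_int_def pl softplus_int_def using that
      by (subst integral_add) (auto simp: integral_sum integrable_sum)
  qed
  have ln_det: "ln (det R) - s * (\<Sum>i<n. x i) = (\<Sum>i<n. ln (k i))"
  proof -
    have "det (rel s) = det (half_inv s) * det R * det (half_inv s)"
      using spdD[OF R] det_mult[of "half_inv s * R" n "half_inv s"] det_mult[of "half_inv s" n R]
      unfolding rel_def by (simp add: half_inv_def)
    also have "det (half_inv s) = exp (- (s * (\<Sum>i<n. x i)) / 2)"
      by (simp add: half_inv_def det_mat_diag exp_sum[symmetric] sum_distrib_left sum_divide_distrib sum_negf)
    finally have "det (rel s) = exp (- (s * (\<Sum>i<n. x i))) * det R" by (simp add: mult.commute mult.left_commute flip: exp_add)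
    moreover have "det (rel s) = (\<Prod>i<n. k i)" by (rule det_spectral[OF sd spdD(1)[OF rel_spd]])
    ultimately have "ln (\<Prod>i<n. k i) = - (s * (\<Sum>i<n. x i)) + ln (det R)"
      using det_spd_pos[OF R] by (simp add: ln_mult)
    moreover have "ln (\<Prod>i<n. k i) = (\<Sum>i<n. ln (k i))" using U(4) by (intro ln_prod) auto
    ultimately show ?thesis by simp
  qed
  have "((\<lambda>c. \<Sum>i<n. softplus_int c (ln (k i)) - softplus_int c 0 - c * ln (k i)) \<longlongrightarrow> (\<Sum>i<n. (ln (k i))\<^sup>2 / 2)) at_top"
    by (intro tendsto_sum softplus_int_limit)
  then have lim: "((\<lambda>c. \<Sum>i<n. softplus_int c (ln (k i)) - softplus_int c 0 - c * ln (k i)) \<longlongrightarrow> hsq s) at_top"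
    by (simp add: hsq_spectral[OF sd] sum_divide_distrib)
  show ?thesis
  proof (rule Lim_transform_eventually[OF lim])
    show "\<forall>\<^sub>F c in at_top. (\<Sum>i<n. softplus_int c (ln (k i)) - softplus_int c 0 - c * ln (k i)) = approx c s"
      using eventually_ge_at_top[of "0 :: real"]
    proof eventually_elim
      case (elim c)
      then show ?case unfolding approx_def ln_det by (simp add: li sum_subtractf sum_distrib_left[symmetric])
    qed
  qed
qed

definition slope :: real where
  "slope = (\<Sum>i<n. x i * mat_log R $$ (i, i))"

lemma approx1_limit: "((\<lambda>c. approx1 c 0) \<longlongrightarrow> - slope) at_top"
proof -
  have "half_inv 0 = 1\<^sub>m n" by (simp add: half_inv_def)
  then have r0: "rel 0 = R"
    using left_mult_one_mat[OF spdD(1)[OF R]] right_mult_one_mat[OF spdD(1)[OF R]] by (simp add: rel_def)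
  obtain U k where sd0: "spectral_decomposition (rel 0) U k"
    and U: "U \<in> carrier_mat n n" "transpose_mat U * U = 1\<^sub>m n" "U * transpose_mat U = 1\<^sub>m n"
    "rel 0 = U * mat_diag n k * transpose_mat U" "\<forall>i<n. 0 < k i"
    using rel_decomp[of 0] by blast
  have sd: "spectral_decomposition R U k" using sd0 by (simp only: r0)
  define Y where "Y = transpose_mat U * mat_diag n x * U"
  have Yc: "Y \<in> carrier_mat n n" using U by (simp add: Y_def)
  have tr: "mat_trace (Y * mat_diag n f) = (\<Sum>i<n. Y $$ (i, i) * f i)" for f
    using Yc by (simp add: mat_trace_def mat_diag_mult_right[of _ n n])
  have trY: "mat_trace (Y * mat_diag n f) = (\<Sum>i<n. x i * (U * mat_diag n f * transpose_mat U) $$ (i, i))" for f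
  proof -
    have "mat_trace (Y * mat_diag n f) = mat_trace (transpose_mat U * (mat_diag n x * U * mat_diag n f))"
      using U(1) by (simp add: Y_def mult_assoc_dim)
    also have "\<dots> = mat_trace ((mat_diag n x * U * mat_diag n f) * transpose_mat U)"
      using U(1) by (intro mat_trace_commute[of _ n n]) auto
    also have "(mat_diag n x * U * mat_diag n f) * transpose_mat U = mat_diag n x * (U * mat_diag n f * transpose_mat U)"
      using U(1) by (simp add: mult_assoc_dim)
    also have "mat_trace \<dots> = (\<Sum>i<n. x i * (U * mat_diag n f * transpose_mat U) $$ (i, i))"
    proof -
      define Z where "Z = U * mat_diag n f * transpose_mat U"
      have Z: "Z \<in> carrier_mat n n" using U(1) by (simp add: Z_def)
      then have "mat_trace (mat_diag n x * Z) = (\<Sum>i<n. x i * Z $$ (i, i))"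
        by (simp add: mat_trace_def mat_diag_mult_left[OF Z] del: index_mult_mat(1))
      then show ?thesis by (simp only: Z_def)
    qed
    finally show ?thesis .
  qed
  have sumY: "(\<Sum>i<n. Y $$ (i, i)) = (\<Sum>i<n. x i)"
    using trY[of "\<lambda>_. 1"] tr[of "\<lambda>_. 1"] U by simp
  have slope: "slope = (\<Sum>i<n. Y $$ (i, i) * ln (k i))"
    unfolding slope_def mat_log_def spectral_fun_eq[OF sd spdD(1)[OF R]] using trY tr by simp
  have li1: "approx1 c 0 = (\<Sum>i<n. Y $$ (i, i) * (c - ln (1 + exp c * k i) + ln (1 + exp (- c) * k i)))" if "0 \<le> c" for c
  proof -
    have "pencil_logdet1 n x R (exp t) 0 = (\<Sum>i<n. Y $$ (i, i) * (1 / (1 + exp t * k i)))" for t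
      unfolding Y_def by (rule pencil_logdet1_spectral[OF spdD(1)[OF R] U(4)[unfolded rel_def half_inv_def] U(1,2)]) (use U(5) in auto)
    moreover have "((\<lambda>t. \<Sum>i<n. Y $$ (i, i) * (1 / (1 + exp t * k i))) has_integral
        (\<Sum>i<n. Y $$ (i, i) * (2 * c - ln (1 + exp c * k i) + ln (1 + exp (- c) * k i)))) {-c..c}"
      by (intro has_integral_sum has_integral_mult_right resolvent_weight_integral) (use U(5) that in auto)
    ultimately have "logdet_int1 c 0 = (\<Sum>i<n. Y $$ (i, i) * (2 * c - ln (1 + exp c * k i) + ln (1 + exp (- c) * k i)))"
      by (simp add: logdet_int1_def integral_unique)
    then show ?thesis
      by (simp add: approx1_def sumY[symmetric] sum_distrib_left sum_subtractf[symmetric] algebra_simps)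
  qed
  have lim: "((\<lambda>c. c - ln (1 + exp c * y) + ln (1 + exp (- c) * y)) \<longlongrightarrow> - ln y) at_top" if "0 < y" for y :: real
    using that by real_asymp
  have "((\<lambda>c. \<Sum>i<n. Y $$ (i, i) * (c - ln (1 + exp c * k i) + ln (1 + exp (- c) * k i))) \<longlongrightarrow> (\<Sum>i<n. Y $$ (i, i) * (- ln (k i)))) at_top"
    by (intro tendsto_sum tendsto_mult tendsto_const lim) (use U(5) in auto)
  then have lim2: "((\<lambda>c. \<Sum>i<n. Y $$ (i, i) * (c - ln (1 + exp c * k i) + ln (1 + exp (- c) * k i))) \<longlongrightarrow> - slope) at_top"
    by (simp add: slope sum_negf)
  show ?thesis
    by (rule Lim_transform_eventually[OF lim2]) (use eventually_ge_at_top[of "0 :: real"] in eventually_elim, simp add: li1)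
qed

lemma approx_taylor:
  assumes s: "0 < s"
  shows "\<exists>\<xi>. 0 < \<xi> \<and> \<xi> < s \<and> approx c s = approx c 0 + approx1 c 0 * s + logdet_int2 c \<xi> / 2 * s\<^sup>2"
proof -
  define df where "df m = (if m = 0 then approx c else if m = 1 then approx1 c else logdet_int2 c)" for m :: nat
  have "\<forall>m t. m < 2 \<and> 0 \<le> t \<and> t \<le> s \<longrightarrow> DERIV (df m) t :> df (Suc m) t"
    using approx_deriv approx1_deriv by (auto simp: df_def less_2_cases_iff)
  from Taylor_up[of 2 df "approx c" 0 s 0, OF _ _ this] s
  show ?thesis by (auto simp: df_def numeral_2_eq_2)
qed

theorem hsq_convex: "convex_on UNIV hsq"
proof -
  have cv: "convex_on UNIV (approx c)" for c
    by (rule f''_ge0_imp_convex[of _ _ "approx1 c" "logdet_int2 c"]) (use approx_deriv approx1_deriv logdet_int2_nonneg in auto)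
  show ?thesis
  proof (rule convex_onI)
    fix t a b :: real assume "0 < t" "t < 1"
    then have "approx c ((1 - t) *\<^sub>R a + t *\<^sub>R b) \<le> (1 - t) * approx c a + t * approx c b" for c
      using convex_onD[OF cv, of t a b] by simp
    then show "hsq ((1 - t) *\<^sub>R a + t *\<^sub>R b) \<le> (1 - t) * hsq a + t * hsq b"
      by (intro tendsto_le[OF trivial_limit_at_top_linorder tendsto_add[OF tendsto_mult[OF tendsto_const approx_limit] tendsto_mult[OF tendsto_const approx_limit]] approx_limit])
        auto
  qed simp
qed

theorem hsq_strongly_convex:
  assumes s: "0 < s"
  shows "hsq 0 - s * slope + s\<^sup>2 / 2 * (\<Sum>i<n. (x i)\<^sup>2) \<le> hsq s"
proof -
  let ?X = "\<Sum>i<n. (x i)\<^sup>2"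
  from logdet_int2_lower[of s] obtain b where b: "\<And>c t. 0 \<le> c \<Longrightarrow> t \<in> {0..s} \<Longrightarrow> (1 - 2 * b * exp (- c)) * ?X \<le> logdet_int2 c t"
    by blast
  have "approx c 0 + approx1 c 0 * s + (1 - 2 * b * exp (- c)) * ?X / 2 * s\<^sup>2 \<le> approx c s" if "0 \<le> c" for c
  proof -
    from approx_taylor[OF s, of c] obtain \<xi> where xi: "0 < \<xi>" "\<xi> < s"
      "approx c s = approx c 0 + approx1 c 0 * s + logdet_int2 c \<xi> / 2 * s\<^sup>2" by blast
    then show ?thesis using b[OF that, of \<xi>] by (simp add: mult_right_mono divide_right_mono)
  qed
  then have "\<forall>\<^sub>F c in at_top. approx c 0 + approx1 c 0 * s + (1 - 2 * b * exp (- c)) * ?X / 2 * s\<^sup>2 \<le> approx c s"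
    by (rule eventually_mono[OF eventually_ge_at_top])
  moreover have "((\<lambda>c. approx c 0 + approx1 c 0 * s + (1 - 2 * b * exp (- c)) * ?X / 2 * s\<^sup>2)
     \<longlongrightarrow> hsq 0 + (- slope) * s + (1 - 0) * ?X / 2 * s\<^sup>2) at_top"
    by (intro tendsto_intros approx_limit approx1_limit tendsto_exp_minus) auto
  ultimately have "hsq 0 + (- slope) * s + (1 - 0) * ?X / 2 * s\<^sup>2 \<le> hsq s"
    by (intro tendsto_le[OF trivial_limit_at_top_linorder approx_limit])
  then show ?thesis by (simp add: algebra_simps)
qed

theorem hsq_smooth:
  assumes s: "0 < s" and m: "\<And>t. 0 \<le> t \<Longrightarrow> t \<le> s \<Longrightarrow> hsq t \<le> m"
  shows "hsq s \<le> hsq 0 - s * slope + s\<^sup>2 / 2 * (psi (sqrt m) * (\<Sum>i<n. (x i)\<^sup>2))"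
proof -
  let ?X = "\<Sum>i<n. (x i)\<^sup>2"
  have "approx c s \<le> approx c 0 + approx1 c 0 * s + psi (sqrt m) * ?X / 2 * s\<^sup>2" if "0 \<le> c" for c
  proof -
    from approx_taylor[OF s, of c] obtain \<xi> where xi: "0 < \<xi>" "\<xi> < s"
      "approx c s = approx c 0 + approx1 c 0 * s + logdet_int2 c \<xi> / 2 * s\<^sup>2" by blast
    have "psi (sqrt (hsq \<xi>)) \<le> psi (sqrt m)"
      using m[of \<xi>] xi by (intro psi_mono) (auto simp: hsq_def)
    then have "logdet_int2 c \<xi> \<le> psi (sqrt m) * ?X"
      using logdet_int2_upper[OF that, of \<xi>] mult_right_mono[of "psi (sqrt (hsq \<xi>))" "psi (sqrt m)" ?X] by (fastforce intro: sum_nonneg)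
    then show ?thesis using xi(3) by (simp add: mult_right_mono divide_right_mono)
  qed
  then have "\<forall>\<^sub>F c in at_top. approx c s \<le> approx c 0 + approx1 c 0 * s + psi (sqrt m) * ?X / 2 * s\<^sup>2"
    by (rule eventually_mono[OF eventually_ge_at_top])
  moreover have "((\<lambda>c. approx c 0 + approx1 c 0 * s + psi (sqrt m) * ?X / 2 * s\<^sup>2)
     \<longlongrightarrow> hsq 0 + (- slope) * s + psi (sqrt m) * ?X / 2 * s\<^sup>2) at_top"
    by (intro tendsto_intros approx_limit approx1_limit)
  ultimately have "hsq s \<le> hsq 0 + (- slope) * s + psi (sqrt m) * ?X / 2 * s\<^sup>2"
    by (intro tendsto_le[OF trivial_limit_at_top_linorder _ approx_limit])
  then show ?thesis by (simp add: algebra_simps)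
qed

end

section \<open>Geodesics of positive definite matrices\<close>

lemma smult_one_mat [simp]: "1 \<cdot>\<^sub>m A = (A :: real mat)"
  by (rule eq_matI) auto

lemma spectral_decomposition_smult:
  assumes "spectral_decomposition S X ev" "S \<in> carrier_mat n n"
  shows "spectral_decomposition (c \<cdot>\<^sub>m S) X (\<lambda>i. c * ev i)"
proof -
  note X = spectral_decompositionD[OF assms]
  show ?thesis
    by (rule spectral_decompositionI[OF X(1,2)])
      (use X(1) in \<open>simp add: X(4) smult_dim flip: smult_mat_diag\<close>)
qed

lemma spectral_fun_smult:
  assumes "S \<in> carrier_mat n n" "transpose_mat S = S"
  shows "spectral_fun f (c \<cdot>\<^sub>m S) = spectral_fun (\<lambda>x. f (c * x)) S"
proof -
  from sym_decomp[OF assms] obtain X ev where X: "spectral_decomposition S X ev" by blast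
  show ?thesis
    using spectral_fun_eq[OF spectral_decomposition_smult[OF X assms(1)], where f = f and n = n] spectral_fun_eq[OF X assms(1)] assms
    by simp
qed

lemma smult_spectral_fun:
  assumes "S \<in> carrier_mat n n" "transpose_mat S = S"
  shows "c \<cdot>\<^sub>m spectral_fun f S = spectral_fun (\<lambda>x. c * f x) S"
proof -
  from sym_decomp[OF assms] obtain X ev where X: "spectral_decomposition S X ev" "X \<in> carrier_mat n n" by blast
  show ?thesis
    using X(2) by (simp add: spectral_fun_eq[OF X(1) assms(1)] smult_dim flip: smult_mat_diag)
qed

lemma spectral_fun_orthogonal_conj:
  assumes "S \<in> carrier_mat n n" "transpose_mat S = S"
    and H: "H \<in> carrier_mat n n" "transpose_mat H * H = 1\<^sub>m n"
  shows "spectral_fun f (H * S * transpose_mat H) = H * spectral_fun f S * transpose_mat H"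
proof -
  from sym_decomp[OF assms(1,2)] obtain X ev where X: "spectral_decomposition S X ev" "X \<in> carrier_mat n n" by blast
  show ?thesis
    using spectral_fun_eq[OF spectral_decomposition_orthogonal_conj[OF X(1) assms(1) H], where f = f and n = n]
      spectral_fun_eq[OF X(1) assms(1), of f] X(2) H assms(1) by (simp add: transpose_mult_dim mult_assoc_dim)
qed

lemma spd_smult: "P \<in> spd n \<Longrightarrow> 0 < c \<Longrightarrow> c \<cdot>\<^sub>m P \<in> spd n"
proof -
  assume P: "P \<in> spd n" and c: "0 < c"
  from spd_decomp[OF P] obtain X ev where X: "spectral_decomposition P X ev" "\<forall>i<n. 0 < ev i" by blast
  show "c \<cdot>\<^sub>m P \<in> spd n"
    by (rule spdI_decomposition[OF spectral_decomposition_smult[OF X(1) spdD(1)[OF P]]]) (use X c spdD[OF P] in auto)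
qed

definition geodesic :: "real mat \<Rightarrow> real mat \<Rightarrow> real \<Rightarrow> real mat" where
  "geodesic P W s = mat_sqrt P * mat_exp (s \<cdot>\<^sub>m W) * mat_sqrt P"

lemma geodesic_spd:
  assumes "P \<in> spd n" "W \<in> carrier_mat n n" "transpose_mat W = W"
  shows "geodesic P W s \<in> spd n"
proof -
  note Q = mat_sqrt_isqrt[OF assms(1)]
  have "transpose_mat (s \<cdot>\<^sub>m W) = s \<cdot>\<^sub>m transpose_mat W" by (rule eq_matI) auto
  then have "mat_exp (s \<cdot>\<^sub>m W) \<in> spd n"
    unfolding mat_exp_def by (intro spectral_fun_spd) (use assms in auto)
  from spd_congruence_invertible[OF this _ _ Q(5)] show ?thesis
    using spdD[OF Q(1)] spdD[OF Q(2)] by (simp add: geodesic_def)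
qed

text \<open>A congruence that diagonalises the direction \<open>W\<close> reduces a geodesic to a diagonal one.\<close>

lemma geodesic_diagonalise:
  assumes P: "P \<in> spd n" and R: "R \<in> spd n" and W: "W \<in> carrier_mat n n" "transpose_mat W = W"
  shows "\<exists>w R'. diagonal_geodesic n R' \<and>
    (\<forall>s. (d_AI (geodesic P W s) R)\<^sup>2 / 2 = diagonal_geodesic.hsq n w R' s) \<and>
    diagonal_geodesic.slope n w R' = frob W (rel_log P R) \<and> (\<Sum>i<n. (w i)\<^sup>2) = frob W W"
proof -
  note Q = mat_sqrt_isqrt[OF P]
  note S = spdD[OF Q(1)] and Si = spdD[OF Q(2)]
  from sym_decomp[OF W] obtain V w where sd: "spectral_decomposition W V w" and V: "V \<in> carrier_mat n n"
    "transpose_mat V * V = 1\<^sub>m n" "V * transpose_mat V = 1\<^sub>m n" "W = V * mat_diag n w * transpose_mat V" by blast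
  define H where "H = transpose_mat V * mat_isqrt P"
  define Hi where "Hi = mat_sqrt P * V"
  have H: "H \<in> carrier_mat n n" "Hi \<in> carrier_mat n n" using V S Si by (auto simp: H_def Hi_def)
  have HH: "H * Hi = 1\<^sub>m n"
    using V S Si by (simp add: H_def Hi_def mult_assoc_dim mult_cancel_left[OF Q(4)])
  define R' where "R' = H * R * transpose_mat H"
  have R': "R' \<in> spd n" unfolding R'_def by (rule spd_congruence_invertible[OF R H HH])
  interpret dg: diagonal_geodesic n w R' by unfold_locales (rule R')
  have geo: "(d_AI (geodesic P W s) R)\<^sup>2 / 2 = dg.hsq s" for s
  proof -
    have e: "mat_exp (s \<cdot>\<^sub>m W) = V * mat_diag n (\<lambda>i. exp (s * w i)) * transpose_mat V"
      unfolding mat_exp_def using spectral_fun_eq[OF spectral_decomposition_smult[OF sd W(1)], where f = exp and n = n] W by simp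
    have "H * geodesic P W s * transpose_mat H = mat_diag n (\<lambda>i. exp (s * w i))"
      using V(1) S Si unfolding geodesic_def e
      by (simp add: H_def transpose_mult_dim mult_assoc_dim mult_cancel_left[OF Q(4)] mult_cancel_left[OF Q(5)]
          mult_cancel_left[OF V(2)] V(2))
    then show ?thesis
      using d_AI_congruence[OF geodesic_spd[OF P W] R H HH, of s] by (simp add: dg.hsq_def flip: R'_def)
  qed
  have "frob W (rel_log P R) = dg.slope"
  proof -
    define K where "K = mat_isqrt P * R * mat_isqrt P"
    have K: "K \<in> carrier_mat n n" "transpose_mat K = K" using spdD[OF rel_log_sym(1)[OF P R]] by (auto simp: K_def)
    have "R' = transpose_mat V * K * transpose_mat (transpose_mat V)"
      using V Si spdD[OF R] by (simp add: R'_def H_def K_def transpose_mult_dim mult_assoc_dim)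
    then have "mat_log R' = transpose_mat V * rel_log P R * transpose_mat (transpose_mat V)"
      unfolding mat_log_def rel_log_def using spectral_fun_orthogonal_conj[OF K, of "transpose_mat V" ln] V
      by (simp add: K_def)
    moreover have "mat_diag n w = transpose_mat V * W * transpose_mat (transpose_mat V)"
      using V(1) by (simp add: V(4) mult_assoc_dim mult_cancel_left[OF V(2)] V(2))
    ultimately have "frob (mat_diag n w) (mat_log R') = frob W (rel_log P R)"
      using frob_orthogonal_conj[OF W(1) rel_log_carrier[OF P R], of "transpose_mat V"] V by simp
    moreover have "frob (mat_diag n w) Z = (\<Sum>i<n. w i * Z $$ (i, i))" for Z
    proof -
      have "frob (mat_diag n w) Z = (\<Sum>i<n. \<Sum>j<n. if i = j then w j * Z $$ (i, j) else 0)"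
        unfolding frob_def by (intro sum.cong refl) auto
      then show ?thesis by simp
    qed
    ultimately show ?thesis by (simp add: dg.slope_def)
  qed
  then show ?thesis
    using geo frob_spectral[OF sd W(1)] by (intro exI[of _ w] exI[of _ R']) (auto intro: dg.diagonal_geodesic_axioms)
qed

lemma geodesic_0: "P \<in> spd n \<Longrightarrow> W \<in> carrier_mat n n \<Longrightarrow> geodesic P W 0 = P"
proof -
  assume P: "P \<in> spd n" and W: "W \<in> carrier_mat n n"
  have "0 \<cdot>\<^sub>m W = 0 \<cdot>\<^sub>m 1\<^sub>m n" by (rule eq_matI) (use W in auto)
  then have "mat_exp (0 \<cdot>\<^sub>m W) = 1\<^sub>m n" by (simp add: mat_exp_def spectral_fun_scalar)
  then show "geodesic P W 0 = P"
    using mat_sqrt_isqrt(3)[OF P] spdD(1)[OF mat_sqrt_isqrt(1)[OF P]] by (simp add: geodesic_def)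
qed

text \<open>The squared distance is strongly convex with modulus one: the space is nonpositively
  curved.\<close>

theorem distance_strongly_convex:
  assumes P: "P \<in> spd n" and R: "R \<in> spd n" and W: "W \<in> carrier_mat n n" "transpose_mat W = W"
  shows "(d_AI P R)\<^sup>2 / 2 - frob W (rel_log P R) + frob W W / 2 \<le> (d_AI (geodesic P W 1) R)\<^sup>2 / 2"
proof -
  from geodesic_diagonalise[OF assms] obtain w R' where dg: "diagonal_geodesic n R'"
    and h: "\<And>s. (d_AI (geodesic P W s) R)\<^sup>2 / 2 = diagonal_geodesic.hsq n w R' s"
      "diagonal_geodesic.slope n w R' = frob W (rel_log P R)" "(\<Sum>i<n. (w i)\<^sup>2) = frob W W" by blast
  interpret dg: diagonal_geodesic n w R' by (rule dg)
  show ?thesis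
    using dg.hsq_strongly_convex[of 1] h(2,3) h(1)[of 1] h(1)[of 0] geodesic_0[OF P W(1)] by simp
qed

text \<open>The smoothness constant \<open>psi (D / sqrt 2)\<close> is valid as long as the distance does not
  exceed \<open>D\<close>. Convexity and the intermediate value theorem exclude that a step of length
  \<open>1 / L\<close> leaves the sublevel set.\<close>

theorem distance_descent:
  assumes P: "P \<in> spd n" and R: "R \<in> spd n" and W: "W \<in> carrier_mat n n" "transpose_mat W = W"
    and L: "psi (d_AI P R / sqrt 2) \<le> L" and grad: "frob W (rel_log P R) = L * frob W W"
  shows "(d_AI (geodesic P W 1) R)\<^sup>2 / 2 \<le> (d_AI P R)\<^sup>2 / 2 - L / 2 * frob W W"
proof -
  from geodesic_diagonalise[OF P R W] obtain w R' where dg: "diagonal_geodesic n R'"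
    and h: "\<And>s. (d_AI (geodesic P W s) R)\<^sup>2 / 2 = diagonal_geodesic.hsq n w R' s"
      "diagonal_geodesic.slope n w R' = frob W (rel_log P R)" "(\<Sum>i<n. (w i)\<^sup>2) = frob W W" by blast
  interpret dg: diagonal_geodesic n w R' by (rule dg)
  define X where "X = frob W W"
  have h0: "dg.hsq 0 = (d_AI P R)\<^sup>2 / 2" using h(1)[of 0] geodesic_0[OF P W(1)] by simp
  have sq: "sqrt (dg.hsq 0) = d_AI P R / sqrt 2" unfolding h0 using d_AI_nonneg by (simp add: real_sqrt_divide)
  have nonneg: "0 \<le> dg.hsq s" for s by (simp add: dg.hsq_def)
  have L1: "1 \<le> L" using psi_ge_1[of "d_AI P R / sqrt 2"] L d_AI_nonneg by fastforce
  have cvx: "dg.hsq t \<le> max (dg.hsq 0) (dg.hsq s)" if "0 \<le> t" "t \<le> s" for s t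
  proof (cases "s = 0")
    case False
    then have t: "t = (1 - t / s) *\<^sub>R 0 + (t / s) *\<^sub>R s" "0 \<le> t / s" "t / s \<le> 1" using that by auto
    have "dg.hsq t \<le> (1 - t / s) * dg.hsq 0 + t / s * dg.hsq s"
      using convex_onD[OF dg.hsq_convex t(2,3), of 0 s] t(1) by simp
    also have "\<dots> \<le> (1 - t / s) * max (dg.hsq 0) (dg.hsq s) + t / s * max (dg.hsq 0) (dg.hsq s)"
      using t by (intro add_mono mult_left_mono) auto
    also have "\<dots> = max (dg.hsq 0) (dg.hsq s)" by (simp add: algebra_simps)
    finally show ?thesis .
  qed (use that in auto)
  have step: "dg.hsq s \<le> dg.hsq 0 - s * L * X + s\<^sup>2 / 2 * (L * X)" if "0 < s" "dg.hsq s \<le> dg.hsq 0" for s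
  proof -
    have "dg.hsq s \<le> dg.hsq 0 - s * dg.slope + s\<^sup>2 / 2 * (psi (sqrt (dg.hsq 0)) * (\<Sum>i<n. (w i)\<^sup>2))"
      by (rule dg.hsq_smooth[OF that(1)]) (use cvx that in fastforce)
    also have "\<dots> \<le> dg.hsq 0 - s * L * X + s\<^sup>2 / 2 * (L * X)"
      unfolding h(2,3) grad sq X_def[symmetric]
      using mult_left_mono[OF mult_right_mono[OF L, of X], of "s\<^sup>2 / 2"] frob_nonneg[of W] by (simp add: X_def algebra_simps)
    finally show ?thesis .
  qed
  have le: "dg.hsq 1 \<le> dg.hsq 0"
  proof (cases "X = 0")
    case True
    have "W = 0\<^sub>m n n" using frob_eq_0[OF _ W(1)] True by (simp add: X_def)
    then have "geodesic P W 1 = geodesic P W 0" by (simp add: geodesic_def)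
    then show ?thesis using h(1)[of 1] h(1)[of 0] by simp
  next
    case False
    then have X: "0 < X" using frob_nonneg[of W] by (simp add: X_def)
    show ?thesis
    proof (rule ccontr)
      assume "\<not> dg.hsq 1 \<le> dg.hsq 0"
      then have gt: "dg.hsq 0 < dg.hsq 1" by simp
      define L' where "L' = psi (sqrt (dg.hsq 1))"
      have L': "1 \<le> L'" unfolding L'_def by (rule psi_ge_1) (use nonneg in simp)
      define s where "s = min 1 (L / L')"
      have s: "0 < s" "s \<le> 1" "s * L' \<le> L" using L1 L' by (auto simp: s_def min_def field_simps)
      have "dg.hsq s \<le> dg.hsq 0 - s * dg.slope + s\<^sup>2 / 2 * (L' * (\<Sum>i<n. (w i)\<^sup>2))"
        unfolding L'_def by (rule dg.hsq_smooth[OF s(1)]) (use cvx[of _ 1] gt s in fastforce)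
      also have "\<dots> = dg.hsq 0 - s * X * (L - s * L' / 2)"
        unfolding h(2,3) grad X_def[symmetric] by (simp add: algebra_simps power2_eq_square)
      also have "\<dots> < dg.hsq 0"
      proof -
        have "0 < L - s * L' / 2" using s(3) L1 by simp
        then show ?thesis using s X by simp
      qed
      finally have lt: "dg.hsq s < dg.hsq 0" .
      have "continuous_on {s..1} dg.hsq"
        by (rule continuous_on_subset[OF convex_on_continuous[OF open_UNIV dg.hsq_convex]]) simp
      from IVT'[OF less_imp_le[OF lt] less_imp_le[OF gt] s(2) this]
      obtain t where t: "s \<le> t" "t \<le> 1" "dg.hsq t = dg.hsq 0" by blast
      have "dg.hsq t \<le> dg.hsq 0 - t * L * X * (1 - t / 2)"
        using step[of t] t s by (simp add: algebra_simps power2_eq_square)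
      moreover have "0 < t * L * X * (1 - t / 2)" using t s L1 X by (intro mult_pos_pos) auto
      ultimately show False using t(3) by simp
    qed
  qed
  have "dg.hsq 1 \<le> dg.hsq 0 - L / 2 * X" using step[of 1, OF _ le] by simp
  then show ?thesis using h0 h(1)[of 1] by (simp add: X_def)
qed

section \<open>Limits of matrices\<close>

definition mat_tendsto :: "nat \<Rightarrow> nat \<Rightarrow> (nat \<Rightarrow> real mat) \<Rightarrow> real mat \<Rightarrow> bool" where
  "mat_tendsto a b A L \<longleftrightarrow> (\<forall>t. A t \<in> carrier_mat a b) \<and> L \<in> carrier_mat a b \<and>
     (\<forall>i<a. \<forall>j<b. (\<lambda>t. A t $$ (i, j)) \<longlonglongrightarrow> L $$ (i, j))"

lemma mat_tendsto_const: "L \<in> carrier_mat a b \<Longrightarrow> mat_tendsto a b (\<lambda>_. L) L"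
  by (simp add: mat_tendsto_def)

lemma mat_tendsto_mult:
  assumes "mat_tendsto a b A L" "mat_tendsto b c A' L'"
  shows "mat_tendsto a c (\<lambda>t. A t * A' t) (L * L')"
proof -
  have "(\<lambda>t. (A t * A' t) $$ (i, j)) \<longlonglongrightarrow> (L * L') $$ (i, j)" if "i < a" "j < c" for i j
  proof -
    have "(\<lambda>t. \<Sum>k<b. A t $$ (i, k) * A' t $$ (k, j)) \<longlonglongrightarrow> (\<Sum>k<b. L $$ (i, k) * L' $$ (k, j))"
      using assms that by (intro tendsto_sum tendsto_mult) (auto simp: mat_tendsto_def)
    moreover have "(A t * A' t) $$ (i, j) = (\<Sum>k<b. A t $$ (i, k) * A' t $$ (k, j))" for t
    proof -
      have "A t \<in> carrier_mat a b" "A' t \<in> carrier_mat b c" using assms by (auto simp: mat_tendsto_def)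
      then show ?thesis using that by (simp add: scalar_prod_def atLeast0LessThan)
    qed
    moreover have "(L * L') $$ (i, j) = (\<Sum>k<b. L $$ (i, k) * L' $$ (k, j))"
    proof -
      have "L \<in> carrier_mat a b" "L' \<in> carrier_mat b c" using assms by (auto simp: mat_tendsto_def)
      then show ?thesis using that by (simp add: scalar_prod_def atLeast0LessThan)
    qed
    ultimately show ?thesis by simp
  qed
  then show ?thesis using assms unfolding mat_tendsto_def by (auto intro!: mult_carrier_mat)
qed

lemma mat_tendsto_transpose:
  assumes "mat_tendsto a b A L" shows "mat_tendsto b a (\<lambda>t. transpose_mat (A t)) (transpose_mat L)"
proof -
  have c: "A t \<in> carrier_mat a b" "L \<in> carrier_mat a b" for t using assms by (auto simp: mat_tendsto_def)
  have "dim_row (A t) = a \<and> dim_col (A t) = b" "dim_row L = a" "dim_col L = b" for t using c by blast+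
  then show ?thesis using assms c by (simp add: mat_tendsto_def)
qed

lemma mat_tendsto_block_diag:
  assumes "mat_tendsto a b A L" "mat_tendsto c d A' L'"
  shows "mat_tendsto (a + c) (b + d) (\<lambda>t. block_diag (A t) (A' t)) (block_diag L L')"
proof -
  have c: "A t \<in> carrier_mat a b" "L \<in> carrier_mat a b" "A' t \<in> carrier_mat c d" "L' \<in> carrier_mat c d" for t
    using assms by (auto simp: mat_tendsto_def)
  have d: "dim_row (A t) = a \<and> dim_col (A t) = b" "dim_row L = a" "dim_col L = b"
    "dim_row (A' t) = c \<and> dim_col (A' t) = d" "dim_row L' = c" "dim_col L' = d" for t using c by blast+
  have "(\<lambda>t. block_diag (A t) (A' t) $$ (i, j)) \<longlonglongrightarrow> block_diag L L' $$ (i, j)" if "i < a + c" "j < b + d" for i j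
    using assms that by (auto simp: block_diag_index d mat_tendsto_def)
  then show ?thesis using c unfolding mat_tendsto_def by auto
qed

lemma mat_tendsto_diag:
  assumes "\<And>i. i < n \<Longrightarrow> (\<lambda>t. f t i) \<longlonglongrightarrow> g i"
  shows "mat_tendsto n n (\<lambda>t. mat_diag n (f t)) (mat_diag n g)"
  using assms unfolding mat_tendsto_def by auto

lemma mat_tendsto_unique: "mat_tendsto a b A L \<Longrightarrow> mat_tendsto a b A L' \<Longrightarrow> L = L'"
proof (rule eq_matI)
  fix i j assume A: "mat_tendsto a b A L" "mat_tendsto a b A L'" and ij: "i < dim_row L'" "j < dim_col L'"
  then have "(\<lambda>t. A t $$ (i, j)) \<longlonglongrightarrow> L $$ (i, j)" "(\<lambda>t. A t $$ (i, j)) \<longlonglongrightarrow> L' $$ (i, j)"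
    by (auto simp: mat_tendsto_def)
  then show "L $$ (i, j) = L' $$ (i, j)" by (rule LIMSEQ_unique)
qed (auto simp: mat_tendsto_def)

lemma bounded_sequences_convergent_subsequence:
  fixes f :: "'i \<Rightarrow> nat \<Rightarrow> real"
  assumes "finite I" "\<And>i t. i \<in> I \<Longrightarrow> \<bar>f i t\<bar> \<le> b"
  shows "\<exists>r l. strict_mono (r :: nat \<Rightarrow> nat) \<and> (\<forall>i\<in>I. (\<lambda>t. f i (r t)) \<longlonglongrightarrow> l i)"
  using assms
proof (induction I rule: finite_induct)
  case empty
  then show ?case by (auto intro!: exI[of _ id] simp: strict_mono_def)
next
  case (insert a I)
  then obtain r l where r: "strict_mono r" "\<forall>i\<in>I. (\<lambda>t. f i (r t)) \<longlonglongrightarrow> l i" by auto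
  have "bounded (range (\<lambda>t. f a (r t)))"
    using insert.prems by (intro boundedI[of _ b]) auto
  then obtain c r' where r': "strict_mono r'" "((\<lambda>t. f a (r t)) \<circ> r') \<longlonglongrightarrow> c"
    using bounded_imp_convergent_subsequence[of "\<lambda>t. f a (r t)"] by blast
  have "(\<lambda>t. f i (r (r' t))) \<longlonglongrightarrow> (if i = a then c else l i)" if "i \<in> insert a I" for i
  proof (cases "i = a")
    case False
    then have "(\<lambda>t. f i (r t)) \<longlonglongrightarrow> l i" using that r by auto
    from LIMSEQ_subseq_LIMSEQ[OF this r'(1)] show ?thesis using False by (simp add: o_def)
  qed (use r' in \<open>simp add: o_def\<close>)
  moreover have "strict_mono (\<lambda>t. r (r' t))" using r r' by (simp add: strict_mono_def)
  ultimately show ?case by (intro exI[of _ "\<lambda>t. r (r' t)"] exI[of _ "\<lambda>i. if i = a then c else l i"]) auto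
qed

lemma orthogonal_entry_le_1:
  fixes X :: "real mat"
  assumes "X \<in> carrier_mat n n" "transpose_mat X * X = 1\<^sub>m n" "i < n" "j < n"
  shows "\<bar>X $$ (i, j)\<bar> \<le> 1"
proof -
  have "(\<Sum>k<n. X $$ (k, j) * X $$ (k, j)) = (transpose_mat X * X) $$ (j, j)"
    using assms(1,3,4) by (simp add: scalar_prod_def atLeast0LessThan)
  then have "(\<Sum>k<n. X $$ (k, j) * X $$ (k, j)) = 1" using assms by simp
  then have "(X $$ (i, j))\<^sup>2 \<le> 1"
    using member_le_sum[of i "{..<n}" "\<lambda>k. X $$ (k, j) * X $$ (k, j)"] assms(3) by (simp add: power2_eq_square)
  then show ?thesis by (simp add: abs_square_le_1)
qed

section \<open>Minimising the distance over a fibre\<close>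

locale fibre =
  fixes m n :: nat and M :: "real mat" and \<rho> :: real and R0 :: "real mat"
  assumes M: "M \<in> spd m" and rho: "0 < \<rho>" and R0: "R0 \<in> spd (m + n)" and n: "0 < n"
begin

definition point :: "real mat \<Rightarrow> real mat" where
  "point \<Sigma> = block_diag M (\<rho> \<cdot>\<^sub>m \<Sigma>)"

definition obj :: "real mat \<Rightarrow> real" where
  "obj \<Sigma> = (d_AI (point \<Sigma>) R0)\<^sup>2 / 2"

definition grad :: "real mat \<Rightarrow> real mat" where
  "grad \<Sigma> = (let R22 = lower_right m (rel_log (point \<Sigma>) R0) in
     R22 - (mat_trace R22 / real n) \<cdot>\<^sub>m 1\<^sub>m n)"

definition step :: "real \<Rightarrow> real mat \<Rightarrow> real mat" where
  "step L \<Sigma> = mat_sqrt \<Sigma> * mat_exp ((1 / L) \<cdot>\<^sub>m grad \<Sigma>) * mat_sqrt \<Sigma>"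

end

lemma spd_block_diag: "P \<in> spd a \<Longrightarrow> R \<in> spd b \<Longrightarrow> block_diag P R \<in> spd (a + b)"
proof -
  assume P: "P \<in> spd a" and R: "R \<in> spd b"
  from spd_decomp[OF P] obtain X ev where X: "spectral_decomposition P X ev" "\<forall>i<a. 0 < ev i" by blast
  from spd_decomp[OF R] obtain Y ew where Y: "spectral_decomposition R Y ew" "\<forall>i<b. 0 < ew i" by blast
  show "block_diag P R \<in> spd (a + b)"
    by (rule spdI_decomposition[OF spectral_decomposition_block_diag[OF X(1) spdD(1)[OF P] Y(1) spdD(1)[OF R]]])
      (use X Y spdD[OF P] spdD[OF R] in auto)
qed

lemma unit_spdD: "\<Sigma> \<in> unit_spd n \<Longrightarrow> \<Sigma> \<in> spd n" "\<Sigma> \<in> unit_spd n \<Longrightarrow> det \<Sigma> = 1"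
  by (auto simp: unit_spd_def)

lemma mat_sqrt_smult: "\<Sigma> \<in> spd n \<Longrightarrow> 0 < c \<Longrightarrow> mat_sqrt (c \<cdot>\<^sub>m \<Sigma>) = sqrt c \<cdot>\<^sub>m mat_sqrt \<Sigma>"
  using spdD[of \<Sigma> n] by (simp add: mat_sqrt_def spectral_fun_smult smult_spectral_fun real_sqrt_mult)

lemma frob_lower_right:
  assumes "X \<in> carrier_mat n n" "Y \<in> carrier_mat (m + n) (m + n)"
  shows "frob (block_diag (0\<^sub>m m m) X) Y = frob X (lower_right m Y)"
  using assms by (simp add: frob_def sum_split block_diag_index lower_right_def)

lemma rel_log_trace:
  assumes "\<Sigma> \<in> unit_spd n" "\<Sigma>' \<in> unit_spd n"
  shows "mat_trace (rel_log \<Sigma> \<Sigma>') = 0"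
proof -
  note s = unit_spdD[OF assms(1)] and s' = unit_spdD[OF assms(2)]
  note Q = mat_sqrt_isqrt[OF s(1)]
  note S = spdD[OF Q(1)] and Si = spdD[OF Q(2)]
  have "det (mat_sqrt \<Sigma>) * det (mat_sqrt \<Sigma>) = 1"
    using arg_cong[OF Q(3), of det] S s(2) by (simp add: det_mult[of _ n])
  moreover have "det (mat_isqrt \<Sigma>) * det (mat_sqrt \<Sigma>) = 1"
    using arg_cong[OF Q(4), of det] S Si by (simp add: det_mult[of _ n])
  ultimately have "det (mat_isqrt \<Sigma>) * det (mat_isqrt \<Sigma>) = 1"
    by (metis mult.assoc mult.commute mult_1)
  moreover have "det (mat_isqrt \<Sigma> * \<Sigma>' * mat_isqrt \<Sigma>) = det (mat_isqrt \<Sigma>) * det \<Sigma>' * det (mat_isqrt \<Sigma>)"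
    using Si spdD[OF s'(1)] det_mult[of "mat_isqrt \<Sigma> * \<Sigma>'" n "mat_isqrt \<Sigma>"] det_mult[of "mat_isqrt \<Sigma>" n \<Sigma>'] by simp
  ultimately have "det (mat_isqrt \<Sigma> * \<Sigma>' * mat_isqrt \<Sigma>) = 1" using s'(2) by (simp add: mult.commute)
  then show ?thesis
    unfolding rel_log_def mat_trace_log[OF rel_log_sym(1)[OF s(1) s'(1)]] by simp
qed

lemma geodesic_rel_log:
  assumes "P \<in> spd n" "R \<in> spd n" shows "geodesic P (rel_log P R) 1 = R"
proof -
  note Q = mat_sqrt_isqrt[OF assms(1)]
  note S = spdD[OF Q(1)] and Si = spdD[OF Q(2)] and r = spdD[OF assms(2)]
  have "geodesic P (rel_log P R) 1 = mat_sqrt P * (mat_isqrt P * R * mat_isqrt P) * mat_sqrt P"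
    using mat_exp_log[OF rel_log_sym(1)[OF assms]] by (simp add: geodesic_def rel_log_def)
  also have "\<dots> = R" using S Si r by (simp add: mult_assoc_dim mult_cancel_left[OF Q(5)] Q(4))
  finally show ?thesis .
qed

lemma geodesic_unit:
  assumes "\<Sigma> \<in> unit_spd n" "X \<in> carrier_mat n n" "transpose_mat X = X" "mat_trace X = 0"
  shows "geodesic \<Sigma> X 1 \<in> unit_spd n"
proof -
  note s = unit_spdD[OF assms(1)]
  note Q = mat_sqrt_isqrt[OF s(1)]
  note S = spdD[OF Q(1)]
  have e: "mat_exp X \<in> carrier_mat n n" unfolding mat_exp_def by (rule spectral_fun_carrier[OF assms(2,3)])
  have "det (geodesic \<Sigma> X 1) = det (mat_sqrt \<Sigma>) * det (mat_exp X) * det (mat_sqrt \<Sigma>)"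
    using S e det_mult[of "mat_sqrt \<Sigma> * mat_exp X" n "mat_sqrt \<Sigma>"] det_mult[of "mat_sqrt \<Sigma>" n "mat_exp X"]
    by (simp add: geodesic_def)
  also have "\<dots> = det (mat_sqrt \<Sigma> * mat_sqrt \<Sigma>)"
    using det_mat_exp[OF assms(2,3)] assms(4) S by (simp add: det_mult[of _ n])
  also have "\<dots> = 1" using Q(3) s(2) by simp
  finally show ?thesis using geodesic_spd[OF s(1) assms(2,3)] by (simp add: unit_spd_def)
qed

context fibre
begin

lemma point_spd: "\<Sigma> \<in> spd n \<Longrightarrow> point \<Sigma> \<in> spd (m + n)"
  unfolding point_def by (intro spd_block_diag M spd_smult rho)

lemma grad_carrier: "\<Sigma> \<in> spd n \<Longrightarrow> grad \<Sigma> \<in> carrier_mat n n"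
  and grad_transpose: "\<Sigma> \<in> spd n \<Longrightarrow> transpose_mat (grad \<Sigma>) = grad \<Sigma>"
  and grad_trace: "\<Sigma> \<in> spd n \<Longrightarrow> mat_trace (grad \<Sigma>) = 0"
  and frob_grad: "\<Sigma> \<in> spd n \<Longrightarrow> X \<in> carrier_mat n n \<Longrightarrow> mat_trace X = 0 \<Longrightarrow>
     frob (block_diag (0\<^sub>m m m) X) (rel_log (point \<Sigma>) R0) = frob X (grad \<Sigma>)"
proof -
  assume S: "\<Sigma> \<in> spd n"
  note Y = rel_log_carrier[OF point_spd[OF S] R0] rel_log_transpose[OF point_spd[OF S] R0]
  define R22 where "R22 = lower_right m (rel_log (point \<Sigma>) R0)"
  have c: "R22 \<in> carrier_mat n n" using Y by (auto simp: R22_def lower_right_def)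
  have g: "grad \<Sigma> = R22 - (mat_trace R22 / real n) \<cdot>\<^sub>m 1\<^sub>m n" by (simp add: grad_def R22_def Let_def)
  then show gc: "grad \<Sigma> \<in> carrier_mat n n" using c by auto
  have e: "R22 $$ (j, i) = R22 $$ (i, j)" if "i < n" "j < n" for i j
  proof -
    have "transpose_mat (rel_log (point \<Sigma>) R0) $$ (m + i, m + j) = rel_log (point \<Sigma>) R0 $$ (m + i, m + j)" using Y by simp
    then show ?thesis using Y(1) that by (simp add: R22_def lower_right_def)
  qed
  have d: "dim_row R22 = n" "dim_col R22 = n" using c by auto
  show "transpose_mat (grad \<Sigma>) = grad \<Sigma>"
    unfolding g using e by (intro eq_matI) (auto simp: d)
  show "mat_trace (grad \<Sigma>) = 0"
    unfolding g using n by (simp add: mat_trace_def d sum_subtractf)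
  assume X: "X \<in> carrier_mat n n" "mat_trace X = 0"
  have "frob X (grad \<Sigma>) = frob (grad \<Sigma>) X" by (rule frob_commute[OF X(1) gc])
  also have "\<dots> = frob R22 X - mat_trace R22 / real n * frob (1\<^sub>m n) X"
    unfolding g using c by (subst frob_minus_left[of _ n n]) (auto simp: frob_smult_left)
  also have "\<dots> = frob X R22" using frob_one_left[OF X(1)] X(2) frob_commute[OF X(1) c] by simp
  finally show "frob (block_diag (0\<^sub>m m m) X) (rel_log (point \<Sigma>) R0) = frob X (grad \<Sigma>)"
    using frob_lower_right[OF X(1) Y(1)] by (simp add: R22_def)
qed

text \<open>The fibre is totally geodesic.\<close>

lemma point_geodesic:
  assumes S: "\<Sigma> \<in> spd n" and X: "X \<in> carrier_mat n n" "transpose_mat X = X"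
  shows "point (geodesic \<Sigma> X 1) = geodesic (point \<Sigma>) (block_diag (0\<^sub>m m m) X) 1"
proof -
  note Q = mat_sqrt_isqrt[OF M] and Q' = mat_sqrt_isqrt[OF S]
  note q = spdD[OF Q(1)] and q' = spdD[OF Q'(1)]
  note r = spdD[OF spd_smult[OF S rho]]
  have e: "mat_exp X \<in> carrier_mat n n" unfolding mat_exp_def by (rule spectral_fun_carrier[OF X])
  have s: "mat_sqrt (point \<Sigma>) = block_diag (mat_sqrt M) (sqrt \<rho> \<cdot>\<^sub>m mat_sqrt \<Sigma>)"
    unfolding point_def mat_sqrt_def spectral_fun_block_diag[OF spdD[OF M] r]
    unfolding mat_sqrt_def[symmetric] mat_sqrt_smult[OF S rho] ..
  have z: "mat_exp (0\<^sub>m m m) = 1\<^sub>m m"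
  proof -
    have "0\<^sub>m m m = 0 \<cdot>\<^sub>m (1\<^sub>m m :: real mat)" by (rule eq_matI) auto
    then show ?thesis using spectral_fun_scalar[of exp 0 m] by (simp add: mat_exp_def)
  qed
  have "mat_exp (block_diag (0\<^sub>m m m) X) = block_diag (1\<^sub>m m) (mat_exp X)"
    using z unfolding mat_exp_def by (subst spectral_fun_block_diag[OF _ _ X]) auto
  then have "geodesic (point \<Sigma>) (block_diag (0\<^sub>m m m) X) 1
      = block_diag (mat_sqrt M * 1\<^sub>m m * mat_sqrt M) ((sqrt \<rho> \<cdot>\<^sub>m mat_sqrt \<Sigma>) * mat_exp X * (sqrt \<rho> \<cdot>\<^sub>m mat_sqrt \<Sigma>))"
    using q q' e by (simp add: geodesic_def s block_diag_mult)
  also have "(sqrt \<rho> \<cdot>\<^sub>m mat_sqrt \<Sigma>) * mat_exp X * (sqrt \<rho> \<cdot>\<^sub>m mat_sqrt \<Sigma>) = (sqrt \<rho> * sqrt \<rho>) \<cdot>\<^sub>m geodesic \<Sigma> X 1"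
    using q' e by (simp add: geodesic_def smult_dim mult_assoc_dim) (rule eq_matI, auto)
  also have "mat_sqrt M * 1\<^sub>m m * mat_sqrt M = M" using Q(3) q by simp
  finally show ?thesis using rho by (simp add: point_def)
qed

lemma obj_strongly_convex:
  assumes S: "\<Sigma> \<in> unit_spd n" and S': "\<Sigma>' \<in> unit_spd n"
  shows "obj \<Sigma> - frob (rel_log \<Sigma> \<Sigma>') (grad \<Sigma>) + (d_AI \<Sigma> \<Sigma>')\<^sup>2 / 2 \<le> obj \<Sigma>'"
proof -
  note s = unit_spdD(1)[OF S] and s' = unit_spdD(1)[OF S']
  define X where "X = rel_log \<Sigma> \<Sigma>'"
  have X: "X \<in> carrier_mat n n" "transpose_mat X = X" "mat_trace X = 0"
    using rel_log_carrier[OF s s'] rel_log_transpose[OF s s'] rel_log_trace[OF S S'] by (auto simp: X_def)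
  have bt: "transpose_mat (block_diag (0\<^sub>m m m) X) = block_diag (0\<^sub>m m m) X" using X(2) by (simp add: block_diag_transpose)
  have "frob (block_diag (0\<^sub>m m m) X) (block_diag (0\<^sub>m m m) X) = frob X X"
    by (subst frob_block_diag[of _ m _ _ n]) (use X in \<open>auto simp: frob_def\<close>)
  then show ?thesis
    using distance_strongly_convex[OF point_spd[OF s] R0 _ bt] X frob_grad[OF s X(1,3)]
      point_geodesic[OF s X(1,2)] geodesic_rel_log[OF s s']
    by (simp add: obj_def X_def d_AI_sq)
qed

lemma obj_gradient_dominated:
  assumes S: "\<Sigma> \<in> unit_spd n" and S': "\<Sigma>' \<in> unit_spd n"
  shows "obj \<Sigma> - obj \<Sigma>' \<le> frob (grad \<Sigma>) (grad \<Sigma>) / 2"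
proof -
  note s = unit_spdD(1)[OF S] and s' = unit_spdD(1)[OF S']
  define X where "X = rel_log \<Sigma> \<Sigma>'"
  have X: "X \<in> carrier_mat n n" using rel_log_carrier[OF s s'] by (simp add: X_def)
  note G = grad_carrier[OF s]
  have "0 \<le> frob (X - grad \<Sigma>) (X - grad \<Sigma>)" by (rule frob_nonneg)
  also have "\<dots> = frob X (X - grad \<Sigma>) - frob (grad \<Sigma>) (X - grad \<Sigma>)" by (rule frob_minus_left[OF X G])
  also have "frob X (X - grad \<Sigma>) = frob X X - frob X (grad \<Sigma>)"
    using frob_commute[OF X minus_carrier_mat[OF G]] frob_minus_left[OF X G, of X] frob_commute[OF G X] by simp
  also have "frob (grad \<Sigma>) (X - grad \<Sigma>) = frob X (grad \<Sigma>) - frob (grad \<Sigma>) (grad \<Sigma>)"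
    using frob_commute[OF G minus_carrier_mat[OF G]] frob_minus_left[OF X G, of "grad \<Sigma>"] by simp
  finally show ?thesis using obj_strongly_convex[OF S S'] by (simp add: X_def d_AI_sq)
qed

lemma step_unit: "0 < L \<Longrightarrow> \<Sigma> \<in> unit_spd n \<Longrightarrow> step L \<Sigma> \<in> unit_spd n"
proof -
  assume L: "0 < L" and S: "\<Sigma> \<in> unit_spd n"
  note s = unit_spdD(1)[OF S]
  note g = grad_carrier[OF s] grad_transpose[OF s] grad_trace[OF s]
  have "transpose_mat ((1 / L) \<cdot>\<^sub>m grad \<Sigma>) = (1 / L) \<cdot>\<^sub>m transpose_mat (grad \<Sigma>)" by (rule eq_matI) auto
  moreover have "mat_trace ((1 / L) \<cdot>\<^sub>m grad \<Sigma>) = 0"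
    using g by (simp add: mat_trace_def sum_divide_distrib[symmetric])
  ultimately have "geodesic \<Sigma> ((1 / L) \<cdot>\<^sub>m grad \<Sigma>) 1 \<in> unit_spd n"
    by (intro geodesic_unit S) (use g in auto)
  then show "step L \<Sigma> \<in> unit_spd n" by (simp add: step_def geodesic_def)
qed

lemma obj_descent:
  assumes S: "\<Sigma> \<in> unit_spd n" and L: "psi (d_AI (point \<Sigma>) R0 / sqrt 2) \<le> L"
  shows "obj (step L \<Sigma>) \<le> obj \<Sigma> - frob (grad \<Sigma>) (grad \<Sigma>) / (2 * L)"
proof -
  note s = unit_spdD(1)[OF S]
  note g = grad_carrier[OF s] grad_transpose[OF s] grad_trace[OF s]
  have L0: "0 < L" using psi_ge_1[of "d_AI (point \<Sigma>) R0 / sqrt 2"] L d_AI_nonneg by fastforce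
  define X where "X = (1 / L) \<cdot>\<^sub>m grad \<Sigma>"
  have X: "X \<in> carrier_mat n n" using g by (simp add: X_def)
  have "transpose_mat X = (1 / L) \<cdot>\<^sub>m transpose_mat (grad \<Sigma>)" unfolding X_def by (rule eq_matI) auto
  then have Xt: "transpose_mat X = X" using g by (simp add: X_def)
  have "mat_trace X = 0" using g by (simp add: X_def mat_trace_def sum_divide_distrib[symmetric])
  note fg = frob_grad[OF s X this]
  have bt: "transpose_mat (block_diag (0\<^sub>m m m) X) = block_diag (0\<^sub>m m m) X" using Xt by (simp add: block_diag_transpose)
  have XX: "frob (block_diag (0\<^sub>m m m) X) (block_diag (0\<^sub>m m m) X) = frob X X"
    by (subst frob_block_diag[of _ m _ _ n]) (use X in \<open>auto simp: frob_def\<close>)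
  have XG: "frob X (grad \<Sigma>) = frob (grad \<Sigma>) (grad \<Sigma>) / L" by (simp add: X_def frob_smult_left)
  have XX': "frob X X = frob (grad \<Sigma>) (grad \<Sigma>) / L / L"
    using frob_commute[OF X g(1)] XG by (simp add: X_def frob_smult_left)
  have "(d_AI (geodesic (point \<Sigma>) (block_diag (0\<^sub>m m m) X) 1) R0)\<^sup>2 / 2
    \<le> (d_AI (point \<Sigma>) R0)\<^sup>2 / 2 - L / 2 * frob (block_diag (0\<^sub>m m m) X) (block_diag (0\<^sub>m m m) X)"
    by (rule distance_descent[OF point_spd[OF s] R0 _ bt L]) (use X L0 in \<open>auto simp: fg XX XG XX'\<close>)
  moreover have "geodesic (point \<Sigma>) (block_diag (0\<^sub>m m m) X) 1 = point (step L \<Sigma>)"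
    using point_geodesic[OF s X Xt] by (simp add: step_def geodesic_def X_def)
  ultimately show ?thesis using L0 by (simp add: obj_def XX XX' mult.commute)
qed

text \<open>A point of the fibre and its distance to \<open>R0\<close>, written in spectral data. In these
  coordinates bounded sets are relatively compact and all relations are closed.\<close>

definition isqrt_at :: "real mat \<Rightarrow> (nat \<Rightarrow> real) \<Rightarrow> real mat" where
  "isqrt_at X l = block_diag (mat_isqrt M) (X * mat_diag n (\<lambda>i. exp (- l i / 2) / sqrt \<rho>) * transpose_mat X)"

definition spectral_data :: "real mat \<Rightarrow> (nat \<Rightarrow> real) \<Rightarrow> real mat \<Rightarrow> (nat \<Rightarrow> real) \<Rightarrow> bool" where
  "spectral_data X l U u \<longleftrightarrow> X \<in> carrier_mat n n \<and> transpose_mat X * X = 1\<^sub>m n \<and> (\<Sum>i<n. l i) = 0 \<and>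
     U \<in> carrier_mat (m + n) (m + n) \<and> transpose_mat U * U = 1\<^sub>m (m + n) \<and>
     isqrt_at X l * R0 * isqrt_at X l = U * mat_diag (m + n) (\<lambda>i. exp (u i)) * transpose_mat U"

lemma spectral_point:
  fixes X :: "real mat" and l :: "nat \<Rightarrow> real"
  assumes X: "X \<in> carrier_mat n n" "transpose_mat X * X = 1\<^sub>m n"
  defines "\<Sigma> \<equiv> X * mat_diag n (\<lambda>i. exp (l i)) * transpose_mat X"
  shows "\<Sigma> \<in> spd n" "mat_isqrt (point \<Sigma>) = isqrt_at X l" "det \<Sigma> = exp (\<Sum>i<n. l i)"
    "(d_AI (1\<^sub>m n) \<Sigma>)\<^sup>2 = (\<Sum>i<n. (l i)\<^sup>2)"
proof -
  have S: "\<Sigma> \<in> carrier_mat n n" using X by (simp add: \<Sigma>_def)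
  have sd: "spectral_decomposition \<Sigma> X (\<lambda>i. exp (l i))"
    by (rule spectral_decompositionI[OF X]) (simp add: \<Sigma>_def)
  show spd: "\<Sigma> \<in> spd n" by (rule spdI_decomposition[OF sd S]) simp
  have "1 / sqrt (\<rho> * exp y) = exp (- y / 2) / sqrt \<rho>" for y
  proof -
    have "sqrt (exp y) = exp (y / 2)"
      by (rule real_sqrt_unique) (auto simp flip: exp_add simp: power2_eq_square)
    then show ?thesis by (simp add: real_sqrt_mult exp_minus field_simps)
  qed
  then have "mat_isqrt (\<rho> \<cdot>\<^sub>m \<Sigma>) = X * mat_diag n (\<lambda>i. exp (- l i / 2) / sqrt \<rho>) * transpose_mat X"
    unfolding mat_isqrt_def by (simp add: spectral_fun_smult[OF S spdD(2)[OF spd]] spectral_fun_eq[OF sd S])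
  then show "mat_isqrt (point \<Sigma>) = isqrt_at X l"
    using spectral_fun_block_diag[OF spdD[OF M] spdD[OF spd_smult[OF spd rho]]]
    by (simp add: isqrt_at_def point_def mat_isqrt_def)
  show "det \<Sigma> = exp (\<Sum>i<n. l i)" unfolding det_spectral[OF sd S] by (simp add: exp_sum)
  show "(d_AI (1\<^sub>m n) \<Sigma>)\<^sup>2 = (\<Sum>i<n. (l i)\<^sup>2)"
    by (rule d_AI_diagonalisation[OF spd_one spd, of "transpose_mat X"])
      (use X in \<open>auto simp: \<Sigma>_def mult_assoc_dim mult_cancel_left[OF X(2)]\<close>)
qed

lemma spectral_data_obj:
  assumes "spectral_data X l U u"
  defines "\<Sigma> \<equiv> X * mat_diag n (\<lambda>i. exp (l i)) * transpose_mat X"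
  shows "\<Sigma> \<in> unit_spd n" "obj \<Sigma> = (\<Sum>i<m + n. (u i)\<^sup>2) / 2"
proof -
  have d: "X \<in> carrier_mat n n" "transpose_mat X * X = 1\<^sub>m n" "(\<Sum>i<n. l i) = 0"
    "U \<in> carrier_mat (m + n) (m + n)" "transpose_mat U * U = 1\<^sub>m (m + n)"
    "isqrt_at X l * R0 * isqrt_at X l = U * mat_diag (m + n) (\<lambda>i. exp (u i)) * transpose_mat U"
    using assms(1) by (auto simp: spectral_data_def)
  note p = spectral_point[OF d(1,2), of l, folded \<Sigma>_def]
  show "\<Sigma> \<in> unit_spd n" using p d(3) by (simp add: unit_spd_def)
  define K where "K = mat_isqrt (point \<Sigma>) * R0 * mat_isqrt (point \<Sigma>)"
  have K: "K \<in> spd (m + n)" unfolding K_def by (rule rel_log_sym(1)[OF point_spd[OF p(1)] R0])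
  have sd: "spectral_decomposition K U (\<lambda>i. exp (u i))"
    by (rule spectral_decompositionI[OF d(4,5)]) (simp add: K_def p(2) d(6))
  show "obj \<Sigma> = (\<Sum>i<m + n. (u i)\<^sup>2) / 2"
    using frob_spectral[OF spectral_fun_decomposition[OF sd spdD(1)[OF K], of ln] spectral_fun_carrier[OF spdD[OF K]]]
    by (simp add: obj_def d_AI_sq rel_log_def mat_log_def K_def)
qed

lemma spectral_data_exists:
  assumes S: "\<Sigma> \<in> unit_spd n"
  shows "\<exists>X l U u. spectral_data X l U u \<and> \<Sigma> = X * mat_diag n (\<lambda>i. exp (l i)) * transpose_mat X"
proof -
  note s = unit_spdD[OF S]
  from spd_decomp[OF s(1)] obtain X e where X: "X \<in> carrier_mat n n" "transpose_mat X * X = 1\<^sub>m n"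
    "\<Sigma> = X * mat_diag n e * transpose_mat X" "\<forall>i<n. 0 < e i" by blast
  have "mat_diag n e = mat_diag n (\<lambda>i. exp (ln (e i)))" using X(4) by (intro mat_diag_cong) auto
  then have Se: "\<Sigma> = X * mat_diag n (\<lambda>i. exp (ln (e i))) * transpose_mat X" using X(3) by simp
  note p = spectral_point[OF X(1,2), of "\<lambda>i. ln (e i)", folded Se]
  have "(\<Sum>i<n. ln (e i)) = 0" using p(3) s(2) by simp
  moreover from spd_decomp[OF rel_log_sym(1)[OF point_spd[OF s(1)] R0]] obtain U k
    where U: "U \<in> carrier_mat (m + n) (m + n)" "transpose_mat U * U = 1\<^sub>m (m + n)"
      "mat_isqrt (point \<Sigma>) * R0 * mat_isqrt (point \<Sigma>) = U * mat_diag (m + n) k * transpose_mat U" "\<forall>i<m + n. 0 < k i"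
    by blast
  have "mat_diag (m + n) k = mat_diag (m + n) (\<lambda>i. exp (ln (k i)))" using U(4) by (intro mat_diag_cong) auto
  then have "isqrt_at X (\<lambda>i. ln (e i)) * R0 * isqrt_at X (\<lambda>i. ln (e i))
      = U * mat_diag (m + n) (\<lambda>i. exp (ln (k i))) * transpose_mat U" using U(3) p(2) by simp
  ultimately have "spectral_data X (\<lambda>i. ln (e i)) U (\<lambda>i. ln (k i))" using X U by (simp add: spectral_data_def)
  then show ?thesis using Se by (intro exI conjI)
qed

lemma spectral_data_closed:
  assumes d: "\<And>t. spectral_data (X t) (l t) (U t) (u t)"
    and X: "mat_tendsto n n X X'" and U: "mat_tendsto (m + n) (m + n) U U'"
    and l: "\<And>i. i < n \<Longrightarrow> (\<lambda>t. l t i) \<longlonglongrightarrow> l' i" and u: "\<And>i. i < m + n \<Longrightarrow> (\<lambda>t. u t i) \<longlonglongrightarrow> u' i"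
  shows "spectral_data X' l' U' u'"
  unfolding spectral_data_def
proof (intro conjI)
  show "X' \<in> carrier_mat n n" "U' \<in> carrier_mat (m + n) (m + n)" using X U by (auto simp: mat_tendsto_def)
  show "transpose_mat X' * X' = 1\<^sub>m n"
    by (rule mat_tendsto_unique[OF mat_tendsto_mult[OF mat_tendsto_transpose[OF X] X]])
      (use d in \<open>simp add: spectral_data_def mat_tendsto_const\<close>)
  show "transpose_mat U' * U' = 1\<^sub>m (m + n)"
    by (rule mat_tendsto_unique[OF mat_tendsto_mult[OF mat_tendsto_transpose[OF U] U]])
      (use d in \<open>simp add: spectral_data_def mat_tendsto_const\<close>)
  have "(\<lambda>t. \<Sum>i<n. l t i) \<longlonglongrightarrow> (\<Sum>i<n. l' i)" by (intro tendsto_sum l) auto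
  moreover have "(\<lambda>t. \<Sum>i<n. l t i) = (\<lambda>t. 0)" using d by (simp add: spectral_data_def)
  ultimately show "(\<Sum>i<n. l' i) = 0" by (simp add: LIMSEQ_const_iff)
  have "(\<lambda>t. exp (- l t i / 2) / sqrt \<rho>) \<longlonglongrightarrow> exp (- l' i / 2) / sqrt \<rho>" if "i < n" for i
    by (intro tendsto_intros l that) (use rho in auto)
  then have "mat_tendsto n n (\<lambda>t. X t * mat_diag n (\<lambda>i. exp (- l t i / 2) / sqrt \<rho>) * transpose_mat (X t))
      (X' * mat_diag n (\<lambda>i. exp (- l' i / 2) / sqrt \<rho>) * transpose_mat X')"
    by (intro mat_tendsto_mult[where b = n] X mat_tendsto_transpose mat_tendsto_diag)
  then have i: "mat_tendsto (m + n) (m + n) (\<lambda>t. isqrt_at (X t) (l t)) (isqrt_at X' l')"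
    unfolding isqrt_at_def
    by (intro mat_tendsto_block_diag mat_tendsto_const) (use spdD[OF mat_sqrt_isqrt(2)[OF M]] in auto)
  have R0c: "mat_tendsto (m + n) (m + n) (\<lambda>t. R0) R0" by (rule mat_tendsto_const[OF spdD(1)[OF R0]])
  have e: "(\<lambda>t. exp (u t i)) \<longlonglongrightarrow> exp (u' i)" if "i < m + n" for i by (intro tendsto_exp u that)
  have rhs: "mat_tendsto (m + n) (m + n) (\<lambda>t. U t * mat_diag (m + n) (\<lambda>i. exp (u t i)) * transpose_mat (U t))
      (U' * mat_diag (m + n) (\<lambda>i. exp (u' i)) * transpose_mat U')"
    by (intro mat_tendsto_mult[where b = "m + n"] U mat_tendsto_transpose mat_tendsto_diag e)
  have lhs: "mat_tendsto (m + n) (m + n) (\<lambda>t. isqrt_at (X t) (l t) * R0 * isqrt_at (X t) (l t)) (isqrt_at X' l' * R0 * isqrt_at X' l')"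
    by (intro mat_tendsto_mult[where b = "m + n"] i R0c)
  have eq: "(\<lambda>t. isqrt_at (X t) (l t) * R0 * isqrt_at (X t) (l t)) = (\<lambda>t. U t * mat_diag (m + n) (\<lambda>i. exp (u t i)) * transpose_mat (U t))"
    using d by (simp add: spectral_data_def)
  show "isqrt_at X' l' * R0 * isqrt_at X' l' = U' * mat_diag (m + n) (\<lambda>i. exp (u' i)) * transpose_mat U'"
    by (rule mat_tendsto_unique[OF lhs[unfolded eq] rhs])
qed

lemma one_unit_spd: "1\<^sub>m n \<in> unit_spd n"
  by (simp add: unit_spd_def)

lemma obj_coercive:
  "\<exists>b. \<forall>\<Sigma>\<in>unit_spd n. obj \<Sigma> \<le> c \<longrightarrow> d_AI (1\<^sub>m n) \<Sigma> \<le> b"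
proof -
  define g where "g = frob_norm (grad (1\<^sub>m n))"
  have "d_AI (1\<^sub>m n) \<Sigma> \<le> 2 * g + 2 * \<bar>c\<bar> + 2" if S: "\<Sigma> \<in> unit_spd n" and le: "obj \<Sigma> \<le> c" for \<Sigma>
  proof (rule ccontr)
    define d where "d = d_AI (1\<^sub>m n) \<Sigma>"
    assume "\<not> ?thesis"
    then have big: "2 * g + 2 * \<bar>c\<bar> + 2 < d" by (simp add: d_def)
    have g: "0 \<le> g" by (simp add: g_def)
    have "frob (rel_log (1\<^sub>m n) \<Sigma>) (grad (1\<^sub>m n)) \<le> d * g"
      unfolding d_def d_AI_def g_def
      by (rule frob_Cauchy_Schwarz[of _ n n]) (use rel_log_carrier[OF spd_one unit_spdD(1)[OF S]] grad_carrier[OF spd_one] in auto)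
    then have "0 - d * g + d\<^sup>2 / 2 \<le> c"
    proof -
      have "0 \<le> obj (1\<^sub>m n)" by (simp add: obj_def)
      then show ?thesis
        using obj_strongly_convex[OF one_unit_spd S] le \<open>frob (rel_log (1\<^sub>m n) \<Sigma>) (grad (1\<^sub>m n)) \<le> d * g\<close>
        unfolding d_def[symmetric] by linarith
    qed
    moreover have "d * (d / 2 - g) > 1 * \<bar>c\<bar>"
      using big g by (intro mult_strict_mono) auto
    ultimately show False by (simp add: power2_eq_square algebra_simps)
  qed
  then show ?thesis by blast
qed

theorem minimiser_exists: "\<exists>\<Sigma>\<in>unit_spd n. \<forall>\<Sigma>'\<in>unit_spd n. obj \<Sigma> \<le> obj \<Sigma>'"
proof -
  define v where "v = Inf (obj ` unit_spd n)"
  have bdd: "bdd_below (obj ` unit_spd n)" by (intro bdd_belowI2[of _ 0]) (simp add: obj_def)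
  have v: "v \<le> obj \<Sigma>" if "\<Sigma> \<in> unit_spd n" for \<Sigma> unfolding v_def by (intro cInf_lower bdd imageI that)
  have "\<exists>\<Sigma>\<in>unit_spd n. obj \<Sigma> < v + 1 / real (Suc j)" for j
    using cInf_lessD[of "obj ` unit_spd n" "v + 1 / real (Suc j)"] one_unit_spd by (auto simp: v_def)
  then obtain S where S: "\<And>j. S j \<in> unit_spd n" "\<And>j. obj (S j) < v + 1 / real (Suc j)" by metis
  have obj_le: "obj (S j) \<le> v + 1" for j  proof -
    have "1 / real (Suc j) \<le> 1" by simp
    then show ?thesis using S(2)[of j] by linarith
  qed
  with obj_coercive[of "v + 1"] S(1) obtain b where b: "\<And>j. d_AI (1\<^sub>m n) (S j) \<le> b" by blast
  define F :: "real mat \<Rightarrow> (nat \<Rightarrow> real) \<Rightarrow> real mat"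
    where "F X l = X * mat_diag n (\<lambda>i. exp (l i)) * transpose_mat X" for X l
  have "\<exists>X l U u. spectral_data X l U u \<and> S j = F X l" for j
    unfolding F_def by (rule spectral_data_exists[OF S(1)])
  then obtain X l U u where d: "\<And>j. spectral_data (X j) (l j) (U j) (u j)" and F: "\<And>j. S j = F (X j) (l j)" by metis
  note Se = F[unfolded F_def]
  have Xc: "X j \<in> carrier_mat n n" "transpose_mat (X j) * X j = 1\<^sub>m n"
    and Uc: "U j \<in> carrier_mat (m + n) (m + n)" "transpose_mat (U j) * U j = 1\<^sub>m (m + n)" for j
    using d[of j] by (auto simp: spectral_data_def)
  have obj: "obj (S j) = (\<Sum>i<m + n. (u j i)\<^sup>2) / 2" for j unfolding Se by (rule spectral_data_obj(2)[OF d])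
  define c where "c = max 1 (max b (2 * (v + 1)))"
  have c: "1 \<le> c" "b \<le> c" "2 * (v + 1) \<le> c" by (auto simp: c_def)
  have lb: "\<bar>l j i\<bar> \<le> c" if "i < n" for i j
  proof -
    have "(l j i)\<^sup>2 \<le> (\<Sum>i<n. (l j i)\<^sup>2)" using that by (intro member_le_sum[of i _ "\<lambda>i. (l j i)\<^sup>2"]) auto
    also have "\<dots> = (d_AI (1\<^sub>m n) (S j))\<^sup>2" unfolding Se by (rule spectral_point(4)[OF Xc, symmetric])
    finally have "\<bar>l j i\<bar> \<le> d_AI (1\<^sub>m n) (S j)" using d_AI_nonneg by (simp add: abs_le_square_iff[symmetric])
    then show ?thesis using b[of j] c(2) by linarith
  qed
  have ub: "\<bar>u j i\<bar> \<le> c" if "i < m + n" for i j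
  proof -
    have "(u j i)\<^sup>2 \<le> (\<Sum>i<m + n. (u j i)\<^sup>2)" using that by (intro member_le_sum[of i _ "\<lambda>i. (u j i)\<^sup>2"]) auto
    also have "\<dots> \<le> 2 * (v + 1)" using obj[of j] obj_le[of j] by simp
    also have "\<dots> \<le> c" by (rule c(3))
    also have "\<dots> \<le> c * c" using c(1) mult_left_mono[of 1 c c] by simp
    finally have "(u j i)\<^sup>2 \<le> c\<^sup>2" by (simp add: power2_eq_square)
    then show ?thesis using c(1) by (simp add: abs_le_square_iff[symmetric])
  qed
  \<comment> \<open>One subsequence along which all entries of the spectral data converge.\<close>
  define I :: "(nat \<times> nat \<times> nat) set" where "I = {0, 1, 2, 3} \<times> {..<m + n} \<times> {..<m + n}"
  define f where "f = (\<lambda>(p :: nat, i, k) j. if p = 0 then (if i < n \<and> k < n then X j $$ (i, k) else 0)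
     else if p = 1 then (if i < n then l j i else 0) else if p = 2 then U j $$ (i, k) else u j i)"
  have Xb: "\<bar>X j $$ (i, k)\<bar> \<le> c" if "i < n" "k < n" for i k j
    using orthogonal_entry_le_1[OF Xc that] c(1) by (rule order_trans)
  have Ub: "\<bar>U j $$ (i, k)\<bar> \<le> c" if "i < m + n" "k < m + n" for i k j
    using orthogonal_entry_le_1[OF Uc that] c(1) by (rule order_trans)
  have fb: "\<bar>f p j\<bar> \<le> c" if "p \<in> I" for p j
    using that lb[of _ j] ub[of _ j] Xb[of _ _ j] Ub[of _ _ j] c(1) by (auto simp: I_def f_def)
  have "finite I" by (simp add: I_def)
  from bounded_sequences_convergent_subsequence[OF this, of f c, OF fb]
  obtain r w where r: "strict_mono r" and w: "\<And>p. p \<in> I \<Longrightarrow> (\<lambda>j. f p (r j)) \<longlonglongrightarrow> w p" by blast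
  define X' where "X' = mat n n (\<lambda>(i, k). w (0, i, k))"
  define U' where "U' = mat (m + n) (m + n) (\<lambda>(i, k). w (2, i, k))"
  define l' where "l' i = w (1, i, 0)" for i
  define u' where "u' i = w (3, i, 0)" for i
  have "(\<lambda>j. X (r j) $$ (i, k)) \<longlonglongrightarrow> w (0, i, k)" if "i < n" "k < n" for i k
    using w[of "(0, i, k)"] that by (auto simp: I_def f_def)
  then have X': "mat_tendsto n n (\<lambda>j. X (r j)) X'"
    using Xc by (auto simp: mat_tendsto_def X'_def)
  have "(\<lambda>j. U (r j) $$ (i, k)) \<longlonglongrightarrow> w (2, i, k)" if "i < m + n" "k < m + n" for i k
    using w[of "(2, i, k)"] that by (auto simp: I_def f_def)
  then have U': "mat_tendsto (m + n) (m + n) (\<lambda>j. U (r j)) U'"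
    using Uc by (auto simp: mat_tendsto_def U'_def)
  have l': "(\<lambda>j. l (r j) i) \<longlonglongrightarrow> l' i" if "i < n" for i
    using w[of "(1, i, 0)"] that by (auto simp: l'_def I_def f_def)
  have u': "(\<lambda>j. u (r j) i) \<longlonglongrightarrow> u' i" if "i < m + n" for i
    using w[of "(3, i, 0)"] that n by (auto simp: u'_def I_def f_def)
  have d': "spectral_data X' l' U' u'"
    by (rule spectral_data_closed[OF d X' U' l' u'])
  define \<Sigma> where "\<Sigma> = X' * mat_diag n (\<lambda>i. exp (l' i)) * transpose_mat X'"
  note \<Sigma> = spectral_data_obj[OF d', folded \<Sigma>_def]
  have "(\<lambda>j. obj (S (r j))) \<longlonglongrightarrow> obj \<Sigma>"
    unfolding \<Sigma>(2) obj by (intro tendsto_divide tendsto_sum tendsto_power u' tendsto_const) auto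
  moreover have "(\<lambda>j. v + 1 / real (Suc (r j))) \<longlonglongrightarrow> v + 0"
    by (intro tendsto_add tendsto_const LIMSEQ_subseq_LIMSEQ[OF LIMSEQ_inverse_real_of_nat r, unfolded o_def, simplified inverse_eq_divide])
  ultimately have "obj \<Sigma> \<le> v" by (intro LIMSEQ_le[of _ "obj \<Sigma>" _ v]) (use S(2) in \<open>auto intro: less_imp_le\<close>)
  then show ?thesis using \<Sigma>(1) v by (meson order_trans)
qed

definition minimiser :: "real mat \<Rightarrow> bool" where
  "minimiser \<Sigma> \<longleftrightarrow> \<Sigma> \<in> unit_spd n \<and> (\<forall>\<Sigma>'\<in>unit_spd n. obj \<Sigma> \<le> obj \<Sigma>')"

lemma minimiser_growth:
  assumes "minimiser \<Sigma>" and S': "\<Sigma>' \<in> unit_spd n"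
  shows "obj \<Sigma> + (d_AI \<Sigma> \<Sigma>')\<^sup>2 / 2 \<le> obj \<Sigma>'"
proof -
  have S: "\<Sigma> \<in> unit_spd n" and min: "\<And>\<Sigma>'. \<Sigma>' \<in> unit_spd n \<Longrightarrow> obj \<Sigma> \<le> obj \<Sigma>'"
    using assms(1) by (auto simp: minimiser_def)
  note s = unit_spdD(1)[OF S] and s' = unit_spdD(1)[OF S']
  define L where "L = psi (d_AI (point \<Sigma>) R0 / sqrt 2)"
  have L: "1 \<le> L" unfolding L_def by (rule psi_ge_1) (simp add: d_AI_nonneg)
  have "frob (grad \<Sigma>) (grad \<Sigma>) / (2 * L) \<le> 0"
  proof -
    have "obj (step L \<Sigma>) \<le> obj \<Sigma> - frob (grad \<Sigma>) (grad \<Sigma>) / (2 * L)"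
      by (rule obj_descent[OF S]) (simp add: L_def)
    moreover have "obj \<Sigma> \<le> obj (step L \<Sigma>)" by (rule min[OF step_unit[OF _ S]]) (use L in simp)
    ultimately show ?thesis by linarith
  qed
  moreover have "0 < frob (grad \<Sigma>) (grad \<Sigma>) / (2 * L)" if "0 < frob (grad \<Sigma>) (grad \<Sigma>)"
    using that L by (intro divide_pos_pos) auto
  ultimately have "frob (grad \<Sigma>) (grad \<Sigma>) = 0" using frob_nonneg[of "grad \<Sigma>"] by fastforce
  then have "(frob_norm (grad \<Sigma>))\<^sup>2 = 0" by (simp only: frob_norm_sq)
  then have "frob_norm (grad \<Sigma>) = 0" by (rule power_eq_0_iff[THEN iffD1, THEN conjunct1])
  then have "frob (rel_log \<Sigma> \<Sigma>') (grad \<Sigma>) \<le> 0"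
    using frob_Cauchy_Schwarz[OF rel_log_carrier[OF s s'] grad_carrier[OF s]] by simp
  then show ?thesis using obj_strongly_convex[OF S S'] by linarith
qed

lemma minimiser_unique:
  assumes "minimiser \<Sigma>" "\<Sigma>' \<in> unit_spd n" "obj \<Sigma>' \<le> obj \<Sigma>"
  shows "\<Sigma>' = \<Sigma>"
proof -
  have "(d_AI \<Sigma> \<Sigma>')\<^sup>2 \<le> 0" using minimiser_growth[OF assms(1,2)] assms(3) by linarith
  then have "d_AI \<Sigma> \<Sigma>' = 0" by simp
  then show ?thesis
    using d_AI_eq_0[OF unit_spdD(1) unit_spdD(1)[OF assms(2)], of \<Sigma>] assms(1) by (simp add: minimiser_def)
qed

text \<open>Adding the strong convexity inequalities at a point and at the minimiser bounds the
  distance between them by the norm of the gradient.\<close>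

theorem distance_le_grad:
  assumes min: "minimiser \<Sigma>'" and S: "\<Sigma> \<in> unit_spd n"
  shows "d_AI \<Sigma> \<Sigma>' \<le> frob_norm (grad \<Sigma>)"
proof -
  have S': "\<Sigma>' \<in> unit_spd n" using min by (simp add: minimiser_def)
  note s = unit_spdD(1)[OF S] and s' = unit_spdD(1)[OF S']
  define d where "d = d_AI \<Sigma> \<Sigma>'"
  have "d\<^sup>2 \<le> frob (rel_log \<Sigma> \<Sigma>') (grad \<Sigma>)"
    using minimiser_growth[OF min S] obj_strongly_convex[OF S S'] d_AI_commute[OF s s'] by (simp add: d_def)
  also have "\<dots> \<le> d * frob_norm (grad \<Sigma>)"
    unfolding d_def d_AI_def by (rule frob_Cauchy_Schwarz[OF rel_log_carrier[OF s s'] grad_carrier[OF s]])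
  finally have "d * d \<le> d * frob_norm (grad \<Sigma>)" by (simp add: power2_eq_square)
  then show ?thesis unfolding d_def[symmetric]
    using d_AI_nonneg[of \<Sigma> \<Sigma>'] frob_norm_nonneg[of "grad \<Sigma>"] by (cases "d = 0") (auto simp: d_def mult_le_cancel_left)
qed

theorem gradient_rate:
  fixes \<Sigma> :: "nat \<Rightarrow> real mat"
  assumes S0: "\<Sigma> 0 \<in> unit_spd n" and L: "L = psi (d_AI (point (\<Sigma> 0)) R0 / sqrt 2)"
    and step: "\<And>k. \<Sigma> (Suc k) = step L (\<Sigma> k)"
  shows "\<Sigma> k \<in> unit_spd n"
    and "(frob_norm (grad (\<Sigma> k)))\<^sup>2 \<le> L * (1 - 1 / L) ^ k * (d_AI (point (\<Sigma> 0)) R0)\<^sup>2"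
proof -
  have L1: "1 \<le> L" unfolding L by (rule psi_ge_1) (simp add: d_AI_nonneg)
  have inv: "\<Sigma> k \<in> unit_spd n \<and> obj (\<Sigma> k) \<le> obj (\<Sigma> 0)" and
    desc: "obj (\<Sigma> (Suc k)) \<le> obj (\<Sigma> k) - frob (grad (\<Sigma> k)) (grad (\<Sigma> k)) / (2 * L)" for k
  proof -
    have D: "obj (\<Sigma> (Suc k)) \<le> obj (\<Sigma> k) - frob (grad (\<Sigma> k)) (grad (\<Sigma> k)) / (2 * L)"
      if "\<Sigma> k \<in> unit_spd n" "obj (\<Sigma> k) \<le> obj (\<Sigma> 0)" for k
    proof -
      have "(d_AI (point (\<Sigma> k)) R0)\<^sup>2 \<le> (d_AI (point (\<Sigma> 0)) R0)\<^sup>2" using that by (simp add: obj_def)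
      then have "d_AI (point (\<Sigma> k)) R0 \<le> d_AI (point (\<Sigma> 0)) R0" using d_AI_nonneg by (rule power2_le_imp_le)
      then have "psi (d_AI (point (\<Sigma> k)) R0 / sqrt 2) \<le> L"
        unfolding L by (intro psi_mono divide_right_mono) (auto simp: d_AI_nonneg)
      then show ?thesis unfolding step by (rule obj_descent[OF that(1)])
    qed
    show I: "\<Sigma> k \<in> unit_spd n \<and> obj (\<Sigma> k) \<le> obj (\<Sigma> 0)" for k
    proof (induction k)
      case (Suc k)
      have "0 \<le> frob (grad (\<Sigma> k)) (grad (\<Sigma> k)) / (2 * L)" using L1 by (simp add: frob_nonneg)
      then show ?case using D[of k] Suc step_unit[of L "\<Sigma> k"] L1 by (auto simp: step)
    qed (simp add: S0)
    show "obj (\<Sigma> (Suc k)) \<le> obj (\<Sigma> k) - frob (grad (\<Sigma> k)) (grad (\<Sigma> k)) / (2 * L)" using D I by blast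
  qed
  show "\<Sigma> k \<in> unit_spd n" using inv by simp
  from minimiser_exists obtain S where S: "S \<in> unit_spd n" "\<And>\<Sigma>'. \<Sigma>' \<in> unit_spd n \<Longrightarrow> obj S \<le> obj \<Sigma>'" by blast
  define gap where "gap k = obj (\<Sigma> k) - obj S" for k
  have gap: "gap (Suc k) \<le> (1 - 1 / L) * gap k" for k
  proof -
    have "gap k / L \<le> (frob (grad (\<Sigma> k)) (grad (\<Sigma> k)) / 2) / L"
      unfolding gap_def using inv L1 by (intro divide_right_mono obj_gradient_dominated S) auto
    moreover have "gap (Suc k) \<le> gap k - frob (grad (\<Sigma> k)) (grad (\<Sigma> k)) / (2 * L)" using desc[of k] by (simp add: gap_def)
    moreover have "(1 - 1 / L) * gap k = gap k - gap k / L" by (simp add: algebra_simps)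
    moreover have "(frob (grad (\<Sigma> k)) (grad (\<Sigma> k)) / 2) / L = frob (grad (\<Sigma> k)) (grad (\<Sigma> k)) / (2 * L)" by simp
    ultimately show ?thesis by linarith
  qed
  have "gap k \<le> (1 - 1 / L) ^ k * gap 0"
  proof (induction k)
    case (Suc k)
    have "gap (Suc k) \<le> (1 - 1 / L) * gap k" by (rule gap)
    also have "\<dots> \<le> (1 - 1 / L) * ((1 - 1 / L) ^ k * gap 0)" using L1 by (intro mult_left_mono Suc) auto
    finally show ?case by simp
  qed simp
  also have "\<dots> \<le> (1 - 1 / L) ^ k * obj (\<Sigma> 0)"
    using L1 by (intro mult_left_mono) (auto simp: gap_def obj_def)
  finally have "gap k \<le> (1 - 1 / L) ^ k * obj (\<Sigma> 0)" .
  moreover have "0 \<le> gap (Suc k)" using S(2) inv by (simp add: gap_def)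
  then have "frob (grad (\<Sigma> k)) (grad (\<Sigma> k)) / (2 * L) \<le> gap k" using desc[of k] by (simp add: gap_def)
  ultimately have "frob (grad (\<Sigma> k)) (grad (\<Sigma> k)) / (2 * L) \<le> (1 - 1 / L) ^ k * obj (\<Sigma> 0)" by linarith
  then have "frob (grad (\<Sigma> k)) (grad (\<Sigma> k)) \<le> (1 - 1 / L) ^ k * obj (\<Sigma> 0) * (2 * L)" using L1 by (simp add: divide_le_eq)
  then show "(frob_norm (grad (\<Sigma> k)))\<^sup>2 \<le> L * (1 - 1 / L) ^ k * (d_AI (point (\<Sigma> 0)) R0)\<^sup>2"
    by (simp add: frob_norm_sq obj_def mult_ac)
qed

end

section \<open>Inverses and adjacent blocks\<close>

lemma minv_eqI:
  assumes C: "C \<in> carrier_mat n n" "D \<in> carrier_mat n n" "C * D = 1\<^sub>m n"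
  shows "minv C = D"
proof -
  note DC = left_inverse_is_right_inverse[OF C]
  have "C \<in> Units (ring_mat TYPE(real) n undefined)"
    using C DC by (auto simp: Units_def ring_mat_def)
  then obtain E where E: "mat_inverse C = Some E"
    using mat_inverse(1)[OF C(1), of undefined] by (cases "mat_inverse C") auto
  from mat_inverse(2)[OF C(1) E] have E': "E * C = 1\<^sub>m n" "E \<in> carrier_mat n n" by auto
  have "E * (C * D) = D" using C E' by (intro mult_cancel_left[OF E'(1)]) auto
  then show ?thesis using C E E' by (simp add: minv_def)
qed

lemma minv_invertible:
  assumes C: "C \<in> carrier_mat n n" and inv: "invertible_mat C"
  shows "minv C \<in> carrier_mat n n" "C * minv C = 1\<^sub>m n" "minv C * C = 1\<^sub>m n"
proof -
  obtain D where D: "C * D = 1\<^sub>m n" "D * C = 1\<^sub>m (dim_row D)"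
    using inv C by (auto simp: invertible_mat_def inverts_mat_def)
  have "D \<in> carrier_mat n n"
    using arg_cong[OF D(1), of dim_col] arg_cong[OF D(2), of dim_col] C by auto
  with D minv_eqI[OF C] left_inverse_is_right_inverse[OF C]
  show "minv C \<in> carrier_mat n n" "C * minv C = 1\<^sub>m n" "minv C * C = 1\<^sub>m n" by auto
qed

lemma invertibleI:
  fixes C D :: "real mat"
  assumes "C \<in> carrier_mat n n" "D \<in> carrier_mat n n" "C * D = 1\<^sub>m n"
  shows "invertible_mat C"
  using assms left_inverse_is_right_inverse[OF assms] by (auto simp: invertible_mat_def inverts_mat_def square_mat.simps)

lemma hcat_dims [simp]:
  "dim_row X = dim_row Y \<Longrightarrow> dim_row (hcat X Y) = dim_row X"
  "dim_col (hcat X Y) = dim_col X + dim_col Y"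
  by (auto simp: hcat_def)

lemma hcat_carrier [simp]: "X \<in> carrier_mat d a \<Longrightarrow> Y \<in> carrier_mat d b \<Longrightarrow> hcat X Y \<in> carrier_mat d (a + b)"
  by (auto simp: hcat_def)

lemma hcat_index:
  "X \<in> carrier_mat d a \<Longrightarrow> Y \<in> carrier_mat d b \<Longrightarrow> i < d \<Longrightarrow> j < a + b \<Longrightarrow>
   hcat X Y $$ (i, j) = (if j < a then X $$ (i, j) else Y $$ (i, j - a))"
  by (auto simp: hcat_def)

lemma hcat_assoc:
  assumes "X \<in> carrier_mat d a" "Y \<in> carrier_mat d b" "Z \<in> carrier_mat d c"
  shows "hcat (hcat X Y) Z = hcat X (hcat Y Z)"
  using assms
  by (intro eq_matI) (auto simp: hcat_index[of _ d "a + b" _ c] hcat_index[of _ d a _ b] hcat_index[of _ d a _ "b + c"]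
      hcat_index[of _ d b _ c] diff_diff_left add.assoc)

lemma hcat_mult_vec:
  assumes X: "X \<in> carrier_mat d a" "Y \<in> carrier_mat d b" and v: "x \<in> carrier_vec a" "y \<in> carrier_vec b"
  shows "hcat X Y *\<^sub>v (x @\<^sub>v y) = X *\<^sub>v x + Y *\<^sub>v y"
proof (rule eq_vecI)
  fix i assume "i < dim_vec (X *\<^sub>v x + Y *\<^sub>v y)"
  then have i: "i < d" using X by simp
  have "(hcat X Y *\<^sub>v (x @\<^sub>v y)) $ i = (\<Sum>k<a + b. hcat X Y $$ (i, k) * (x @\<^sub>v y) $ k)"
    using X v i by (subst index_mult_vec_sum) auto
  also have "\<dots> = (\<Sum>k<a. X $$ (i, k) * x $ k) + (\<Sum>k<b. Y $$ (i, k) * y $ k)"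
    using X v i by (simp add: sum_split hcat_index[of _ d a _ b])
  also have "\<dots> = (X *\<^sub>v x + Y *\<^sub>v y) $ i"
    using X v i by (simp add: index_mult_vec_sum del: index_mult_mat_vec)
  finally show "(hcat X Y *\<^sub>v (x @\<^sub>v y)) $ i = (X *\<^sub>v x + Y *\<^sub>v y) $ i" .
qed (use X in auto)

lemma hcat_outer:
  assumes X: "X \<in> carrier_mat d a" "Y \<in> carrier_mat d b" and P: "P \<in> carrier_mat a a" "R \<in> carrier_mat b b"
  shows "hcat X Y * block_diag P R * transpose_mat (hcat X Y) = X * P * transpose_mat X + Y * R * transpose_mat Y"
proof -
  have m: "hcat X Y * block_diag P R = hcat (X * P) (Y * R)"
  proof (rule eq_matI)
    fix i j assume "i < dim_row (hcat (X * P) (Y * R))" "j < dim_col (hcat (X * P) (Y * R))"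
    then have ij: "i < d" "j < a + b" using X P by auto
    have "(hcat X Y * block_diag P R) $$ (i, j) = (\<Sum>k<a + b. hcat X Y $$ (i, k) * block_diag P R $$ (k, j))"
      using X P ij by (subst index_mult_sum) auto
    also have "\<dots> = (\<Sum>k<a. X $$ (i, k) * block_diag P R $$ (k, j)) + (\<Sum>k<b. Y $$ (i, k) * block_diag P R $$ (a + k, j))"
      using X ij by (simp add: sum_split hcat_index[of _ d a _ b])
    also have "\<dots> = hcat (X * P) (Y * R) $$ (i, j)"
      using X P ij by (auto simp: block_diag_index hcat_index[of _ d a _ b] index_mult_sum simp del: index_mult_mat(1))
    finally show "(hcat X Y * block_diag P R) $$ (i, j) = hcat (X * P) (Y * R) $$ (i, j)" .
  qed (use X P in auto)
  have X': "X * P \<in> carrier_mat d a" "Y * R \<in> carrier_mat d b" using X P by auto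
  show ?thesis unfolding m
  proof (rule eq_matI)
    fix i j assume "i < dim_row (X * P * transpose_mat X + Y * R * transpose_mat Y)"
      "j < dim_col (X * P * transpose_mat X + Y * R * transpose_mat Y)"
    then have ij: "i < d" "j < d" using X P by auto
    have "(hcat (X * P) (Y * R) * transpose_mat (hcat X Y)) $$ (i, j)
        = (\<Sum>k<a + b. hcat (X * P) (Y * R) $$ (i, k) * hcat X Y $$ (j, k))"
      using X P ij by (subst index_mult_sum) auto
    also have "\<dots> = (\<Sum>k<a. (X * P) $$ (i, k) * X $$ (j, k)) + (\<Sum>k<b. (Y * R) $$ (i, k) * Y $$ (j, k))"
      using X X' ij by (simp add: sum_split hcat_index[of _ d a _ b] del: index_mult_mat(1))
    also have "\<dots> = (X * P * transpose_mat X + Y * R * transpose_mat Y) $$ (i, j)"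
    proof -
      have "(X * P * transpose_mat X) $$ (i, j) = (\<Sum>k<a. (X * P) $$ (i, k) * X $$ (j, k))"
        using X P ij by (subst index_mult_sum) auto
      moreover have "(Y * R * transpose_mat Y) $$ (i, j) = (\<Sum>k<b. (Y * R) $$ (i, k) * Y $$ (j, k))"
        using X P ij by (subst index_mult_sum) auto
      ultimately show ?thesis using X P ij by (simp del: index_mult_mat(1) add: index_add_mat)
    qed
    finally show "(hcat (X * P) (Y * R) * transpose_mat (hcat X Y)) $$ (i, j)
      = (X * P * transpose_mat X + Y * R * transpose_mat Y) $$ (i, j)" .
  qed (use X P in auto)
qed

lemma hcat_outer_one:
  assumes X: "X \<in> carrier_mat d a" "Y \<in> carrier_mat d b"
  shows "hcat X Y * transpose_mat (hcat X Y) = X * transpose_mat X + Y * transpose_mat Y"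
  using hcat_outer[OF X, of "1\<^sub>m a" "1\<^sub>m b"] X by simp

lemma hcat_gram:
  assumes X: "X \<in> carrier_mat d a" "Y \<in> carrier_mat d b"
  shows "transpose_mat (hcat X Y) * hcat X Y = four_block_mat (transpose_mat X * X) (transpose_mat X * Y)
     (transpose_mat Y * X) (transpose_mat Y * Y)"
proof -
  have "(\<Sum>k<d. hcat X Y $$ (k, i) * hcat X Y $$ (k, j)) =
     four_block_mat (transpose_mat X * X) (transpose_mat X * Y) (transpose_mat Y * X) (transpose_mat Y * Y) $$ (i, j)"
    if "i < a + b" "j < a + b" for i j
    using X that by (auto simp: hcat_index[of _ d a _ b] scalar_prod_def atLeast0LessThan)
  then show ?thesis
    using X by (intro eq_matI) (auto simp: scalar_prod_def atLeast0LessThan)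
qed

lemma hcat_gram_one_iff:
  assumes X: "X \<in> carrier_mat d a" "Y \<in> carrier_mat d b"
  shows "transpose_mat (hcat X Y) * hcat X Y = 1\<^sub>m (a + b) \<longleftrightarrow>
    transpose_mat X * X = 1\<^sub>m a \<and> transpose_mat X * Y = 0\<^sub>m a b \<and> transpose_mat Y * X = 0\<^sub>m b a \<and> transpose_mat Y * Y = 1\<^sub>m b"
    (is "?G = _ \<longleftrightarrow> ?R")
proof
  assume "?R"
  then show "?G = 1\<^sub>m (a + b)" unfolding hcat_gram[OF X] by auto
next
  assume G: "?G = 1\<^sub>m (a + b)"
  define K where "K = four_block_mat (transpose_mat X * X) (transpose_mat X * Y) (transpose_mat Y * X) (transpose_mat Y * Y)"
  have K: "K = 1\<^sub>m (a + b)" using G unfolding hcat_gram[OF X] K_def .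
  have d: "dim_row X = d" "dim_col X = a" "dim_row Y = d" "dim_col Y = b" using X by auto
  have "(transpose_mat X * X) $$ (i, j) = K $$ (i, j)" if "i < a" "j < a" for i j using that d by (simp add: K_def)
  moreover have "(transpose_mat X * Y) $$ (i, j) = K $$ (i, a + j)" if "i < a" "j < b" for i j using that d by (simp add: K_def)
  moreover have "(transpose_mat Y * X) $$ (i, j) = K $$ (a + i, j)" if "i < b" "j < a" for i j using that d by (simp add: K_def)
  moreover have "(transpose_mat Y * Y) $$ (i, j) = K $$ (a + i, a + j)" if "i < b" "j < b" for i j using that d by (simp add: K_def)
  ultimately show "?R"
    using d unfolding K by (auto intro!: eq_matI simp del: index_mult_mat(1))
qed

lemma hcat_unit_lower:
  assumes X: "X \<in> carrier_mat d a" "Y \<in> carrier_mat d b" and T: "T \<in> carrier_mat b a"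
  shows "hcat X Y * unit_lower T = hcat (X + Y * T) Y"
proof (rule eq_matI)
  fix i j assume "i < dim_row (hcat (X + Y * T) Y)" "j < dim_col (hcat (X + Y * T) Y)"
  then have ij: "i < d" "j < a + b" using X T by auto
  have c: "X + Y * T \<in> carrier_mat d a" using X T by auto
  have "(hcat X Y * unit_lower T) $$ (i, j) = (\<Sum>k<a + b. hcat X Y $$ (i, k) * unit_lower T $$ (k, j))"
    using X T ij by (subst index_mult_sum) (auto simp: unit_lower_def)
  also have "\<dots> = (\<Sum>k<a. X $$ (i, k) * unit_lower T $$ (k, j)) + (\<Sum>k<b. Y $$ (i, k) * unit_lower T $$ (a + k, j))"
    using X ij by (simp add: sum_split hcat_index[of _ d a _ b])
  also have "\<dots> = hcat (X + Y * T) Y $$ (i, j)"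
  proof (cases "j < a")
    case True
    have "(\<Sum>k<a. X $$ (i, k) * unit_lower T $$ (k, j)) = (\<Sum>k<a. if k = j then X $$ (i, j) else 0)"
      using T True by (intro sum.cong) (auto simp: unit_lower_def)
    moreover have "(\<Sum>k<b. Y $$ (i, k) * unit_lower T $$ (a + k, j)) = (Y * T) $$ (i, j)"
      using X T True ij by (subst index_mult_sum) (auto simp: unit_lower_def)
    ultimately show ?thesis using True ij X T by (simp add: hcat_index[OF c X(2)] del: index_mult_mat(1))
  next
    case False
    have "(\<Sum>k<a. X $$ (i, k) * unit_lower T $$ (k, j)) = 0"
      using T False ij by (intro sum.neutral) (auto simp: unit_lower_def)
    moreover have "(\<Sum>k<b. Y $$ (i, k) * unit_lower T $$ (a + k, j)) = (\<Sum>k<b. if k = j - a then Y $$ (i, j - a) else 0)"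
      using T False ij by (intro sum.cong) (auto simp: unit_lower_def)
    ultimately show ?thesis using False ij by (simp add: hcat_index[OF c X(2)])
  qed
  finally show "(hcat X Y * unit_lower T) $$ (i, j) = hcat (X + Y * T) Y $$ (i, j)" .
qed (use X T in \<open>auto simp: unit_lower_def\<close>)

lemma unit_lower_carrier [simp]: "T \<in> carrier_mat b a \<Longrightarrow> unit_lower T \<in> carrier_mat (a + b) (a + b)"
  by (auto simp: unit_lower_def)

lemma unit_lower_inverse:
  assumes T: "T \<in> carrier_mat b a"
  shows "unit_lower T * unit_lower (- T) = 1\<^sub>m (a + b)"
proof -
  have "unit_lower T * unit_lower (- T) = four_block_mat (1\<^sub>m a * 1\<^sub>m a + 0\<^sub>m a b * - T) (1\<^sub>m a * 0\<^sub>m a b + 0\<^sub>m a b * 1\<^sub>m b)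
    (T * 1\<^sub>m a + 1\<^sub>m b * - T) (T * 0\<^sub>m a b + 1\<^sub>m b * 1\<^sub>m b)"
  proof -
    have d: "dim_col T = a" "dim_row T = b" "dim_col (- T) = a" "dim_row (- T) = b" using T by auto
    show ?thesis unfolding unit_lower_def d by (rule mult_four_block_mat) (use T in auto)
  qed
  also have "\<dots> = four_block_mat (1\<^sub>m a) (0\<^sub>m a b) (0\<^sub>m b a) (1\<^sub>m b)"
    using T by (intro cong_four_block_mat) (auto simp: uminus_l_inv_mat)
  finally show ?thesis by simp
qed

lemma minv_unit_lower:
  assumes T: "T \<in> carrier_mat b a"
  shows "minv (unit_lower T) = unit_lower (- T)" "minv (unit_lower T) \<in> carrier_mat (a + b) (a + b)"
    "unit_lower T * minv (unit_lower T) = 1\<^sub>m (a + b)" "minv (unit_lower T) * unit_lower T = 1\<^sub>m (a + b)"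
proof -
  have c: "unit_lower T \<in> carrier_mat (a + b) (a + b)" "unit_lower (- T) \<in> carrier_mat (a + b) (a + b)" using T by auto
  show e: "minv (unit_lower T) = unit_lower (- T)" by (rule minv_eqI[OF c unit_lower_inverse[OF T]])
  show "minv (unit_lower T) \<in> carrier_mat (a + b) (a + b)" "unit_lower T * minv (unit_lower T) = 1\<^sub>m (a + b)"
    "minv (unit_lower T) * unit_lower T = 1\<^sub>m (a + b)"
    unfolding e using c unit_lower_inverse[OF T] left_inverse_is_right_inverse[OF c] by auto
qed

lemma det_unit_lower: "T \<in> carrier_mat b a \<Longrightarrow> det (unit_lower T) = 1"
  using det_four_block_mat_upper_right_zero[of "1\<^sub>m a" a "0\<^sub>m a b" b T "1\<^sub>m b"] by (auto simp: unit_lower_def)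

section \<open>Column spaces and ranks\<close>

lemma span_cols:
  fixes N :: "real mat"
  assumes N: "N \<in> carrier_mat d l"
  shows "LinearCombinations.module.span class_ring (module_vec TYPE(real) d) (set (cols N)) = {N *\<^sub>v x | x. x \<in> carrier_vec l}"
proof -
  interpret vec_space "TYPE(real)" d .
  have c: "set (cols N) \<subseteq> carrier_vec d" using cols_dim[of N] N by auto
  have l: "lincomb_list c (cols N) = N *\<^sub>v vec l c" for c
  proof -
    have "mat_of_cols d (cols N) = N" "length (cols N) = l" using mat_of_cols_cols[of N] N by auto
    moreover have "\<forall>w\<in>set (cols N). dim_vec w = d" using c carrier_vecD by blast
    ultimately show ?thesis using lincomb_list_as_mat_mult[of "cols N" c] by simp
  qed
  have "span (set (cols N)) = {lincomb_list c (cols N) | c. True}"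
    using span_list_as_span[OF c] by (simp add: span_list_def)
  also have "\<dots> = {N *\<^sub>v x | x. x \<in> carrier_vec l}"
  proof -
    have "\<exists>c. x = vec l c" if "x \<in> carrier_vec l" for x :: "real vec"
      using that by (intro exI[of _ "\<lambda>i. x $ i"]) (auto intro!: eq_vecI)
    then show ?thesis unfolding l by fastforce
  qed
  finally show ?thesis .
qed

lemma orthonormal_rank:
  fixes E :: "real mat"
  assumes E: "E \<in> carrier_mat d k" "transpose_mat E * E = 1\<^sub>m k"
  shows "vec_space.rank d E = k"
proof -
  interpret vec_space "TYPE(real)" d .
  have dot: "col E i \<bullet> col E j = (if i = j then 1 else 0)" if "i < k" "j < k" for i j
    using arg_cong[OF E(2), of "\<lambda>M. M $$ (i, j)"] that E(1) by simp
  have dist: "distinct (cols E)"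
    unfolding distinct_conv_nth
  proof (intro allI impI)
    fix i j assume ij: "i < length (cols E)" "j < length (cols E)" "i \<noteq> j"
    show "cols E ! i \<noteq> cols E ! j"
    proof
      assume "cols E ! i = cols E ! j"
      then have "col E i = col E j" using ij by simp
      then show False using dot[of i i] dot[of i j] ij E(1) by simp
    qed
  qed
  have "lin_indpt (set (cols E))"
  proof
    assume "lin_dep (set (cols E))"
    from lin_depE[OF E(1) this dist] obtain v where v: "v \<in> carrier_vec k" "v \<noteq> 0\<^sub>v k" "E *\<^sub>v v = 0\<^sub>v d" by blast
    have "v = (transpose_mat E * E) *\<^sub>v v" using v E by simp
    also have "\<dots> = transpose_mat E *\<^sub>v (E *\<^sub>v v)" using v E by (intro assoc_mult_mat_vec[of _ k d]) auto
    also have "\<dots> = 0\<^sub>v k" unfolding v(3) using E by auto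
    finally show False using v by simp
  qed
  then show ?thesis by (rule lin_indpt_full_rank[OF E(1) dist])
qed

lemma full_rank_injective:
  fixes A :: "real mat"
  assumes A: "A \<in> carrier_mat d k" "vec_space.rank d A = k"
    and v: "v \<in> carrier_vec k" "A *\<^sub>v v = 0\<^sub>v d"
  shows "v = 0\<^sub>v k"
proof (rule ccontr)
  assume ne: "v \<noteq> 0\<^sub>v k"
  interpret vec_space "TYPE(real)" d .
  have dist: "distinct (cols A)"
  proof (rule ccontr)
    assume "\<not> distinct (cols A)"
    then have lt: "card (set (cols A)) < k"
      using card_length[of "cols A"] card_distinct[of "cols A"] A(1) by fastforce
    obtain S where S: "maximal S (\<lambda>T. T \<subseteq> set (cols A) \<and> lin_indpt T)"
      using maximal_exists[of "(\<lambda>T. T \<subseteq> set (cols A) \<and> lin_indpt T)" "card (set (cols A))" "{}"]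
      by (meson List.finite_set card_mono empty_iff empty_subsetI finite_lin_indpt2 rev_finite_subset)
    then have "card S \<le> card (set (cols A))" by (simp add: card_mono maximal_def)
    then show False using rank_card_indpt[OF A(1) S] A(2) lt by simp
  qed
  show False
    using full_rank_lin_indpt[OF A dist] lin_depI[OF A(1) v(1) ne v(2) dist] by simp
qed

lemma gram_spd:
  fixes A :: "real mat"
  assumes "A \<in> carrier_mat d k" "vec_space.rank d A = k"
  shows "transpose_mat A * A \<in> spd k"
  using spd_congruence[OF spd_one[of d] assms(1) full_rank_injective[OF assms]] assms(1) by simp

lemma active_space_range:
  assumes A: "A \<in> carrier_mat d m" and B: "B \<in> carrier_mat d m"
  shows "active_space A B = {A *\<^sub>v x + B *\<^sub>v y | x y. x \<in> carrier_vec m \<and> y \<in> carrier_vec m}"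
    and "active_space A B = LinearCombinations.module.span class_ring (module_vec TYPE(real) d) (set (cols (hcat A B)))"
proof -
  have "cols (hcat A B) = cols A @ cols B"
  proof (rule nth_equalityI)
    show "length (cols (hcat A B)) = length (cols A @ cols B)" by simp
    fix i assume "i < length (cols (hcat A B))"
    then have i: "i < m + m" using A B by simp
    show "cols (hcat A B) ! i = (cols A @ cols B) ! i"
      using A B i by (auto simp: nth_append intro!: eq_vecI simp: hcat_index[of _ d m _ m])
  qed
  then show 1: "active_space A B = LinearCombinations.module.span class_ring (module_vec TYPE(real) d) (set (cols (hcat A B)))"
    using A by (simp add: active_space_def)
  have "{hcat A B *\<^sub>v z | z. z \<in> carrier_vec (m + m)} = {A *\<^sub>v x + B *\<^sub>v y | x y. x \<in> carrier_vec m \<and> y \<in> carrier_vec m}"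
  proof -
    have "\<exists>x y. hcat A B *\<^sub>v z = A *\<^sub>v x + B *\<^sub>v y \<and> x \<in> carrier_vec m \<and> y \<in> carrier_vec m"
      if z: "z \<in> carrier_vec (m + m)" for z
    proof -
      have "z = vec_first z m @\<^sub>v vec_last z m" using z by simp
      then have "hcat A B *\<^sub>v z = A *\<^sub>v vec_first z m + B *\<^sub>v vec_last z m"
        using hcat_mult_vec[OF A B, of "vec_first z m" "vec_last z m"] by simp
      then show ?thesis by (intro exI conjI) auto
    qed
    moreover have "\<exists>z. A *\<^sub>v x + B *\<^sub>v y = hcat A B *\<^sub>v z \<and> z \<in> carrier_vec (m + m)"
      if "x \<in> carrier_vec m" "y \<in> carrier_vec m" for x y
      using hcat_mult_vec[OF A B that] that by (intro exI[of _ "x @\<^sub>v y"]) auto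
    ultimately show ?thesis by blast
  qed
  then show "active_space A B = {A *\<^sub>v x + B *\<^sub>v y | x y. x \<in> carrier_vec m \<and> y \<in> carrier_vec m}"
    unfolding 1 using A B by (subst span_cols[of _ d "m + m"]) auto
qed

lemma dim_r_eq_rank:
  assumes "A \<in> carrier_mat d m" "B \<in> carrier_mat d m"
    and "LinearCombinations.module.span class_ring (module_vec TYPE(real) d) (set (cols E)) = active_space A B"
  shows "dim_r A B = vec_space.rank d E"
proof -
  interpret vec_space "TYPE(real)" d .
  show ?thesis using assms by (simp add: dim_r_def rank_def)
qed

lemma dim_r_le:
  assumes "A \<in> carrier_mat d m" "B \<in> carrier_mat d m"
  shows "dim_r A B \<le> 2 * m"
proof -
  interpret vec_space "TYPE(real)" d .
  show ?thesis
    using dim_r_eq_rank[OF assms active_space_range(2)[OF assms, symmetric]] rank_le_nc[of "hcat A B" "m + m"] assms by simp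
qed

lemma admissibleD:
  assumes "admissible A B"
  defines "d \<equiv> dim_row A" and "m \<equiv> dim_col A"
  shows "1 \<le> m" "m < d" "A \<in> carrier_mat d m" "B \<in> carrier_mat d m" "transpose_mat A * B \<in> spd m"
    "transpose_mat A * A \<in> spd m"
  using assms gram_spd[of A d m] by (auto simp: admissible_def Let_def)

section \<open>Orthonormal bases from eigenvectors\<close>

lemma select_cols_index:
  fixes X y :: "real mat"
  assumes X: "X \<in> carrier_mat d k"
  defines "sel \<equiv> filter (\<lambda>j. y $$ (j, 0) > 0) [0..<k]"
  shows "select_cols X y \<in> carrier_mat d (length sel)"
    and "i < d \<Longrightarrow> j < length sel \<Longrightarrow> select_cols X y $$ (i, j) = X $$ (i, sel ! j)"
proof -
  have l: "concat (map (\<lambda>j. if 0 < y $$ (j, 0) then [col X j] else []) js) = map (col X) (filter (\<lambda>j. 0 < y $$ (j, 0)) js)" for js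
    by (induction js) auto
  have e: "select_cols X y = mat_of_cols d (map (col X) sel)"
    using X l unfolding select_cols_def sel_def by simp
  show "select_cols X y \<in> carrier_mat d (length sel)"
    unfolding e using mat_of_cols_carrier(1)[of d "map (col X) sel"] by simp
  assume ij: "i < d" "j < length sel"
  then have "sel ! j < k" using nth_mem[of j sel] by (auto simp: sel_def)
  then show "select_cols X y $$ (i, j) = X $$ (i, sel ! j)" unfolding e using ij X by (simp add: mat_of_cols_index)
qed

text \<open>The eigenvectors of \<open>Y\<^sup>T Y\<close> with positive eigenvalues, mapped by \<open>Y\<close> and normalised, form
  an orthonormal basis of the column space of \<open>Y\<close>.\<close>

lemma orthonormal_range:
  fixes Y :: "real mat"
  assumes Y: "Y \<in> carrier_mat d k" and sd: "spectral_decomposition (transpose_mat Y * Y) X ev"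
  defines "S \<equiv> select_cols X (mat k 1 (\<lambda>(j, _). ev j))"
  defines "G \<equiv> transpose_mat (Y * S) * (Y * S)"
  defines "V \<equiv> Y * S * mat_isqrt G"
  shows "\<exists>l\<le>k. S \<in> carrier_mat k l \<and> G \<in> spd l \<and> V \<in> carrier_mat d l \<and>
    transpose_mat V * V = 1\<^sub>m l \<and> V * transpose_mat V * Y = Y \<and>
    V = Y * (S * mat_isqrt G) \<and> S * mat_isqrt G \<in> carrier_mat k l"
proof -
  define sel where "sel = filter (\<lambda>j. ev j > 0) [0..<k]"
  define l where "l = length sel"
  have lk: "l \<le> k" unfolding l_def sel_def using length_filter_le[of _ "[0..<k]"] by simp
  have YYc: "transpose_mat Y * Y \<in> carrier_mat k k" using Y by simp
  note X = spectral_decompositionD[OF sd YYc]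
  have seq: "filter (\<lambda>j. mat k 1 (\<lambda>(j, _). ev j) $$ (j, 0) > 0) [0..<k] = sel"
    unfolding sel_def by (rule filter_cong) auto
  note S = select_cols_index[OF X(1), where y = "mat k 1 (\<lambda>(j, _). ev j)", folded S_def, unfolded seq, folded l_def]
  have selm: "sel ! j < k" "ev (sel ! j) > 0" if "j < l" for j
    using nth_mem[of j sel] that by (auto simp: l_def sel_def)
  have dsel: "distinct sel" by (simp add: sel_def)
  have YX: "transpose_mat (Y * X) * (Y * X) = mat_diag k ev"
  proof -
    have "transpose_mat (Y * X) * (Y * X) = transpose_mat X * (transpose_mat Y * Y) * X"
      using Y X(1) by (simp add: transpose_mult_dim mult_assoc_dim)
    also have "\<dots> = mat_diag k ev"
      unfolding X(4) using X(1) by (simp add: mult_assoc_dim mult_cancel_left[OF X(2)] X(2))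
    finally show ?thesis .
  qed
  have YXc: "Y * X \<in> carrier_mat d k" using Y X by simp
  have dotYX: "(\<Sum>t<d. (Y * X) $$ (t, i) * (Y * X) $$ (t, j)) = (if i = j then ev j else 0)" if "i < k" "j < k" for i j
  proof -
    have "(transpose_mat (Y * X) * (Y * X)) $$ (i, j) = (\<Sum>t<d. (Y * X) $$ (t, i) * (Y * X) $$ (t, j))"
      using YXc that by (subst index_mult_sum) auto
    then show ?thesis unfolding YX using that by simp
  qed
  have YS: "(Y * S) $$ (t, j) = (Y * X) $$ (t, sel ! j)" if "t < d" "j < l" for t j
    using Y S X(1) that selm[of j] by (simp add: scalar_prod_def)
  have YSc: "Y * S \<in> carrier_mat d l" using Y S by simp
  have G: "G = mat_diag l (\<lambda>j. ev (sel ! j))"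
  proof (rule eq_matI)
    fix i j assume "i < dim_row (mat_diag l (\<lambda>j. ev (sel ! j)))" "j < dim_col (mat_diag l (\<lambda>j. ev (sel ! j)))"
    then have ij: "i < l" "j < l" by auto
    have "G $$ (i, j) = (\<Sum>t<d. (Y * S) $$ (t, i) * (Y * S) $$ (t, j))"
      unfolding G_def using YSc ij by (subst index_mult_sum) auto
    also have "\<dots> = (if sel ! i = sel ! j then ev (sel ! j) else 0)"
      using dotYX[of "sel ! i" "sel ! j"] selm ij by (simp add: YS del: index_mult_mat(1))
    finally show "G $$ (i, j) = mat_diag l (\<lambda>j. ev (sel ! j)) $$ (i, j)"
      using ij dsel by (simp add: nth_eq_iff_index_eq l_def)
  qed (use YSc in \<open>auto simp: G_def\<close>)
  have Gs: "G \<in> spd l" unfolding G using selm by (intro spd_mat_diag) auto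
  note Q = mat_sqrt_isqrt[OF Gs]
  note q = spdD[OF Q(2)] and q' = spdD[OF Q(1)]
  have V: "V \<in> carrier_mat d l" using YSc q by (simp add: V_def)
  have "transpose_mat V * V = mat_isqrt G * G * mat_isqrt G"
    using YSc q unfolding V_def by (simp add: G_def transpose_mult_dim mult_assoc_dim)
  also have "\<dots> = mat_isqrt G * (mat_sqrt G * mat_sqrt G) * mat_isqrt G" using Q(3) by simp
  also have "\<dots> = 1\<^sub>m l" using q q' by (simp add: mult_assoc_dim mult_cancel_left[OF Q(4)] Q(5))
  finally have VV: "transpose_mat V * V = 1\<^sub>m l" .
  \<comment> \<open>Every column of \<open>Y * X\<close> vanishes or is a column of \<open>Y * S = V * mat_sqrt G\<close>.\<close>
  have YSV: "Y * S = V * mat_sqrt G"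
    using YSc q q' unfolding V_def by (simp add: mult_assoc_dim Q(4))
  have VYS: "V * transpose_mat V * (Y * S) = Y * S"
    unfolding YSV using V q' by (simp add: mult_assoc_dim mult_cancel_left[OF VV])
  have "V * transpose_mat V * (Y * X) = Y * X"
  proof (rule eq_matI)
    fix t i assume "t < dim_row (Y * X)" "i < dim_col (Y * X)"
    then have ti: "t < d" "i < k" using YXc by auto
    have e: "(V * transpose_mat V * Z) $$ (t, i) = (\<Sum>b<d. (V * transpose_mat V) $$ (t, b) * Z $$ (b, i))"
      if "Z \<in> carrier_mat d c" "i < c" for Z c i
      using that ti V by (subst index_mult_sum) auto
    show "(V * transpose_mat V * (Y * X)) $$ (t, i) = (Y * X) $$ (t, i)"
    proof (cases "ev i > 0")
      case True
      then have "i \<in> set sel" using ti by (simp add: sel_def)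
      then obtain j where j: "j < l" "sel ! j = i" by (auto simp: in_set_conv_nth l_def)
      have "(V * transpose_mat V * (Y * X)) $$ (t, i) = (V * transpose_mat V * (Y * S)) $$ (t, j)"
        unfolding e[OF YXc ti(2)] e[OF YSc j(1)] using YS[OF _ j(1)] j(2) by (intro sum.cong) auto
      then show ?thesis unfolding VYS using YS[OF ti(1) j(1)] j(2) by simp
    next
      case False
      have s0: "(\<Sum>b<d. (Y * X) $$ (b, i) * (Y * X) $$ (b, i)) = ev i" using dotYX[of i i] ti by simp
      have "0 \<le> (\<Sum>b<d. (Y * X) $$ (b, i) * (Y * X) $$ (b, i))" by (intro sum_nonneg) simp
      then have z: "(\<Sum>b<d. (Y * X) $$ (b, i) * (Y * X) $$ (b, i)) = 0" using s0 False by linarith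
      have "\<forall>b\<in>{..<d}. (Y * X) $$ (b, i) * (Y * X) $$ (b, i) = 0"
        using z by (subst sum_nonneg_eq_0_iff[symmetric]) (auto simp del: index_mult_mat(1))
      then have "(Y * X) $$ (b, i) = 0" if "b < d" for b using that by (simp del: index_mult_mat(1))
      then show ?thesis unfolding e[OF YXc ti(2)] using ti by (simp del: index_mult_mat(1))
    qed
  qed (use V YXc in auto)
  then have "V * transpose_mat V * (Y * X) * transpose_mat X = Y * X * transpose_mat X" by simp
  then have "V * transpose_mat V * Y = Y" using V Y X(1) by (simp add: mult_assoc_dim X(3))
  moreover have "V = Y * (S * mat_isqrt G)" "S * mat_isqrt G \<in> carrier_mat k l"
    unfolding V_def using Y S(1) q by (auto simp: mult_assoc_dim)
  ultimately show ?thesis using S(1) Gs V VV lk by (intro exI[of _ l] conjI)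
qed

lemma orthonormal_completion:
  fixes E :: "real mat"
  assumes E: "E \<in> carrier_mat d k" "transpose_mat E * E = 1\<^sub>m k"
  shows "\<exists>Z. k \<le> d \<and> Z \<in> carrier_mat d (d - k) \<and> transpose_mat (hcat E Z) * hcat E Z = 1\<^sub>m d"
proof -
  define Y where "Y = 1\<^sub>m d - E * transpose_mat E"
  have Y: "Y \<in> carrier_mat d d" using E by (auto simp: Y_def)
  have "transpose_mat (transpose_mat Y * Y) = transpose_mat Y * Y"
    using Y by (simp add: transpose_mult_dim)
  then obtain X ev where sd: "spectral_decomposition (transpose_mat Y * Y) X ev"
    using symmetric_spectral_theorem[of "transpose_mat Y * Y" d] Y by auto
  define S0 where "S0 = select_cols X (mat d 1 (\<lambda>(j, _). ev j))"
  define S where "S = S0 * mat_isqrt (transpose_mat (Y * S0) * (Y * S0))"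
  define V where "V = Y * S0 * mat_isqrt (transpose_mat (Y * S0) * (Y * S0))"
  obtain l where V: "V \<in> carrier_mat d l" "transpose_mat V * V = 1\<^sub>m l"
    "V * transpose_mat V * Y = Y" and S: "V = Y * S" "S \<in> carrier_mat d l"
    using orthonormal_range[OF Y sd, folded S0_def, folded V_def S_def] by auto
  have "transpose_mat E * Y = 0\<^sub>m k d"
  proof -
    have "transpose_mat E * Y = transpose_mat E * 1\<^sub>m d - transpose_mat E * (E * transpose_mat E)"
      unfolding Y_def using E by (intro distrib_dim) auto
    also have "transpose_mat E * (E * transpose_mat E) = transpose_mat E"
      using E by (intro mult_cancel_left[OF E(2)]) auto
    finally show ?thesis using E by simp
  qed
  then have EV: "transpose_mat E * V = 0\<^sub>m k l"
    unfolding S(1) using E Y S(2) by (simp flip: mult_assoc_dim)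
  then have "transpose_mat (transpose_mat E * V) = 0\<^sub>m l k" by simp
  then have VE: "transpose_mat V * E = 0\<^sub>m l k" using E V by (simp add: transpose_mult_dim)
  have QQ: "transpose_mat (hcat E V) * hcat E V = 1\<^sub>m (k + l)"
    unfolding hcat_gram_one_iff[OF E(1) V(1)] using E V EV VE by simp
  have out: "E * transpose_mat E + V * transpose_mat V = 1\<^sub>m d"
  proof -
    have "V * transpose_mat V * Y = V * transpose_mat V * 1\<^sub>m d - V * transpose_mat V * (E * transpose_mat E)"
      unfolding Y_def using E V by (intro distrib_dim) auto
    also have "V * transpose_mat V * (E * transpose_mat E) = V * (transpose_mat V * E * transpose_mat E)"
      using E V by (simp add: mult_assoc_dim)
    also have "\<dots> = 0\<^sub>m d d" unfolding VE using E V by auto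
    finally have "V * transpose_mat V * Y = V * transpose_mat V * 1\<^sub>m d - 0\<^sub>m d d" .
    also have "V * transpose_mat V * 1\<^sub>m d - 0\<^sub>m d d = V * transpose_mat V"
      using V by (intro eq_matI) auto
    finally have YV: "Y = V * transpose_mat V" using V(3) by simp
    have "E * transpose_mat E + Y = 1\<^sub>m d" unfolding Y_def using E by (intro eq_matI) auto
    then show ?thesis unfolding YV .
  qed
  have "real d = mat_trace (1\<^sub>m d)" by (simp add: mat_trace_def)
  also have "\<dots> = mat_trace (hcat E V * transpose_mat (hcat E V))"
    using hcat_outer_one[OF E(1) V(1)] out by simp
  also have "\<dots> = mat_trace (transpose_mat (hcat E V) * hcat E V)"
    using E V by (intro mat_trace_commute[of _ d "k + l"]) auto
  also have "\<dots> = real (k + l)" unfolding QQ by (simp add: mat_trace_def)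
  finally have "d = k + l" by linarith
  then show ?thesis using V QQ by (intro exI[of _ V]) auto
qed

section \<open>The active-adapted frame\<close>

text \<open>The polar factor \<open>A (A\<^sup>T A)\<^sup>-\<^sup>1\<^sup>/\<^sup>2\<close> spans the columns of \<open>A\<close>; an orthonormal basis of the columns
  of \<open>B\<close> after projection completes it to the active space. The complement is arbitrary.\<close>

definition polar :: "real mat \<Rightarrow> real mat" where
  "polar A = A * mat_isqrt (transpose_mat A * A)"

definition residual_part :: "real mat \<Rightarrow> real mat \<Rightarrow> real mat" where
  "residual_part A B = B - polar A * (transpose_mat (polar A) * B)"

lemma frame_exists:
  assumes adm: "admissible A B"
    and V: "V = residual_part A B * W" "W \<in> carrier_mat (dim_col A) l" "V \<in> carrier_mat (dim_row A) l"
      "transpose_mat V * V = 1\<^sub>m l" "V * transpose_mat V * residual_part A B = residual_part A B"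
  shows "\<exists>Z. active_frame A B \<lparr>frU = polar A, frC = mat_sqrt (transpose_mat A * A), frVa = V, frZ = Z\<rparr>"
    and "dim_r A B = dim_col A + l"
proof -
  define d where "d = dim_row A"
  define m where "m = dim_col A"
  note a = admissibleD[OF adm, folded d_def m_def]
  note V' = V(2-4)[folded d_def m_def]
  define G where "G = transpose_mat A * A"
  have G: "G \<in> spd m" using a(6) by (simp add: G_def)
  note Q = mat_sqrt_isqrt[OF G]
  note q = spdD[OF Q(1)] and q' = spdD[OF Q(2)]
  define U where "U = polar A"
  have Ue: "U = A * mat_isqrt G" by (simp add: U_def polar_def G_def)
  have U: "U \<in> carrier_mat d m" using a q' by (simp add: Ue)
  have UU: "transpose_mat U * U = 1\<^sub>m m"
  proof -
    have "transpose_mat U * U = mat_isqrt G * G * mat_isqrt G"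
      using a(3) q' by (simp add: Ue G_def transpose_mult_dim mult_assoc_dim)
    also have "\<dots> = mat_isqrt G * (mat_sqrt G * mat_sqrt G) * mat_isqrt G" using Q(3) by simp
    also have "\<dots> = 1\<^sub>m m" using q q' by (simp add: mult_assoc_dim mult_cancel_left[OF Q(4)] Q(5))
    finally show ?thesis .
  qed
  have AU: "A = U * mat_sqrt G" using a(3) q q' by (simp add: Ue mult_assoc_dim Q(4))
  define Y where "Y = residual_part A B"
  have Ye: "Y = B - U * (transpose_mat U * B)" by (simp add: Y_def residual_part_def U_def)
  have Y: "Y \<in> carrier_mat d m" using a U by (auto simp: Ye)
  note VY = V(1)[folded Y_def] and VVY = V(5)[folded Y_def]
  have UY: "transpose_mat U * Y = 0\<^sub>m m m"
  proof -
    have "transpose_mat U * Y = transpose_mat U * B - transpose_mat U * (U * (transpose_mat U * B))"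
      unfolding Ye using U a by (intro distrib_dim) auto
    also have "transpose_mat U * (U * (transpose_mat U * B)) = transpose_mat U * B"
      using U a by (intro mult_cancel_left[OF UU]) auto
    finally show ?thesis using U a by simp
  qed
  then have UV: "transpose_mat U * V = 0\<^sub>m m l"
    unfolding VY using U Y V' by (simp flip: mult_assoc_dim)
  then have "transpose_mat (transpose_mat U * V) = 0\<^sub>m l m" by simp
  then have VU: "transpose_mat V * U = 0\<^sub>m l m" using U V' by (simp add: transpose_mult_dim)
  have EE: "transpose_mat (hcat U V) * hcat U V = 1\<^sub>m (m + l)"
    unfolding hcat_gram_one_iff[OF U V'(2)] using UU V' UV VU by simp
  have E: "hcat U V \<in> carrier_mat d (m + l)" using U V' by simp
  have span: "LinearCombinations.module.span class_ring (module_vec TYPE(real) d) (set (cols (hcat U V))) = active_space A B"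
  proof -
    have Bd: "B = U * (transpose_mat U * B) + V * (transpose_mat V * Y)"
    proof -
      have "V * (transpose_mat V * Y) = Y" using VVY V' Y by (simp add: mult_assoc_dim)
      then show ?thesis unfolding Ye using a U by (auto intro!: eq_matI)
    qed
    have 1: "\<exists>x y. hcat U V *\<^sub>v z = A *\<^sub>v x + B *\<^sub>v y \<and> x \<in> carrier_vec m \<and> y \<in> carrier_vec m"
      if z: "z \<in> carrier_vec (m + l)" for z
    proof -
      define u w where "u = vec_first z m" and "w = vec_last z l"
      have uw: "u \<in> carrier_vec m" "w \<in> carrier_vec l" "z = u @\<^sub>v w" using z by (auto simp: u_def w_def)
      define y where "y = W *\<^sub>v w"
      define x where "x = mat_isqrt G *\<^sub>v (u - transpose_mat U *\<^sub>v (B *\<^sub>v y))"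
      have y: "y \<in> carrier_vec m" using V' uw by (simp add: y_def)
      have By: "B *\<^sub>v y \<in> carrier_vec d" "transpose_mat U *\<^sub>v (B *\<^sub>v y) \<in> carrier_vec m" using a y U by auto
      have x: "x \<in> carrier_vec m" unfolding x_def using q'(1) uw(1) By(2) by (metis minus_carrier_vec mult_mat_vec_carrier)
      have Ax: "A *\<^sub>v x = U *\<^sub>v u - U *\<^sub>v (transpose_mat U *\<^sub>v (B *\<^sub>v y))"
      proof -
        have "A *\<^sub>v x = U *\<^sub>v (u - transpose_mat U *\<^sub>v (B *\<^sub>v y))"
          unfolding x_def Ue using a q' uw By by (subst assoc_mult_mat_vec[of A d m _ m]) auto
        also have "\<dots> = U *\<^sub>v u - U *\<^sub>v (transpose_mat U *\<^sub>v (B *\<^sub>v y))"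
          using U uw By by (intro mult_minus_distrib_mat_vec[of _ d m]) auto
        finally show ?thesis .
      qed
      have Vw: "V *\<^sub>v w = B *\<^sub>v y - U *\<^sub>v (transpose_mat U *\<^sub>v (B *\<^sub>v y))"
      proof -
        have "V *\<^sub>v w = Y *\<^sub>v y" unfolding VY y_def using Y V' uw by (intro assoc_mult_mat_vec[of _ d m]) auto
        also have "\<dots> = B *\<^sub>v y - (U * (transpose_mat U * B)) *\<^sub>v y"
          unfolding Ye using a U y by (intro minus_mult_distrib_mat_vec[of _ d m]) auto
        also have "(U * (transpose_mat U * B)) *\<^sub>v y = U *\<^sub>v (transpose_mat U *\<^sub>v (B *\<^sub>v y))"
          using a U y By by (simp add: assoc_mult_mat_vec[of U d m _ m] assoc_mult_mat_vec[of "transpose_mat U" m d _ m])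
        finally show ?thesis .
      qed
      have "hcat U V *\<^sub>v z = U *\<^sub>v u + V *\<^sub>v w" unfolding uw(3) by (rule hcat_mult_vec[OF U V'(2) uw(1,2)])
      also have "\<dots> = A *\<^sub>v x + B *\<^sub>v y"
        unfolding Ax Vw using U a uw y By by (intro eq_vecI) auto
      finally show ?thesis using x y by blast
    qed
    have 2: "\<exists>z. A *\<^sub>v x + B *\<^sub>v y = hcat U V *\<^sub>v z \<and> z \<in> carrier_vec (m + l)"
      if xy: "x \<in> carrier_vec m" "y \<in> carrier_vec m" for x y
    proof -
      define u where "u = mat_sqrt G *\<^sub>v x + (transpose_mat U * B) *\<^sub>v y"
      define w where "w = (transpose_mat V * Y) *\<^sub>v y"
      have u: "u \<in> carrier_vec m" and w: "w \<in> carrier_vec l" using q U a V' Y xy by (auto simp: u_def w_def)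
      have "A *\<^sub>v x = U *\<^sub>v (mat_sqrt G *\<^sub>v x)"
        by (subst AU, rule assoc_mult_mat_vec[of _ d m _ m]) (use U q xy in auto)
      moreover have "B *\<^sub>v y = U *\<^sub>v ((transpose_mat U * B) *\<^sub>v y) + V *\<^sub>v w"
      proof -
        have "B *\<^sub>v y = (U * (transpose_mat U * B)) *\<^sub>v y + (V * (transpose_mat V * Y)) *\<^sub>v y"
          by (subst Bd, rule add_mult_distrib_mat_vec[of _ d m]) (use U V' a Y xy in auto)
        then show ?thesis unfolding w_def
          using U V' a Y xy by (simp add: assoc_mult_mat_vec[of U d m _ m] assoc_mult_mat_vec[of V d l _ m])
      qed
      moreover have "U *\<^sub>v u = U *\<^sub>v (mat_sqrt G *\<^sub>v x) + U *\<^sub>v ((transpose_mat U * B) *\<^sub>v y)"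
        unfolding u_def using U q a xy by (intro mult_add_distrib_mat_vec[of _ d m]) auto
      ultimately have "A *\<^sub>v x + B *\<^sub>v y = U *\<^sub>v u + V *\<^sub>v w"
        using U V' q a xy u w by (simp add: assoc_add_vec[of _ d])
      then show ?thesis using hcat_mult_vec[OF U V'(2) u w] u w by (intro exI[of _ "u @\<^sub>v w"]) auto
    qed
    show ?thesis
      unfolding span_cols[OF E] active_space_range(1)[OF a(3,4)] using 1 2 by blast
  qed
  show r: "dim_r A B = dim_col A + l"
    using dim_r_eq_rank[OF a(3,4) span] orthonormal_rank[OF E EE] by (simp add: m_def)
  from orthonormal_completion[OF E EE] obtain Z where Z: "m + l \<le> d" "Z \<in> carrier_mat d (d - (m + l))"
    "transpose_mat (hcat (hcat U V) Z) * hcat (hcat U V) Z = 1\<^sub>m d" by blast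
  have s: "dim_s A B = l" "dim_q A B = d - (m + l)" using r by (auto simp: dim_s_def dim_q_def m_def d_def)
  have "invertible_mat (mat_sqrt G)" by (rule invertibleI[OF q(1) q'(1) Q(5)])
  moreover have "hcat (hcat U V) Z \<in> carrier_mat d d" using hcat_carrier[OF E Z(2)] Z(1) by simp
  ultimately have "active_frame A B \<lparr>frU = U, frC = mat_sqrt G, frVa = V, frZ = Z\<rparr>"
    unfolding active_frame_def Let_def
    using U q(1) V' Z UU EE E span by (simp add: s E_of_def Q_of_def flip: d_def m_def) (rule AU)
  then show "\<exists>Z. active_frame A B \<lparr>frU = polar A, frC = mat_sqrt (transpose_mat A * A), frVa = V, frZ = Z\<rparr>"
    unfolding U_def G_def by blast
qed

section \<open>Controllers as points of a fibre\<close>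

lemma mult_indicator: "a * (if P then 1 else 0) = (if P then a else 0 :: real)"
    "(if P then 1 else 0) * a = (if P then a else 0 :: real)"
  by auto

locale active_setting =
  fixes A B :: "real mat" and F :: frame
  assumes adm: "admissible A B" and fr: "active_frame A B F"
begin

abbreviation "d \<equiv> dim_row A"
abbreviation "m \<equiv> dim_col A"
abbreviation "n \<equiv> dim_n A"
abbreviation "r \<equiv> dim_r A B"
abbreviation "s \<equiv> dim_s A B"
abbreviation "q \<equiv> dim_q A B"
abbreviation "U \<equiv> frU F"
abbreviation "C \<equiv> frC F"
abbreviation "Ci \<equiv> minv (frC F)"
abbreviation "Va \<equiv> frVa F"
abbreviation "Z \<equiv> frZ F"
abbreviation "V \<equiv> V_of F"
abbreviation "E \<equiv> E_of F"
abbreviation "Q \<equiv> Q_of F"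
abbreviation "M \<equiv> M_of A B F"
abbreviation "\<rho> \<equiv> rho_of A B F"
abbreviation "T \<equiv> T_of A B F"
abbreviation "Ta \<equiv> Ta_of A B F"
abbreviation "L \<equiv> L_of A B F"
abbreviation "La \<equiv> La_of A B F"
abbreviation "R0 \<equiv> R0_of A B F"
abbreviation "R0a \<equiv> R0a_of A B F"
abbreviation "L0 \<equiv> L0_of A B F"
abbreviation "D0 \<equiv> D0_of A B F"

lemma frameD: "transpose_mat U * U = 1\<^sub>m m" "invertible_mat C" "A = U * C"
    "transpose_mat E * E = 1\<^sub>m (dim_col E)"
    "LinearCombinations.module.span class_ring (module_vec TYPE(real) d) (set (cols E)) = active_space A B"
    "Q \<in> carrier_mat d d" "transpose_mat Q * Q = 1\<^sub>m d"
  using fr unfolding active_frame_def Let_def by blast+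

lemma frame_carriers: "A \<in> carrier_mat d m" "B \<in> carrier_mat d m" "U \<in> carrier_mat d m" "C \<in> carrier_mat m m"
    "Va \<in> carrier_mat d s" "Z \<in> carrier_mat d q" "E \<in> carrier_mat d (m + s)"
proof -
  show AB: "A \<in> carrier_mat d m" "B \<in> carrier_mat d m" using admissibleD(3,4)[OF adm] by simp_all
  show "U \<in> carrier_mat d m" "C \<in> carrier_mat m m" "Va \<in> carrier_mat d s" "Z \<in> carrier_mat d q"
    using fr unfolding active_frame_def Let_def by blast+
  then show "E \<in> carrier_mat d (m + s)" by (simp add: E_of_def)
qed

lemma dims: "1 \<le> m" "m < d" "r = m + s" "m + s + q = d" "n = s + q" "1 \<le> n" "m + n = d"
proof -
  show m: "1 \<le> m" "m < d" using admissibleD(1,2)[OF adm] by auto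
  have "transpose_mat E * E = 1\<^sub>m (m + s)"
    "LinearCombinations.module.span class_ring (module_vec TYPE(real) d) (set (cols E)) = active_space A B"
    using frameD(4,5) frame_carriers(7) by simp_all
  then show r: "r = m + s"
    using dim_r_eq_rank[OF frame_carriers(1,2)] orthonormal_rank[OF frame_carriers(7)] by simp
  have "Q \<in> carrier_mat d d" by (rule frameD(6))
  then show sq: "m + s + q = d"
    using frame_carriers(6,7) arg_cong[OF Q_of_def[of F], of dim_col] by auto
  then show "n = s + q" by (simp add: dim_n_def)
  then show "1 \<le> n" "m + n = d" using m sq by (auto simp: dim_n_def)
qed

lemma V_carrier: "V \<in> carrier_mat d n"
  using frame_carriers(2-7) dims unfolding V_of_def by simp

lemma Q_eq: "Q = hcat E Z" "Q = hcat U V" "Q \<in> carrier_mat d d"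
  using hcat_assoc[OF frame_carriers(3,5,6)] frameD(6) by (simp_all add: Q_of_def E_of_def V_of_def)

lemma Q_orth: "transpose_mat Q * Q = 1\<^sub>m d" "Q * transpose_mat Q = 1\<^sub>m d"
proof -
  show 1: "transpose_mat Q * Q = 1\<^sub>m d" by (rule frameD(7))
  show "Q * transpose_mat Q = 1\<^sub>m d" by (rule left_inverse_is_right_inverse[OF _ _ 1]) (use Q_eq in auto)
qed

lemma gram_UV: "transpose_mat U * U = 1\<^sub>m m" "transpose_mat U * V = 0\<^sub>m m n" "transpose_mat V * U = 0\<^sub>m n m" "transpose_mat V * V = 1\<^sub>m n"
  using Q_orth(1) hcat_gram_one_iff[OF frame_carriers(3) V_carrier] dims by (simp_all add: Q_eq(2))

lemma gram_EZ: "transpose_mat E * E = 1\<^sub>m (m + s)" "transpose_mat E * Z = 0\<^sub>m (m + s) q"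
    "transpose_mat Z * E = 0\<^sub>m q (m + s)" "transpose_mat Z * Z = 1\<^sub>m q"
  using Q_orth(1) hcat_gram_one_iff[OF frame_carriers(7,6)] dims by (simp_all add: Q_eq(1))

lemma outer_UV: "U * transpose_mat U + V * transpose_mat V = 1\<^sub>m d"
  using Q_orth(2) hcat_outer_one[OF frame_carriers(3) V_carrier] by (simp add: Q_eq(2))

lemma outer_EZ: "E * transpose_mat E + Z * transpose_mat Z = 1\<^sub>m d"
  using Q_orth(2) hcat_outer_one[OF frame_carriers(7,6)] by (simp add: Q_eq(1))

lemma Ci: "Ci \<in> carrier_mat m m" "C * Ci = 1\<^sub>m m" "Ci * C = 1\<^sub>m m"
proof -
  from minv_invertible[OF frame_carriers(4) frameD(2)] show "Ci \<in> carrier_mat m m" "C * Ci = 1\<^sub>m m" "Ci * C = 1\<^sub>m m" .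
qed

lemma A_eq: "A = U * C"
  by (rule frameD(3))

lemma A_Ci: "A * Ci = U"
  using frame_carriers(2-7) Ci by (subst A_eq) (simp add: mult_assoc_dim)

lemma M_eq: "M = transpose_mat U * (B * Ci)"
proof -
  have "M = transpose_mat (A * Ci) * (B * Ci)"
    using frame_carriers(2-7) Ci by (simp add: M_of_def transpose_mult_dim mult_assoc_dim)
  then show ?thesis by (simp add: A_Ci)
qed

lemma M_spd: "M \<in> spd m"
proof -
  have "transpose_mat Ci * (transpose_mat A * B) * Ci \<in> spd m"
  proof (rule spd_congruence[OF admissibleD(5)[OF adm] Ci(1)])
    fix v assume v: "v \<in> carrier_vec m" "Ci *\<^sub>v v = 0\<^sub>v m"
    have "v = C *\<^sub>v (Ci *\<^sub>v v)"
      using v(1) Ci frame_carriers(4) by (subst assoc_mult_mat_vec[symmetric, of C m m Ci m v]) auto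
    then show "v = 0\<^sub>v m" unfolding v(2) using frame_carriers(4) by auto
  qed
  moreover have "M = transpose_mat Ci * (transpose_mat A * B) * Ci"
    unfolding M_of_def using frame_carriers(1,2) Ci(1) by (subst assoc_mult_mat[of _ m m _ d _ m]) auto
  ultimately show ?thesis by (simp only:)
qed

lemma rho: "0 < \<rho>" "det M * \<rho> ^ n = 1"
proof -
  note dM = det_spd_pos[OF M_spd]
  show "0 < \<rho>" using dM by (simp add: rho_of_def)
  have "\<rho> ^ n = det M powr (- 1 / real n * real n)"
  proof -
    have "\<rho> ^ n = \<rho> powr real n" using dM by (simp add: rho_of_def powr_realpow)
    then show ?thesis by (simp add: rho_of_def powr_powr)
  qed
  also have "\<dots> = det M powr (- 1)" using dims by simp
  finally show "det M * \<rho> ^ n = 1" using dM by (simp add: powr_minus)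
qed

lemma minv_M: "minv M \<in> carrier_mat m m" "minv M * M = 1\<^sub>m m"
proof -
  have "M * spectral_fun inverse M = 1\<^sub>m m" "spectral_fun inverse M \<in> carrier_mat m m"
  proof -
    have "M * spectral_fun inverse M = spectral_fun (\<lambda>y. y * inverse y) M"
      using spectral_fun_mult[OF spdD[OF M_spd], of "\<lambda>y. y" inverse] spectral_fun_id[OF spdD[OF M_spd]] by simp
    also have "\<dots> = spectral_fun (\<lambda>y. 1) M" by (rule spectral_fun_cong_spd[OF M_spd]) simp
    finally show "M * spectral_fun inverse M = 1\<^sub>m m" using spectral_fun_const[OF spdD[OF M_spd], of 1] by simp
    show "spectral_fun inverse M \<in> carrier_mat m m" by (rule spectral_fun_carrier[OF spdD[OF M_spd]])
  qed
  then have "invertible_mat M" using invertibleI spdD[OF M_spd] by blast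
  from minv_invertible[OF spdD(1)[OF M_spd] this] show "minv M \<in> carrier_mat m m" "minv M * M = 1\<^sub>m m" by auto
qed

lemma T_carrier: "T \<in> carrier_mat n m" and Ta_carrier: "Ta \<in> carrier_mat s m"
  using V_carrier frame_carriers(2,5) Ci(1) minv_M(1) unfolding T_of_def Ta_of_def
  by (auto intro!: mult_carrier_mat)

lemma L_carrier: "L \<in> carrier_mat d d" and La_carrier: "La \<in> carrier_mat (m + s) (m + s)"
  using unit_lower_carrier[OF T_carrier] unit_lower_carrier[OF Ta_carrier] dims by (auto simp: L_of_def La_of_def)

text \<open>The basis \<open>W\<close>: its first \<open>m\<close> columns are \<open>B C\<^sup>-\<^sup>1 M\<^sup>-\<^sup>1\<close>, the others are orthogonal to the columns
  of \<open>A\<close>. In this basis the constraint \<open>P A = B\<close> fixes the first \<open>m\<close> rows and columns of \<open>P\<close>.\<close>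

definition S0 :: "real mat" where "S0 = U + V * T"
definition W :: "real mat" where "W = Q * L"
definition Wi :: "real mat" where "Wi = minv L * transpose_mat Q"

lemma minv_L: "minv L \<in> carrier_mat d d" "L * minv L = 1\<^sub>m d" "minv L * L = 1\<^sub>m d"
  using minv_unit_lower[OF T_carrier] dims by (auto simp: L_of_def)

lemma S0_carrier: "S0 \<in> carrier_mat d m"
  using frame_carriers(3) V_carrier T_carrier unfolding S0_def by auto

lemma W_eq: "W = hcat S0 V" "W \<in> carrier_mat d d" "Wi \<in> carrier_mat d d" "W * Wi = 1\<^sub>m d" "Wi * W = 1\<^sub>m d"
proof -
  show "W = hcat S0 V"
    unfolding W_def Q_eq(2) L_of_def S0_def by (rule hcat_unit_lower[OF frame_carriers(3) V_carrier T_carrier])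
  show W: "W \<in> carrier_mat d d" "Wi \<in> carrier_mat d d" using Q_eq L_carrier minv_L by (auto simp: W_def Wi_def)
  show WWi: "W * Wi = 1\<^sub>m d"
    using Q_eq(3) L_carrier minv_L by (simp add: W_def Wi_def mult_assoc_dim mult_cancel_left[OF minv_L(2)] Q_orth(2))
  show "Wi * W = 1\<^sub>m d" by (rule left_inverse_is_right_inverse[OF W WWi])
qed

lemma S0_M: "S0 * M = B * Ci"
proof -
  note c = frame_carriers(2-7) V_carrier T_carrier Ci(1) minv_M(1) spdD(1)[OF M_spd]
  have "T * M = transpose_mat V * (B * Ci)"
    using c by (simp add: T_of_def mult_assoc_dim minv_M(2))
  then have "S0 * M = U * (transpose_mat U * (B * Ci)) + V * (transpose_mat V * (B * Ci))"
    unfolding S0_def using c by (simp add: distrib_dim mult_assoc_dim M_eq[symmetric])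
  also have "\<dots> = (U * transpose_mat U + V * transpose_mat V) * (B * Ci)"
    using c by (simp add: distrib_dim mult_assoc_dim)
  also have "\<dots> = B * Ci" unfolding outer_UV using c by simp
  finally show ?thesis .
qed

lemma V_A: "transpose_mat V * A = 0\<^sub>m n m"
proof -
  have "transpose_mat V * A = transpose_mat V * U * C"
    unfolding A_eq[symmetric] assoc_mult_mat[OF transpose_carrier_mat[THEN iffD2, OF V_carrier] frame_carriers(3,4)] ..
  then show ?thesis unfolding gram_UV(3) using frame_carriers(2-7) by simp
qed

lemma S0_A: "transpose_mat S0 * A = C"
proof -
  note c = frame_carriers(2-7) V_carrier T_carrier
  have "transpose_mat S0 = transpose_mat U + transpose_mat T * transpose_mat V"
    unfolding S0_def using c by (subst transpose_add[of _ d m]) (auto simp: transpose_mult_dim)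
  then have "transpose_mat S0 * A = transpose_mat U * A + transpose_mat T * (transpose_mat V * A)"
    using c by (simp add: distrib_dim mult_assoc_dim)
  also have "transpose_mat U * A = transpose_mat U * (U * C)"
    unfolding A_eq[symmetric] ..
  also have "\<dots> = C" using frame_carriers(3,4) by (intro mult_cancel_left[OF gram_UV(1)]) auto
  finally show ?thesis unfolding V_A using c by simp
qed

lemma Phi_eq: "Phi A B F \<Sigma> = W * QS_of A B F \<Sigma> * transpose_mat W" if "\<Sigma> \<in> carrier_mat n n"
  using Q_eq(3) L_carrier that spdD(1)[OF M_spd] dims
  by (simp add: Phi_def W_def transpose_mult_dim mult_assoc_dim QS_of_def)

lemma Phi_sum: "Phi A B F \<Sigma> = S0 * M * transpose_mat S0 + V * (\<rho> \<cdot>\<^sub>m \<Sigma>) * transpose_mat V" if "\<Sigma> \<in> carrier_mat n n"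
  unfolding Phi_eq[OF that] W_eq(1) QS_of_def
  by (rule hcat_outer[OF S0_carrier V_carrier]) (use spdD(1)[OF M_spd] that in auto)

lemma Phi_mult_A: "Phi A B F \<Sigma> * A = B" if "\<Sigma> \<in> carrier_mat n n"
proof -
  note c = S0_carrier V_carrier frame_carriers(2-7) that spdD(1)[OF M_spd] Ci(1)
  have "Phi A B F \<Sigma> * A = S0 * M * (transpose_mat S0 * A) + V * (\<rho> \<cdot>\<^sub>m \<Sigma>) * (transpose_mat V * A)"
    unfolding Phi_sum[OF that] using c by (simp add: distrib_dim mult_assoc_dim)
  also have "\<dots> = B * (Ci * C)" unfolding S0_A V_A S0_M using c by (simp add: mult_assoc_dim)
  finally show ?thesis using c by (simp add: Ci(3))
qed

lemma QS_spd: "\<Sigma> \<in> spd n \<Longrightarrow> QS_of A B F \<Sigma> \<in> spd d"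
  using spd_block_diag[OF M_spd spd_smult[OF _ rho(1)], of \<Sigma> n] dims by (simp add: QS_of_def)

lemma Phi_spd: "\<Sigma> \<in> spd n \<Longrightarrow> Phi A B F \<Sigma> \<in> spd d"
  using spd_congruence_invertible[OF QS_spd W_eq(2,3,4)] Phi_eq[OF spdD(1)] by simp

lemma det_W_sq: "det W * det W = 1"
proof -
  have "det Q * det Q = 1"
    using arg_cong[OF Q_orth(1), of det] Q_eq(3) by (simp add: det_mult[of _ d] det_transpose)
  moreover have "det L = 1" by (simp add: L_of_def det_unit_lower[OF T_carrier])
  ultimately show ?thesis using Q_eq(3) L_carrier by (simp add: W_def det_mult[of _ d])
qed

lemma det_W_congruence: "P \<in> carrier_mat d d \<Longrightarrow> det (W * P * transpose_mat W) = det P"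
  using W_eq(2) det_W_sq det_mult[of "W * P" d "transpose_mat W"] det_mult[of W d P] det_transpose[of W d]
  by (simp add: mult.commute mult.left_commute)

lemma det_QS: "\<Sigma> \<in> carrier_mat n n \<Longrightarrow> det (QS_of A B F \<Sigma>) = det \<Sigma>"
proof -
  assume S: "\<Sigma> \<in> carrier_mat n n"
  have "det (QS_of A B F \<Sigma>) = det M * (\<rho> ^ n * det \<Sigma>)"
    unfolding QS_of_def using S spdD(1)[OF M_spd] by (subst det_block_diag[of _ m _ n]) auto
  then show ?thesis using rho(2) by (simp add: mult.assoc[symmetric])
qed

lemma Phi_unit: "\<Sigma> \<in> unit_spd n \<Longrightarrow> Phi A B F \<Sigma> \<in> unit_spd d"
  using Phi_spd Phi_eq det_W_congruence det_QS spdD(1)[OF QS_spd] spdD(1)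
  by (simp add: unit_spd_def)

lemma R0_eq: "R0 = Wi * 1\<^sub>m d * transpose_mat Wi"
  using minv_L Q_eq(3) by (simp add: R0_of_def Wi_def transpose_mult_dim mult_assoc_dim mult_cancel_left[OF Q_orth(1)])

lemma R0_spd: "R0 \<in> spd d"
  unfolding R0_eq by (rule spd_congruence_invertible[OF spd_one W_eq(3,2,5)])

lemma d_AI_Phi: "\<Sigma> \<in> spd n \<Longrightarrow> d_AI (1\<^sub>m d) (Phi A B F \<Sigma>) = d_AI R0 (QS_of A B F \<Sigma>)"
proof -
  assume S: "\<Sigma> \<in> spd n"
  have T: "transpose_mat W * transpose_mat Wi = 1\<^sub>m d"
    using W_eq(2,3,5) by (simp flip: transpose_mult_dim)
  have "Wi * Phi A B F \<Sigma> * transpose_mat Wi = QS_of A B F \<Sigma>"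
    unfolding Phi_eq[OF spdD(1)[OF S]] using W_eq(2,3) spdD(1)[OF QS_spd[OF S]]
    by (simp add: mult_assoc_dim mult_cancel_left[OF W_eq(5)] T)
  then show ?thesis
    using d_AI_congruence[OF spd_one Phi_spd[OF S] W_eq(3,2,5)] by (simp add: R0_eq)
qed

lemma d_AI_Phi_Phi:
  assumes S: "\<Sigma> \<in> spd n" and S': "\<Sigma>' \<in> spd n"
  shows "d_AI (Phi A B F \<Sigma>) (Phi A B F \<Sigma>') = d_AI \<Sigma> \<Sigma>'"
proof -
  have 1: "d_AI (Phi A B F \<Sigma>) (Phi A B F \<Sigma>') = d_AI (QS_of A B F \<Sigma>) (QS_of A B F \<Sigma>')"
    unfolding Phi_eq[OF spdD(1)[OF S]] Phi_eq[OF spdD(1)[OF S']]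
    by (rule d_AI_congruence[OF QS_spd[OF S] QS_spd[OF S'] W_eq(2,3,4)])
  define H where "H = sqrt \<rho> \<cdot>\<^sub>m 1\<^sub>m n"
  have H: "H \<in> carrier_mat n n" "(1 / sqrt \<rho>) \<cdot>\<^sub>m 1\<^sub>m n \<in> carrier_mat n n" "H * ((1 / sqrt \<rho>) \<cdot>\<^sub>m 1\<^sub>m n) = 1\<^sub>m n"
    using rho(1) by (auto simp: H_def smult_dim intro!: eq_matI)
  have HS: "H * P * transpose_mat H = \<rho> \<cdot>\<^sub>m P" if "P \<in> carrier_mat n n" for P
  proof -
    have "transpose_mat H = H" by (rule eq_matI) (auto simp: H_def)
    then have "H * P * transpose_mat H = sqrt \<rho> \<cdot>\<^sub>m (sqrt \<rho> \<cdot>\<^sub>m P)" using that by (simp add: H_def smult_dim)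
    also have "\<dots> = (sqrt \<rho> * sqrt \<rho>) \<cdot>\<^sub>m P" by (rule eq_matI) auto
    finally show ?thesis using rho(1) by simp
  qed
  have "d_AI (\<rho> \<cdot>\<^sub>m \<Sigma>) (\<rho> \<cdot>\<^sub>m \<Sigma>') = d_AI \<Sigma> \<Sigma>'"
    using d_AI_congruence[OF S S' H] HS spdD(1)[OF S] spdD(1)[OF S'] by simp
  moreover have "(d_AI (QS_of A B F \<Sigma>) (QS_of A B F \<Sigma>'))\<^sup>2 = (d_AI M M)\<^sup>2 + (d_AI (\<rho> \<cdot>\<^sub>m \<Sigma>) (\<rho> \<cdot>\<^sub>m \<Sigma>'))\<^sup>2"
    unfolding QS_of_def by (rule d_AI_block_diag[OF M_spd M_spd spd_smult[OF S rho(1)] spd_smult[OF S' rho(1)]])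
  ultimately have "(d_AI (QS_of A B F \<Sigma>) (QS_of A B F \<Sigma>'))\<^sup>2 = (d_AI \<Sigma> \<Sigma>')\<^sup>2"
    by (simp add: d_AI_refl[OF M_spd])
  then show ?thesis unfolding 1 using d_AI_nonneg by (simp add: power2_eq_iff_nonneg)
qed

text \<open>The parametrisation \<open>Phi\<close> reaches every unimodular controller.\<close>

lemma Phi_surj:
  assumes P: "P \<in> unit_spd d" and PA: "P * A = B"
  shows "\<exists>\<Sigma>\<in>unit_spd n. P = Phi A B F \<Sigma>"
proof -
  note p = unit_spdD[OF P]
  note c = frame_carriers(2-7) V_carrier S0_carrier W_eq(2,3) Ci(1) spdD[OF p(1)] spdD[OF M_spd]
  define P' where "P' = Wi * P * transpose_mat Wi"
  have P': "P' \<in> spd d" unfolding P'_def by (rule spd_congruence_invertible[OF p(1) W_eq(3,2,5)])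
  note p' = spdD[OF P']
  have T: "transpose_mat Wi * transpose_mat W = 1\<^sub>m d" using W_eq(2-4) by (simp flip: transpose_mult_dim)
  have PW: "P = W * P' * transpose_mat W"
    unfolding P'_def using c by (simp add: mult_assoc_dim mult_cancel_left[OF W_eq(4)] T)
  define J where "J = mat d m (\<lambda>(i, j). if i = j then 1 else 0 :: real)"
  have J: "J \<in> carrier_mat d m" by (simp add: J_def)
  have WJ: "W * J = S0"
  proof (rule eq_matI)
    fix i j assume "i < dim_row S0" "j < dim_col S0"
    then have ij: "i < d" "j < m" using c by auto
    have "(W * J) $$ (i, j) = (\<Sum>k<d. if k = j then W $$ (i, j) else 0)"
      using c J ij by (subst index_mult_sum) (auto simp: J_def mult_indicator)
    also have "\<dots> = S0 $$ (i, j)"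
      using ij dims c unfolding W_eq(1) by (simp add: hcat_index[OF S0_carrier V_carrier])
    finally show "(W * J) $$ (i, j) = S0 $$ (i, j)" .
  qed (use c J in auto)
  have WU: "transpose_mat W * U = J"
  proof (rule eq_matI)
    have S0U: "transpose_mat S0 * U = 1\<^sub>m m"
    proof -
      have "transpose_mat S0 * U = transpose_mat S0 * A * Ci" using c by (simp add: mult_assoc_dim A_Ci)
      then show ?thesis by (simp add: S0_A Ci)
    qed
    fix i j assume "i < dim_row J" "j < dim_col J"
    then have ij: "i < d" "j < m" using J by auto
    have "(transpose_mat W * U) $$ (i, j) = (\<Sum>k<d. hcat S0 V $$ (k, i) * U $$ (k, j))"
      using c ij W_eq(1) by (subst index_mult_sum) auto
    also have "\<dots> = (if i < m then (transpose_mat S0 * U) $$ (i, j) else (transpose_mat V * U) $$ (i - m, j))"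
    proof (cases "i < m")
      case True
      have "(transpose_mat S0 * U) $$ (i, j) = (\<Sum>k<d. S0 $$ (k, i) * U $$ (k, j))"
        using c ij True by (subst index_mult_sum) auto
      then show ?thesis using True ij dims by (simp add: hcat_index[OF S0_carrier V_carrier])
    next
      case False
      have "(transpose_mat V * U) $$ (i - m, j) = (\<Sum>k<d. V $$ (k, i - m) * U $$ (k, j))"
        using c ij False dims by (subst index_mult_sum) auto
      then show ?thesis using False ij dims by (simp add: hcat_index[OF S0_carrier V_carrier])
    qed
    also have "\<dots> = J $$ (i, j)" unfolding S0U gram_UV(3) using ij dims by (auto simp: J_def)
    finally show "(transpose_mat W * U) $$ (i, j) = J $$ (i, j)" .
  qed (use c J in auto)
  have "P' * J = J * M"
  proof -
    have PU: "P * U = B * Ci" using c by (simp add: A_Ci[symmetric] PA[symmetric] mult_assoc_dim)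
    have "W * (P' * J) = P * U"
      unfolding WU[symmetric] PW using c p' by (simp add: mult_assoc_dim)
    also have "\<dots> = W * (J * M)" using c J by (simp add: PU S0_M[symmetric] WJ[symmetric] mult_assoc_dim)
    finally have "Wi * (W * (P' * J)) = Wi * (W * (J * M))" by simp
    then show ?thesis using c J p' by (simp add: mult_cancel_left[OF W_eq(5)])
  qed
  then have ent: "P' $$ (i, j) = (if i < m then M $$ (i, j) else 0)" if "i < d" "j < m" for i j
  proof -
    have "(P' * J) $$ (i, j) = (\<Sum>k<d. if k = j then P' $$ (i, j) else 0)"
      using p' J that dims by (subst index_mult_sum) (auto simp: J_def mult_indicator)
    moreover have "(J * M) $$ (i, j) = (\<Sum>k<m. if k = i then M $$ (i, j) else 0)"
      using c J that by (subst index_mult_sum) (auto simp: J_def mult_indicator)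
    ultimately show ?thesis using \<open>P' * J = J * M\<close> that dims by simp
  qed
  have entT: "P' $$ (i, j) = P' $$ (j, i)" if "i < d" "j < d" for i j
    using arg_cong[OF p'(2), of "\<lambda>K. K $$ (i, j)"] that p'(1) by simp
  define Y where "Y = lower_right m P'"
  have Y: "Y \<in> carrier_mat n n" using p'(1) dims by (auto simp: Y_def lower_right_def)
  have bd: "P' = block_diag M Y"
  proof (rule eq_matI)
    fix i j assume "i < dim_row (block_diag M Y)" "j < dim_col (block_diag M Y)"
    then have ij: "i < d" "j < d" using Y c dims by auto
    show "P' $$ (i, j) = block_diag M Y $$ (i, j)"
    proof (cases "j < m")
      case True
      then show ?thesis using ent[OF ij(1) True] ij Y c dims by (auto simp: block_diag_index)
    next
      case False
      then show ?thesis
        using entT[OF ij] ent[OF ij(2), of i] ij Y c dims p' by (auto simp: block_diag_index Y_def lower_right_def)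
    qed
  qed (use Y c p' dims in auto)
  have Ys: "Y \<in> spd n"
  proof -
    define K where "K = mat d n (\<lambda>(i, j). if i = m + j then 1 else 0 :: real)"
    have K: "K \<in> carrier_mat d n" by (simp add: K_def)
    have Kv: "(K *\<^sub>v v) $ (m + j) = v $ j" if "v \<in> carrier_vec n" "j < n" for v j
    proof -
      have "(K *\<^sub>v v) $ (m + j) = (\<Sum>k<n. if k = j then v $ j else 0)"
        using that dims K by (subst index_mult_vec_sum) (auto simp: K_def mult_indicator)
      then show ?thesis using that by simp
    qed
    have "transpose_mat K * P' * K \<in> spd n"
    proof (rule spd_congruence[OF P' K])
      fix v assume v: "v \<in> carrier_vec n" "K *\<^sub>v v = 0\<^sub>v d"
      then show "v = 0\<^sub>v n" using Kv[OF v(1)] dims by (intro eq_vecI) auto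
    qed
    moreover have "transpose_mat K * P' * K = Y"
    proof (rule eq_matI)
      fix i j assume "i < dim_row Y" "j < dim_col Y"
      then have ij: "i < n" "j < n" using Y by auto
      have r: "(transpose_mat K * P') $$ (i, l) = P' $$ (m + i, l)" if "l < d" for l
      proof -
        have "(transpose_mat K * P') $$ (i, l) = (\<Sum>k<d. if k = m + i then P' $$ (m + i, l) else 0)"
          using K p' ij that dims by (subst index_mult_sum) (auto simp: K_def mult_indicator)
        then show ?thesis using ij dims by simp
      qed
      have "(transpose_mat K * P' * K) $$ (i, j) = (\<Sum>l<d. (transpose_mat K * P') $$ (i, l) * K $$ (l, j))"
        using K p' ij by (subst index_mult_sum) auto
      also have "\<dots> = (\<Sum>l<d. if l = m + j then P' $$ (m + i, m + j) else 0)"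
        using r ij by (intro sum.cong) (auto simp: K_def simp del: index_mult_mat(1))
      also have "\<dots> = Y $$ (i, j)" using ij dims p' by (simp add: Y_def lower_right_def)
      finally show "(transpose_mat K * P' * K) $$ (i, j) = Y $$ (i, j)" .
    qed (use K Y in auto)
    ultimately show ?thesis by simp
  qed
  define \<Sigma> where "\<Sigma> = (1 / \<rho>) \<cdot>\<^sub>m Y"
  have rS: "\<rho> \<cdot>\<^sub>m \<Sigma> = Y" using rho(1) by (intro eq_matI) (auto simp: \<Sigma>_def)
  have S: "\<Sigma> \<in> spd n" unfolding \<Sigma>_def using rho(1) by (intro spd_smult Ys) simp
  have QS: "QS_of A B F \<Sigma> = P'" by (simp add: QS_of_def rS bd)
  have "P = Phi A B F \<Sigma>" unfolding Phi_eq[OF spdD(1)[OF S]] QS by (rule PW)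
  moreover have "det \<Sigma> = 1"
    using det_QS[OF spdD(1)[OF S]] det_W_congruence[OF p'(1)] p(2) by (simp add: QS PW[symmetric])
  ultimately show ?thesis using S by (auto simp: unit_spd_def)
qed

lemma fibre: "fibre m n M \<rho> R0"
  using M_spd rho(1) R0_spd dims by unfold_locales auto

sublocale fb: fibre m n M \<rho> R0
  by (rule fibre)

lemma point_eq: "fb.point \<Sigma> = QS_of A B F \<Sigma>"
  by (simp add: fb.point_def QS_of_def)

lemma grad_eq: "fb.grad \<Sigma> = W_full A B F \<Sigma>"
  by (simp add: fb.grad_def W_full_def point_eq)

lemma obj_eq: "\<Sigma> \<in> spd n \<Longrightarrow> fb.obj \<Sigma> = (d_AI (1\<^sub>m d) (Phi A B F \<Sigma>))\<^sup>2 / 2"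
  using d_AI_commute[OF R0_spd QS_spd] by (simp add: fb.obj_def point_eq d_AI_Phi)

lemma obj_le_iff:
  assumes "\<Sigma> \<in> unit_spd n" "\<Sigma>' \<in> unit_spd n"
  shows "fb.obj \<Sigma> \<le> fb.obj \<Sigma>' \<longleftrightarrow> d_AI (1\<^sub>m d) (Phi A B F \<Sigma>) \<le> d_AI (1\<^sub>m d) (Phi A B F \<Sigma>')"
  using assms by (simp add: obj_eq unit_spdD(1) d_AI_nonneg flip: abs_le_square_iff)

lemma canonical:
  assumes min: "fb.minimiser \<Sigma>"
  shows "canonical_controller A B = Phi A B F \<Sigma>"
  unfolding canonical_controller_def
proof (rule the_equality)
  have S: "\<Sigma> \<in> unit_spd n" and le: "\<And>\<Sigma>'. \<Sigma>' \<in> unit_spd n \<Longrightarrow> fb.obj \<Sigma> \<le> fb.obj \<Sigma>'"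
    using min by (auto simp: fb.minimiser_def)
  note ok = Phi_unit[OF S] Phi_mult_A[OF spdD(1)[OF unit_spdD(1)[OF S]]]
  have leP: "d_AI (1\<^sub>m d) (Phi A B F \<Sigma>) \<le> d_AI (1\<^sub>m d) P" if P: "P \<in> unit_spd d" "P * A = B" for P
  proof -
    from Phi_surj[OF that] obtain \<Sigma>' where S': "\<Sigma>' \<in> unit_spd n" "P = Phi A B F \<Sigma>'" by blast
    show ?thesis using le[OF S'(1)] by (simp add: obj_le_iff[OF S S'(1)] S'(2))
  qed
  show "is_arg_min (d_AI (1\<^sub>m d)) (\<lambda>P. P \<in> unit_spd d \<and> P * A = B) (Phi A B F \<Sigma>)"
    using ok leP by (auto simp: is_arg_min_def not_less)
  fix P assume "is_arg_min (d_AI (1\<^sub>m d)) (\<lambda>P. P \<in> unit_spd d \<and> P * A = B) P"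
  then have P: "P \<in> unit_spd d" "P * A = B" and "d_AI (1\<^sub>m d) P \<le> d_AI (1\<^sub>m d) (Phi A B F \<Sigma>)"
    using ok by (auto simp: is_arg_min_def not_less)
  moreover from Phi_surj[OF P] obtain \<Sigma>' where S': "\<Sigma>' \<in> unit_spd n" "P = Phi A B F \<Sigma>'" by blast
  ultimately have "fb.obj \<Sigma>' \<le> fb.obj \<Sigma>" by (simp add: obj_le_iff[OF S'(1) S])
  then show "P = Phi A B F \<Sigma>" using fb.minimiser_unique[OF min S'(1)] S'(2) by simp
qed

section \<open>The full iteration\<close>

lemma L0_eq: "L0 = psi (d_AI (fb.point (1\<^sub>m n)) R0 / sqrt 2)" "D0 = d_AI (fb.point (1\<^sub>m n)) R0"
  using d_AI_commute[OF R0_spd QS_spd[OF spd_one]] by (simp_all add: L0_of_def D0_of_def point_eq)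

lemma L0_ge_1: "1 \<le> L0" and L0_gt_1: "0 < D0 \<Longrightarrow> 1 < L0"
  using d_AI_nonneg by (auto simp: L0_of_def D0_of_def intro!: psi_ge_1 psi_gt_1)

lemma full_iter_step: "full_iter A B F (Suc k) = fb.step L0 (full_iter A B F k)"
  by (simp add: fb.step_def grad_eq)

lemma full_iter_unit: "full_iter A B F k \<in> unit_spd n"
  and full_iter_rate: "(frob_norm (W_full A B F (full_iter A B F k)))\<^sup>2 \<le> L0 * (1 - 1 / L0) ^ k * D0\<^sup>2"
proof -
  have 0: "full_iter A B F 0 \<in> unit_spd n" by (simp add: fb.one_unit_spd)
  have L: "L0 = psi (d_AI (fb.point (full_iter A B F 0)) R0 / sqrt 2)" by (simp add: L0_eq)
  note r = fb.gradient_rate[OF 0 L full_iter_step]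
  show "full_iter A B F k \<in> unit_spd n" by (rule r)
  show "(frob_norm (W_full A B F (full_iter A B F k)))\<^sup>2 \<le> L0 * (1 - 1 / L0) ^ k * D0\<^sup>2"
    using r(2)[of k] by (simp add: grad_eq L0_eq(2))
qed

lemma Phi_canonical_distance:
  assumes S: "\<Sigma> \<in> unit_spd n"
  shows "d_AI (Phi A B F \<Sigma>) (canonical_controller A B) \<le> frob_norm (W_full A B F \<Sigma>)"
proof -
  from fb.minimiser_exists obtain \<Sigma>' where min: "fb.minimiser \<Sigma>'" by (auto simp: fb.minimiser_def)
  then have S': "\<Sigma>' \<in> unit_spd n" by (simp add: fb.minimiser_def)
  show ?thesis
    using fb.distance_le_grad[OF min S] by (simp add: canonical[OF min] d_AI_Phi_Phi unit_spdD(1)[OF S] unit_spdD(1)[OF S'] grad_eq)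
qed

section \<open>Reduction to the active variables\<close>

lemma Z_E: "transpose_mat Z * U = 0\<^sub>m q m" "transpose_mat Z * A = 0\<^sub>m q m" "transpose_mat Z * B = 0\<^sub>m q m"
proof -
  have span: "{E *\<^sub>v x | x. x \<in> carrier_vec (m + s)} = {A *\<^sub>v x + B *\<^sub>v y | x y. x \<in> carrier_vec m \<and> y \<in> carrier_vec m}"
    using frameD(5) span_cols[OF frame_carriers(7)] active_space_range(1)[OF frame_carriers(1,2)]
    by simp
  have Zv: "transpose_mat Z *\<^sub>v v = 0\<^sub>v q" if "v \<in> {E *\<^sub>v x | x. x \<in> carrier_vec (m + s)}" for v
  proof -
    from that obtain x where x: "x \<in> carrier_vec (m + s)" "v = E *\<^sub>v x" by blast
    have "transpose_mat Z *\<^sub>v v = (transpose_mat Z * E) *\<^sub>v x"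
      unfolding x(2) using frame_carriers(2-7) x(1) by (subst assoc_mult_mat_vec[of _ q d _ "m + s"]) auto
    then show ?thesis unfolding gram_EZ(3) using x by auto
  qed
  have cols0: "transpose_mat Z * K = 0\<^sub>m q m"
    if K: "K \<in> carrier_mat d m" "\<And>j. j < m \<Longrightarrow> col K j \<in> {E *\<^sub>v x | x. x \<in> carrier_vec (m + s)}" for K
  proof (rule mat_col_eqI)
    fix j assume "j < dim_col (0\<^sub>m q m :: real mat)"
    then have j: "j < m" by simp
    have "col (transpose_mat Z * K) j = transpose_mat Z *\<^sub>v col K j"
      using frame_carriers(6) K(1) j by (intro col_mult2[of _ q d _ m]) auto
    then show "col (transpose_mat Z * K) j = col (0\<^sub>m q m) j" using Zv[OF K(2)[OF j]] j by simp
  qed (use frame_carriers(2-7) K in auto)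
  have unit: "K *\<^sub>v unit_vec m j = col K j" if "K \<in> carrier_mat d m" "j < m" for K :: "real mat" and j
    using that by (intro eq_vecI) auto
  show "transpose_mat Z * A = 0\<^sub>m q m"
  proof (rule cols0[OF frame_carriers(1)])
    fix j assume j: "j < m"
    have "col A j = A *\<^sub>v unit_vec m j + B *\<^sub>v 0\<^sub>v m"
      using unit[OF frame_carriers(1) j] frame_carriers(2) by auto
    then show "col A j \<in> {E *\<^sub>v x | x. x \<in> carrier_vec (m + s)}" unfolding span by fastforce
  qed
  show "transpose_mat Z * B = 0\<^sub>m q m"
  proof (rule cols0[OF frame_carriers(2)])
    fix j assume j: "j < m"
    have "col B j = A *\<^sub>v 0\<^sub>v m + B *\<^sub>v unit_vec m j"
    proof -
      have "A *\<^sub>v 0\<^sub>v m = 0\<^sub>v d" by (rule eq_vecI) auto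
      then show ?thesis using unit[OF frame_carriers(2) j] frame_carriers(2) by auto
    qed
    then show "col B j \<in> {E *\<^sub>v x | x. x \<in> carrier_vec (m + s)}" unfolding span by fastforce
  qed
  then show "transpose_mat Z * U = 0\<^sub>m q m"
    using \<open>transpose_mat Z * A = 0\<^sub>m q m\<close> frame_carriers(2-7) Ci by (simp add: A_Ci[symmetric] flip: mult_assoc_dim)
qed

lemma L_block: "L = block_diag La (1\<^sub>m q)"
proof -
  define G where "G = B * Ci * minv M"
  have G: "G \<in> carrier_mat d m" using frame_carriers(2-7) Ci minv_M by (simp add: G_def)
  have T: "T = transpose_mat V * G" "Ta = transpose_mat Va * G"
    using frame_carriers(2-7) V_carrier Ci minv_M by (simp_all add: T_of_def Ta_of_def G_def mult_assoc_dim)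
  have ZG: "transpose_mat Z * G = 0\<^sub>m q m"
  proof -
    have "transpose_mat Z * G = transpose_mat Z * B * Ci * minv M"
      using frame_carriers(2-7) Ci minv_M by (simp add: G_def mult_assoc_dim)
    then show ?thesis using Ci minv_M by (simp add: Z_E)
  qed
  have ent: "T $$ (i, j) = (if i < s then Ta $$ (i, j) else 0)" if ij: "i < n" "j < m" for i j
  proof -
    have "T $$ (i, j) = (\<Sum>k<d. V $$ (k, i) * G $$ (k, j))"
      unfolding T using V_carrier G ij by (subst index_mult_sum) auto
    also have "\<dots> = (if i < s then (transpose_mat Va * G) $$ (i, j) else (transpose_mat Z * G) $$ (i - s, j))"
    proof (cases "i < s")
      case True
      have "(transpose_mat Va * G) $$ (i, j) = (\<Sum>k<d. Va $$ (k, i) * G $$ (k, j))"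
        using frame_carriers(2-7) G True ij by (subst index_mult_sum) auto
      then show ?thesis using True ij dims by (simp add: V_of_def hcat_index[OF frame_carriers(5,6)])
    next
      case False
      have "(transpose_mat Z * G) $$ (i - s, j) = (\<Sum>k<d. Z $$ (k, i - s) * G $$ (k, j))"
        using frame_carriers(2-7) G False ij dims by (subst index_mult_sum) auto
      then show ?thesis using False ij dims by (simp add: V_of_def hcat_index[OF frame_carriers(5,6)])
    qed
    also have "\<dots> = (if i < s then Ta $$ (i, j) else 0)" unfolding ZG using ij dims by (auto simp: T)
    finally show ?thesis .
  qed
  have d: "dim_row T = n" "dim_col T = m" "dim_row Ta = s" "dim_col Ta = m" using T_carrier Ta_carrier by auto
  show ?thesis
    unfolding L_of_def La_of_def
  proof (rule eq_matI)
    fix i j assume "i < dim_row (block_diag (unit_lower Ta) (1\<^sub>m q))" "j < dim_col (block_diag (unit_lower Ta) (1\<^sub>m q))"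
    then have ij: "i < m + (s + q)" "j < m + (s + q)" by (auto simp: unit_lower_def d)
    then show "unit_lower T $$ (i, j) = block_diag (unit_lower Ta) (1\<^sub>m q) $$ (i, j)"
    proof (cases "m \<le> i \<and> j < m")
      case True
      then have "T $$ (i - m, j) = (if i - m < s then Ta $$ (i - m, j) else 0)"
        using ij True dims(5) by (intro ent) linarith+
      moreover have "i - m < s \<longleftrightarrow> i < m + s" using True by linarith
      ultimately show ?thesis using True ij by (simp add: unit_lower_def block_diag_index d dims(5))
    next
      case False
      then show ?thesis using ij
        by (cases "i < m"; cases "j < m"; cases "i < m + s"; cases "j < m + s")
          (auto simp: unit_lower_def block_diag_index d dims(5))
    qed
  qed (auto simp: unit_lower_def d dims(5))
qed

lemma minv_La: "minv La \<in> carrier_mat (m + s) (m + s)" "La * minv La = 1\<^sub>m (m + s)" "minv La * La = 1\<^sub>m (m + s)"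
  using minv_unit_lower[OF Ta_carrier] by (auto simp: La_of_def)

lemma R0_block: "R0 = block_diag R0a (1\<^sub>m q)"
proof -
  have "minv L = block_diag (minv La) (1\<^sub>m q)"
    using La_carrier minv_La dims unfolding L_block
    by (intro minv_eqI[of _ "m + s + q"]) (auto simp: block_diag_mult)
  then show ?thesis using minv_La by (simp add: R0_of_def R0a_of_def block_diag_transpose block_diag_mult)
qed

lemma R0a_spd: "R0a \<in> spd (m + s)"
  using spd_congruence_invertible[OF spd_one minv_La(1) La_carrier minv_La(3)] minv_La by (simp add: R0a_of_def)

lemma Qa_spd: "\<Sigma>a \<in> spd s \<Longrightarrow> Qa_of A B F \<Sigma>a \<in> spd (m + s)"
  using spd_block_diag[OF M_spd spd_smult[OF _ rho(1)]] by (simp add: Qa_of_def)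

lemma QS_block: "\<Sigma>a \<in> spd s \<Longrightarrow> QS_of A B F (block_diag \<Sigma>a (\<beta> \<cdot>\<^sub>m 1\<^sub>m q)) = block_diag (Qa_of A B F \<Sigma>a) ((\<rho> * \<beta>) \<cdot>\<^sub>m 1\<^sub>m q)"
proof -
  have "\<rho> \<cdot>\<^sub>m (\<beta> \<cdot>\<^sub>m 1\<^sub>m q) = (\<rho> * \<beta>) \<cdot>\<^sub>m 1\<^sub>m q" by (rule eq_matI) auto
  then show ?thesis by (simp add: QS_of_def Qa_of_def block_diag_smult block_diag_assoc)
qed

lemma rel_log_scalar: "0 < c \<Longrightarrow> rel_log (c \<cdot>\<^sub>m 1\<^sub>m k) (1\<^sub>m k) = (- ln c) \<cdot>\<^sub>m 1\<^sub>m k"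
proof -
  assume c: "0 < c"
  have "(1 / sqrt c) \<cdot>\<^sub>m 1\<^sub>m k * 1\<^sub>m k * ((1 / sqrt c) \<cdot>\<^sub>m 1\<^sub>m k) = (1 / c) \<cdot>\<^sub>m 1\<^sub>m k"
    using c by (simp add: smult_dim) (rule eq_matI, auto)
  then show ?thesis using c by (simp add: rel_log_def mat_isqrt_def mat_log_def spectral_fun_scalar ln_div)
qed

lemma rel_log_block:
  assumes S: "\<Sigma>a \<in> spd s" and b: "0 < \<beta>"
  shows "rel_log (QS_of A B F (block_diag \<Sigma>a (\<beta> \<cdot>\<^sub>m 1\<^sub>m q))) R0
    = block_diag (rel_log (Qa_of A B F \<Sigma>a) R0a) (rc_of A B F \<beta> \<cdot>\<^sub>m 1\<^sub>m q)"
proof -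
  have c: "0 < \<rho> * \<beta>" using rho(1) b by simp
  show ?thesis
    unfolding QS_block[OF S] R0_block
    using rel_log_block_diag[OF Qa_spd[OF S] R0a_spd spd_smult[OF spd_one c] spd_one, of q] rel_log_scalar[OF c]
    by (simp add: rc_of_def)
qed

lemma lower_right_block:
  "X \<in> carrier_mat (m + s) (m + s) \<Longrightarrow> Y \<in> carrier_mat q q \<Longrightarrow>
   lower_right m (block_diag X Y) = block_diag (lower_right m X) Y"
  by (rule eq_matI) (auto simp: lower_right_def block_diag_index)

lemma Ra22_carrier: "\<Sigma>a \<in> spd s \<Longrightarrow> Ra22_of A B F \<Sigma>a \<in> carrier_mat s s"
  and Ra22_sym: "\<Sigma>a \<in> spd s \<Longrightarrow> transpose_mat (Ra22_of A B F \<Sigma>a) = Ra22_of A B F \<Sigma>a"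
proof -
  assume S: "\<Sigma>a \<in> spd s"
  note Y = rel_log_carrier[OF Qa_spd[OF S] R0a_spd] rel_log_transpose[OF Qa_spd[OF S] R0a_spd]
  show c: "Ra22_of A B F \<Sigma>a \<in> carrier_mat s s" using Y(1) by (auto simp: Ra22_of_def lower_right_def)
  have "rel_log (Qa_of A B F \<Sigma>a) R0a $$ (m + j, m + i) = rel_log (Qa_of A B F \<Sigma>a) R0a $$ (m + i, m + j)"
    if "i < s" "j < s" for i j
    using arg_cong[OF Y(2), of "\<lambda>K. K $$ (m + i, m + j)"] Y(1) that by simp
  then show "transpose_mat (Ra22_of A B F \<Sigma>a) = Ra22_of A B F \<Sigma>a"
    using Y(1) by (intro eq_matI) (auto simp: Ra22_of_def lower_right_def)
qed

lemma mat_trace_scalar: "mat_trace (c \<cdot>\<^sub>m 1\<^sub>m k) = c * real k"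
  by (simp add: mat_trace_def)

lemma W_block:
  assumes S: "\<Sigma>a \<in> spd s" and b: "0 < \<beta>"
  shows "W_full A B F (block_diag \<Sigma>a (\<beta> \<cdot>\<^sub>m 1\<^sub>m q)) = block_diag (Wa_of A B F \<Sigma>a \<beta>) (wc_of A B F \<Sigma>a \<beta> \<cdot>\<^sub>m 1\<^sub>m q)"
proof -
  note c = Ra22_carrier[OF S]
  have R22: "lower_right m (rel_log (QS_of A B F (block_diag \<Sigma>a (\<beta> \<cdot>\<^sub>m 1\<^sub>m q))) R0)
      = block_diag (Ra22_of A B F \<Sigma>a) (rc_of A B F \<beta> \<cdot>\<^sub>m 1\<^sub>m q)"
    unfolding rel_log_block[OF S b] Ra22_of_def
    by (rule lower_right_block) (use rel_log_carrier[OF Qa_spd[OF S] R0a_spd] in auto)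
  have tau: "mat_trace (block_diag (Ra22_of A B F \<Sigma>a) (rc_of A B F \<beta> \<cdot>\<^sub>m 1\<^sub>m q)) / real n = tau_of A B F \<Sigma>a \<beta>"
    using mat_trace_block_diag[OF c, of "rc_of A B F \<beta> \<cdot>\<^sub>m 1\<^sub>m q" q]
    by (simp add: tau_of_def mat_trace_scalar dims(5) mult.commute)
  have "tau_of A B F \<Sigma>a \<beta> \<cdot>\<^sub>m 1\<^sub>m n = block_diag (tau_of A B F \<Sigma>a \<beta> \<cdot>\<^sub>m 1\<^sub>m s) (tau_of A B F \<Sigma>a \<beta> \<cdot>\<^sub>m 1\<^sub>m q)"
    unfolding dims(5) block_diag_one[symmetric] block_diag_smult ..
  moreover have "rc_of A B F \<beta> \<cdot>\<^sub>m 1\<^sub>m q - tau_of A B F \<Sigma>a \<beta> \<cdot>\<^sub>m 1\<^sub>m q = wc_of A B F \<Sigma>a \<beta> \<cdot>\<^sub>m 1\<^sub>m q"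
    by (rule eq_matI) (auto simp: wc_of_def)
  ultimately show ?thesis
    unfolding W_full_def Let_def R22 tau Wa_of_def
    using c by (simp add: block_diag_minus[of _ s s _ _ q q])
qed

lemma Wa_sym: "\<Sigma>a \<in> spd s \<Longrightarrow> Wa_of A B F \<Sigma>a \<beta> \<in> carrier_mat s s \<and> transpose_mat (Wa_of A B F \<Sigma>a \<beta>) = Wa_of A B F \<Sigma>a \<beta>"
proof -
  assume S: "\<Sigma>a \<in> spd s"
  note c = Ra22_carrier[OF S] Ra22_sym[OF S]
  have "transpose_mat (Wa_of A B F \<Sigma>a \<beta>) = transpose_mat (Ra22_of A B F \<Sigma>a) - transpose_mat (tau_of A B F \<Sigma>a \<beta> \<cdot>\<^sub>m 1\<^sub>m s)"
    unfolding Wa_of_def using c by (intro transpose_minus) auto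
  also have "transpose_mat (tau_of A B F \<Sigma>a \<beta> \<cdot>\<^sub>m 1\<^sub>m s) = tau_of A B F \<Sigma>a \<beta> \<cdot>\<^sub>m 1\<^sub>m s"
    by (rule eq_matI) auto
  finally show ?thesis using c by (auto simp: Wa_of_def)
qed

lemma residual_sq_full:
  assumes S: "\<Sigma>a \<in> spd s" and b: "0 < \<beta>"
  shows "residual_sq A B F \<Sigma>a \<beta> = (frob_norm (W_full A B F (block_diag \<Sigma>a (\<beta> \<cdot>\<^sub>m 1\<^sub>m q))))\<^sup>2"
proof -
  have "frob (c \<cdot>\<^sub>m 1\<^sub>m q) (c \<cdot>\<^sub>m 1\<^sub>m q) = real q * c\<^sup>2" for c
    unfolding scalar_mat_diag frob_diag by (simp add: power2_eq_square)
  then show ?thesis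
    unfolding W_block[OF assms] frob_norm_sq residual_sq_def
    using Wa_sym[OF S] by (subst frob_block_diag[of _ s _ _ q]) auto
qed

text \<open>The scalar blocks are preserved by the update, so the two iterations agree.\<close>

lemma iter_invariant:
  "fst (active_iter A B F k) \<in> spd s \<and> 0 < snd (active_iter A B F k) \<and>
   full_iter A B F k = block_diag (fst (active_iter A B F k)) (snd (active_iter A B F k) \<cdot>\<^sub>m 1\<^sub>m q)"
proof (induction k)
  case 0
  then show ?case by (simp add: dims(5))
next
  case (Suc k)
  obtain \<Sigma>a \<beta> where st: "active_iter A B F k = (\<Sigma>a, \<beta>)" by fastforce
  have S: "\<Sigma>a \<in> spd s" and b: "0 < \<beta>" and full: "full_iter A B F k = block_diag \<Sigma>a (\<beta> \<cdot>\<^sub>m 1\<^sub>m q)"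
    using Suc by (auto simp: st)
  define X where "X = (1 / L0) \<cdot>\<^sub>m Wa_of A B F \<Sigma>a \<beta>"
  define w where "w = wc_of A B F \<Sigma>a \<beta>"
  have X: "X \<in> carrier_mat s s" "transpose_mat X = X"
  proof -
    show "X \<in> carrier_mat s s" using Wa_sym[OF S] by (simp add: X_def)
    have "transpose_mat X = (1 / L0) \<cdot>\<^sub>m transpose_mat (Wa_of A B F \<Sigma>a \<beta>)" unfolding X_def by (rule eq_matI) auto
    then show "transpose_mat X = X" using Wa_sym[OF S, of \<beta>] by (simp add: X_def)
  qed
  have sym1: "c \<cdot>\<^sub>m 1\<^sub>m q \<in> carrier_mat q q" "transpose_mat (c \<cdot>\<^sub>m 1\<^sub>m q) = c \<cdot>\<^sub>m 1\<^sub>m q" for c :: real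
    by (auto intro!: eq_matI)
  have e: "(1 / L0) \<cdot>\<^sub>m W_full A B F (full_iter A B F k) = block_diag X ((w / L0) \<cdot>\<^sub>m 1\<^sub>m q)"
  proof -
    have "(1 / L0) \<cdot>\<^sub>m (w \<cdot>\<^sub>m 1\<^sub>m q) = (w / L0) \<cdot>\<^sub>m 1\<^sub>m q" by (rule eq_matI) auto
    then show ?thesis unfolding full W_block[OF S b] by (simp add: block_diag_smult X_def w_def)
  qed
  have sq: "mat_sqrt (full_iter A B F k) = block_diag (mat_sqrt \<Sigma>a) (sqrt \<beta> \<cdot>\<^sub>m 1\<^sub>m q)"
    unfolding full mat_sqrt_def spectral_fun_block_diag[OF spdD[OF S] sym1] spectral_fun_scalar ..
  have ex: "mat_exp (block_diag X ((w / L0) \<cdot>\<^sub>m 1\<^sub>m q)) = block_diag (mat_exp X) (exp (w / L0) \<cdot>\<^sub>m 1\<^sub>m q)"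
    unfolding mat_exp_def spectral_fun_block_diag[OF X sym1] spectral_fun_scalar ..
  note qc = spdD(1)[OF mat_sqrt_isqrt(1)[OF S]]
  have ec: "mat_exp X \<in> carrier_mat s s" unfolding mat_exp_def by (rule spectral_fun_carrier[OF X])
  have "sqrt \<beta> \<cdot>\<^sub>m 1\<^sub>m q * (exp (w / L0) \<cdot>\<^sub>m 1\<^sub>m q) * (sqrt \<beta> \<cdot>\<^sub>m 1\<^sub>m q) = (sqrt \<beta> * sqrt \<beta> * exp (w / L0)) \<cdot>\<^sub>m 1\<^sub>m q"
    by (simp add: smult_dim) (rule eq_matI, auto)
  then have sc: "sqrt \<beta> \<cdot>\<^sub>m 1\<^sub>m q * (exp (w / L0) \<cdot>\<^sub>m 1\<^sub>m q) * (sqrt \<beta> \<cdot>\<^sub>m 1\<^sub>m q) = (\<beta> * exp (w / L0)) \<cdot>\<^sub>m 1\<^sub>m q"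
    using b by simp
  have "full_iter A B F (Suc k) = block_diag (mat_sqrt \<Sigma>a * mat_exp X * mat_sqrt \<Sigma>a) ((\<beta> * exp (w / L0)) \<cdot>\<^sub>m 1\<^sub>m q)"
    unfolding full_iter.simps e sq ex sc[symmetric] using qc ec by (simp add: block_diag_mult)
  moreover have "mat_sqrt \<Sigma>a * mat_exp X * mat_sqrt \<Sigma>a \<in> spd s"
    using geodesic_spd[OF S X, of 1] by (simp add: geodesic_def)
  ultimately show ?case using b by (simp add: st X_def w_def)
qed

lemma iter_active_state: "active_state s q (fst (active_iter A B F k)) (snd (active_iter A B F k))"
proof -
  note i = iter_invariant[of k]
  have "det (full_iter A B F k) = det (fst (active_iter A B F k)) * snd (active_iter A B F k) ^ q"
    using i by (simp add: det_block_diag[of _ s _ q] spdD(1))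
  then show ?thesis using i full_iter_unit[of k] by (simp add: active_state_def unit_spd_def)
qed

lemma residual_sq_iter:
  "residual_sq A B F (fst (active_iter A B F k)) (snd (active_iter A B F k)) = (frob_norm (W_full A B F (full_iter A B F k)))\<^sup>2"
  using residual_sq_full iter_invariant[of k] by simp

lemma Phi_active:
  assumes S: "\<Sigma>a \<in> spd s"
  shows "Phi A B F (block_diag \<Sigma>a (\<beta> \<cdot>\<^sub>m 1\<^sub>m q))
    = E * H_of A B F \<Sigma>a * transpose_mat E + (\<rho> * \<beta>) \<cdot>\<^sub>m (1\<^sub>m d - E * transpose_mat E)"
proof -
  note Qc = spdD(1)[OF Qa_spd[OF S]]
  have H: "H_of A B F \<Sigma>a \<in> carrier_mat (m + s) (m + s)" using La_carrier Qc by (auto simp: H_of_def)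
  have "L * QS_of A B F (block_diag \<Sigma>a (\<beta> \<cdot>\<^sub>m 1\<^sub>m q)) * transpose_mat L = block_diag (H_of A B F \<Sigma>a) ((\<rho> * \<beta>) \<cdot>\<^sub>m 1\<^sub>m q)"
    unfolding QS_block[OF S] L_block using La_carrier Qc by (simp add: block_diag_transpose block_diag_mult H_of_def)
  moreover have "QS_of A B F (block_diag \<Sigma>a (\<beta> \<cdot>\<^sub>m 1\<^sub>m q)) \<in> carrier_mat d d"
    unfolding QS_block[OF S] using Qc dims by auto
  ultimately have "Phi A B F (block_diag \<Sigma>a (\<beta> \<cdot>\<^sub>m 1\<^sub>m q)) = Q * block_diag (H_of A B F \<Sigma>a) ((\<rho> * \<beta>) \<cdot>\<^sub>m 1\<^sub>m q) * transpose_mat Q"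
    using Q_eq(3) L_carrier by (simp add: Phi_def mult_assoc_dim)
  also have "\<dots> = E * H_of A B F \<Sigma>a * transpose_mat E + Z * ((\<rho> * \<beta>) \<cdot>\<^sub>m 1\<^sub>m q) * transpose_mat Z"
    unfolding Q_eq(1) by (rule hcat_outer[OF frame_carriers(7,6) H]) auto
  also have "Z * ((\<rho> * \<beta>) \<cdot>\<^sub>m 1\<^sub>m q) * transpose_mat Z = (\<rho> * \<beta>) \<cdot>\<^sub>m (Z * transpose_mat Z)"
    using frame_carriers(6) by (simp add: smult_dim)
  also have "Z * transpose_mat Z = 1\<^sub>m d - E * transpose_mat E"
    unfolding outer_EZ[symmetric] using frame_carriers(6,7) by (intro eq_matI) auto
  finally show ?thesis .
qed

lemma Phi_iter:
  "Phi A B F (full_iter A B F k) = E * H_of A B F (fst (active_iter A B F k)) * transpose_mat E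
    + (\<rho> * snd (active_iter A B F k)) \<cdot>\<^sub>m (1\<^sub>m d - E * transpose_mat E)"
  using iter_invariant[of k] Phi_active by simp

end

context active_setting
begin

abbreviation "Sig_at k \<equiv> fst (active_iter A B F k)"
abbreviation "beta_at k \<equiv> snd (active_iter A B F k)"
abbreviation "res_at k \<equiv> residual_sq A B F (Sig_at k) (beta_at k)"

lemma Sig_at_spd: "Sig_at k \<in> spd s" and beta_at_pos: "0 < beta_at k"
  using iter_invariant[of k] by auto

lemma H_carrier: "S \<in> spd s \<Longrightarrow> H_of A B F S \<in> carrier_mat (m + s) (m + s)"
  using La_carrier spdD(1)[OF Qa_spd[of S]] by (auto simp: H_of_def)

lemma Phi_rank_update:
  "Phi A B F (full_iter A B F k) = (\<rho> * beta_at k) \<cdot>\<^sub>m 1\<^sub>m d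
    + E * ((H_of A B F (Sig_at k) - (\<rho> * beta_at k) \<cdot>\<^sub>m 1\<^sub>m r) * transpose_mat E)"
proof -
  define c where "c = \<rho> * beta_at k"
  define H where "H = H_of A B F (Sig_at k)"
  have H: "H \<in> carrier_mat (m + s) (m + s)" unfolding H_def by (rule H_carrier[OF Sig_at_spd])
  note E = frame_carriers(7)
  have "(H - c \<cdot>\<^sub>m 1\<^sub>m (m + s)) * transpose_mat E = H * transpose_mat E - c \<cdot>\<^sub>m transpose_mat E"
    using H E by (subst minus_mult_distrib_mat[of _ "m + s" "m + s"]) (auto simp: smult_dim)
  moreover have "E * (H * transpose_mat E - c \<cdot>\<^sub>m transpose_mat E) = E * H * transpose_mat E - c \<cdot>\<^sub>m (E * transpose_mat E)"
    using H E by (subst mult_minus_distrib_mat[of _ d "m + s"]) (auto simp: smult_dim mult_assoc_dim)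
  ultimately have e: "E * ((H - c \<cdot>\<^sub>m 1\<^sub>m r) * transpose_mat E) = E * H * transpose_mat E - c \<cdot>\<^sub>m (E * transpose_mat E)"
    by (simp add: dims(3))
  have c2: "E * H * transpose_mat E \<in> carrier_mat d d" "E * transpose_mat E \<in> carrier_mat d d" using H E by auto
  show ?thesis
    unfolding Phi_iter c_def[symmetric] H_def[symmetric] e
    using c2 by (intro eq_matI) (auto simp: algebra_simps)
qed

lemma implicit_application:
  assumes x: "x \<in> carrier_vec d"
  shows "Phi A B F (full_iter A B F k) *\<^sub>v x = (\<rho> * beta_at k) \<cdot>\<^sub>v x
    + E *\<^sub>v ((H_of A B F (Sig_at k) - (\<rho> * beta_at k) \<cdot>\<^sub>m 1\<^sub>m r) *\<^sub>v (transpose_mat E *\<^sub>v x))"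
proof -
  define G where "G = H_of A B F (Sig_at k) - (\<rho> * beta_at k) \<cdot>\<^sub>m 1\<^sub>m r"
  have G: "G \<in> carrier_mat (m + s) (m + s)" unfolding G_def dims(3) by auto
  note E = frame_carriers(7)
  have "E *\<^sub>v (G *\<^sub>v (transpose_mat E *\<^sub>v x)) = (E * (G * transpose_mat E)) *\<^sub>v x"
    using E G x by (subst assoc_mult_mat_vec[of _ d "m + s" _ d]; (subst assoc_mult_mat_vec[of _ "m + s" "m + s" _ d])?) auto
  moreover have "((\<rho> * beta_at k) \<cdot>\<^sub>m 1\<^sub>m d) *\<^sub>v x = (\<rho> * beta_at k) \<cdot>\<^sub>v x"
    using x by (intro eq_vecI) auto
  moreover have "((\<rho> * beta_at k) \<cdot>\<^sub>m 1\<^sub>m d + E * (G * transpose_mat E)) *\<^sub>v x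
      = ((\<rho> * beta_at k) \<cdot>\<^sub>m 1\<^sub>m d) *\<^sub>v x + (E * (G * transpose_mat E)) *\<^sub>v x"
    using E G x by (intro add_mult_distrib_mat_vec[of _ d d]) auto
  ultimately show ?thesis unfolding Phi_rank_update G_def[symmetric] by simp
qed

lemma stopping_test:
  assumes eps: "0 \<le> \<epsilon>" and res: "res_at k \<le> \<epsilon>\<^sup>2"
  shows "d_AI (Phi A B F (full_iter A B F k)) (canonical_controller A B) \<le> \<epsilon>"
proof -
  have "frob_norm (W_full A B F (full_iter A B F k)) \<le> \<epsilon>"
    using res eps unfolding residual_sq_iter by (rule power2_le_imp_le)
  then show ?thesis using Phi_canonical_distance[OF full_iter_unit[of k]] by linarith
qed

lemma outer_E_no_complement: "q = 0 \<Longrightarrow> E * transpose_mat E = 1\<^sub>m d"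
proof -
  assume q: "q = 0"
  have "Z * transpose_mat Z = 0\<^sub>m d d" using frame_carriers(6) q by (intro eq_matI) (auto simp: scalar_prod_def)
  then have "E * transpose_mat E + 0\<^sub>m d d = 1\<^sub>m d" using outer_EZ by simp
  then show ?thesis using frame_carriers(7) by simp
qed

lemma no_complement:
  assumes q: "q = 0"
  shows "full_iter A B F k = Sig_at k"
    and "Phi A B F (full_iter A B F k) = E * H_of A B F (Sig_at k) * transpose_mat E"
    and "Wa_of A B F S \<beta> = Ra22_of A B F S - (mat_trace (Ra22_of A B F S) / real s) \<cdot>\<^sub>m 1\<^sub>m s"
proof -
  have "(beta_at k \<cdot>\<^sub>m 1\<^sub>m q :: real mat) = 1\<^sub>m 0" using q by (intro eq_matI) auto
  moreover have "block_diag X (1\<^sub>m 0) = X" for X by (rule eq_matI) (auto simp: block_diag_index)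
  ultimately show "full_iter A B F k = Sig_at k" using iter_invariant[of k] by simp
  show "Phi A B F (full_iter A B F k) = E * H_of A B F (Sig_at k) * transpose_mat E"
    unfolding Phi_iter outer_E_no_complement[OF q] using frame_carriers(7) H_carrier[OF Sig_at_spd[of k]]
    by (intro eq_matI) auto
  show "Wa_of A B F S \<beta> = Ra22_of A B F S - (mat_trace (Ra22_of A B F S) / real s) \<cdot>\<^sub>m 1\<^sub>m s"
    by (simp add: Wa_of_def tau_of_def q)
qed

lemma no_variable:
  assumes s: "s = 0"
  shows "active_state s q S \<beta> \<Longrightarrow> S = 1\<^sub>m 0 \<and> \<beta> = 1"
    and "canonical_controller A B = E * M * transpose_mat E + \<rho> \<cdot>\<^sub>m (1\<^sub>m d - E * transpose_mat E)"
proof -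
  have q: "0 < q" using dims s by simp
  show "S = 1\<^sub>m 0 \<and> \<beta> = 1" if a: "active_state s q S \<beta>"
  proof
    have S: "S \<in> carrier_mat 0 0" and b: "0 < \<beta>" and p: "det S * \<beta> ^ q = 1"
      using a s by (auto simp: active_state_def spd_def)
    show S1: "S = 1\<^sub>m 0" using S by (intro eq_matI) auto
    have "\<beta> ^ q = 1 ^ q" using p by (simp add: S1)
    then show "\<beta> = 1" by (rule power_eq_imp_eq_base) (use b q in auto)
  qed
  have W: "Wa_of A B F (1\<^sub>m 0) 1 \<in> carrier_mat 0 0" using Wa_sym[of "1\<^sub>m 0" 1] s spd_one[of 0] by simp
  have R: "Ra22_of A B F (1\<^sub>m 0) \<in> carrier_mat 0 0" using Ra22_carrier[of "1\<^sub>m 0"] s spd_one[of 0] by simp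
  have "wc_of A B F (1\<^sub>m 0) 1 = 0" using R q by (simp add: wc_of_def tau_of_def s mat_trace_def)
  then have "res_at 0 = 0" using W by (simp add: residual_sq_def s frob_norm_def)
  then have d0: "d_AI (Phi A B F (full_iter A B F 0)) (canonical_controller A B) \<le> 0"
    using stopping_test[of 0 0] by simp
  from fb.minimiser_exists obtain \<Sigma>' where min: "fb.minimiser \<Sigma>'" by (auto simp: fb.minimiser_def)
  have can: "canonical_controller A B \<in> spd d"
    unfolding canonical[OF min] using min by (intro Phi_spd) (auto simp: fb.minimiser_def unit_spd_def)
  have P: "Phi A B F (full_iter A B F 0) \<in> spd d" using Phi_spd full_iter_unit[of 0] by (auto simp: unit_spd_def)
  have "canonical_controller A B = Phi A B F (full_iter A B F 0)"
    using d_AI_eq_0[OF P can] d0 d_AI_nonneg[of "Phi A B F (full_iter A B F 0)" "canonical_controller A B"] by auto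
  also have "\<dots> = E * H_of A B F (1\<^sub>m 0) * transpose_mat E + \<rho> \<cdot>\<^sub>m (1\<^sub>m d - E * transpose_mat E)"
    unfolding Phi_iter by (simp add: s)
  also have "H_of A B F (1\<^sub>m 0) = M"
  proof -
    have "La = 1\<^sub>m m" using Ta_carrier s unfolding La_of_def by (intro eq_matI) (auto simp: unit_lower_def)
    moreover have "Qa_of A B F (1\<^sub>m 0) = M" unfolding Qa_of_def by (rule eq_matI) (auto simp: block_diag_index)
    ultimately show ?thesis using spdD(1)[OF M_spd] by (simp add: H_of_def)
  qed
  finally show "canonical_controller A B = E * M * transpose_mat E + \<rho> \<cdot>\<^sub>m (1\<^sub>m d - E * transpose_mat E)" .
qed

lemma chi0_pos: "0 < D0 \<Longrightarrow> 0 < chi0_of A B F"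
  using L0_gt_1 by (simp add: chi0_of_def)

text \<open>Taking logarithms in the linear rate bounds the number of steps before the test succeeds.\<close>

lemma iterations_before_stop:
  assumes D: "0 < D0" and eps: "0 < \<epsilon>" and run: "\<And>j. j < k \<Longrightarrow> \<epsilon>\<^sup>2 < res_at j"
  shows "real k \<le> 1 + 2 * (1 / chi0_of A B F * max 0 (ln (sqrt L0 * D0 / \<epsilon>)))"
proof (cases k)
  case 0
  then show ?thesis using chi0_pos[OF D] by simp
next
  case (Suc j)
  have L: "1 < L0" by (rule L0_gt_1[OF D])
  then have l: "0 < 1 - 1 / L0" by simp
  have "\<epsilon>\<^sup>2 < L0 * (1 - 1 / L0) ^ j * D0\<^sup>2"
    using run[of j] full_iter_rate[of j] Suc unfolding residual_sq_iter by simp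
  then have "ln (\<epsilon>\<^sup>2) < ln (L0 * (1 - 1 / L0) ^ j * D0\<^sup>2)" using eps by (subst ln_less_cancel_iff) (auto intro: less_trans[rotated])
  also have "\<dots> = ln L0 + real j * ln (1 - 1 / L0) + 2 * ln D0"
    using L l D by (simp add: ln_mult_pos ln_realpow)
  finally have "real j * chi0_of A B F < ln L0 + 2 * ln D0 - 2 * ln \<epsilon>"
    using eps by (simp add: chi0_of_def ln_realpow)
  also have "\<dots> = 2 * ln (sqrt L0 * D0 / \<epsilon>)"
    using L D eps by (simp add: ln_mult_pos ln_div ln_sqrt)
  also have "\<dots> \<le> 2 * max 0 (ln (sqrt L0 * D0 / \<epsilon>))" by simp
  finally have "real j < 2 * max 0 (ln (sqrt L0 * D0 / \<epsilon>)) / chi0_of A B F"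
    using chi0_pos[OF D] by (simp add: pos_less_divide_eq)
  then show ?thesis using Suc by simp
qed

lemma first_stop:
  assumes D: "0 < D0" and eps: "0 < \<epsilon>"
  obtains k where "res_at k \<le> \<epsilon>\<^sup>2" "\<And>j. j < k \<Longrightarrow> \<epsilon>\<^sup>2 < res_at j"
    "real k \<le> 1 + 2 * (1 / chi0_of A B F * max 0 (ln (sqrt L0 * D0 / \<epsilon>)))"
proof -
  have ex: "\<exists>k. res_at k \<le> \<epsilon>\<^sup>2"
  proof (rule ccontr)
    assume "\<not> ?thesis"
    then have run: "\<epsilon>\<^sup>2 < res_at j" for j by (simp add: not_le)
    obtain k :: nat where "1 + 2 * (1 / chi0_of A B F * max 0 (ln (sqrt L0 * D0 / \<epsilon>))) < real k"
      using reals_Archimedean2 by blast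
    with iterations_before_stop[OF D eps run, of k] show False by linarith
  qed
  define k where "k = (LEAST k. res_at k \<le> \<epsilon>\<^sup>2)"
  have "res_at k \<le> \<epsilon>\<^sup>2" unfolding k_def by (rule LeastI_ex[OF ex])
  moreover have run: "\<epsilon>\<^sup>2 < res_at j" if "j < k" for j
    using not_less_Least[OF that[unfolded k_def]] by simp
  ultimately show thesis using that iterations_before_stop[OF D eps run] by blast
qed

end

section \<open>Straight-line programs\<close>

type_synonym line = "reg \<times> op"

fun prog :: "line list \<Rightarrow> com" where
  "prog [] = Assign reg_y (Copy reg_y)"
| "prog [(i, f)] = Assign i f"
| "prog ((i, f) # l # p) = Seq (Assign i f) (prog (l # p))"

fun after :: "line list \<Rightarrow> store \<Rightarrow> store" where
  "after [] \<sigma> = \<sigma>"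
| "after ((i, f) # p) \<sigma> = after p (\<sigma>(i := op_val \<sigma> f))"

fun safe :: "nat \<Rightarrow> nat \<Rightarrow> line list \<Rightarrow> store \<Rightarrow> bool" where
  "safe b e [] \<sigma> = True"
| "safe b e ((i, f) # p) \<sigma> \<longleftrightarrow>
     op_ok \<sigma> f \<and> op_cost \<sigma> f \<le> b \<and> entries (op_val \<sigma> f) \<le> e \<and> safe b e p (\<sigma>(i := op_val \<sigma> f))"

definition held :: "nat \<Rightarrow> nat \<Rightarrow> store \<Rightarrow> bool" where
  "held N e \<sigma> \<longleftrightarrow> (\<forall>i. entries (\<sigma> i) \<le> e) \<and> (\<forall>i\<ge>N. entries (\<sigma> i) = 0)"

lemma words_le:
  assumes "held N e \<sigma>" shows "words \<sigma> \<le> N * e"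
proof -
  have "{i. entries (\<sigma> i) \<noteq> 0} \<subseteq> {..<N}" using assms unfolding held_def by (metis (mono_tags) lessThan_iff mem_Collect_eq not_le subsetI)
  then have "words \<sigma> \<le> (\<Sum>i<N. entries (\<sigma> i))" unfolding words_def by (intro sum_mono2) auto
  also have "\<dots> \<le> (\<Sum>i<N. e)" using assms by (intro sum_mono) (auto simp: held_def)
  finally show ?thesis by simp
qed

lemma exec_prog:
  assumes "p \<noteq> []" "safe b e p \<sigma>"
  shows "\<exists>t w. exec (prog p) \<sigma> t w (after p \<sigma>) \<and> t \<le> length p * b \<and>
    (held N e \<sigma> \<and> (\<forall>l\<in>set p. fst l < N) \<longrightarrow> w \<le> N * e \<and> held N e (after p \<sigma>))"
  using assms
proof (induction p arbitrary: \<sigma> rule: prog.induct)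
  case 1
  then show ?case by simp
next
  case (2 i f)
  let ?s = "\<sigma>(i := op_val \<sigma> f)"
  have x: "exec (Assign i f) \<sigma> (op_cost \<sigma> f) (max (words \<sigma>) (words ?s)) ?s"
    using 2 by (intro exec.Assign) auto
  have "held N e \<sigma> \<and> i < N \<longrightarrow> held N e ?s" using 2 by (auto simp: held_def)
  then have "held N e \<sigma> \<and> i < N \<longrightarrow> max (words \<sigma>) (words ?s) \<le> N * e \<and> held N e ?s"
    using words_le[of N e] by auto
  then show ?case
    using x 2 by (intro exI[of _ "op_cost \<sigma> f"] exI[of _ "max (words \<sigma>) (words ?s)"]) (auto simp del: fun_upd_apply)
next
  case (3 i f l p)
  let ?s = "\<sigma>(i := op_val \<sigma> f)"
  have x: "exec (Assign i f) \<sigma> (op_cost \<sigma> f) (max (words \<sigma>) (words ?s)) ?s"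
    using 3 by (intro exec.Assign) auto
  obtain t w where y: "exec (prog (l # p)) ?s t w (after (l # p) ?s)" "t \<le> length (l # p) * b"
      "held N e ?s \<and> (\<forall>l\<in>set (l # p). fst l < N) \<longrightarrow> w \<le> N * e \<and> held N e (after (l # p) ?s)"
    using 3(1)[of ?s] 3(3) by (auto simp del: fun_upd_apply)
  have "held N e \<sigma> \<and> i < N \<longrightarrow> held N e ?s" using 3 by (auto simp: held_def)
  then have h: "held N e \<sigma> \<and> i < N \<longrightarrow> max (words \<sigma>) (words ?s) \<le> N * e \<and> held N e ?s"
    using words_le[of N e] by auto
  have "op_cost \<sigma> f \<le> b" using 3(3) by simp
  then show ?case
    using exec.Seq[OF x y(1)] y(2,3) h
    by (intro exI[of _ "op_cost \<sigma> f + t"] exI[of _ "max (max (words \<sigma>) (words ?s)) w"]) (auto simp del: fun_upd_apply)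
qed

lemma after_append: "after (p @ p') \<sigma> = after p' (after p \<sigma>)"
  by (induction p arbitrary: \<sigma>) auto

lemma after_other: "i \<notin> fst ` set p \<Longrightarrow> after p \<sigma> i = \<sigma> i"
  by (induction p arbitrary: \<sigma>) auto

text \<open>A matrix fits if one side is at most \<open>R\<close> and the other at most \<open>D\<close>. A product of two matrices
  that fit costs at most \<open>1 + 2 D R\<^sup>2\<close> provided that the result fits as well: two of its three
  dimensions are then at most \<open>R\<close>. The large dimension thus enters the cost only linearly.\<close>

definition fits :: "nat \<Rightarrow> nat \<Rightarrow> real mat \<Rightarrow> bool" where
  "fits D R X \<longleftrightarrow> dim_row X \<le> D \<and> dim_col X \<le> R \<or> dim_row X \<le> R \<and> dim_col X \<le> D"

fun operands :: "op \<Rightarrow> reg list" where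
  "operands (Times i j) = [i, j]"
| "operands (Trace i) = [i]"
| "operands (Apply f i) = [i]"
| "operands (EigVecs i) = [i]"
| "operands (EigVals i) = [i]"
| "operands (SelCols i j) = [i]"
| "operands f = []"

fun fit :: "nat \<Rightarrow> nat \<Rightarrow> line list \<Rightarrow> store \<Rightarrow> bool" where
  "fit D R [] \<sigma> = True"
| "fit D R ((i, f) # p) \<sigma> \<longleftrightarrow>
     op_ok \<sigma> f \<and> (\<forall>j\<in>set (operands f). fits D R (\<sigma> j)) \<and> fits D R (op_val \<sigma> f) \<and>
     fit D R p (\<sigma>(i := op_val \<sigma> f))"

lemma fit_append: "fit D R (p @ p') \<sigma> \<longleftrightarrow> fit D R p \<sigma> \<and> fit D R p' (after p \<sigma>)"
  by (induction p arbitrary: \<sigma>) auto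

lemma entries_fits: "fits D R X \<Longrightarrow> entries X \<le> D * R"
proof -
  assume "fits D R X"
  then consider "dim_row X \<le> D" "dim_col X \<le> R" | "dim_col X \<le> D" "dim_row X \<le> R" by (auto simp: fits_def)
  then show ?thesis
  proof cases
    case 1 then show ?thesis unfolding entries_def by (rule mult_le_mono)
  next
    case 2
    from mult_le_mono[OF this] show ?thesis unfolding entries_def by (simp add: mult.commute)
  qed
qed

lemma op_cost_fits:
  assumes ok: "op_ok \<sigma> f" and arg: "\<forall>j\<in>set (operands f). fits D R (\<sigma> j)" and val: "fits D R (op_val \<sigma> f)"
    and RD: "1 \<le> R" "R \<le> D"
  shows "op_cost \<sigma> f \<le> 1 + 2 * (D * R * R)"
proof -
  have D: "D * R \<le> D * R * R" "D \<le> D * R" using RD by simp_all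
  have e: "1 + entries (op_val \<sigma> f) \<le> 1 + 2 * (D * R * R)" using entries_fits[OF val] D by linarith
  have cube: "k ^ 3 \<le> D * R * R" if "k \<le> R" for k
    using mult_le_mono[OF mult_le_mono[OF order.trans[OF that RD(2)] that] that] by (simp add: power3_eq_cube)
  have sq: "dim_row (\<sigma> i) \<le> R" if "fits D R (\<sigma> i)" "square_mat (\<sigma> i)" for i
    using that RD by (auto simp: fits_def)
  show ?thesis
  proof (cases f)
    case (Times i j)
    define a b c where "a = dim_row (\<sigma> i)" and "b = dim_col (\<sigma> i)" and "c = dim_col (\<sigma> j)"
    have "a \<le> D \<and> b \<le> R \<or> a \<le> R \<and> b \<le> D" "b \<le> D \<and> c \<le> R \<or> b \<le> R \<and> c \<le> D" "a \<le> D \<and> c \<le> R \<or> a \<le> R \<and> c \<le> D"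
      using ok arg val by (auto simp: Times fits_def a_def b_def c_def)
    then consider "a \<le> D" "b \<le> R" "c \<le> R" | "b \<le> D" "a \<le> R" "c \<le> R" | "c \<le> D" "a \<le> R" "b \<le> R"
      using RD by linarith
    then have "a * b * c \<le> D * R * R"
    proof cases
      case 1 then show ?thesis by (intro mult_le_mono)
    next
      case 2
      then have "b * a * c \<le> D * R * R" by (intro mult_le_mono)
      then show ?thesis by (simp add: mult.commute)
    next
      case 3
      then have "c * a * b \<le> D * R * R" by (intro mult_le_mono)
      then show ?thesis by (simp add: ac_simps)
    qed
    then have "2 * (a * b * c) \<le> 2 * (D * R * R)" by simp
    moreover have "op_cost \<sigma> f = 1 + 2 * (a * b * c)" by (simp add: Times a_def b_def c_def)
    ultimately show ?thesis by linarith
  next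
    case (Trace i)
    then have "dim_row (\<sigma> i) \<le> R" using ok arg sq by auto
    then have "dim_row (\<sigma> i) \<le> 2 * (D * R * R)" using RD D by linarith
    then show ?thesis by (simp add: Trace)
  next
    case (Apply g i)
    then have "dim_row (\<sigma> i) \<le> R" using ok arg sq by (auto simp: sym_mat_def)
    from cube[OF this] show ?thesis by (simp add: Apply)
  next
    case (EigVecs i)
    then have "dim_row (\<sigma> i) \<le> R" using ok arg sq by (auto simp: sym_mat_def)
    from cube[OF this] show ?thesis by (simp add: EigVecs)
  next
    case (EigVals i)
    then have "dim_row (\<sigma> i) \<le> R" using ok arg sq by (auto simp: sym_mat_def)
    from cube[OF this] show ?thesis by (simp add: EigVals)
  next
    case (SelCols i j)
    then have "fits D R (\<sigma> i)" using arg by simp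
    then have "entries (\<sigma> i) \<le> D * R" "dim_col (\<sigma> i) \<le> D" using entries_fits RD by (auto simp: fits_def)
    then have "dim_col (\<sigma> i) + entries (\<sigma> i) \<le> 2 * (D * R * R)" using D by linarith
    then show ?thesis by (simp add: SelCols)
  qed (use e in simp_all)
qed

lemma fit_safe: "1 \<le> R \<Longrightarrow> R \<le> D \<Longrightarrow> fit D R p \<sigma> \<Longrightarrow> safe (1 + 2 * (D * R * R)) (D * R) p \<sigma>"
proof (induction p arbitrary: \<sigma>)
  case (Cons l p)
  obtain i f where l: "l = (i, f)" by fastforce
  have "op_cost \<sigma> f \<le> 1 + 2 * (D * R * R)" using op_cost_fits[of \<sigma> f D R] Cons.prems by (auto simp: l)
  then show ?case using Cons by (auto simp: l entries_fits)
qed simp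

section \<open>Scalars and matrix functions as instructions\<close>

lemma scal_dims [simp]: "dim_row (scal x) = 1" "dim_col (scal x) = 1" "scal x \<in> carrier_mat 1 1"
  "scal x \<in> carrier_mat (Suc 0) (Suc 0)" "scal x $$ (0, 0) = x"
  by (auto simp: scal_def)

lemma scal_arith [simp]: "scal x + scal y = scal (x + y)" "scal x - scal y = scal (x - y)"
    "scal x * scal y = scal (x * y)" "mat_trace (scal x) = x"
  by (auto intro!: eq_matI simp: scal_def scalar_prod_def mat_trace_def)

lemma scal_eq_smult: "scal x = x \<cdot>\<^sub>m 1\<^sub>m 1"
  by (rule eq_matI) (auto simp: scal_def)

lemma spectral_fun_scal [simp]: "spectral_fun f (scal x) = scal (f x)"
  by (simp add: scal_eq_smult spectral_fun_scalar)

lemma eigenvalue_scal: "eigenvalue (scal x) y \<Longrightarrow> y = x"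
proof -
  assume "eigenvalue (scal x) y"
  then obtain v where v: "v \<in> carrier_vec 1" "v \<noteq> 0\<^sub>v 1" "scal x *\<^sub>v v = y \<cdot>\<^sub>v v"
    unfolding eigenvalue_def eigenvector_def by auto
  have "x * v $ 0 = y * v $ 0"
    using arg_cong[OF v(3), of "\<lambda>u. u $ 0"] v(1) by (simp add: scal_def scalar_prod_def)
  moreover have "v $ 0 \<noteq> 0" using v(1,2) by (metis eq_vecI carrier_vecD index_zero_vec less_one)
  ultimately show "y = x" by simp
qed

lemma apply_scal_ok: "\<sigma> i = scal x \<Longrightarrow> x \<in> efun_dom f \<Longrightarrow> op_ok \<sigma> (Apply f i)"
proof -
  assume i: "\<sigma> i = scal x" and x: "x \<in> efun_dom f"
  have "transpose_mat (scal x) = scal x" by (rule eq_matI) (auto simp: scal_def)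
  then have "sym_mat (scal x)" by (simp add: sym_mat_def)
  moreover have "\<forall>y. eigenvalue (scal x) y \<longrightarrow> y \<in> efun_dom f" using eigenvalue_scal[of x] x by blast
  ultimately show "op_ok \<sigma> (Apply f i)" by (simp add: i)
qed

lemma eigenvalue_spd: "P \<in> spd k \<Longrightarrow> eigenvalue P x \<Longrightarrow> 0 < x"
proof -
  assume P: "P \<in> spd k" and x: "eigenvalue P x"
  note c = spdD[OF P]
  from x obtain v where v: "v \<in> carrier_vec k" "v \<noteq> 0\<^sub>v k" "P *\<^sub>v v = x \<cdot>\<^sub>v v"
    unfolding eigenvalue_def eigenvector_def carrier_matD(1)[OF c(1)] by blast
  have "0 < v \<bullet> (P *\<^sub>v v)" using P v(1,2) unfolding spd_def by blast
  then have "0 < x * (v \<bullet> v)" using v(1) by (simp add: v(3))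
  moreover have "0 \<le> v \<bullet> v" by (simp add: scalar_prod_def sum_nonneg)
  ultimately show "0 < x" by (simp add: zero_less_mult_iff)
qed

lemma apply_spd_ok: "P \<in> spd k \<Longrightarrow> \<sigma> i = P \<Longrightarrow> op_ok \<sigma> (Apply f i)"
proof -
  assume P: "P \<in> spd k" and i: "\<sigma> i = P"
  have "x \<in> efun_dom f" if "0 < x" for x using that by (cases f) auto
  then have "\<forall>y. eigenvalue P y \<longrightarrow> y \<in> efun_dom f" using eigenvalue_spd[OF P] by blast
  moreover have "sym_mat P" using spdD[OF P] by (simp add: sym_mat_def)
  ultimately show "op_ok \<sigma> (Apply f i)" by (simp add: i)
qed

lemma apply_exp_ok: "X \<in> carrier_mat k k \<Longrightarrow> transpose_mat X = X \<Longrightarrow> \<sigma> i = X \<Longrightarrow> op_ok \<sigma> (Apply EExp i)"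
  by (simp add: sym_mat_def)

lemma mat_isqrt_inverse:
  assumes "P \<in> spd k" shows "spectral_fun inverse (mat_sqrt P) = mat_isqrt P"
  unfolding mat_sqrt_def mat_isqrt_def spectral_fun_compose[OF spdD[OF assms]] by (simp add: divide_inverse)

lemma trace_gram: "mat_trace (transpose_mat X * X) = (frob_norm X)\<^sup>2"
proof -
  have "mat_trace (transpose_mat X * X) = (\<Sum>j<dim_col X. \<Sum>i<dim_row X. X $$ (i, j) * X $$ (i, j))"
    by (simp add: mat_trace_def scalar_prod_def lessThan_atLeast0)
  also have "\<dots> = frob X X" unfolding frob_def by (rule sum.swap)
  finally show ?thesis by (simp add: frob_norm_sq)
qed

section \<open>One evaluation of the residual\<close>

definition ev_log :: "line list" where
  "ev_log = [(14, Times 7 11), (60, Scale 7 10), (61, Zeros 4 10), (62, Zeros 10 4), (63, Blocks 4 61 62 60),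
    (64, Apply ESqrt 63), (65, Apply EInv 64), (66, Times 65 6), (67, Times 66 65), (68, Apply ELn 67),
    (69, LowerRight 68 4)]"

definition ev_tau :: "line list" where
  "ev_tau = [(70, Apply ELn 14), (71, IConst 0), (72, Minus 71 70), (73, NRows 3), (74, NCols 3),
    (75, Minus 73 74), (76, NRows 10), (77, Plus 76 75), (78, Apply EInv 77), (79, Trace 69),
    (80, Times 75 72), (81, Plus 79 80), (82, Times 81 78)]"

definition ev_res :: "line list" where
  "ev_res = [(83, Eye 10), (84, Scale 82 83), (85, Minus 69 84), (86, Minus 72 82), (87, Transp 85),
    (88, Times 87 85), (89, Trace 88), (90, Times 86 86), (91, Times 75 90), (12, Plus 89 91)]"

definition ev_H :: "line list" where
  "ev_H = [(92, Times 5 63), (93, Transp 5), (13, Times 92 93)]"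

definition eval_prog :: "line list" where
  "eval_prog = ev_log @ ev_tau @ ev_res @ ev_H"

lemma lower_right_dims: "dim_row (lower_right k X) = dim_row X - k" "dim_col (lower_right k X) = dim_col X - k"
  by (simp_all add: lower_right_def)

lemma congruence_spd: "P \<in> spd k \<Longrightarrow> X \<in> spd k \<Longrightarrow> mat_isqrt P * X * mat_isqrt P \<in> spd k"
  using spd_congruence_invertible[of X k "mat_isqrt P" "mat_sqrt P"] mat_sqrt_isqrt[of P k]
    spdD[of "mat_isqrt P" k] spdD[of "mat_sqrt P" k] by simp

context active_setting
begin

lemma ev_log_correct:
  assumes S: "S \<in> spd s" and \<beta>: "0 < \<beta>" and RD: "m + s \<le> R" "R \<le> D"
    and reg: "\<sigma> 4 = M" "\<sigma> 6 = R0a" "\<sigma> 7 = scal \<rho>" "\<sigma> 10 = S" "\<sigma> 11 = scal \<beta>"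
  shows "fit D R ev_log \<sigma>" "after ev_log \<sigma> 14 = scal (\<rho> * \<beta>)" "after ev_log \<sigma> 63 = Qa_of A B F S"
    "after ev_log \<sigma> 68 = rel_log (Qa_of A B F S) R0a" "after ev_log \<sigma> 69 = Ra22_of A B F S"
proof -
  define QA where "QA = Qa_of A B F S"
  define SQ where "SQ = mat_sqrt QA"
  define IQ where "IQ = mat_isqrt QA"
  define X where "X = IQ * R0a * IQ"
  define Y where "Y = rel_log QA R0a"
  have Q: "QA \<in> spd (m + s)" unfolding QA_def by (rule Qa_spd[OF S])
  have SQ: "SQ \<in> spd (m + s)" and IQ: "IQ \<in> spd (m + s)" unfolding SQ_def IQ_def by (rule mat_sqrt_isqrt[OF Q])+
  have X: "X \<in> spd (m + s)" unfolding X_def IQ_def by (rule congruence_spd[OF Q R0a_spd])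
  have Y: "Y \<in> carrier_mat (m + s) (m + s)" unfolding Y_def by (rule rel_log_carrier[OF Q R0a_spd])
  have blk: "four_block_mat M (0\<^sub>m m s) (0\<^sub>m s m) (\<rho> \<cdot>\<^sub>m S) = QA"
    using spdD(1)[OF M_spd] spdD(1)[OF S] by (simp add: QA_def Qa_of_def block_diag_def)
  have v: "spectral_fun sqrt QA = SQ" "spectral_fun inverse SQ = IQ" "IQ * R0a * IQ = X" "spectral_fun ln X = Y"
    using mat_isqrt_inverse[OF Q] by (simp_all add: SQ_def IQ_def mat_sqrt_def X_def Y_def rel_log_def mat_log_def)
  have Y22: "lower_right m Y = Ra22_of A B F S" by (simp add: Y_def QA_def Ra22_of_def)
  note c = dim_spd[OF M_spd] dim_spd[OF S] dim_spd[OF Q] dim_spd[OF SQ] dim_spd[OF IQ] dim_spd[OF X]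
    carrier_matD[OF Y] dim_spd[OF R0a_spd] carrier_matD[OF Ra22_carrier[OF S]]
  note ap = apply_spd_ok[OF Q] apply_spd_ok[OF SQ] apply_spd_ok[OF X]
  have le: "m \<le> R" "s \<le> R" "Suc 0 \<le> R" "m \<le> D" "s \<le> D" "Suc 0 \<le> D" "m + s \<le> D" using RD dims(1) by auto
  show "fit D R ev_log \<sigma>" "after ev_log \<sigma> 14 = scal (\<rho> * \<beta>)" "after ev_log \<sigma> 63 = Qa_of A B F S"
    "after ev_log \<sigma> 68 = rel_log (Qa_of A B F S) R0a" "after ev_log \<sigma> 69 = Ra22_of A B F S"
    unfolding QA_def[symmetric] Y_def[symmetric]
    by (simp_all add: ev_log_def reg c blk v Y22 ap fits_def RD le lower_right_dims del: op_ok.simps(6))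
qed

lemma ev_tau_correct:
  assumes S: "S \<in> spd s" and \<beta>: "0 < \<beta>" and RD: "m + s \<le> R" "R \<le> D"
    and reg: "\<sigma> 3 = E" "\<sigma> 10 = S" "\<sigma> 14 = scal (\<rho> * \<beta>)" "\<sigma> 69 = Ra22_of A B F S"
  shows "fit D R ev_tau \<sigma>" "after ev_tau \<sigma> 71 = scal 0" "after ev_tau \<sigma> 72 = scal (rc_of A B F \<beta>)"
    "after ev_tau \<sigma> 75 = scal (real q)" "after ev_tau \<sigma> 82 = scal (tau_of A B F S \<beta>)"
proof -
  have le: "s \<le> R" "Suc 0 \<le> R" "s \<le> D" "Suc 0 \<le> D" using RD dims(1) by auto
  note c = dim_spd[OF S] carrier_matD[OF Ra22_carrier[OF S]] carrier_matD[OF frame_carriers(7)]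
  have pos: "\<rho> * \<beta> \<noteq> 0" "0 < \<rho> * \<beta>" "real s + real q \<noteq> 0" using rho(1) \<beta> dims by (auto simp: zero_less_mult_iff)
  have q: "real d - (real m + real s) = real q" using dims by linarith
  have ok: "\<sigma>' i = scal x \<Longrightarrow> 0 < x \<Longrightarrow> op_ok \<sigma>' (Apply ELn i)" "\<sigma>' i = scal x \<Longrightarrow> x \<noteq> 0 \<Longrightarrow> op_ok \<sigma>' (Apply EInv i)" for \<sigma>' i x
    by (auto intro: apply_scal_ok simp del: op_ok.simps)
  show "fit D R ev_tau \<sigma>" "after ev_tau \<sigma> 71 = scal 0" "after ev_tau \<sigma> 72 = scal (rc_of A B F \<beta>)"
    "after ev_tau \<sigma> 75 = scal (real q)" "after ev_tau \<sigma> 82 = scal (tau_of A B F S \<beta>)"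
    using pos(2)
    by (simp_all add: ev_tau_def reg c fits_def le q pos ok rc_of_def tau_of_def divide_inverse del: op_ok.simps(6))
qed

lemma ev_res_correct:
  assumes S: "S \<in> spd s" and RD: "m + s \<le> R" "R \<le> D"
    and reg: "\<sigma> 10 = S" "\<sigma> 69 = Ra22_of A B F S" "\<sigma> 72 = scal (rc_of A B F \<beta>)" "\<sigma> 75 = scal (real q)"
      "\<sigma> 82 = scal (tau_of A B F S \<beta>)"
  shows "fit D R ev_res \<sigma>" "after ev_res \<sigma> 85 = Wa_of A B F S \<beta>" "after ev_res \<sigma> 86 = scal (wc_of A B F S \<beta>)"
    "after ev_res \<sigma> 12 = scal (residual_sq A B F S \<beta>)"
proof -
  have le: "s \<le> R" "Suc 0 \<le> R" "s \<le> D" "Suc 0 \<le> D" using RD dims(1) by auto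
  note W = conjunct1[OF Wa_sym[OF S, of \<beta>]]
  note c = dim_spd[OF S] carrier_matD[OF Ra22_carrier[OF S]] carrier_matD[OF W]
  have v: "Ra22_of A B F S - tau_of A B F S \<beta> \<cdot>\<^sub>m 1\<^sub>m s = Wa_of A B F S \<beta>" "rc_of A B F \<beta> - tau_of A B F S \<beta> = wc_of A B F S \<beta>"
    by (simp_all add: Wa_of_def wc_of_def)
  show "fit D R ev_res \<sigma>" "after ev_res \<sigma> 85 = Wa_of A B F S \<beta>" "after ev_res \<sigma> 86 = scal (wc_of A B F S \<beta>)"
    "after ev_res \<sigma> 12 = scal (residual_sq A B F S \<beta>)"
    by (simp_all add: ev_res_def reg c v fits_def le trace_gram residual_sq_def power2_eq_square[of "wc_of A B F S \<beta>"])
qed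

lemma ev_H_correct:
  assumes S: "S \<in> spd s" and RD: "m + s \<le> R" "R \<le> D"
    and reg: "\<sigma> 5 = La" "\<sigma> 63 = Qa_of A B F S"
  shows "fit D R ev_H \<sigma>" "after ev_H \<sigma> 13 = H_of A B F S"
proof -
  have le: "m + s \<le> D" using RD by auto
  show "fit D R ev_H \<sigma>" "after ev_H \<sigma> 13 = H_of A B F S"
    by (simp_all add: ev_H_def reg carrier_matD[OF La_carrier] dim_spd[OF Qa_spd[OF S]] fits_def le RD H_of_def)
qed

lemma eval_correct:
  assumes S: "S \<in> spd s" and \<beta>: "0 < \<beta>" and RD: "m + s \<le> R" "R \<le> D"
    and reg: "\<sigma> 3 = E" "\<sigma> 4 = M" "\<sigma> 5 = La" "\<sigma> 6 = R0a" "\<sigma> 7 = scal \<rho>" "\<sigma> 10 = S" "\<sigma> 11 = scal \<beta>"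
  defines "\<sigma>' \<equiv> after eval_prog \<sigma>"
  shows "fit D R eval_prog \<sigma>"
    and "\<sigma>' 12 = scal (residual_sq A B F S \<beta>)" "\<sigma>' 13 = H_of A B F S" "\<sigma>' 14 = scal (\<rho> * \<beta>)"
    and "\<sigma>' 68 = rel_log (Qa_of A B F S) R0a" "\<sigma>' 71 = scal 0" "\<sigma>' 72 = scal (rc_of A B F \<beta>)"
      "\<sigma>' 75 = scal (real q)" "\<sigma>' 85 = Wa_of A B F S \<beta>" "\<sigma>' 86 = scal (wc_of A B F S \<beta>)"
    and "\<And>i. i \<notin> {12, 13, 14} \<Longrightarrow> i < 60 \<Longrightarrow> \<sigma>' i = \<sigma> i"
proof -
  define \<sigma>1 where "\<sigma>1 = after ev_log \<sigma>"
  define \<sigma>2 where "\<sigma>2 = after ev_tau \<sigma>1"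
  define \<sigma>3 where "\<sigma>3 = after ev_res \<sigma>2"
  have s': "\<sigma>' = after ev_H \<sigma>3"
    by (simp add: \<sigma>'_def eval_prog_def after_append \<sigma>1_def \<sigma>2_def \<sigma>3_def)
  note 1 = ev_log_correct[OF S \<beta> RD reg(2,4-7), folded \<sigma>1_def]
  have o1: "i \<noteq> 14 \<Longrightarrow> i < 60 \<Longrightarrow> \<sigma>1 i = \<sigma> i" for i
    unfolding \<sigma>1_def by (rule after_other) (simp add: ev_log_def)
  have o2: "i < 70 \<Longrightarrow> \<sigma>2 i = \<sigma>1 i" for i
    unfolding \<sigma>2_def by (rule after_other) (simp add: ev_tau_def)
  have o3: "i \<noteq> 12 \<Longrightarrow> i < 83 \<Longrightarrow> \<sigma>3 i = \<sigma>2 i" for i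
    unfolding \<sigma>3_def by (rule after_other) (simp add: ev_res_def)
  have o4: "i \<noteq> 13 \<Longrightarrow> i < 92 \<Longrightarrow> \<sigma>' i = \<sigma>3 i" for i
    unfolding s' by (rule after_other) (simp add: ev_H_def)
  have "\<sigma>1 3 = E" "\<sigma>1 10 = S" using reg by (simp_all add: o1)
  note 2 = ev_tau_correct[OF S \<beta> RD this 1(2,5), folded \<sigma>2_def]
  have "\<sigma>2 10 = S" "\<sigma>2 69 = Ra22_of A B F S" using reg 1 by (simp_all add: o1 o2)
  note 3 = ev_res_correct[OF S RD this 2(3,4,5), folded \<sigma>3_def]
  have "\<sigma>3 5 = La" "\<sigma>3 63 = Qa_of A B F S" using reg 1 by (simp_all add: o1 o2 o3)
  note 4 = ev_H_correct[OF S RD this, folded s']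
  show "fit D R eval_prog \<sigma>"
    using 1(1) 2(1) 3(1) 4(1) by (simp add: eval_prog_def fit_append after_append \<sigma>1_def \<sigma>2_def \<sigma>3_def)
  show "\<sigma>' 12 = scal (residual_sq A B F S \<beta>)" "\<sigma>' 13 = H_of A B F S" "\<sigma>' 14 = scal (\<rho> * \<beta>)"
    "\<sigma>' 68 = rel_log (Qa_of A B F S) R0a" "\<sigma>' 71 = scal 0" "\<sigma>' 72 = scal (rc_of A B F \<beta>)"
    "\<sigma>' 75 = scal (real q)" "\<sigma>' 85 = Wa_of A B F S \<beta>" "\<sigma>' 86 = scal (wc_of A B F S \<beta>)"
    using 1 2 3 4 by (simp_all add: o1 o2 o3 o4)
  show "i \<notin> {12, 13, 14} \<Longrightarrow> i < 60 \<Longrightarrow> \<sigma>' i = \<sigma> i" for i by (simp add: o1 o2 o3 o4)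
qed

end

section \<open>The iteration step and the controller application\<close>

definition update_prog :: "line list" where
  "update_prog = [(110, Apply EInv 8), (111, Scale 110 85), (112, Apply EExp 111), (113, Apply ESqrt 10),
    (114, Times 113 112), (115, Times 114 113), (116, Times 86 110), (117, Apply EExp 116),
    (11, Times 11 117), (10, Copy 115)]"

definition step_prog :: "line list" where
  "step_prog = eval_prog @ update_prog @ eval_prog"

definition app_prog :: "line list" where
  "app_prog = [(120, Transp 3), (121, Times 120 15), (122, Eye 13), (123, Scale 14 122), (124, Minus 13 123),
    (125, Times 124 121), (126, Times 3 125), (127, Scale 14 15), (16, Plus 127 126)]"

lemmas reg_defs = reg_A_def reg_B_def reg_eps_def reg_E_def reg_M_def reg_La_def reg_R0a_def reg_rho_def
  reg_L0_def reg_tol_def reg_Sig_def reg_beta_def reg_res_def reg_H_def reg_c_def reg_x_def reg_y_def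

lemma pow3: "(k::nat) * k * k = k ^ 3"
  by (simp add: power3_eq_cube)

lemma step_lengths: "length eval_prog = 37" "length step_prog = 84"
  by (simp_all add: step_prog_def eval_prog_def ev_log_def ev_tau_def ev_res_def ev_H_def update_prog_def)

lemma app_prog_length: "app_prog \<noteq> []" "length app_prog = 9"
  by (simp_all add: app_prog_def)

context active_setting
begin

lemma update_correct:
  assumes S: "S \<in> spd s" and RD: "m + s \<le> R" "R \<le> D"
    and reg: "\<sigma> 8 = scal L0" "\<sigma> 10 = S" "\<sigma> 11 = scal \<beta>" "\<sigma> 85 = Wa_of A B F S \<beta>" "\<sigma> 86 = scal (wc_of A B F S \<beta>)"
  shows "fit D R update_prog \<sigma>"
    "after update_prog \<sigma> 10 = mat_sqrt S * mat_exp ((1 / L0) \<cdot>\<^sub>m Wa_of A B F S \<beta>) * mat_sqrt S"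
    "after update_prog \<sigma> 11 = scal (\<beta> * exp (wc_of A B F S \<beta> / L0))"
proof -
  define X where "X = (1 / L0) \<cdot>\<^sub>m Wa_of A B F S \<beta>"
  have W: "Wa_of A B F S \<beta> \<in> carrier_mat s s" "transpose_mat (Wa_of A B F S \<beta>) = Wa_of A B F S \<beta>"
    using Wa_sym[OF S, of \<beta>] by auto
  have X: "X \<in> carrier_mat s s" "transpose_mat X = X"
  proof -
    show "X \<in> carrier_mat s s" using W by (simp add: X_def)
    have "transpose_mat X = (1 / L0) \<cdot>\<^sub>m transpose_mat (Wa_of A B F S \<beta>)" unfolding X_def by (rule eq_matI) auto
    then show "transpose_mat X = X" using W by (simp add: X_def)
  qed
  have XE: "mat_exp X \<in> carrier_mat s s" unfolding mat_exp_def by (rule spectral_fun_carrier[OF X])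
  have SQ: "mat_sqrt S \<in> spd s" by (rule mat_sqrt_isqrt[OF S])
  have v: "spectral_fun exp X = mat_exp X" "spectral_fun sqrt S = mat_sqrt S" "inverse L0 \<cdot>\<^sub>m Wa_of A B F S \<beta> = X"
    by (simp_all add: mat_exp_def mat_sqrt_def X_def divide_inverse)
  have ok: "\<sigma>' i = scal x \<Longrightarrow> x \<noteq> 0 \<Longrightarrow> op_ok \<sigma>' (Apply EInv i)" "\<sigma>' i = scal x \<Longrightarrow> op_ok \<sigma>' (Apply EExp i)" for \<sigma>' i x
    by (auto intro: apply_scal_ok simp del: op_ok.simps)
  have le: "s \<le> R" "Suc 0 \<le> R" "s \<le> D" "Suc 0 \<le> D" using RD dims(1) by auto
  have L: "L0 \<noteq> 0" using L0_ge_1 by auto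
  note c = dim_spd[OF S] dim_spd[OF SQ] carrier_matD[OF W(1)] carrier_matD[OF X(1)] carrier_matD[OF XE]
  show "fit D R update_prog \<sigma>"
    "after update_prog \<sigma> 10 = mat_sqrt S * mat_exp ((1 / L0) \<cdot>\<^sub>m Wa_of A B F S \<beta>) * mat_sqrt S"
    "after update_prog \<sigma> 11 = scal (\<beta> * exp (wc_of A B F S \<beta> / L0))"
    unfolding X_def[symmetric]
    by (simp_all add: update_prog_def reg c v le L ok apply_exp_ok[OF X] apply_spd_ok[OF S] fits_def divide_inverse
        del: op_ok.simps(6))
qed

lemma holds_stateD:
  assumes "holds_state A B F \<epsilon> k \<sigma>"
  shows "\<sigma> 3 = E" "\<sigma> 4 = M" "\<sigma> 5 = La" "\<sigma> 6 = R0a" "\<sigma> 7 = scal \<rho>" "\<sigma> 8 = scal L0" "\<sigma> 9 = scal (\<epsilon>\<^sup>2)"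
    "\<sigma> 10 = Sig_at k" "\<sigma> 11 = scal (beta_at k)" "\<sigma> 12 = scal (res_at k)" "\<sigma> 13 = H_of A B F (Sig_at k)"
    "\<sigma> 14 = scal (\<rho> * beta_at k)"
  using assms by (auto simp: holds_state_def reg_defs case_prod_beta)

lemma holds_stateI:
  assumes "\<sigma> 3 = E" "\<sigma> 4 = M" "\<sigma> 5 = La" "\<sigma> 6 = R0a" "\<sigma> 7 = scal \<rho>" "\<sigma> 8 = scal L0" "\<sigma> 9 = scal (\<epsilon>\<^sup>2)"
    "\<sigma> 10 = Sig_at k" "\<sigma> 11 = scal (beta_at k)" "\<sigma> 12 = scal (res_at k)" "\<sigma> 13 = H_of A B F (Sig_at k)"
    "\<sigma> 14 = scal (\<rho> * beta_at k)"
  shows "holds_state A B F \<epsilon> k \<sigma>"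
  using assms by (simp add: holds_state_def reg_defs case_prod_beta)

lemma step_correct:
  assumes st: "holds_state A B F \<epsilon> k \<sigma>"
  shows "\<exists>t w \<sigma>'. exec (prog step_prog) \<sigma> t w \<sigma>' \<and> holds_state A B F \<epsilon> (Suc k) \<sigma>' \<and> t \<le> 84 * (1 + 2 * r ^ 3)"
proof -
  note h = holds_stateD[OF st]
  define \<sigma>1 where "\<sigma>1 = after eval_prog \<sigma>"
  define \<sigma>2 where "\<sigma>2 = after update_prog \<sigma>1"
  define \<sigma>3 where "\<sigma>3 = after eval_prog \<sigma>2"
  have R: "m + s \<le> r" "r \<le> r" using dims by auto
  note 1 = eval_correct[OF Sig_at_spd beta_at_pos R h(1-5,8,9), folded \<sigma>1_def]
  have "\<sigma>1 8 = scal L0" "\<sigma>1 10 = Sig_at k" "\<sigma>1 11 = scal (beta_at k)" using h by (simp_all add: 1(11))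
  note 2 = update_correct[OF Sig_at_spd R this 1(9,10), folded \<sigma>2_def]
  have o2: "i \<noteq> 10 \<Longrightarrow> i \<noteq> 11 \<Longrightarrow> i < 110 \<Longrightarrow> \<sigma>2 i = \<sigma>1 i" for i
    unfolding \<sigma>2_def by (rule after_other) (simp add: update_prog_def)
  have S2: "\<sigma>2 10 = Sig_at (Suc k)" "\<sigma>2 11 = scal (beta_at (Suc k))"
    using 2 by (simp_all add: case_prod_beta)
  have "\<sigma>2 3 = E" "\<sigma>2 4 = M" "\<sigma>2 5 = La" "\<sigma>2 6 = R0a" "\<sigma>2 7 = scal \<rho>" using h by (simp_all add: o2 1(11))
  note 3 = eval_correct[OF Sig_at_spd beta_at_pos R this S2, folded \<sigma>3_def]
  have H: "holds_state A B F \<epsilon> (Suc k) \<sigma>3"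
  proof (rule holds_stateI)
    show "\<sigma>3 3 = E" "\<sigma>3 4 = M" "\<sigma>3 5 = La" "\<sigma>3 6 = R0a" "\<sigma>3 7 = scal \<rho>" "\<sigma>3 8 = scal L0" "\<sigma>3 9 = scal (\<epsilon>\<^sup>2)"
      using h by (simp_all add: 3(11) o2 1(11))
    show "\<sigma>3 10 = Sig_at (Suc k)" "\<sigma>3 11 = scal (beta_at (Suc k))"
      by (simp_all add: 3(11) S2 del: active_iter.simps)
  qed (rule 3)+
  have fit: "fit r r step_prog \<sigma>"
    using 1(1) 2(1) 3(1) by (simp add: step_prog_def fit_append \<sigma>1_def \<sigma>2_def \<sigma>3_def)
  have "1 \<le> r" using dims by simp
  from exec_prog[OF _ fit_safe[OF this le_refl fit]] obtain t w where
    "exec (prog step_prog) \<sigma> t w (after step_prog \<sigma>)" "t \<le> length step_prog * (1 + 2 * (r * r * r))"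
    using step_lengths(2) by (metis list.size(3) zero_neq_numeral)
  moreover have "after step_prog \<sigma> = \<sigma>3" by (simp add: step_prog_def after_append \<sigma>1_def \<sigma>2_def \<sigma>3_def)
  ultimately show ?thesis using H by (auto simp: step_lengths pow3)
qed

lemma app_correct:
  assumes st: "holds_state A B F \<epsilon> k \<sigma>" and x: "x \<in> carrier_mat d 1" "\<sigma> 15 = x"
  shows "\<exists>t w \<sigma>'. exec (prog app_prog) \<sigma> t w \<sigma>' \<and> \<sigma>' 16 = Phi A B F (full_iter A B F k) * x \<and>
    t \<le> 9 * (1 + 2 * d * r + 2 * r * r)"
proof -
  note h = holds_stateD[OF st]
  define c where "c = \<rho> * beta_at k"
  define H where "H = H_of A B F (Sig_at k)"
  define G where "G = H - c \<cdot>\<^sub>m 1\<^sub>m r"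
  note E = frame_carriers(7)
  have H: "H \<in> carrier_mat r r" unfolding H_def dims(3) by (rule H_carrier[OF Sig_at_spd])
  have G: "G \<in> carrier_mat r r" unfolding G_def by auto
  have E': "E \<in> carrier_mat d r" using E dims(3) by simp
  have reg: "\<sigma> 3 = E" "\<sigma> 13 = H" "\<sigma> 14 = scal c" using h by (simp_all add: H_def c_def)
  have "Phi A B F (full_iter A B F k) * x = (c \<cdot>\<^sub>m 1\<^sub>m d + E * (G * transpose_mat E)) * x"
    unfolding Phi_rank_update G_def H_def c_def ..
  also have "\<dots> = c \<cdot>\<^sub>m x + E * (G * (transpose_mat E * x))"
    using E' G x(1) by (simp add: distrib_dim mult_assoc_dim smult_dim)
  finally have val: "Phi A B F (full_iter A B F k) * x = c \<cdot>\<^sub>m x + E * (G * (transpose_mat E * x))" .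
  have r1: "1 \<le> r" "r \<le> d" using dims by auto
  then have "d * 1 \<le> d * r" "r * r \<le> d * r" by (intro mult_le_mono; simp)+
  then have dr: "r * r \<le> d * r + d" "r \<le> d * r + d" "d \<le> 2 * d * r + 2 * r * r" using r1(2) by linarith+
  note cs = carrier_matD[OF E'] carrier_matD[OF H] carrier_matD[OF x(1)]
  have "safe (1 + 2 * d * r + 2 * r * r) (d * r + d) app_prog \<sigma>"
    using dr x(1) by (simp add: app_prog_def reg x(2) cs entries_def mult.commute[of r d])
  from exec_prog[OF app_prog_length(1) this] obtain t w where
    "exec (prog app_prog) \<sigma> t w (after app_prog \<sigma>)" "t \<le> length app_prog * (1 + 2 * d * r + 2 * r * r)"
    by blast
  moreover have "after app_prog \<sigma> 16 = Phi A B F (full_iter A B F k) * x"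
    unfolding val by (simp add: app_prog_def reg x(2) cs G_def)
  ultimately show ?thesis unfolding app_prog_length(2) by blast
qed

end

section \<open>Preprocessing\<close>

definition pre_U :: "line list" where
  "pre_U = [(17, Transp 0), (18, Times 17 0), (19, Apply ESqrt 18), (20, Apply EInv 19), (21, Times 0 20)]"

definition pre_Y :: "line list" where
  "pre_Y = [(22, Transp 21), (23, Times 22 1), (24, Times 21 23), (25, Minus 1 24), (26, Transp 25),
    (27, Times 26 25), (28, EigVecs 27), (29, EigVals 27)]"

definition pre_V :: "line list" where
  "pre_V = [(30, SelCols 28 29), (31, Times 25 30), (32, Transp 31),
    (33, Times 32 31), (34, Apply ESqrt 33), (35, Apply EInv 34), (36, Times 31 35), (3, HCat 21 36)]"

definition pre_M :: "line list" where
  "pre_M = [(37, Times 1 20), (4, Times 22 37), (38, Apply EInv 4), (39, Transp 36), (40, Times 39 37),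
    (41, Times 40 38)]"

definition pre_L :: "line list" where
  "pre_L = [(42, Eye 4), (43, Eye 39), (44, Zeros 4 36), (5, Blocks 42 44 41 43), (45, Zeros 39 4),
    (46, Minus 45 41), (47, Blocks 42 44 46 43), (48, Transp 47), (6, Times 47 48)]"

definition pre_rho :: "line list" where
  "pre_rho = [(49, Apply ELn 4), (50, Trace 49), (51, NRows 0), (52, NCols 0), (53, Minus 51 52),
    (54, Apply EInv 53), (55, Times 50 54), (56, IConst 0), (57, Minus 56 55), (7, Apply EExp 57),
    (9, Times 2 2), (10, Eye 39), (11, IConst 1)]"

definition pre_D :: "line list" where
  "pre_D = [(94, Transp 68), (95, Times 94 68), (96, Trace 95), (97, Times 72 72), (98, Times 75 97),
    (99, Plus 96 98), (100, IConst 2), (101, Apply EInv 100), (102, Times 99 101), (103, Apply ESqrt 102)]"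

definition pre_lines :: "line list" where
  "pre_lines = pre_U @ pre_Y @ pre_V @ pre_M @ pre_L @ pre_rho @ eval_prog @ pre_D"

definition psi_lines :: "line list" where
  "psi_lines = [(104, Apply EExp 103), (105, Apply EInv 104), (106, Plus 104 105), (107, Minus 104 105),
    (108, Apply EInv 107), (109, Times 106 108), (8, Times 103 109)]"

definition pre_com :: com where
  "pre_com = Seq (prog pre_lines) (IfGreater 103 71 (prog psi_lines) (prog [(8, IConst 1)]))"

lemma eig_sys:
  assumes "S \<in> carrier_mat k k" "transpose_mat S = S"
  shows "spectral_decomposition S (fst (eig_sys S)) (snd (eig_sys S))"
proof -
  obtain X ev where "spectral_decomposition S X ev" using symmetric_spectral_theorem[OF assms] by auto
  then have "(\<lambda>(X, ev). spectral_decomposition S X ev) (X, ev)" by simp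
  from someI[of "\<lambda>(X, ev). spectral_decomposition S X ev", OF this]
  show ?thesis unfolding eig_sys_def by (simp add: case_prod_beta)
qed

lemma minv_spd: "P \<in> spd k \<Longrightarrow> minv P = spectral_fun inverse P"
proof -
  assume P: "P \<in> spd k"
  note c = spdD[OF P]
  have "P * spectral_fun inverse P = spectral_fun (\<lambda>y. y * inverse y) P"
    using spectral_fun_mult[OF c, of "\<lambda>y. y" inverse] spectral_fun_id[OF c] by simp
  also have "\<dots> = spectral_fun (\<lambda>y. 1) P" by (rule spectral_fun_cong_spd[OF P]) simp
  also have "\<dots> = 1\<^sub>m k" by (simp add: spectral_fun_const[OF c])
  finally show ?thesis by (intro minv_eqI[OF c(1) spectral_fun_carrier[OF c]])
qed

lemma pre_U_correct:
  assumes adm: "admissible A B" and reg: "\<sigma> 0 = A" and R: "dim_col A \<le> R" "R \<le> dim_row A"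
  shows "fit (dim_row A) R pre_U \<sigma>" "after pre_U \<sigma> 20 = mat_isqrt (transpose_mat A * A)"
    "after pre_U \<sigma> 21 = polar A"
proof -
  define G where "G = transpose_mat A * A"
  have G: "G \<in> spd (dim_col A)" unfolding G_def by (rule admissibleD(6)[OF adm])
  note SQ = mat_sqrt_isqrt(1,2)[OF G]
  have v: "spectral_fun sqrt G = mat_sqrt G" "spectral_fun inverse (mat_sqrt G) = mat_isqrt G"
    using mat_isqrt_inverse[OF G] by (simp_all add: mat_sqrt_def)
  have le: "dim_col A \<le> dim_row A" using R by simp
  show "fit (dim_row A) R pre_U \<sigma>" "after pre_U \<sigma> 20 = mat_isqrt (transpose_mat A * A)"
    "after pre_U \<sigma> 21 = polar A"
    unfolding polar_def G_def[symmetric]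
    by (simp_all add: pre_U_def reg G_def[symmetric] v dim_spd[OF G] dim_spd[OF SQ(1)] dim_spd[OF SQ(2)]
      apply_spd_ok[OF G] apply_spd_ok[OF SQ(1)] fits_def R le del: op_ok.simps(6))
qed

lemma pre_Y_correct:
  assumes adm: "admissible A B" and reg: "\<sigma> 1 = B" "\<sigma> 21 = polar A" and R: "dim_col A \<le> R" "R \<le> dim_row A"
  defines "Y \<equiv> residual_part A B"
  shows "fit (dim_row A) R pre_Y \<sigma>" "after pre_Y \<sigma> 22 = transpose_mat (polar A)" "after pre_Y \<sigma> 25 = Y"
    "after pre_Y \<sigma> 28 = fst (eig_sys (transpose_mat Y * Y))"
    "after pre_Y \<sigma> 29 = mat (dim_col A) 1 (\<lambda>(j, _). snd (eig_sys (transpose_mat Y * Y)) j)"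
proof -
  note a = admissibleD[OF adm]
  define U where "U = polar A"
  define S where "S = transpose_mat Y * Y"
  have U: "dim_row U = dim_row A" "dim_col U = dim_col A"
    using spdD(1)[OF mat_sqrt_isqrt(2)[OF a(6)]] by (auto simp: U_def polar_def)
  have Y: "B - U * (transpose_mat U * B) = Y" by (simp add: Y_def residual_part_def U_def)
  have Yd: "dim_row Y = dim_row A" "dim_col Y = dim_col A" using a(4) U by (auto simp: Y[symmetric])
  have S: "S \<in> carrier_mat (dim_col A) (dim_col A)" "transpose_mat S = S"
    using Yd by (auto simp: S_def transpose_mult_dim)
  have X: "fst (eig_sys S) \<in> carrier_mat (dim_col A) (dim_col A)"
    by (rule spectral_decompositionD(1)[OF eig_sys[OF S] S(1)])
  have sy: "sym_mat S" using S by (simp add: sym_mat_def)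
  have le: "dim_col A \<le> dim_row A" "Suc 0 \<le> R" and reg1: "\<sigma> (Suc 0) = B" using R a(1) reg(1) by simp_all
  show "fit (dim_row A) R pre_Y \<sigma>" "after pre_Y \<sigma> 22 = transpose_mat (polar A)" "after pre_Y \<sigma> 25 = Y"
    "after pre_Y \<sigma> 28 = fst (eig_sys (transpose_mat Y * Y))"
    "after pre_Y \<sigma> 29 = mat (dim_col A) 1 (\<lambda>(j, _). snd (eig_sys (transpose_mat Y * Y)) j)"
    unfolding U_def[symmetric] S_def[symmetric]
    by (simp_all add: pre_Y_def reg reg1 U_def[symmetric] U Y Yd carrier_matD[OF a(4)] S_def[symmetric] sy
      carrier_matD[OF S(1)] carrier_matD[OF X] fits_def R le)
qed

lemma pre_V_correct:
  assumes adm: "admissible A B"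
  defines "Y \<equiv> residual_part A B"
  assumes reg: "\<sigma> 21 = polar A" "\<sigma> 25 = Y" "\<sigma> 28 = fst (eig_sys (transpose_mat Y * Y))"
    "\<sigma> 29 = mat (dim_col A) 1 (\<lambda>(j, _). snd (eig_sys (transpose_mat Y * Y)) j)"
  shows "\<exists>F. active_frame A B F \<and> frU F = polar A \<and> frC F = mat_sqrt (transpose_mat A * A) \<and>
    fit (dim_row A) (dim_r A B) pre_V \<sigma> \<and> after pre_V \<sigma> 36 = frVa F \<and> after pre_V \<sigma> 3 = E_of F"
proof -
  note a = admissibleD[OF adm]
  define m where "m = dim_col A"
  define d where "d = dim_row A"
  have U: "polar A \<in> carrier_mat d m"
    using spdD(1)[OF mat_sqrt_isqrt(2)[OF a(6)]] a(3) unfolding polar_def m_def d_def by (intro mult_carrier_mat)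
  have Y: "Y \<in> carrier_mat d m" using U a(4) unfolding Y_def residual_part_def d_def m_def by (intro minus_carrier_mat) auto
  define S where "S = transpose_mat Y * Y"
  have S: "S \<in> carrier_mat m m" "transpose_mat S = S" using Y by (auto simp: S_def transpose_mult_dim)
  define X where "X = fst (eig_sys S)"
  define yv where "yv = mat m 1 (\<lambda>(j, _). snd (eig_sys S) j)"
  define K where "K = select_cols X yv"
  define G where "G = transpose_mat (Y * K) * (Y * K)"
  define Va where "Va = Y * K * mat_isqrt G"
  have sd: "spectral_decomposition S X (snd (eig_sys S))" unfolding X_def by (rule eig_sys[OF S])
  have Xc: "X \<in> carrier_mat m m" by (rule spectral_decompositionD(1)[OF sd S(1)])
  from orthonormal_range[OF Y sd[unfolded S_def], folded S_def, folded yv_def, folded K_def, folded G_def, folded Va_def]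
  obtain l where l: "l \<le> m" "K \<in> carrier_mat m l" "G \<in> spd l" "Va \<in> carrier_mat d l"
    "transpose_mat Va * Va = 1\<^sub>m l" "Va * transpose_mat Va * Y = Y" "Va = Y * (K * mat_isqrt G)"
    "K * mat_isqrt G \<in> carrier_mat m l" by blast
  note fe = frame_exists[OF adm l(7,8,4,5,6)[unfolded m_def d_def Y_def]]
  from fe(1) obtain Z where F: "active_frame A B \<lparr>frU = polar A, frC = mat_sqrt (transpose_mat A * A), frVa = Va, frZ = Z\<rparr>"
    by blast
  have r: "dim_r A B = m + l" using fe(2) by (simp add: m_def)
  interpret active_setting A B "\<lparr>frU = polar A, frC = mat_sqrt (transpose_mat A * A), frVa = Va, frZ = Z\<rparr>"
    by unfold_locales (rule adm, rule F)
  have rd: "m + l \<le> d" using dims r by (simp add: m_def d_def)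
  then have le: "m \<le> d" "l \<le> d" by simp_all
  note SQ = mat_sqrt_isqrt(1,2)[OF l(3)]
  have v: "spectral_fun sqrt G = mat_sqrt G" "spectral_fun inverse (mat_sqrt G) = mat_isqrt G"
    using mat_isqrt_inverse[OF l(3)] by (simp_all add: mat_sqrt_def)
  have reg': "\<sigma> 21 = polar A" "\<sigma> 25 = Y" "\<sigma> 28 = X" "\<sigma> 29 = yv"
    using reg by (simp_all add: X_def S_def yv_def m_def)
  have yv: "yv \<in> carrier_mat m 1" by (simp add: yv_def)
  have fit: "fit d (m + l) pre_V \<sigma>"
    by (simp add: pre_V_def reg' K_def[symmetric] G_def[symmetric] v Va_def[symmetric] carrier_matD[OF Y] carrier_matD[OF Xc]
      carrier_matD[OF l(2)] carrier_matD[OF U] yv[simplified] carrier_matD[OF l(4)] dim_spd[OF l(3)] dim_spd[OF SQ(1)] dim_spd[OF SQ(2)]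
      apply_spd_ok[OF l(3)] apply_spd_ok[OF SQ(1)] fits_def le del: op_ok.simps(6))
  have "after pre_V \<sigma> 36 = Va" "after pre_V \<sigma> 3 = hcat (polar A) Va"
    by (simp_all add: pre_V_def reg' K_def[symmetric] G_def[symmetric] v Va_def[symmetric])
  then show ?thesis
    using F fit unfolding r d_def by (intro exI[of _ "\<lparr>frU = polar A, frC = mat_sqrt (transpose_mat A * A), frVa = Va, frZ = Z\<rparr>"])
      (simp add: E_of_def)
qed

context active_setting
begin

lemma minv_spectral: "minv M = spectral_fun inverse M"
  by (rule minv_spd[OF M_spd])

lemma pre_M_correct:
  assumes RD: "m + s \<le> R" "R \<le> d"
    and reg: "\<sigma> 1 = B" "\<sigma> 20 = Ci" "\<sigma> 22 = transpose_mat U" "\<sigma> 36 = Va"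
  shows "fit d R pre_M \<sigma>" "after pre_M \<sigma> 4 = M" "after pre_M \<sigma> 39 = transpose_mat Va" "after pre_M \<sigma> 41 = Ta"
proof -
  define J where "J = B * Ci"
  define K where "K = minv M"
  have J: "J \<in> carrier_mat d m" using frame_carriers(2) Ci(1) unfolding J_def by (rule mult_carrier_mat)
  have K: "K \<in> carrier_mat m m" unfolding K_def by (rule minv_M(1))
  have v: "transpose_mat U * J = M" "spectral_fun inverse M = K" "B * Ci = J"
    using M_eq minv_spectral by (simp_all add: J_def K_def)
  have T: "transpose_mat Va * J * K = Ta"
    unfolding Ta_of_def J_def K_def using frame_carriers(2,5) Ci(1) by (subst assoc_mult_mat[of _ s d _ m _ m]) auto
  have le: "m \<le> R" "s \<le> R" "m \<le> d" "s \<le> d" using RD by simp_all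
  have reg1: "\<sigma> (Suc 0) = B" using reg(1) by simp
  show "fit d R pre_M \<sigma>" "after pre_M \<sigma> 4 = M" "after pre_M \<sigma> 39 = transpose_mat Va" "after pre_M \<sigma> 41 = Ta"
    by (simp_all add: pre_M_def reg reg1 v T carrier_matD[OF frame_carriers(2)] carrier_matD[OF frame_carriers(3)]
      carrier_matD[OF frame_carriers(5)] carrier_matD[OF Ci(1)] carrier_matD[OF J] carrier_matD[OF K] dim_spd[OF M_spd]
      carrier_matD[OF Ta_carrier] apply_spd_ok[OF M_spd] fits_def le RD del: op_ok.simps(6))
qed

lemma pre_L_correct:
  assumes RD: "m + s \<le> R" "R \<le> D"
    and reg: "\<sigma> 4 = M" "\<sigma> 36 = Va" "\<sigma> 39 = transpose_mat Va" "\<sigma> 41 = Ta"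
  shows "fit D R pre_L \<sigma>" "after pre_L \<sigma> 5 = La" "after pre_L \<sigma> 6 = R0a"
proof -
  have le: "m \<le> R" "s \<le> R" "m \<le> D" "s \<le> D" "m + s \<le> D" using RD by simp_all
  note c = dim_spd[OF M_spd] carrier_matD[OF frame_carriers(5)] carrier_matD[OF Ta_carrier] carrier_matD[OF La_carrier]
    carrier_matD[OF minv_La(1)]
  have neg: "0\<^sub>m s m - Ta = - Ta" using Ta_carrier by (intro eq_matI) auto
  have v: "four_block_mat (1\<^sub>m m) (0\<^sub>m m s) Ta (1\<^sub>m s) = La"
      "four_block_mat (1\<^sub>m m) (0\<^sub>m m s) (- Ta) (1\<^sub>m s) = minv La"
    using minv_unit_lower(1)[OF Ta_carrier] c by (simp_all add: La_of_def unit_lower_def)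
  show "fit D R pre_L \<sigma>" "after pre_L \<sigma> 5 = La" "after pre_L \<sigma> 6 = R0a"
    by (simp_all add: pre_L_def reg c neg v R0a_of_def fits_def le RD)
qed

lemma rho_exp: "\<rho> = exp (0 - ln (det M) * inverse (real n))"
  using det_spd_pos[OF M_spd] by (simp add: rho_of_def powr_def divide_inverse mult.commute)

lemma pre_rho_correct:
  assumes RD: "m + s \<le> R" "R \<le> D"
    and reg: "\<sigma> 0 = A" "\<sigma> 2 = scal \<epsilon>" "\<sigma> 4 = M" "\<sigma> 39 = transpose_mat Va"
  shows "fit D R pre_rho \<sigma>" "after pre_rho \<sigma> 7 = scal \<rho>" "after pre_rho \<sigma> 9 = scal (\<epsilon>\<^sup>2)"
    "after pre_rho \<sigma> 10 = 1\<^sub>m s" "after pre_rho \<sigma> 11 = scal 1"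
proof -
  have le: "m \<le> R" "s \<le> R" "m \<le> D" "s \<le> D" "Suc 0 \<le> R" "Suc 0 \<le> D" using RD dims(1) by simp_all
  have LM: "spectral_fun ln M \<in> carrier_mat m m" by (rule spectral_fun_carrier[OF spdD[OF M_spd]])
  note c = dim_spd[OF M_spd] carrier_matD[OF frame_carriers(5)] carrier_matD[OF LM]
  have tr: "mat_trace (spectral_fun ln M) = ln (det M)" using mat_trace_log[OF M_spd] by (simp add: mat_log_def)
  have n: "real d - real m = real n" "real n \<noteq> 0" using dims by linarith+
  have ok: "\<sigma>' i = scal x \<Longrightarrow> x \<noteq> 0 \<Longrightarrow> op_ok \<sigma>' (Apply EInv i)" "\<sigma>' i = scal x \<Longrightarrow> op_ok \<sigma>' (Apply EExp i)" for \<sigma>' i x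
    by (auto intro: apply_scal_ok simp del: op_ok.simps)
  show "fit D R pre_rho \<sigma>" "after pre_rho \<sigma> 7 = scal \<rho>" "after pre_rho \<sigma> 9 = scal (\<epsilon>\<^sup>2)"
    "after pre_rho \<sigma> 10 = 1\<^sub>m s" "after pre_rho \<sigma> 11 = scal 1"
    by (simp_all add: pre_rho_def reg c tr n(1) ok n(2)[simplified] apply_spd_ok[OF M_spd] fits_def le rho_exp power2_eq_square
        del: op_ok.simps(6))
qed

text \<open>The initial distance splits over the two diagonal blocks.\<close>

lemma D0_sq: "D0\<^sup>2 = (frob_norm (rel_log (Qa_of A B F (1\<^sub>m s)) R0a))\<^sup>2 + real q * (rc_of A B F 1)\<^sup>2"
proof -
  have one: "(1\<^sub>m n :: real mat) = block_diag (1\<^sub>m s) (1 \<cdot>\<^sub>m 1\<^sub>m q)"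
    using iter_invariant[of 0] by simp
  have D: "D0 = frob_norm (rel_log (QS_of A B F (1\<^sub>m n)) R0)"
    using L0_eq(2) by (simp add: point_eq d_AI_def)
  have rel: "rel_log (QS_of A B F (block_diag (1\<^sub>m s) (1 \<cdot>\<^sub>m 1\<^sub>m q))) R0
      = block_diag (rel_log (Qa_of A B F (1\<^sub>m s)) R0a) (rc_of A B F 1 \<cdot>\<^sub>m 1\<^sub>m q)"
    by (rule rel_log_block) auto
  have "frob (c \<cdot>\<^sub>m 1\<^sub>m q) (c \<cdot>\<^sub>m 1\<^sub>m q) = real q * c\<^sup>2" for c
    unfolding scalar_mat_diag frob_diag by (simp add: power2_eq_square)
  then show ?thesis
    unfolding D one rel frob_norm_sq
    using rel_log_carrier[OF Qa_spd[OF spd_one] R0a_spd] by (subst frob_block_diag[of _ "m + s" _ _ q]) auto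
qed

lemma D0_nonneg: "0 \<le> D0"
  by (simp add: D0_of_def d_AI_nonneg)

lemma pre_D_correct:
  assumes RD: "m + s \<le> R" "R \<le> D"
    and reg: "\<sigma> 68 = rel_log (Qa_of A B F (1\<^sub>m s)) R0a" "\<sigma> 72 = scal (rc_of A B F 1)" "\<sigma> 75 = scal (real q)"
  shows "fit D R pre_D \<sigma>" "after pre_D \<sigma> 103 = scal (D0 / sqrt 2)"
proof -
  define Y where "Y = rel_log (Qa_of A B F (1\<^sub>m s)) R0a"
  have Y: "Y \<in> carrier_mat (m + s) (m + s)" unfolding Y_def by (rule rel_log_carrier[OF Qa_spd[OF spd_one] R0a_spd])
  have le: "Suc 0 \<le> R" "Suc 0 \<le> D" "m + s \<le> D" using RD dims(1) by simp_all
  have ok: "\<sigma>' i = scal x \<Longrightarrow> x \<noteq> 0 \<Longrightarrow> op_ok \<sigma>' (Apply EInv i)" "\<sigma>' i = scal x \<Longrightarrow> 0 \<le> x \<Longrightarrow> op_ok \<sigma>' (Apply ESqrt i)" for \<sigma>' i x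
    by (auto intro: apply_scal_ok simp del: op_ok.simps)
  define e where "e = D0\<^sup>2"
  have v: "mat_trace (transpose_mat Y * Y) + real q * (rc_of A B F 1 * rc_of A B F 1) = e"
    unfolding e_def D0_sq trace_gram Y_def[symmetric] by (simp add: power2_eq_square)
  have e0: "0 \<le> e" by (simp add: e_def)
  have "e / 2 = (D0 / sqrt 2)\<^sup>2" by (simp add: e_def power_divide)
  then have sq: "sqrt (e / 2) = D0 / sqrt 2" using D0_nonneg by (simp only: real_sqrt_abs) simp
  have inv2: "e * inverse 2 = e / 2" by simp
  show "fit D R pre_D \<sigma>" "after pre_D \<sigma> 103 = scal (D0 / sqrt 2)"
    unfolding sq[symmetric]
    by (simp_all add: pre_D_def reg Y_def[symmetric] carrier_matD[OF Y] v e0 ok inv2 fits_def le RD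
      del: op_ok.simps(6) real_sqrt_divide real_sqrt_eq_iff)
qed

end

lemma psi_correct:
  assumes t: "0 < t" and reg: "\<sigma> 103 = scal t" and RD: "1 \<le> R" "R \<le> D"
  shows "fit D R psi_lines \<sigma>" "after psi_lines \<sigma> 8 = scal (psi t)"
proof -
  have le: "Suc 0 \<le> R" "Suc 0 \<le> D" using RD by simp_all
  have ok: "\<sigma>' i = scal x \<Longrightarrow> x \<noteq> 0 \<Longrightarrow> op_ok \<sigma>' (Apply EInv i)" "\<sigma>' i = scal x \<Longrightarrow> op_ok \<sigma>' (Apply EExp i)" for \<sigma>' i x
    by (auto intro: apply_scal_ok simp del: op_ok.simps)
  have "inverse (exp t) < 1" using less_imp_inverse_less[of 1 "exp t"] t by simp
  moreover have "1 < exp t" using t by simp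
  ultimately have ne: "exp t - inverse (exp t) \<noteq> 0" by linarith
  have ch: "cosh t = (exp t + inverse (exp t)) / 2" and sh: "sinh t = (exp t - inverse (exp t)) / 2"
    by (simp_all add: cosh_field_def sinh_field_def exp_minus)
  have psi: "t * ((exp t + inverse (exp t)) * inverse (exp t - inverse (exp t))) = psi t"
  proof -
    have h: "a / 2 / (b / 2) = a / b" for a b :: real by simp
    have "psi t = t * ((exp t + inverse (exp t)) / (exp t - inverse (exp t)))"
      using t unfolding psi_def ch sh h by (simp only: if_False less_irrefl refl split: if_split) simp
    then show ?thesis by (simp only: divide_inverse)
  qed
  show "fit D R psi_lines \<sigma>" "after psi_lines \<sigma> 8 = scal (psi t)"
    by (simp_all add: psi_lines_def reg ok ok(1)[OF _ ne] psi fits_def le del: op_ok.simps(6))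
qed

lemma frame_ex:
  assumes adm: "admissible A B" shows "\<exists>F. active_frame A B F"
proof -
  define Y where "Y = residual_part A B"
  define e where "e = eig_sys (transpose_mat Y * Y)"
  define \<sigma> :: store where "\<sigma> = (\<lambda>_. 0\<^sub>m 0 0)(21 := polar A, 25 := Y, 28 := fst e, 29 := mat (dim_col A) 1 (\<lambda>(j, _). snd e j))"
  have "\<sigma> 21 = polar A" "\<sigma> 25 = Y" "\<sigma> 28 = fst e" "\<sigma> 29 = mat (dim_col A) 1 (\<lambda>(j, _). snd e j)"
    by (simp_all add: \<sigma>_def)
  from pre_V_correct[where \<sigma> = \<sigma>, OF adm this[unfolded Y_def e_def]] show ?thesis by blast
qed

lemma pre_lengths: "length pre_lines = 96" "length psi_lines = 7"
  by (simp_all add: pre_lines_def psi_lines_def pre_U_def pre_Y_def pre_V_def pre_M_def pre_L_def pre_rho_def pre_D_def step_lengths)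

lemma pre_registers: "\<forall>l\<in>set pre_lines. fst l < 128" "\<forall>l\<in>set psi_lines. fst l < 128"
  by (simp_all add: pre_lines_def psi_lines_def pre_U_def pre_Y_def pre_V_def pre_M_def pre_L_def pre_rho_def pre_D_def
      eval_prog_def ev_log_def ev_tau_def ev_res_def ev_H_def)

lemma safe_mono: "safe b e p \<sigma> \<Longrightarrow> b \<le> b' \<Longrightarrow> e \<le> e' \<Longrightarrow> safe b' e' p \<sigma>"
  by (induction p \<sigma> rule: after.induct) auto

lemma ne_lines: "pre_lines \<noteq> []" "psi_lines \<noteq> []"
  by (simp_all add: pre_lines_def pre_U_def psi_lines_def)

context active_setting
begin

text \<open>The branch that evaluates \<open>psi\<close> at the initial distance.\<close>

lemma psi_branch:
  assumes reg: "\<sigma> 103 = scal (D0 / sqrt 2)" "\<sigma> 71 = scal 0" and he: "held 128 e \<sigma>" and e: "d * r \<le> e"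
    and b: "1 + 2 * (d * r * r) \<le> b"
  shows "\<exists>t w \<sigma>'. exec (IfGreater 103 71 (prog psi_lines) (prog [(8, IConst 1)])) \<sigma> t w \<sigma>' \<and>
    \<sigma>' 8 = scal L0 \<and> (\<forall>i. i \<noteq> 8 \<longrightarrow> i < 104 \<longrightarrow> \<sigma>' i = \<sigma> i) \<and> t \<le> 8 * b \<and> w \<le> 128 * e"
proof -
  have RD: "1 \<le> r" "r \<le> d" using dims by auto
  then have "1 * 1 \<le> d * r" by (intro mult_le_mono) auto
  then have e1: "1 \<le> e" using e by linarith
  have drr: "1 \<le> d * r * r" using mult_le_mono[OF \<open>1 * 1 \<le> d * r\<close> RD(1)] by simp
  have g: "guard_ok \<sigma> 103 71" by (simp add: guard_ok_def reg)
  show ?thesis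
  proof (cases "D0 = 0")
    case True
    have ng: "\<not> greater \<sigma> 103 71" by (simp add: greater_def reg True)
    have "2 \<le> b" using b drr by linarith
    then have "safe b e [(8, IConst 1)] \<sigma>" using e1 by (simp add: entries_def)
    from exec_prog[OF _ this, of 128] he obtain t w where
      x: "exec (prog [(8, IConst 1)]) \<sigma> t w (after [(8, IConst 1)] \<sigma>)" "t \<le> b" "w \<le> 128 * e" by auto
    have v: "after [(8, IConst 1)] \<sigma> 8 = scal L0" by (simp add: L0_of_def True psi_def)
    show ?thesis
      using exec.IfFalse[OF g ng x(1)] v x(2,3) b
      by (intro exI[of _ "1 + t"] exI[of _ w] exI[of _ "after [(8, IConst 1)] \<sigma>"]) auto
  next
    case False
    then have D: "0 < D0 / sqrt 2" using D0_nonneg by simp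
    then have gr: "greater \<sigma> 103 71" by (simp add: greater_def reg)
    note p = psi_correct[where \<sigma> = \<sigma>, OF D reg(1) RD]
    have "safe b e psi_lines \<sigma>" using fit_safe[OF RD p(1)] safe_mono[OF _ b e] by blast
    from exec_prog[OF ne_lines(2) this, of 128] he pre_registers(2) obtain t w where
      x: "exec (prog psi_lines) \<sigma> t w (after psi_lines \<sigma>)" "t \<le> 7 * b" "w \<le> 128 * e"
      unfolding pre_lengths by blast
    have v: "after psi_lines \<sigma> 8 = scal L0" using p(2) by (simp add: L0_of_def)
    have o: "i \<noteq> 8 \<Longrightarrow> i < 104 \<Longrightarrow> after psi_lines \<sigma> i = \<sigma> i" for i
      by (rule after_other) (simp add: psi_lines_def)
    show ?thesis
      using exec.IfTrue[OF g gr x(1)] v x(2,3) b o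
      by (intro exI[of _ "1 + t"] exI[of _ w] exI[of _ "after psi_lines \<sigma>"]) auto
  qed
qed

text \<open>While the test fails the loop performs one step; it stops at the first index that passes.\<close>

lemma loop_correct:
  assumes stop: "res_at k \<le> \<epsilon>\<^sup>2" and run: "\<And>j. j < k \<Longrightarrow> \<epsilon>\<^sup>2 < res_at j"
  shows "holds_state A B F \<epsilon> j \<sigma> \<Longrightarrow> j \<le> k \<Longrightarrow>
    \<exists>t w \<sigma>'. exec (WhileGreater reg_res reg_tol (prog step_prog)) \<sigma> t w \<sigma>' \<and> holds_state A B F \<epsilon> k \<sigma>' \<and>
      t \<le> (k - j) * (1 + 84 * (1 + 2 * r ^ 3)) + 1"
proof (induction "k - j" arbitrary: j \<sigma>)
  case 0
  then have j: "j = k" by simp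
  note h = holds_stateD[OF 0(2)]
  have "guard_ok \<sigma> reg_res reg_tol" "\<not> greater \<sigma> reg_res reg_tol"
    using stop by (simp_all add: guard_ok_def greater_def reg_defs h j)
  from exec.WhileFalse[OF this] show ?case using 0 j by auto
next
  case (Suc n)
  then have j: "j < k" "n = k - Suc j" by auto
  note h = holds_stateD[OF Suc(3)]
  have g: "guard_ok \<sigma> reg_res reg_tol" "greater \<sigma> reg_res reg_tol"
    using run[OF j(1)] by (simp_all add: guard_ok_def greater_def reg_defs h)
  from step_correct[OF Suc(3)] obtain t1 w1 \<sigma>1 where 1: "exec (prog step_prog) \<sigma> t1 w1 \<sigma>1"
    "holds_state A B F \<epsilon> (Suc j) \<sigma>1" "t1 \<le> 84 * (1 + 2 * r ^ 3)" by blast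
  from Suc(1)[OF j(2) 1(2)] j(1) obtain t2 w2 \<sigma>2 where
    2: "exec (WhileGreater reg_res reg_tol (prog step_prog)) \<sigma>1 t2 w2 \<sigma>2" "holds_state A B F \<epsilon> k \<sigma>2"
      "t2 \<le> (k - Suc j) * (1 + 84 * (1 + 2 * r ^ 3)) + 1" by auto
  have "k - j = Suc (k - Suc j)" using j by simp
  then have "1 + t1 + t2 \<le> (k - j) * (1 + 84 * (1 + 2 * r ^ 3)) + 1" using 1(3) 2(3) by simp
  then show ?case using exec.WhileTrue[OF g 1(1) 2(1)] 2(2) by blast
qed

end

lemma pre_correct:
  assumes adm: "admissible A B"
  defines "d \<equiv> dim_row A" and "r \<equiv> dim_r A B"
  shows "\<exists>F. active_frame A B F \<and> (\<exists>t w \<sigma>. exec pre_com (input_store A B \<epsilon>) t w \<sigma> \<and>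
    holds_state A B F \<epsilon> 0 \<sigma> \<and> t \<le> 104 * (1 + 2 * (d * r * r)) \<and> w \<le> 128 * (d * r))"
proof -
  define m where "m = dim_col A"
  note a = admissibleD[OF adm, folded m_def d_def]
  have rd: "m \<le> r" "r \<le> d"
  proof -
    from frame_ex[OF adm] obtain F where F: "active_frame A B F" by blast
    interpret active_setting A B F by unfold_locales (rule adm, rule F)
    show "m \<le> r" "r \<le> d" using dims by (simp_all add: m_def r_def d_def)
  qed
  have r1: "1 \<le> r" using a(1) rd by simp
  define b where "b = 1 + 2 * (d * r * r)"
  define e where "e = d * r"
  define \<sigma>0 where "\<sigma>0 = input_store A B \<epsilon>"
  define \<sigma>1 where "\<sigma>1 = after pre_U \<sigma>0"
  define \<sigma>2 where "\<sigma>2 = after pre_Y \<sigma>1"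
  define \<sigma>3 where "\<sigma>3 = after pre_V \<sigma>2"
  define \<sigma>4 where "\<sigma>4 = after pre_M \<sigma>3"
  define \<sigma>5 where "\<sigma>5 = after pre_L \<sigma>4"
  define \<sigma>6 where "\<sigma>6 = after pre_rho \<sigma>5"
  define \<sigma>7 where "\<sigma>7 = after eval_prog \<sigma>6"
  define \<sigma>8 where "\<sigma>8 = after pre_D \<sigma>7"
  have s0: "\<sigma>0 0 = A" "\<sigma>0 1 = B" "\<sigma>0 2 = scal \<epsilon>"
    by (simp_all add: \<sigma>0_def input_store_def reg_defs)
  have o1: "i < 17 \<Longrightarrow> \<sigma>1 i = \<sigma>0 i" for i unfolding \<sigma>1_def by (rule after_other) (simp add: pre_U_def)
  have o2: "i < 22 \<Longrightarrow> \<sigma>2 i = \<sigma>1 i" for i unfolding \<sigma>2_def by (rule after_other) (simp add: pre_Y_def)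
  have o3: "i \<noteq> 3 \<Longrightarrow> i < 30 \<Longrightarrow> \<sigma>3 i = \<sigma>2 i" for i unfolding \<sigma>3_def by (rule after_other) (simp add: pre_V_def)
  have o4: "i \<noteq> 4 \<Longrightarrow> i < 37 \<Longrightarrow> \<sigma>4 i = \<sigma>3 i" for i unfolding \<sigma>4_def by (rule after_other) (simp add: pre_M_def)
  have o5: "i \<noteq> 5 \<Longrightarrow> i \<noteq> 6 \<Longrightarrow> i < 42 \<Longrightarrow> \<sigma>5 i = \<sigma>4 i" for i
    unfolding \<sigma>5_def by (rule after_other) (simp add: pre_L_def)
  have o6: "i \<noteq> 7 \<Longrightarrow> i \<noteq> 9 \<Longrightarrow> i \<noteq> 10 \<Longrightarrow> i \<noteq> 11 \<Longrightarrow> i < 49 \<Longrightarrow> \<sigma>6 i = \<sigma>5 i" for i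
    unfolding \<sigma>6_def by (rule after_other) (simp add: pre_rho_def)
  have o8: "i < 94 \<Longrightarrow> \<sigma>8 i = \<sigma>7 i" for i unfolding \<sigma>8_def by (rule after_other) (simp add: pre_D_def)
  note mr = rd(1)[unfolded m_def] and rd' = rd(2)[unfolded d_def]
  note 1 = pre_U_correct[where \<sigma> = \<sigma>0, OF adm s0(1) mr rd', folded \<sigma>1_def]
  have "\<sigma>1 1 = B" using s0(2) o1[of 1] by simp
  note 2 = pre_Y_correct[where \<sigma> = \<sigma>1, OF adm this 1(3) mr rd', folded \<sigma>2_def]
  have "\<sigma>2 21 = polar A" using 1 by (simp add: o2)
  from pre_V_correct[where \<sigma> = \<sigma>2, OF adm this 2(3,4,5), folded \<sigma>3_def] obtain F where F: "active_frame A B F" "frU F = polar A"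
    "frC F = mat_sqrt (transpose_mat A * A)" and 3: "fit d r pre_V \<sigma>2" "\<sigma>3 36 = frVa F" "\<sigma>3 3 = E_of F"
    unfolding d_def r_def by blast
  interpret af: active_setting A B F by unfold_locales (rule adm, rule F(1))
  have RD: "dim_col A + dim_s A B \<le> r" "r \<le> dim_row A" using af.dims rd by (simp_all add: r_def d_def)
  have Ci: "minv (frC F) = mat_isqrt (transpose_mat A * A)"
    unfolding F(3) using mat_sqrt_isqrt(1,2,5)[OF a(6)] by (intro minv_eqI) (auto dest: spdD)
  have s31: "\<sigma>3 1 = B" using s0(2) o1[of 1] o2[of 1] o3[of 1] by simp
  have s32: "\<sigma>3 20 = minv (frC F)" "\<sigma>3 22 = transpose_mat (frU F)"
    using 1 2 by (simp_all add: o2 o3 Ci F(2))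
  note 4 = af.pre_M_correct[where \<sigma> = \<sigma>3, OF RD s31 s32 3(2), folded \<sigma>4_def]
  have "\<sigma>4 36 = frVa F" using 3 by (simp add: o4)
  note 5 = af.pre_L_correct[where \<sigma> = \<sigma>4, OF RD 4(2) this 4(3,4), folded \<sigma>5_def]
  have "\<sigma>5 0 = A" "\<sigma>5 2 = scal \<epsilon>" "\<sigma>5 4 = M_of A B F" "\<sigma>5 39 = transpose_mat (frVa F)"
    using s0 4 by (simp_all add: o1 o2 o3 o4 o5)
  note 6 = af.pre_rho_correct[where \<sigma> = \<sigma>5, OF RD this, folded \<sigma>6_def]
  have s6: "\<sigma>6 3 = E_of F" "\<sigma>6 4 = M_of A B F" "\<sigma>6 5 = La_of A B F" "\<sigma>6 6 = R0a_of A B F"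
    using 3 4 5 by (simp_all add: o4 o5 o6)
  have z: "0 < (1::real)" by simp
  note 7 = af.eval_correct[where \<sigma> = \<sigma>6, OF spd_one[of "dim_s A B"] z RD s6 6(2,4,5), folded \<sigma>7_def]
  note 8 = af.pre_D_correct[where \<sigma> = \<sigma>7, OF RD 7(5,7,8), folded \<sigma>8_def]
  have s8: "after pre_lines \<sigma>0 = \<sigma>8"
    by (simp add: pre_lines_def after_append \<sigma>1_def \<sigma>2_def \<sigma>3_def \<sigma>4_def \<sigma>5_def \<sigma>6_def \<sigma>7_def \<sigma>8_def)
  have fit: "fit d r pre_lines \<sigma>0"
    using 1(1) 2(1) 3(1) 4(1) 5(1) 6(1) 7(1) 8(1)
    by (simp add: pre_lines_def fit_append d_def r_def \<sigma>1_def \<sigma>2_def \<sigma>3_def \<sigma>4_def \<sigma>5_def \<sigma>6_def \<sigma>7_def)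
  have held: "held 128 e \<sigma>0"
  proof -
    have "d * m \<le> e" "1 * 1 \<le> e" unfolding e_def using rd r1 by (intro mult_le_mono; simp)+
    moreover have "dim_row A = d" "dim_col A = m" "dim_row B = d" "dim_col B = m" using a(3,4) by auto
    ultimately show ?thesis by (auto simp: held_def \<sigma>0_def input_store_def reg_defs entries_def)
  qed
  from exec_prog[OF ne_lines(1) fit_safe[OF r1 rd(2) fit, folded b_def e_def], of 128, folded s8] held pre_registers(1)
  obtain t w where x: "exec (prog pre_lines) \<sigma>0 t w \<sigma>8" "t \<le> 96 * b" "w \<le> 128 * e" "held 128 e \<sigma>8"
    unfolding pre_lengths s8 by blast
  have "\<sigma>8 71 = scal 0" using 7(6) by (simp add: o8)
  from af.psi_branch[OF 8(2) this x(4), of b] obtain t' w' \<sigma>9 where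
    y: "exec (IfGreater 103 71 (prog psi_lines) (prog [(8, IConst 1)])) \<sigma>8 t' w' \<sigma>9" "\<sigma>9 8 = scal (L0_of A B F)"
      "\<And>i. i \<noteq> 8 \<Longrightarrow> i < 104 \<Longrightarrow> \<sigma>9 i = \<sigma>8 i" "t' \<le> 8 * b" "w' \<le> 128 * e"
    by (auto simp: b_def e_def d_def r_def)
  have "holds_state A B F \<epsilon> 0 \<sigma>9"
  proof (rule af.holds_stateI)
    show "\<sigma>9 8 = scal (L0_of A B F)" by (rule y(2))
    show "\<sigma>9 3 = E_of F" "\<sigma>9 4 = M_of A B F" "\<sigma>9 5 = La_of A B F" "\<sigma>9 6 = R0a_of A B F" "\<sigma>9 7 = scal (rho_of A B F)"
      "\<sigma>9 9 = scal (\<epsilon>\<^sup>2)" "\<sigma>9 10 = fst (active_iter A B F 0)" "\<sigma>9 11 = scal (snd (active_iter A B F 0))"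
      using s6 6 by (simp_all add: y(3) o8 7(11))
    show "\<sigma>9 12 = scal (residual_sq A B F (fst (active_iter A B F 0)) (snd (active_iter A B F 0)))"
      "\<sigma>9 13 = H_of A B F (fst (active_iter A B F 0))" "\<sigma>9 14 = scal (rho_of A B F * snd (active_iter A B F 0))"
      using 7(2,3,4) by (simp_all add: y(3) o8)
  qed
  moreover have "t + t' \<le> 104 * b" "max w w' \<le> 128 * e" using x y by auto
  moreover have "exec pre_com \<sigma>0 (t + t') (max w w') \<sigma>9" unfolding pre_com_def by (rule exec.Seq[OF x(1) y(1)])
  ultimately show ?thesis using F(1) unfolding b_def e_def \<sigma>0_def by blast
qed

lemma constants:
  fixes t t' u v w x y z :: real
  shows "t \<le> 84 * (1 + 2 * v) \<Longrightarrow> 1 \<le> v \<Longrightarrow> t \<le> 1000 * v"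
    and "t \<le> 9 * (1 + 2 * x + 2 * y) \<Longrightarrow> 1 \<le> x \<Longrightarrow> 0 \<le> y \<Longrightarrow> t \<le> 1000 * (x + y)"
    and "w \<le> 128 * x \<Longrightarrow> x \<le> 2 * z \<Longrightarrow> 1 \<le> x \<Longrightarrow> 0 \<le> y \<Longrightarrow> w \<le> 1000 * (z + y)"
    and "t \<le> 104 * (1 + 2 * w) \<Longrightarrow> w \<le> 4 * u \<Longrightarrow> 1 \<le> u \<Longrightarrow> 1 \<le> v \<Longrightarrow> t \<le> 1000 * (u + v)"
    and "t \<le> 104 * (1 + 2 * w) \<Longrightarrow> w \<le> 4 * u \<Longrightarrow> 1 \<le> u \<Longrightarrow> 0 \<le> x \<Longrightarrow> t' \<le> 506 * x + 1 \<Longrightarrow> t + t' \<le> 1000 * (u + x)"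
  by (simp_all add: distrib_left)

context active_setting
begin

lemma real_bounds: "1 \<le> real d * (real m)\<^sup>2" "1 \<le> real r ^ 3" "1 \<le> real d * real r" "real d * real r \<le> 2 * (real d * real m)"
    "real d * real r * real r \<le> 4 * (real d * (real m)\<^sup>2)"
proof -
  have le: "real r \<le> 2 * real m" using dim_r_le[OF frame_carriers(1,2)] by linarith
  have one: "1 \<le> real m" "1 \<le> real d" "1 \<le> real r" using dims by linarith+
  show "1 \<le> real d * (real m)\<^sup>2" using mult_mono[OF one(2) one_le_power[OF one(1), of 2]] by simp
  show "1 \<le> real r ^ 3" using one by simp
  show "1 \<le> real d * real r" using mult_mono[OF one(2,3)] by simp
  show dr: "real d * real r \<le> 2 * (real d * real m)" using mult_left_mono[OF le, of "real d"] by simp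
  have "real d * real r * real r \<le> 2 * (real d * real m) * (2 * real m)" by (rule mult_mono[OF dr le]) auto
  then show "real d * real r * real r \<le> 4 * (real d * (real m)\<^sup>2)" by (simp add: power2_eq_square)
qed

lemma solver_correct:
  assumes pre: "exec pre_com \<sigma>0 t w \<sigma>" "holds_state A B F \<epsilon> 0 \<sigma>" "t \<le> 104 * (1 + 2 * (d * r * r))"
    and eps: "0 < \<epsilon>" and D: "0 < D0"
  shows "\<exists>k t w \<sigma>'. exec (Seq pre_com (WhileGreater reg_res reg_tol (prog step_prog))) \<sigma>0 t w \<sigma>' \<and>
    holds_state A B F \<epsilon> k \<sigma>' \<and> res_at k \<le> \<epsilon>\<^sup>2 \<and>
    real t \<le> 1000 * (real d * (real m)\<^sup>2 + real r ^ 3 *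
      (1 + 1 / chi0_of A B F * max 0 (ln (sqrt L0 * D0 / \<epsilon>))))"
proof -
  define X where "X = 1 / chi0_of A B F * max 0 (ln (sqrt L0 * D0 / \<epsilon>))"
  have X: "0 \<le> X" using chi0_pos[OF D] by (simp add: X_def)
  from first_stop[OF D eps] obtain k where k: "res_at k \<le> \<epsilon>\<^sup>2" "\<And>j. j < k \<Longrightarrow> \<epsilon>\<^sup>2 < res_at j" "real k \<le> 1 + 2 * X"
    unfolding X_def by blast
  from loop_correct[OF k(1,2) pre(2) le0] obtain t' w' \<sigma>' where
    l: "exec (WhileGreater reg_res reg_tol (prog step_prog)) \<sigma> t' w' \<sigma>'" "holds_state A B F \<epsilon> k \<sigma>'"
      "t' \<le> k * (1 + 84 * (1 + 2 * r ^ 3)) + 1" by auto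
  define u where "u = real d * (real m)\<^sup>2"
  define v where "v = real r ^ 3"
  note b = real_bounds(1,2,5)[folded u_def v_def]
  have "real t \<le> real (104 * (1 + 2 * (d * r * r)))" using pre(3) by (simp only: of_nat_le_iff)
  then have t: "real t \<le> 104 * (1 + 2 * (real d * real r * real r))" by simp
  have "real t' \<le> real (k * (1 + 84 * (1 + 2 * r ^ 3)) + 1)" using l(3) by (simp only: of_nat_le_iff)
  also have "\<dots> = real k * (85 + 168 * v) + 1" by (simp add: v_def algebra_simps)
  also have "\<dots> \<le> (1 + 2 * X) * (253 * v) + 1"
    using k(3) b(2) X by (intro add_right_mono mult_mono) auto
  also have "(1 + 2 * X) * (253 * v) \<le> (2 + 2 * X) * (253 * v)" using b(2) by (intro mult_right_mono) auto
  finally have t': "real t' \<le> 506 * (v * (1 + X)) + 1" by (simp add: algebra_simps)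
  have "0 \<le> v * (1 + X)" using b(2) X by simp
  then have "real (t + t') \<le> 1000 * (u + v * (1 + X))" unfolding of_nat_add by (intro constants(5)[OF t b(3,1) _ t'])
  then show ?thesis
    using exec.Seq[OF pre(1) l(1)] l(2) k(1) unfolding u_def v_def X_def by blast
qed

end

theorem corollary2:
  shows
   "(\<forall>A B. admissible A B \<longrightarrow> dim_r A B \<le> 2 * dim_col A \<and> (\<exists>F. active_frame A B F)) \<and>
    (\<forall>(d::nat) (r::nat) (s::nat) (q::nat) A B F.
       admissible A B \<and> active_frame A B F \<and>
       d = dim_row A \<and>
       r = dim_r A B \<and> s = dim_s A B \<and> q = dim_q A B \<longrightarrow>
       (let \<Sigma>a = (\<lambda>k. fst (active_iter A B F k));
            \<beta> = (\<lambda>k. snd (active_iter A B F k));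
            \<Sigma> = full_iter A B F;
            P = (\<lambda>k. Phi A B F (\<Sigma> k));
            c = (\<lambda>k. rho_of A B F * \<beta> k);
            H = (\<lambda>k. H_of A B F (\<Sigma>a k));
            E = E_of F
        in
         \<comment> \<open>(i)\<close>
         (\<forall>k. active_state s q (\<Sigma>a k) (\<beta> k) \<and> \<Sigma> k = block_diag (\<Sigma>a k) (\<beta> k \<cdot>\<^sub>m 1\<^sub>m q)) \<and>
         \<comment> \<open>(ii)\<close>
         (\<forall>k. P k * A = B \<and> P k \<in> spd d \<and> det (P k) = 1 \<and>
            (\<forall>\<epsilon>\<ge>0. (frob_norm (Wa_of A B F (\<Sigma>a k) (\<beta> k)))\<^sup>2
                    + real q * (wc_of A B F (\<Sigma>a k) (\<beta> k))\<^sup>2 \<le> \<epsilon>\<^sup>2 \<longrightarrow>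
               d_AI (P k) (canonical_controller A B) \<le> \<epsilon>)) \<and>
         \<comment> \<open>the formula of the implicit application, used in (iii)\<close>
         (\<forall>k. \<forall>x \<in> carrier_vec d. P k *\<^sub>v x =
            c k \<cdot>\<^sub>v x + E *\<^sub>v ((H k - c k \<cdot>\<^sub>m 1\<^sub>m r) *\<^sub>v (transpose_mat E *\<^sub>v x))) \<and>
         \<comment> \<open>(iv)\<close>
         (q = 0 \<longrightarrow>
            (let W = (\<lambda>k. Ra22_of A B F (\<Sigma>a k)
                          - (mat_trace (Ra22_of A B F (\<Sigma>a k)) / real s) \<cdot>\<^sub>m 1\<^sub>m s)
             in \<Sigma>a 0 = 1\<^sub>m s \<and>
                (\<forall>k. \<Sigma>a (Suc k) = mat_sqrt (\<Sigma>a k) *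
                        mat_exp ((1 / L0_of A B F) \<cdot>\<^sub>m W k) * mat_sqrt (\<Sigma>a k) \<and>
                     \<Sigma> k = \<Sigma>a k \<and> P k = E * H k * transpose_mat E \<and>
                     (\<forall>\<epsilon>\<ge>0. (frob_norm (W k))\<^sup>2 \<le> \<epsilon>\<^sup>2 \<longrightarrow>
                        d_AI (P k) (canonical_controller A B) \<le> \<epsilon>)))) \<and>
         (s = 0 \<longrightarrow>
            (\<forall>\<Sigma>' \<beta>'. active_state s q \<Sigma>' \<beta>' \<longrightarrow> \<Sigma>' = 1\<^sub>m 0 \<and> \<beta>' = 1) \<and>
            canonical_controller A B =
              E * M_of A B F * transpose_mat E
              + rho_of A B F \<cdot>\<^sub>m (1\<^sub>m d - E * transpose_mat E)))) \<and>
    \<comment> \<open>(iii)\<close>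
    (\<exists>pre step app (K::real). 0 < K \<and>
       (\<forall>(d::real) (m::real) (r::real) A B \<epsilon>.
          admissible A B \<and> 0 < \<epsilon> \<and>
          d = real (dim_row A) \<and> m = real (dim_col A) \<and> r = real (dim_r A B) \<longrightarrow>
          (\<exists>F. active_frame A B F \<and>
             (\<exists>t w \<sigma>. exec pre (input_store A B \<epsilon>) t w \<sigma> \<and> holds_state A B F \<epsilon> 0 \<sigma> \<and>
                real t \<le> K * (d * m\<^sup>2 + r ^ 3) \<and> real w \<le> K * (d * m + r\<^sup>2)) \<and>
             (0 < D0_of A B F \<longrightarrow>
                (\<exists>k t w \<sigma>.
                   exec (Seq pre (WhileGreater reg_res reg_tol step)) (input_store A B \<epsilon>) t w \<sigma> \<and>
                   holds_state A B F \<epsilon> k \<sigma> \<and>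
                   residual_sq A B F (fst (active_iter A B F k)) (snd (active_iter A B F k)) \<le> \<epsilon>\<^sup>2 \<and>
                   real t \<le> K * (d * m\<^sup>2 + r ^ 3 *
                     (1 + 1 / chi0_of A B F *
                        max 0 (ln (sqrt (L0_of A B F) * D0_of A B F / \<epsilon>))))))) \<and>
          (\<forall>F k \<sigma>. active_frame A B F \<and> holds_state A B F \<epsilon> k \<sigma> \<longrightarrow>
             (\<exists>t w \<sigma>'. exec step \<sigma> t w \<sigma>' \<and> holds_state A B F \<epsilon> (Suc k) \<sigma>' \<and>
                real t \<le> K * r ^ 3) \<and>
             (\<forall>x \<in> carrier_mat (dim_row A) 1. \<sigma> reg_x = x \<longrightarrow>
                (\<exists>t w \<sigma>'. exec app \<sigma> t w \<sigma>' \<and>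
                   \<sigma>' reg_y = Phi A B F (full_iter A B F k) * x \<and>
                   real t \<le> K * (d * r + r\<^sup>2))))))"
proof (intro conjI, goal_cases)
  case 1
  show ?case using frame_ex dim_r_le admissibleD(3,4) by blast
next
  case 2
  show ?case
  proof (intro allI impI, goal_cases)
    case (1 d r s q A B F)
    then have adm: "admissible A B" and fr: "active_frame A B F"
      and eqs: "d = dim_row A" "r = dim_r A B" "s = dim_s A B" "q = dim_q A B" by blast+
    interpret active_setting A B F by unfold_locales (rule adm, rule fr)
    have P: "Phi A B F (full_iter A B F k) * A = B" "Phi A B F (full_iter A B F k) \<in> spd (dim_row A)"
      "det (Phi A B F (full_iter A B F k)) = 1" for k
      using Phi_unit[OF full_iter_unit[of k]] Phi_mult_A[OF spdD(1)] full_iter_unit[of k]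
      by (simp_all add: unit_spd_def)
    show ?case
      unfolding Let_def eqs
    proof (intro conjI allI ballI impI, goal_cases)
      case 1 show ?case by (rule iter_active_state)
    next
      case 2 show ?case using iter_invariant by blast
    next
      case 3 show ?case by (rule P)
    next
      case 4 show ?case by (rule P)
    next
      case 5 show ?case by (rule P)
    next
      case (6 k \<epsilon>)
      then show ?case using stopping_test[of \<epsilon> k] by (simp add: residual_sq_def)
    next
      case 7 then show ?case by (rule implicit_application)
    next
      case 8 show ?case by simp
    next
      case (9 k)
      then show ?case by (simp add: case_prod_beta no_complement(3))
    next
      case 10 then show ?case by (rule no_complement)
    next
      case 11 then show ?case by (rule no_complement)
    next
      case (12 k \<epsilon>)
      then show ?case using stopping_test[of \<epsilon> k] by (simp add: residual_sq_def no_complement(3))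
    next
      case 13 then show ?case using no_variable(1) by blast
    next
      case 14 then show ?case using no_variable(1) by blast
    next
      case 15 then show ?case by (intro no_variable(2))
    qed
  qed
next
  case 3
  show ?case
  proof (rule exI[of _ pre_com], rule exI[of _ "prog step_prog"], rule exI[of _ "prog app_prog"],
      rule exI[of _ "1000::real"], intro conjI, goal_cases)
    case 2
    show ?case
    proof (intro allI impI, goal_cases)
      case (1 d m r A B \<epsilon>)
      then have adm: "admissible A B" and eps: "0 < \<epsilon>"
        and eqs: "d = real (dim_row A)" "m = real (dim_col A)" "r = real (dim_r A B)" by blast+
      show ?case
        unfolding eqs
      proof (intro conjI allI impI ballI, goal_cases)
        case 1
        from pre_correct[OF adm, of \<epsilon>] obtain F t w \<sigma> where F: "active_frame A B F"
          and x: "exec pre_com (input_store A B \<epsilon>) t w \<sigma>" "holds_state A B F \<epsilon> 0 \<sigma>"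
            "t \<le> 104 * (1 + 2 * (dim_row A * dim_r A B * dim_r A B))" "w \<le> 128 * (dim_row A * dim_r A B)" by blast
        interpret active_setting A B F by unfold_locales (rule adm, rule F)
        define u where "u = real (dim_row A) * (real (dim_col A))\<^sup>2"
        define v where "v = real (dim_r A B) ^ 3"
        define z where "z = real (dim_row A) * real (dim_col A)"
        note b = real_bounds[folded u_def v_def z_def]
        have "real t \<le> real (104 * (1 + 2 * (dim_row A * dim_r A B * dim_r A B)))" using x(3) by (simp only: of_nat_le_iff)
        then have "real t \<le> 104 * (1 + 2 * (real (dim_row A) * real (dim_r A B) * real (dim_r A B)))" by simp
        then have t: "real t \<le> 1000 * (u + v)" by (rule constants(4)[OF _ b(5,1,2)])
        have "real w \<le> real (128 * (dim_row A * dim_r A B))" using x(4) by (simp only: of_nat_le_iff)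
        then have "real w \<le> 128 * (real (dim_row A) * real (dim_r A B))" by simp
        then have w: "real w \<le> 1000 * (z + (real (dim_r A B))\<^sup>2)" by (rule constants(3)[OF _ b(4,3) zero_le_power2])
        note sol = solver_correct[OF x(1,2,3) eps]
        show ?case using F x(1,2) t w sol unfolding u_def v_def z_def by blast
      next
        case (2 F k \<sigma>)
        then interpret active_setting A B F using adm by unfold_locales blast+
        from 2 step_correct obtain t w \<sigma>' where x: "exec (prog step_prog) \<sigma> t w \<sigma>'" "holds_state A B F \<epsilon> (Suc k) \<sigma>'"
          "t \<le> 84 * (1 + 2 * dim_r A B ^ 3)" by blast
        have "real t \<le> real (84 * (1 + 2 * dim_r A B ^ 3))" using x(3) by (simp only: of_nat_le_iff)
        then have "real t \<le> 84 * (1 + 2 * real (dim_r A B) ^ 3)" by simp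
        then have "real t \<le> 1000 * real (dim_r A B) ^ 3" by (rule constants(1)[OF _ real_bounds(2)])
        then show ?case using x by blast
      next
        case (3 F k \<sigma> x)
        then interpret active_setting A B F using adm by unfold_locales blast+
        have "holds_state A B F \<epsilon> k \<sigma>" "x \<in> carrier_mat (dim_row A) 1" "\<sigma> 15 = x" using 3 by (simp_all add: reg_x_def)
        from app_correct[OF this] obtain t w \<sigma>' where y: "exec (prog app_prog) \<sigma> t w \<sigma>'"
          "\<sigma>' 16 = Phi A B F (full_iter A B F k) * x" "t \<le> 9 * (1 + 2 * dim_row A * dim_r A B + 2 * dim_r A B * dim_r A B)" by blast
        have "real t \<le> real (9 * (1 + 2 * dim_row A * dim_r A B + 2 * dim_r A B * dim_r A B))" using y(3) by (simp only: of_nat_le_iff)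
        then have "real t \<le> 9 * (1 + 2 * (real (dim_row A) * real (dim_r A B)) + 2 * (real (dim_r A B))\<^sup>2)"
          by (simp add: power2_eq_square)
        then have "real t \<le> 1000 * (real (dim_row A) * real (dim_r A B) + (real (dim_r A B))\<^sup>2)"
          by (rule constants(2)[OF _ real_bounds(3) zero_le_power2])
        then show ?case using y(1,2) by (auto simp: reg_y_def)
      qed
    qed
  qed simp
qed

end
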